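(* Let $G=\sum_{l\ge 1} w_l\delta_{\xi_l}$ be a random atomic probability measure on the unit ball of $\ell_2$, with non-increasing weights, and let $q^*$, $b_p$, $g_p$, $\pi$, $w^\pi$, $Q$, $Q^\pi$ be as defined in the context. Then the following are equivalent: (i) $G$ satisfies the Ghirlanda-Guerra identities and the Aizenman-Contucci stochastic stability; (ii) with probability one $G$ is concentrated on the sphere of constant (non-random) radius $\sqrt{q^*}$, and for any integer $p\geq 1$ and any $t\in\mathbb{R}$, $$ \Bigl(\bigl(w_l^\pi\bigr)_{l\geq 1},\ \bigl(g_p(\xi_{\pi(l)})-b_p t\bigr)_{l\geq 1},\ Q^\pi\Bigr) \stackrel{d}{=} \Bigl(\bigl(w_l\bigr)_{l\geq 1},\ \bigl(g_p(\xi_l)\bigr)_{l\geq 1},\ Q\Bigr), $$ where equality in distribution is in the sense of finite dimensional distributions of these arrays.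
   Context: Setting. $G=\sum_{l\geq 1} w_l\delta_{\xi_l}$ is a random probability measure on the unit ball of the Hilbert space $\ell_2$; the weights $w_1\geq w_2\geq\ldots\ge 0$ (summing to $1$) are arranged in non-increasing order and $\xi_1,\xi_2,\ldots$ are the (distinct) points in the support of $G$. Let $Q=(\xi_l\cdot\xi_{l'})_{l,l'\geq 1}$ be the matrix of scalar products. Given $G$, let $(\vec\sigma^l)_{l\geq 1}$ be an i.i.d. sample from $G$ and let $R_{l,l'}=\vec\sigma^l\cdot\vec\sigma^{l'}$ (the overlaps). For a function $f=f(\vec\sigma^1,\ldots,\vec\sigma^n)$ write $$\langle f\rangle=\sum_{l_1,\ldots,l_n\geq 1}w_{l_1}\cdots w_{l_n}\,f(\xi_{l_1},\ldots,\xi_{l_n}),$$ and let $\mathbb{E}$ denote expectation over the randomness of $G$ (and of any auxiliary Gaussian sequence). Constants. $q^*$ is the supremum of the support of the distribution of $R_{1,2}$ under $\mathbb{E}G^{\otimes 2}$, and for an integer $p\ge 1$, $b_p=(q^* )^p-\mathbb{E}\langle R_{1,2}^p\rangle$. Ghirlanda-Guerra identities. $G$ satisfies them if for any $n\geq 2$, any bounded measurable function $f$ of the overlaps $(R_{l,l'})_{l,l'\leq n}$ and any integer $p\geq 1$, $$\mathbb{E}\langle f R_{1,n+1}^p\rangle=\frac1n\,\mathbb{E}\langle f\rangle\,\mathbb{E}\langle R_{1,2}^p\rangle+\frac1n\sum_{l=2}^n\mathbb{E}\langle f R_{1,l}^p\rangle .$$ Random change of density. For an integer $p\geq 1$ let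 $(g_p(\xi_l))_{l\geq 1}$ be, conditionally on $G$, a (centered) Gaussian sequence with covariance $\mathrm{Cov}(g_p(\xi_l),g_p(\xi_{l'}))=(\xi_l\cdot\xi_{l'})^p$. For $t\in\mathbb{R}$ let $$w_l^t=\frac{w_l e^{t g_p(\xi_l)}}{\sum_{j\geq 1}w_j e^{t g_p(\xi_j)}} .$$ Let $(w_l^\pi)_{l\geq 1}$ be the weights $(w_l^t)_{l\ge1}$ arranged in non-increasing order and let $\pi:\mathbb{N}\to\mathbb{N}$ be the permutation keeping track of the reordering, $w_l^\pi=w_{\pi(l)}^t$ (ties broken by index). Let $Q^\pi=(\xi_{\pi(l)}\cdot\xi_{\pi(l')})_{l,l'\geq 1}$. (All of these depend on $p$ and $t$.) Aizenman-Contucci stochastic stability. $G$ satisfies it if for any integer $p\geq 1$ and any $t\in\mathbb{R}$, $\bigl((w_l^\pi)_{l\geq 1},Q^\pi\bigr)\stackrel{d}{=}\bigl((w_l)_{l\geq 1},Q\bigr)$ in the sense of finite dimensional distributions. *)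

theory Defs
  imports "HOL-Probability.Probability"
begin

section \<open>The Hilbert space of square-summable sequences\<close>

text \<open>Points are plain sequences, with the Hilbert space as a carrier set. Since the norm is a
  countable supremum of continuous functions of finitely many coordinates, its Borel sets are the
  traces of the product sigma-algebra \<open>seq_space\<close>.\<close>

type_synonym point = "nat \<Rightarrow> real"

abbreviation seq_space :: "(nat \<Rightarrow> real) measure" where
  "seq_space \<equiv> Pi\<^sub>M UNIV (\<lambda>_. borel)"

definition ell2 :: "point set" where
  "ell2 = {x. summable (\<lambda>i. (x i)\<^sup>2)}"

definition ell2_inner :: "point \<Rightarrow> point \<Rightarrow> real" where
  "ell2_inner x y = (\<Sum>i. x i * y i)"

definition ell2_norm :: "point \<Rightarrow> real" where
  "ell2_norm x = sqrt (ell2_inner x x)"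

definition ell2_unit_ball :: "point set" where
  "ell2_unit_ball = {x \<in> ell2. ell2_norm x \<le> 1}"


section \<open>Random atomic measures and replica averages\<close>

text \<open>All sequences are indexed from 0. If there are only finitely many atoms, the remaining
  weights are 0 and the points attached to them are arbitrary points of the ball; only the
  atoms themselves have to be distinct.\<close>

definition random_atomic_measure ::
    "'a measure \<Rightarrow> ('a \<Rightarrow> nat \<Rightarrow> real) \<Rightarrow> ('a \<Rightarrow> nat \<Rightarrow> point) \<Rightarrow> bool" where
  "random_atomic_measure M w \<xi> \<longleftrightarrow>
     w \<in> M \<rightarrow>\<^sub>M seq_space \<and>
     \<xi> \<in> M \<rightarrow>\<^sub>M Pi\<^sub>M UNIV (\<lambda>_. seq_space) \<and>
     (\<forall>\<omega>\<in>space M.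
        (\<forall>l. 0 \<le> w \<omega> l) \<and> decseq (w \<omega>) \<and> w \<omega> sums 1 \<and>
        range (\<xi> \<omega>) \<subseteq> ell2_unit_ball \<and> inj_on (\<xi> \<omega>) {l. 0 < w \<omega> l})"

text \<open>The measure with mass \<open>v l\<close> at \<open>x l\<close>.\<close>

definition atomic_measure :: "(nat \<Rightarrow> real) \<Rightarrow> (nat \<Rightarrow> point) \<Rightarrow> point measure" where
  "atomic_measure v x = distr (point_measure UNIV (\<lambda>l. ennreal (v l))) seq_space x"

text \<open>The average of \<open>f\<close> over \<open>n\<close> replicas \<open>\<sigma> 0, \<dots>, \<sigma> (n - 1)\<close>; \<open>f\<close> must only
  depend on these.\<close>

definition bracket ::
    "(nat \<Rightarrow> real) \<Rightarrow> (nat \<Rightarrow> point) \<Rightarrow> nat \<Rightarrow> ((nat \<Rightarrow> point) \<Rightarrow> real) \<Rightarrow> real" where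
  "bracket v x n f =
     (\<Sum>\<^sub>\<infinity>l \<in> {..<n} \<rightarrow>\<^sub>E UNIV. (\<Prod>k<n. v (l k)) * f (\<lambda>k. x (l k)))"

definition mean_bracket ::
    "'a measure \<Rightarrow> ('a \<Rightarrow> nat \<Rightarrow> real) \<Rightarrow> ('a \<Rightarrow> nat \<Rightarrow> point) \<Rightarrow>
      nat \<Rightarrow> ((nat \<Rightarrow> point) \<Rightarrow> real) \<Rightarrow> real" where
  "mean_bracket M w \<xi> n f = (\<integral>\<omega>. bracket (w \<omega>) (\<xi> \<omega>) n f \<partial>M)"

definition overlap :: "(nat \<Rightarrow> point) \<Rightarrow> nat \<Rightarrow> nat \<Rightarrow> real" where
  "overlap \<sigma> k k' = ell2_inner (\<sigma> k) (\<sigma> k')"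

definition overlaps :: "nat \<Rightarrow> (nat \<Rightarrow> point) \<Rightarrow> nat \<times> nat \<Rightarrow> real" where
  "overlaps n \<sigma> = (\<lambda>(k, k') \<in> {..<n} \<times> {..<n}. overlap \<sigma> k k')"

definition overlap_support ::
    "'a measure \<Rightarrow> ('a \<Rightarrow> nat \<Rightarrow> real) \<Rightarrow> ('a \<Rightarrow> nat \<Rightarrow> point) \<Rightarrow> real set" where
  "overlap_support M w \<xi> =
     {r. \<forall>U. open U \<and> r \<in> U \<longrightarrow> 0 < mean_bracket M w \<xi> 2 (\<lambda>\<sigma>. indicator U (overlap \<sigma> 0 1))}"

definition q_star ::
    "'a measure \<Rightarrow> ('a \<Rightarrow> nat \<Rightarrow> real) \<Rightarrow> ('a \<Rightarrow> nat \<Rightarrow> point) \<Rightarrow> real" where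
  "q_star M w \<xi> = Sup (overlap_support M w \<xi>)"

definition b_const ::
    "'a measure \<Rightarrow> ('a \<Rightarrow> nat \<Rightarrow> real) \<Rightarrow> ('a \<Rightarrow> nat \<Rightarrow> point) \<Rightarrow> nat \<Rightarrow> real" where
  "b_const M w \<xi> p = q_star M w \<xi> ^ p - mean_bracket M w \<xi> 2 (\<lambda>\<sigma>. overlap \<sigma> 0 1 ^ p)"


section \<open>Ghirlanda-Guerra identities\<close>

definition ghirlanda_guerra ::
    "'a measure \<Rightarrow> ('a \<Rightarrow> nat \<Rightarrow> real) \<Rightarrow> ('a \<Rightarrow> nat \<Rightarrow> point) \<Rightarrow> bool" where
  "ghirlanda_guerra M w \<xi> \<longleftrightarrow>
     (\<forall>n\<ge>2. \<forall>f \<in> borel_measurable (Pi\<^sub>M ({..<n} \<times> {..<n}) (\<lambda>_. borel)). \<forall>p\<ge>1.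
        (\<exists>B. \<forall>R. \<bar>f R\<bar> \<le> B) \<longrightarrow>
        mean_bracket M w \<xi> (n + 1) (\<lambda>\<sigma>. f (overlaps n \<sigma>) * overlap \<sigma> 0 n ^ p) =
          1 / real n * mean_bracket M w \<xi> n (\<lambda>\<sigma>. f (overlaps n \<sigma>))
                     * mean_bracket M w \<xi> 2 (\<lambda>\<sigma>. overlap \<sigma> 0 1 ^ p)
          + 1 / real n * (\<Sum>l = 1..<n.
              mean_bracket M w \<xi> n (\<lambda>\<sigma>. f (overlaps n \<sigma>) * overlap \<sigma> 0 l ^ p)))"


section \<open>Conditionally Gaussian sequences\<close>

definition centered_normal :: "real \<Rightarrow> real measure" where
  "centered_normal v =
     (if 0 < v then density lborel (\<lambda>x. ennreal (normal_density 0 (sqrt v) x))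
      else return borel 0)"

text \<open>Conditionally on \<open>F\<close>, every finite linear combination of the \<open>X \<omega> l\<close> is a centered,
  possibly degenerate, normal variable with the variance prescribed by the covariance \<open>C \<omega>\<close>.\<close>

definition cond_centered_gaussian ::
    "'a measure \<Rightarrow> 'a measure \<Rightarrow> ('a \<Rightarrow> nat \<Rightarrow> real) \<Rightarrow> ('a \<Rightarrow> nat \<Rightarrow> nat \<Rightarrow> real) \<Rightarrow> bool" where
  "cond_centered_gaussian M F X C \<longleftrightarrow>
     X \<in> M \<rightarrow>\<^sub>M seq_space \<and>
     (\<forall>(a :: nat \<Rightarrow> real) m. \<forall>B \<in> sets borel. AE \<omega> in M.
        real_cond_exp M F (\<lambda>\<omega>'. indicator B (\<Sum>l<m. a l * X \<omega>' l)) \<omega> =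
        measure (centered_normal (\<Sum>l<m. \<Sum>l'<m. a l * a l' * C \<omega> l l')) B)"

definition gen_algebra ::
    "'a measure \<Rightarrow> ('a \<Rightarrow> nat \<Rightarrow> real) \<Rightarrow> ('a \<Rightarrow> nat \<Rightarrow> point) \<Rightarrow> 'a measure" where
  "gen_algebra M w \<xi> =
     vimage_algebra (space M) (\<lambda>\<omega>. (w \<omega>, \<xi> \<omega>)) (seq_space \<Otimes>\<^sub>M Pi\<^sub>M UNIV (\<lambda>_. seq_space))"

text \<open>\<open>g p \<omega> l\<close> is the value of the \<open>p\<close>-th Gaussian field at the point \<open>\<xi> \<omega> l\<close>; nothing is
  assumed about the joint law for different \<open>p\<close>.\<close>

definition gaussian_fields ::
    "'a measure \<Rightarrow> ('a \<Rightarrow> nat \<Rightarrow> real) \<Rightarrow> ('a \<Rightarrow> nat \<Rightarrow> point) \<Rightarrow>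
      (nat \<Rightarrow> 'a \<Rightarrow> nat \<Rightarrow> real) \<Rightarrow> bool" where
  "gaussian_fields M w \<xi> g \<longleftrightarrow>
     (\<forall>p\<ge>1. cond_centered_gaussian M (gen_algebra M w \<xi>) (g p)
              (\<lambda>\<omega> l l'. ell2_inner (\<xi> \<omega> l) (\<xi> \<omega> l') ^ p))"


section \<open>Random change of density\<close>

definition tilted :: "(nat \<Rightarrow> real) \<Rightarrow> (nat \<Rightarrow> real) \<Rightarrow> real \<Rightarrow> nat \<Rightarrow> real" where
  "tilted v h t l = v l * exp (t * h l) / (\<Sum>j. v j * exp (t * h j))"

text \<open>The permutation listing \<open>v\<close> in non-increasing order, ties broken by index. For a summable
  \<open>v\<close> that is either positive everywhere or nonnegative and zero from some index on, it exists and
  is unique; the tilted weights are almost surely of this kind.\<close>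

definition decreasing_perm :: "(nat \<Rightarrow> real) \<Rightarrow> nat \<Rightarrow> nat" where
  "decreasing_perm v =
     (THE \<pi>. bij \<pi> \<and>
        (\<forall>l l'. l < l' \<longrightarrow> v (\<pi> l') < v (\<pi> l) \<or> v (\<pi> l') = v (\<pi> l) \<and> \<pi> l < \<pi> l'))"

definition perm ::
    "('a \<Rightarrow> nat \<Rightarrow> real) \<Rightarrow> (nat \<Rightarrow> 'a \<Rightarrow> nat \<Rightarrow> real) \<Rightarrow> nat \<Rightarrow> real \<Rightarrow> 'a \<Rightarrow> nat \<Rightarrow> nat" where
  "perm w g p t \<omega> = decreasing_perm (tilted (w \<omega>) (g p \<omega>) t)"

definition w_perm ::
    "('a \<Rightarrow> nat \<Rightarrow> real) \<Rightarrow> (nat \<Rightarrow> 'a \<Rightarrow> nat \<Rightarrow> real) \<Rightarrow> nat \<Rightarrow> real \<Rightarrow> 'a \<Rightarrow> nat \<Rightarrow> real" where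
  "w_perm w g p t \<omega> l = tilted (w \<omega>) (g p \<omega>) t (perm w g p t \<omega> l)"

definition Q_mat :: "('a \<Rightarrow> nat \<Rightarrow> point) \<Rightarrow> 'a \<Rightarrow> nat \<times> nat \<Rightarrow> real" where
  "Q_mat \<xi> \<omega> = (\<lambda>(l, l'). ell2_inner (\<xi> \<omega> l) (\<xi> \<omega> l'))"

definition Q_perm ::
    "('a \<Rightarrow> nat \<Rightarrow> real) \<Rightarrow> ('a \<Rightarrow> nat \<Rightarrow> point) \<Rightarrow> (nat \<Rightarrow> 'a \<Rightarrow> nat \<Rightarrow> real) \<Rightarrow>
      nat \<Rightarrow> real \<Rightarrow> 'a \<Rightarrow> nat \<times> nat \<Rightarrow> real" where
  "Q_perm w \<xi> g p t \<omega> =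
     (\<lambda>(l, l'). ell2_inner (\<xi> \<omega> (perm w g p t \<omega> l)) (\<xi> \<omega> (perm w g p t \<omega> l')))"

text \<open>Several arrays are treated jointly by taking the sum of their index types.\<close>

definition same_fdd ::
    "'a measure \<Rightarrow> ('a \<Rightarrow> 'i \<Rightarrow> real) \<Rightarrow> ('a \<Rightarrow> 'i \<Rightarrow> real) \<Rightarrow> bool" where
  "same_fdd M X Y \<longleftrightarrow>
     (\<forall>J. finite J \<longrightarrow>
        distr M (Pi\<^sub>M J (\<lambda>_. borel)) (\<lambda>\<omega>. restrict (X \<omega>) J) =
        distr M (Pi\<^sub>M J (\<lambda>_. borel)) (\<lambda>\<omega>. restrict (Y \<omega>) J))"

definition aizenman_contucci ::
    "'a measure \<Rightarrow> ('a \<Rightarrow> nat \<Rightarrow> real) \<Rightarrow> ('a \<Rightarrow> nat \<Rightarrow> point) \<Rightarrow>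
      (nat \<Rightarrow> 'a \<Rightarrow> nat \<Rightarrow> real) \<Rightarrow> bool" where
  "aizenman_contucci M w \<xi> g \<longleftrightarrow>
     (\<forall>p\<ge>1. \<forall>t. same_fdd M
        (\<lambda>\<omega>. case_sum (w_perm w g p t \<omega>) (Q_perm w \<xi> g p t \<omega>))
        (\<lambda>\<omega>. case_sum (w \<omega>) (Q_mat \<xi> \<omega>)))"

end

theory Submission
  imports Defs "HOL-Complex_Analysis.Cauchy_Integral_Formula"
begin

text \<open>
  For a sphere of radius \<open>sqrt q\<close> and under Aizenman-Contucci stability, the Cameron-Martin formula
  computes the joint moment generating function of the overlaps and of the centred field
  \<open>g - b t\<close> after the change of density: it differs from the original one by a factor
  \<open>tilt_ratio\<close> under the average over the replicas. The Ghirlanda-Guerra identities say that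
  averages against this factor have derivative 0 at \<open>t = 0\<close>. Applied with suitable test functions they also
  show that these averages are constant: the \<open>t\<close>-derivatives vanish at every \<open>t\<close>, because the
  denominator of the factor is approximated by polynomials in averages over further replicas.

  The moment generating functions determine the law of the overlaps and field values of infinitely many
  replicas. The arrays are recovered from it, because on a sphere the overlap \<open>q\<close> marks the replicas
  that share an atom, so that the weights are the frequencies of the atoms. The order of
  the atoms is determined since the weights are almost surely distinct: a Gaussian change of density
  has no ties, and by stability this passes to the original weights. It remains to exclude finitely
  many atoms: under the identities a new replica finds a new atom often enough that either all weights
  are positive or there is a single atom.
\<close>

section \<open>Laws determined by their moment generating functions\<close>

text \<open>The Gaussian hypothesis is given one linear combination and one Borel set at a time, so
  no realisation of the field is at hand that could be shifted. Real exponentials of linear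
  combinations are what it computes, and products of them stay in the class; hence laws are compared
  through real generating functions, and the Cameron-Martin formula itself is obtained as an
  equality of two laws with the same generating function. The constant b_p is a diagonal correction.
  Shifting the field by its covariance with \<open>\<Sum>i<n. s i * h (l i)\<close> produces the
  overlap of replica \<open>i\<close> with every replica \<open>j\<close>, also with
  \<open>j = i\<close>, where the sphere gives q^p; the Ghirlanda-Guerra identities have the mean of
  R^p in that place. The difference is deterministic only because the radius is. Polynomials in the
  denominator help because of homogeneity: n replicas give the denominator x^n, and for psi(x) =
  x^-n the expression n psi + x psi', which multiplies the average over a new replica, is
  zero.\<close>

lemma powser_moments:
  fixes \<mu> :: "real measure" and z :: complex
  assumes fin: "finite_measure \<mu>" and sets[measurable_cong]: "sets \<mu> = sets borel"
    and int: "\<And>c. integrable \<mu> (\<lambda>x. exp (c * x))"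
  shows "(\<lambda>k. z ^ k / fact k * complex_of_real (\<integral>x. x ^ k \<partial>\<mu>)) sums (CLINT x|\<mu>. exp (z * of_real x))"
proof -
  interpret finite_measure \<mu> by fact
  define f where "f k x = (z * complex_of_real x) ^ k / fact k" for k x
  define c where "c = cmod z"
  have meas[measurable]: "f k \<in> borel_measurable \<mu>" for k
    unfolding f_def by measurable
  have nf: "norm (f k x) = (c * \<bar>x\<bar>) ^ k / fact k" for k x
    by (simp add: f_def c_def norm_divide norm_power norm_mult)
  \<comment> \<open>The series is dominated by exp(c|x|), and
    \<open>exp (c * x) + exp (- c * x)\<close> is an upper bound of this that \<open>int\<close>
    makes integrable. One bound for all partial sums yields both summability conditions for
    exchanging sum and integral.\<close>
  have ps: "(\<Sum>k<n. norm (f k x)) \<le> exp (c * x) + exp (- c * x)" for n x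
  proof -
    have s: "(\<lambda>k. norm (f k x)) sums exp (c * \<bar>x\<bar>)"
      using exp_converges[of "c * \<bar>x\<bar>"] by (simp add: nf divide_inverse ac_simps)
    have "(\<Sum>k<n. norm (f k x)) \<le> exp (c * \<bar>x\<bar>)"
      using sum_le_suminf[OF sums_summable[OF s], of "{..<n}"] sums_unique[OF s] by simp
    also have "\<dots> \<le> exp (c * x) + exp (- c * x)"
      by (cases "x \<ge> 0") auto
    finally show ?thesis .
  qed
  have le: "norm (f k x) \<le> exp (c * x) + exp (- c * x)" for k x
  proof -
    have "norm (f k x) \<le> (\<Sum>k<Suc k. norm (f k x))"
      by (simp add: sum_nonneg)
    then show ?thesis using ps[of x "Suc k"] by linarith
  qed
  have intE: "integrable \<mu> (\<lambda>x. exp (c * x) + exp (- c * x))"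
    using int[of c] int[of "- c"] by (intro Bochner_Integration.integrable_add) auto
  have inf: "integrable \<mu> (f k)" for k
    by (rule Bochner_Integration.integrable_bound[OF intE]) (use le in \<open>auto intro!: AE_I2 order_trans[OF le]\<close>)
  have "(\<lambda>k. integral\<^sup>L \<mu> (f k)) sums (\<integral>x. (\<Sum>k. f k x) \<partial>\<mu>)"
  proof (rule sums_integral[OF inf])
    show "AE x in \<mu>. summable (\<lambda>i. norm (f i x))"
      by (intro AE_I2 summableI_nonneg_bounded[OF _ ps]) auto
    show "summable (\<lambda>i. \<integral>x. norm (f i x) \<partial>\<mu>)"
    proof (rule summableI_nonneg_bounded[where x = "\<integral>x. exp (c * x) + exp (- c * x) \<partial>\<mu>"])
      show "0 \<le> (\<integral>x. norm (f n x) \<partial>\<mu>)" for n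
        by simp
      show "(\<Sum>i<n. \<integral>x. norm (f i x) \<partial>\<mu>) \<le> (\<integral>x. exp (c * x) + exp (- c * x) \<partial>\<mu>)" for n
      proof -
        have "(\<Sum>i<n. \<integral>x. norm (f i x) \<partial>\<mu>) = (\<integral>x. (\<Sum>i<n. norm (f i x)) \<partial>\<mu>)"
          using inf by (subst Bochner_Integration.integral_sum) auto
        also have "\<dots> \<le> (\<integral>x. exp (c * x) + exp (- c * x) \<partial>\<mu>)"
          using inf ps by (intro Bochner_Integration.integral_mono intE Bochner_Integration.integrable_sum) auto
        finally show ?thesis .
      qed
    qed
  qed
  moreover have "(\<Sum>k. f k x) = exp (z * of_real x)" for x
    using exp_converges[of "z * of_real x"]
    by (simp add: sums_iff f_def scaleR_conv_of_real divide_inverse ac_simps)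
  moreover have "integral\<^sup>L \<mu> (f k) = z ^ k / fact k * complex_of_real (\<integral>x. x ^ k \<partial>\<mu>)" for k
  proof -
    have "integral\<^sup>L \<mu> (f k) = (\<integral>x. z ^ k / fact k * complex_of_real (x ^ k) \<partial>\<mu>)"
      by (intro Bochner_Integration.integral_cong) (auto simp: f_def power_mult_distrib)
    also have "\<dots> = z ^ k / fact k * complex_of_real (\<integral>x. x ^ k \<partial>\<mu>)"
      by (subst integral_mult_right_zero, subst integral_complex_of_real) (rule refl)
    finally show ?thesis .
  qed
  ultimately show ?thesis by simp
qed

text \<open>Exponential moments make the characteristic function an everywhere convergent power
  series in the moments, so equal moments give equal characteristic functions. Levy uniqueness
  concerns probability measures, hence the division by the total mass \<open>c\<close>, with
  \<open>c = 0\<close> treated apart.\<close>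

lemma finite_measure_eq_of_moments:
  fixes \<mu> \<nu> :: "real measure"
  assumes fin: "finite_measure \<mu>" "finite_measure \<nu>"
    and sets: "sets \<mu> = sets borel" "sets \<nu> = sets borel"
    and int: "\<And>c. integrable \<mu> (\<lambda>x. exp (c * x))" "\<And>c. integrable \<nu> (\<lambda>x. exp (c * x))"
    and mom: "\<And>k. (\<integral>x. x ^ k \<partial>\<mu>) = (\<integral>x. x ^ k \<partial>\<nu>)"
  shows "\<mu> = \<nu>"
proof -
  interpret m: finite_measure \<mu> by fact
  interpret n: finite_measure \<nu> by fact
  have sp: "space \<mu> = UNIV" "space \<nu> = UNIV"
    using sets sets_eq_imp_space_eq[of _ borel] by auto
  have ch: "(CLINT x|\<mu>. iexp (t * x)) = (CLINT x|\<nu>. iexp (t * x))" for t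
    using powser_moments[OF fin(1) sets(1) int(1), of "\<i> * t"]
      powser_moments[OF fin(2) sets(2) int(2), of "\<i> * t"]
    by (simp add: mom sums_iff mult.assoc)
  define c where "c = measure \<mu> UNIV"
  have c: "c = measure \<nu> UNIV"
    using mom[of 0] sp by (simp add: c_def)
  show ?thesis
  proof (cases "c = 0")
    case True
    then have "emeasure \<mu> UNIV = 0" "emeasure \<nu> UNIV = 0"
      using c by (simp_all add: c_def m.emeasure_eq_measure n.emeasure_eq_measure)
    then have "emeasure \<mu> A = 0" "emeasure \<nu> A = 0" for A
      by (metis emeasure_eq_0 emeasure_notin_sets sets sets.top space_borel subset_UNIV)+
    then show ?thesis
      using sets by (intro measure_eqI) auto
  next
    case False
    then have "c > 0" by (simp add: c_def zero_less_measure_iff)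
    have pr: "real_distribution (scale_measure (ennreal (1 / c)) M)"
      if "finite_measure M" "sets M = sets borel" "measure M UNIV = c" "space M = UNIV" for M
    proof -
      interpret finite_measure M by fact
      show ?thesis
        unfolding real_distribution_def real_distribution_axioms_def
        using that \<open>c > 0\<close>
        by (auto intro!: prob_spaceI simp: emeasure_eq_measure ennreal_mult[symmetric] space_scale_measure)
    qed
    have chs: "char (scale_measure (ennreal (1 / c)) M) t = (1 / c) *\<^sub>R (CLINT x|M. iexp (t * x))"
      if "sets M = sets borel" for M t
    proof -
      have [measurable_cong]: "sets M = sets borel" by fact
      have "density M (\<lambda>_. ennreal (1/c)) = scale_measure (ennreal (1 / c)) M"
        by (rule measure_eqI) (auto simp: emeasure_density nn_integral_cmult)
      then have "char (scale_measure (ennreal (1 / c)) M) t = (CLINT x|density M (\<lambda>_. ennreal (1/c)). iexp (t * x))"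
        unfolding char_def by simp
      also have "\<dots> = (CLINT x|M. (1 / c) *\<^sub>R iexp (t * x))"
        using \<open>c > 0\<close> by (subst integral_density) auto
      finally show ?thesis by simp
    qed
    have eq: "scale_measure (ennreal (1 / c)) \<mu> = scale_measure (ennreal (1 / c)) \<nu>"
    proof (intro Levy_uniqueness pr ext)
      show "char (scale_measure (ennreal (1 / c)) \<mu>) t = char (scale_measure (ennreal (1 / c)) \<nu>) t" for t
        unfolding chs[OF sets(1)] chs[OF sets(2)] ch ..
    qed (use fin sets sp c c_def in auto)
    have "emeasure \<mu> A = emeasure \<nu> A" for A
    proof -
      have "ennreal c * emeasure (scale_measure (ennreal (1 / c)) \<mu>) A =
        ennreal c * emeasure (scale_measure (ennreal (1 / c)) \<nu>) A"
        using eq by simp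
      then show ?thesis
        using \<open>c > 0\<close> by (simp add: mult.assoc[symmetric] ennreal_mult[symmetric])
    qed
    then show ?thesis
      using sets by (intro measure_eqI) auto
  qed
qed

text \<open>Both sides are power series in the real variable \<open>c\<close> with coefficients
  given by the moments, so the identity theorem reduces the claim to equality of moments.\<close>

lemma finite_measure_eq_of_mgf:
  fixes \<mu> \<nu> :: "real measure"
  assumes sets: "sets \<mu> = sets borel" "sets \<nu> = sets borel"
    and eq: "\<And>c. (\<integral>\<^sup>+x. ennreal (exp (c * x)) \<partial>\<mu>) = (\<integral>\<^sup>+x. ennreal (exp (c * x)) \<partial>\<nu>)"
    and fin: "\<And>c. (\<integral>\<^sup>+x. ennreal (exp (c * x)) \<partial>\<mu>) < \<infinity>"
  shows "\<mu> = \<nu>"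
proof -
  have [measurable_cong]: "sets \<mu> = sets borel" "sets \<nu> = sets borel" by fact+
  have int: "integrable \<mu> (\<lambda>x. exp (c * x))" "integrable \<nu> (\<lambda>x. exp (c * x))" for c
    using fin[of c] eq[of c] by (auto intro!: integrableI_nonneg)
  have fm: "finite_measure \<mu>" "finite_measure \<nu>"
    using fin[of 0] eq[of 0] by (auto intro!: finite_measureI)
  have inteq: "(\<integral>x. exp (c * x) \<partial>\<mu>) = (\<integral>x. exp (c * x) \<partial>\<nu>)" for c
    using eq[of c] by (simp add: integral_eq_nn_integral)
  have ser: "(\<lambda>k. 1 / fact k * (\<integral>x. x ^ k \<partial>M) * z ^ k) sums (\<integral>x. exp (z * x) \<partial>M)"
    if "finite_measure M" "sets M = sets borel" "\<And>c. integrable M (\<lambda>x. exp (c * x))" for M :: "real measure" and z :: real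
  proof -
    have "(\<lambda>k. complex_of_real (1 / fact k * (\<integral>x. x ^ k \<partial>M) * z ^ k)) sums complex_of_real (\<integral>x. exp (z * x) \<partial>M)"
    proof -
      have "(CLINT x|M. exp (complex_of_real z * complex_of_real x)) = (CLINT x|M. complex_of_real (exp (z * x)))"
        by (simp add: exp_of_real[symmetric])
      also have "\<dots> = complex_of_real (\<integral>x. exp (z * x) \<partial>M)"
        by (rule integral_complex_of_real)
      finally show ?thesis
        using powser_moments[OF that, of "complex_of_real z"] by (simp add: mult_ac)
    qed
    then show ?thesis by (simp only: sums_of_real_iff)
  qed
  define a where "a k = 1 / fact k * ((\<integral>x. x ^ k \<partial>\<mu>) - (\<integral>x. x ^ k \<partial>\<nu>))" for k
  have sums: "(\<lambda>k. a k * (z - 0) ^ k) sums 0" for z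
  proof -
    have "(\<lambda>k. 1 / fact k * (\<integral>x. x ^ k \<partial>\<mu>) * z ^ k - 1 / fact k * (\<integral>x. x ^ k \<partial>\<nu>) * z ^ k) sums
      ((\<integral>x. exp (z * x) \<partial>\<mu>) - (\<integral>x. exp (z * x) \<partial>\<nu>))"
      by (rule sums_diff[OF ser[OF fm(1) sets(1) int(1)] ser[OF fm(2) sets(2) int(2)]])
    also have "(\<integral>x. exp (z * x) \<partial>\<mu>) - (\<integral>x. exp (z * x) \<partial>\<nu>) = 0"
      using inteq[of z] by linarith
    also have "(\<lambda>k. 1 / fact k * (\<integral>x. x ^ k \<partial>\<mu>) * z ^ k - 1 / fact k * (\<integral>x. x ^ k \<partial>\<nu>) * z ^ k) = (\<lambda>k. a k * (z - 0) ^ k)"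
      by (rule ext) (simp add: a_def right_diff_distrib diff_divide_distrib left_diff_distrib)
    finally show ?thesis .
  qed
  \<comment> \<open>A power series with a nonzero coefficient of positive order has no other zeros
    near 0 if it vanishes at 0, whereas this one vanishes everywhere. The coefficient of order 0 is
    read off from the total masses.\<close>
  have "a k = 0" if k: "k > 0" for k
  proof (rule ccontr)
    assume "a k \<noteq> 0"
    then obtain s where "0 < s" "\<And>z. z \<in> cball (0::real) s - {0} \<Longrightarrow> (0::real) \<noteq> 0"
      using powser_0_nonzero[of 1 0 a "\<lambda>_. 0" k, OF zero_less_one sums refl \<open>a k \<noteq> 0\<close> k] by blast
    from this(2)[of s] \<open>0 < s\<close> show False by simp
  qed
  moreover have "a 0 = 0"
    using inteq[of 0] by (simp add: a_def)
  ultimately have "a k = 0" for k by (cases "k = 0") auto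
  then have "(\<integral>x. x ^ k \<partial>\<mu>) = (\<integral>x. x ^ k \<partial>\<nu>)" for k
    by (simp add: a_def)
  then show ?thesis
    using finite_measure_eq_of_moments fm sets int by blast
qed

text \<open>Exponentials are traded for indicators one coordinate at a time. With the indicators
  already obtained and an arbitrary exponential used as a density, the law of the next coordinate is
  a finite measure on the line, and it is determined by its generating function.\<close>

lemma distr_PiM_eq_of_mgf:
  fixes X :: "'a \<Rightarrow> 'i \<Rightarrow> real" and Y :: "'b \<Rightarrow> 'i \<Rightarrow> real"
  assumes X[measurable]: "\<And>i. (\<lambda>x. X x i) \<in> borel_measurable A"
    and Y[measurable]: "\<And>i. (\<lambda>y. Y y i) \<in> borel_measurable B"
    and eq: "\<And>J a. finite J \<Longrightarrow>
      (\<integral>\<^sup>+x. ennreal (exp (\<Sum>i\<in>J. a i * X x i)) \<partial>A) = (\<integral>\<^sup>+y. ennreal (exp (\<Sum>i\<in>J. a i * Y y i)) \<partial>B)"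
    and fin: "\<And>J a. finite J \<Longrightarrow> (\<integral>\<^sup>+x. ennreal (exp (\<Sum>i\<in>J. a i * X x i)) \<partial>A) < \<infinity>"
  shows "distr A (Pi\<^sub>M UNIV (\<lambda>_. borel)) X = distr B (Pi\<^sub>M UNIV (\<lambda>_. borel)) Y"
proof -
  have mX[measurable]: "X \<in> A \<rightarrow>\<^sub>M Pi\<^sub>M UNIV (\<lambda>_. borel)"
    by (rule measurable_PiM_single') auto
  have mY[measurable]: "Y \<in> B \<rightarrow>\<^sub>M Pi\<^sub>M UNIV (\<lambda>_. borel)"
    by (rule measurable_PiM_single') auto
  have key: "(\<integral>\<^sup>+x. (\<Prod>i\<in>J. indicator (E i) (X x i)) * ennreal (exp (\<Sum>i\<in>K. a i * X x i)) \<partial>A) =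
      (\<integral>\<^sup>+y. (\<Prod>i\<in>J. indicator (E i) (Y y i)) * ennreal (exp (\<Sum>i\<in>K. a i * Y y i)) \<partial>B)"
    if "finite J" "finite K" "\<And>i. i \<in> J \<Longrightarrow> E i \<in> sets borel" for J K E a
    using that
  proof (induction J arbitrary: K a rule: finite_induct)
    case empty
    then show ?case using eq by simp
  next
    case (insert j J)
    have [measurable]: "E i \<in> sets borel" if "i \<in> J" for i
      using insert.prems that by auto
    have [measurable]: "E j \<in> sets borel"
      using insert.prems by auto
    define f where "f x = (\<Prod>i\<in>J. indicator (E i) (X x i)) * ennreal (exp (\<Sum>i\<in>K. a i * X x i))" for x
    define g where "g y = (\<Prod>i\<in>J. indicator (E i) (Y y i)) * ennreal (exp (\<Sum>i\<in>K. a i * Y y i))" for y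
    have [measurable]: "f \<in> borel_measurable A" "g \<in> borel_measurable B"
      unfolding f_def g_def by measurable
    define \<mu> where "\<mu> = distr (density A f) borel (\<lambda>x. X x j)"
    define \<nu> where "\<nu> = distr (density B g) borel (\<lambda>y. Y y j)"
    have i\<mu>: "(\<integral>\<^sup>+z. h z \<partial>\<mu>) = (\<integral>\<^sup>+x. f x * h (X x j) \<partial>A)" if [measurable]: "h \<in> borel_measurable borel" for h
      unfolding \<mu>_def by (subst nn_integral_distr) (auto simp: nn_integral_density)
    have i\<nu>: "(\<integral>\<^sup>+z. h z \<partial>\<nu>) = (\<integral>\<^sup>+y. g y * h (Y y j) \<partial>B)" if [measurable]: "h \<in> borel_measurable borel" for h
      unfolding \<nu>_def by (subst nn_integral_distr) (auto simp: nn_integral_density)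
    \<comment> \<open>The new coordinate \<open>j\<close> may already occur in \<open>K\<close>, so
      its coefficient is added to the old one.\<close>
    define a' where "a' c = (\<lambda>i. (if i \<in> K then a i else 0) + (if i = j then c else 0))" for c
    have sum: "(\<Sum>i\<in>K. a i * z i) + c * z j = (\<Sum>i\<in>insert j K. a' c i * z i)" for c and z :: "'i \<Rightarrow> real"
    proof -
      have "(\<Sum>i\<in>insert j K. a' c i * z i) =
        (\<Sum>i\<in>insert j K. (if i \<in> K then a i * z i else 0)) + (\<Sum>i\<in>insert j K. (if i = j then c * z i else 0))"
        by (auto simp: a'_def sum.distrib[symmetric] algebra_simps intro!: sum.cong)
      also have "(\<Sum>i\<in>insert j K. (if i \<in> K then a i * z i else 0)) = (\<Sum>i\<in>K. a i * z i)"
        using insert.prems(1) by (intro sum.mono_neutral_cong_right) auto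
      also have "(\<Sum>i\<in>insert j K. (if i = j then c * z i else 0)) = c * z j"
        using insert.prems(1) by (simp add: sum.delta)
      finally show ?thesis by simp
    qed
    have e\<mu>: "(\<integral>\<^sup>+z. ennreal (exp (c * z)) \<partial>\<mu>) =
      (\<integral>\<^sup>+x. (\<Prod>i\<in>J. indicator (E i) (X x i)) * ennreal (exp (\<Sum>i\<in>insert j K. a' c i * X x i)) \<partial>A)" for c
      by (subst i\<mu>) (auto simp: f_def mult.assoc ennreal_mult[symmetric] exp_add[symmetric] sum)
    have e\<nu>: "(\<integral>\<^sup>+z. ennreal (exp (c * z)) \<partial>\<nu>) =
      (\<integral>\<^sup>+y. (\<Prod>i\<in>J. indicator (E i) (Y y i)) * ennreal (exp (\<Sum>i\<in>insert j K. a' c i * Y y i)) \<partial>B)" for c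
      by (subst i\<nu>) (auto simp: g_def mult.assoc ennreal_mult[symmetric] exp_add[symmetric] sum)
    have "\<mu> = \<nu>"
    proof (rule finite_measure_eq_of_mgf)
      show "(\<integral>\<^sup>+z. ennreal (exp (c * z)) \<partial>\<mu>) = (\<integral>\<^sup>+z. ennreal (exp (c * z)) \<partial>\<nu>)" for c
        unfolding e\<mu> e\<nu> using insert.prems by (intro insert.IH) auto
      have "(\<integral>\<^sup>+z. ennreal (exp (c * z)) \<partial>\<mu>) \<le> (\<integral>\<^sup>+x. ennreal (exp (\<Sum>i\<in>insert j K. a' c i * X x i)) \<partial>A)" for c
      proof -
        have "(\<Prod>i\<in>J. indicator (E i) (X x i)) \<le> (1::ennreal)" for x
          by (intro prod_le_1) (auto split: split_indicator)
        then show ?thesis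
          unfolding e\<mu> by (intro nn_integral_mono) (metis mult_right_mono mult_1 zero_le)
      qed
      then show "(\<integral>\<^sup>+z. ennreal (exp (c * z)) \<partial>\<mu>) < \<infinity>" for c
        using fin[of "insert j K" "a' c"] insert.prems(1) by (auto intro: le_less_trans)
    qed (simp_all add: \<mu>_def \<nu>_def)
    then have "(\<integral>\<^sup>+z. indicator (E j) z \<partial>\<mu>) = (\<integral>\<^sup>+z. indicator (E j) z \<partial>\<nu>)"
      by simp
    then show ?case
      using insert.hyps by (subst (asm) i\<mu>, simp, subst (asm) i\<nu>, simp) (simp add: f_def g_def mult_ac)
  qed
  show ?thesis
  proof (rule measure_eqI_PiM_infinite)
    fix E :: "'i \<Rightarrow> real set" and J assume J: "finite J" "\<And>i. i \<in> J \<Longrightarrow> E i \<in> sets borel"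
    have ind: "indicator (prod_emb UNIV (\<lambda>_. borel) J (Pi\<^sub>E J E)) x = (\<Prod>i\<in>J. indicator (E i) (x i) :: ennreal)" for x
    proof -
      have "x \<in> prod_emb UNIV (\<lambda>_. borel) J (Pi\<^sub>E J E) \<longleftrightarrow> (\<forall>i\<in>J. x i \<in> E i)"
        by (simp add: prod_emb_def PiE_iff)
      moreover have "(\<Prod>i\<in>J. indicator (E i) (x i)) = (0::ennreal)" if "i \<in> J" "x i \<notin> E i" for i
        using that J(1) by (intro prod_zero) (auto intro!: bexI[of _ i])
      ultimately show ?thesis
        by (cases "\<forall>i\<in>J. x i \<in> E i") (auto simp: indicator_def)
    qed
    have [measurable]: "prod_emb UNIV (\<lambda>_. borel) J (Pi\<^sub>E J E) \<in> sets (Pi\<^sub>M UNIV (\<lambda>_. borel))"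
      using J by (intro sets_PiM_I) auto
    show "emeasure (distr A (Pi\<^sub>M UNIV (\<lambda>_. borel)) X) (prod_emb UNIV (\<lambda>_. borel) J (Pi\<^sub>E J E)) =
      emeasure (distr B (Pi\<^sub>M UNIV (\<lambda>_. borel)) Y) (prod_emb UNIV (\<lambda>_. borel) J (Pi\<^sub>E J E))"
      using key[of J "{}" E] J
      by (simp add: nn_integral_indicator[symmetric] nn_integral_distr ind del: nn_integral_indicator)
  next
    show "finite_measure (distr A (Pi\<^sub>M UNIV (\<lambda>_. borel)) X)"
    proof (rule finite_measureI)
      have "(\<integral>\<^sup>+x. 1 \<partial>distr A (Pi\<^sub>M UNIV (\<lambda>_. borel)) X) = (\<integral>\<^sup>+x. 1 \<partial>A)"
        by (subst nn_integral_distr) auto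
      then show "emeasure (distr A (Pi\<^sub>M UNIV (\<lambda>_. borel)) X) (space (distr A (Pi\<^sub>M UNIV (\<lambda>_. borel)) X)) \<noteq> \<infinity>"
        using fin[of "{}"] by simp
    qed
  qed simp_all
qed

section \<open>The random atoms and the Gaussian field\<close>

lemma ell2_summable_mult:
  assumes "x \<in> ell2" "y \<in> ell2"
  shows "summable (\<lambda>i. x i * y i)"
proof (rule summable_comparison_test)
  show "summable (\<lambda>i. (x i)\<^sup>2 + (y i)\<^sup>2)"
    using assms by (intro summable_add) (auto simp: ell2_def)
  have "\<bar>x i * y i\<bar> \<le> (x i)\<^sup>2 + (y i)\<^sup>2" for i
  proof -
    have "0 \<le> (\<bar>x i\<bar> - \<bar>y i\<bar>)\<^sup>2" by simp
    then have "2 * \<bar>x i * y i\<bar> \<le> (x i)\<^sup>2 + (y i)\<^sup>2"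
      by (simp add: power2_diff abs_mult)
    then show ?thesis
      using abs_ge_zero[of "x i * y i"] by linarith
  qed
  then show "\<exists>N. \<forall>i\<ge>N. norm (x i * y i) \<le> (x i)\<^sup>2 + (y i)\<^sup>2" by auto
qed

lemma ell2_inner_sums:
  assumes "x \<in> ell2" "y \<in> ell2"
  shows "(\<lambda>i. x i * y i) sums ell2_inner x y"
  using ell2_summable_mult[OF assms] by (simp add: ell2_inner_def summable_sums)

lemma ell2_inner_commute: "ell2_inner x y = ell2_inner y x"
  by (simp add: ell2_inner_def mult.commute)

lemma ell2_dist_sums:
  assumes "x \<in> ell2" "y \<in> ell2"
  shows "(\<lambda>i. (x i - y i)\<^sup>2) sums (ell2_inner x x + ell2_inner y y - 2 * ell2_inner x y)"
proof -
  have "(\<lambda>i. x i * x i + y i * y i - 2 * (x i * y i)) sums (ell2_inner x x + ell2_inner y y - 2 * ell2_inner x y)"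
    using assms by (intro sums_diff sums_add sums_mult ell2_inner_sums)
  also have "(\<lambda>i. x i * x i + y i * y i - 2 * (x i * y i)) = (\<lambda>i. (x i - y i)\<^sup>2)"
    by (auto simp: power2_eq_square algebra_simps)
  finally show ?thesis .
qed

lemma ell2_inner_le:
  assumes "x \<in> ell2" "y \<in> ell2"
  shows "2 * ell2_inner x y \<le> ell2_inner x x + ell2_inner y y"
  using sums_le[OF _ sums_zero ell2_dist_sums[OF assms]] by auto

text \<open>Equality in 2 x.y \<le> x.x + y.y. On a sphere of squared radius q this is how an
  overlap q identifies two points.\<close>

lemma ell2_eq_of_inner:
  assumes xy: "x \<in> ell2" "y \<in> ell2" and "ell2_inner x x + ell2_inner y y = 2 * ell2_inner x y"
  shows "x = y"
proof
  fix i
  have "(\<lambda>i. (x i - y i)\<^sup>2) sums 0"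
    using ell2_dist_sums[OF xy] assms(3) by simp
  then have "(x i - y i)\<^sup>2 \<le> 0"
    using sum_le_suminf[of "\<lambda>i. (x i - y i)\<^sup>2" "{i}"] by (auto simp: sums_iff)
  then show "x i = y i" by simp
qed

lemma ell2_unit_ballD:
  assumes "x \<in> ell2_unit_ball"
  shows "x \<in> ell2" "ell2_inner x x \<le> 1"
  using assms by (auto simp: ell2_unit_ball_def ell2_norm_def)

lemma ell2_unit_ball_inner_abs_le:
  assumes "x \<in> ell2_unit_ball" "y \<in> ell2_unit_ball"
  shows "\<bar>ell2_inner x y\<bar> \<le> 1"
proof -
  note x = ell2_unit_ballD[OF assms(1)] and y = ell2_unit_ballD[OF assms(2)]
  have m: "(\<lambda>i. - y i) \<in> ell2" using y by (auto simp: ell2_def)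
  have "ell2_inner x (\<lambda>i. - y i) = - ell2_inner x y"
    using ell2_inner_sums[OF x(1) y(1)] by (auto simp: ell2_inner_def sums_iff suminf_minus)
  moreover have "ell2_inner (\<lambda>i. - y i) (\<lambda>i. - y i) = ell2_inner y y"
    by (simp add: ell2_inner_def)
  ultimately show ?thesis
    using ell2_inner_le[OF x(1) y(1)] ell2_inner_le[OF x(1) m] x(2) y(2) by (auto simp: abs_le_iff)
qed

lemma ell2_unit_ball_coord_abs_le:
  assumes "x \<in> ell2_unit_ball"
  shows "\<bar>x i\<bar> \<le> 1"
proof -
  note x = ell2_unit_ballD[OF assms]
  have "(x i)\<^sup>2 \<le> ell2_inner x x"
    using sum_le_suminf[of "\<lambda>i. (x i)\<^sup>2" "{i}"] x(1) by (auto simp: ell2_def ell2_inner_def power2_eq_square)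
  then have "(x i)\<^sup>2 \<le> 1" using x(2) by linarith
  then show ?thesis by (simp add: abs_square_le_1)
qed

text \<open>Schur's product argument: expanding one factor of the inner product in coordinates, each
  coordinate is absorbed into the coefficients \<open>a\<close>, which leaves the form for the
  previous power.\<close>

lemma inner_power_psd:
  fixes a :: "'i \<Rightarrow> real"
  assumes x: "\<And>i. i \<in> I \<Longrightarrow> x i \<in> ell2"
  shows "0 \<le> (\<Sum>i\<in>I. \<Sum>j\<in>I. a i * a j * ell2_inner (x i) (x j) ^ p)"
proof (induction p arbitrary: a)
  case 0
  have "(\<Sum>i\<in>I. \<Sum>j\<in>I. a i * a j) = (\<Sum>i\<in>I. a i)\<^sup>2"
    by (simp add: power2_eq_square sum_product)
  then show ?case by simp
next
  case (Suc p)
  have s: "(\<lambda>r. \<Sum>i\<in>I. \<Sum>j\<in>I. a i * a j * ell2_inner (x i) (x j) ^ p * (x i r * x j r)) sums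
    (\<Sum>i\<in>I. \<Sum>j\<in>I. a i * a j * ell2_inner (x i) (x j) ^ p * ell2_inner (x i) (x j))"
    using x by (intro sums_sum sums_mult ell2_inner_sums) auto
  have p: "0 \<le> (\<Sum>i\<in>I. \<Sum>j\<in>I. a i * a j * ell2_inner (x i) (x j) ^ p * (x i r * x j r))" for r
    using Suc.IH[of "\<lambda>i. a i * x i r"] by (simp add: mult_ac)
  have "0 \<le> (\<Sum>i\<in>I. \<Sum>j\<in>I. a i * a j * ell2_inner (x i) (x j) ^ p * ell2_inner (x i) (x j))"
    by (rule sums_le[OF p sums_zero s])
  then show ?case by (simp add: mult_ac)
qed

section \<open>Gaussian integrals\<close>

abbreviation std_normal :: "real measure" where
  "std_normal \<equiv> density lborel (\<lambda>x. ennreal (std_normal_density x))"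

lemma nn_integral_exp_std_normal:
  "(\<integral>\<^sup>+z. ennreal (exp (c * z)) \<partial>std_normal) = ennreal (exp (c\<^sup>2 / 2))"
proof -
  have eq: "std_normal_density z * exp (c * z) = exp (c\<^sup>2 / 2) * normal_density c 1 z" for z
  proof -
    have "- z\<^sup>2 / 2 + c * z = c\<^sup>2 / 2 + - (z - c)\<^sup>2 / 2"
      by (simp add: power2_eq_square field_simps)
    then have "exp (- z\<^sup>2 / 2) * exp (c * z) = exp (c\<^sup>2 / 2) * exp (- (z - c)\<^sup>2 / 2)"
      by (simp only: exp_add[symmetric])
    then show ?thesis
      by (simp add: normal_density_def)
  qed
  have "(\<integral>\<^sup>+z. ennreal (exp (c * z)) \<partial>std_normal) =
    (\<integral>\<^sup>+z. ennreal (exp (c\<^sup>2 / 2)) * ennreal (normal_density c 1 z) \<partial>lborel)"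
    by (subst nn_integral_density) (auto simp: ennreal_mult[symmetric] eq)
  also have "\<dots> = ennreal (exp (c\<^sup>2 / 2)) * (\<integral>\<^sup>+z. ennreal (normal_density c 1 z) \<partial>lborel)"
    by (rule nn_integral_cmult) simp
  also have "(\<integral>\<^sup>+z. ennreal (normal_density c 1 z) \<partial>lborel) = 1"
    using prob_space.emeasure_space_1[OF prob_space_normal_density[of 1 c]]
    by (simp add: emeasure_density)
  finally show ?thesis by simp
qed

text \<open>One formula for the degenerate and the nondegenerate case. It depends measurably on the
  variance, so a normal law with random variance can be realised as a multiple of an independent
  standard normal variable.\<close>

lemma centered_normal_eq_distr:
  assumes "0 \<le> v"
  shows "centered_normal v = distr std_normal borel (\<lambda>z. sqrt v * z)"
proof (cases "v = 0")
  case True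
  interpret prob_space std_normal by (rule prob_space_normal_density) simp
  show ?thesis
    unfolding True using distr_const[of 0 borel] by (simp add: centered_normal_def)
next
  case False
  then have v: "0 < v" using assms by simp
  interpret prob_space std_normal by (rule prob_space_normal_density) simp
  have "distributed std_normal lborel (\<lambda>x. x) std_normal_density"
    unfolding distributed_def by (auto simp: distr_id2)
  from normal_density_affine[OF this, of "sqrt v" 0]
  have "distributed std_normal lborel (\<lambda>z. sqrt v * z) (normal_density 0 (sqrt v))"
    using v by simp
  then show ?thesis
    using v by (simp add: distributed_def centered_normal_def cong: distr_cong)
qed

section \<open>The setting and its measurability\<close>

locale random_atoms = prob_space M for M :: "'a measure" +
  fixes w :: "'a \<Rightarrow> nat \<Rightarrow> real" and \<xi> :: "'a \<Rightarrow> nat \<Rightarrow> point"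
  assumes atomic: "random_atomic_measure M w \<xi>"
begin

abbreviation Q :: "'a \<Rightarrow> nat \<Rightarrow> nat \<Rightarrow> real" where
  "Q \<omega> l l' \<equiv> ell2_inner (\<xi> \<omega> l) (\<xi> \<omega> l')"

abbreviation F :: "'a measure" where
  "F \<equiv> gen_algebra M w \<xi>"

lemma w_nonneg: "\<omega> \<in> space M \<Longrightarrow> 0 \<le> w \<omega> l"
  and w_decseq: "\<omega> \<in> space M \<Longrightarrow> decseq (w \<omega>)"
  and w_sums: "\<omega> \<in> space M \<Longrightarrow> w \<omega> sums 1"
  and xi_ball: "\<omega> \<in> space M \<Longrightarrow> \<xi> \<omega> l \<in> ell2_unit_ball"
  and xi_inj: "\<omega> \<in> space M \<Longrightarrow> inj_on (\<xi> \<omega>) {l. 0 < w \<omega> l}"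
  using atomic unfolding random_atomic_measure_def by auto

lemma w_le_1: assumes "\<omega> \<in> space M" shows "w \<omega> l \<le> 1"
  using sum_le_suminf[of "w \<omega>" "{l}"] w_nonneg[OF assms] w_sums[OF assms] by (auto simp: sums_iff)

lemma xi_ell2: "\<omega> \<in> space M \<Longrightarrow> \<xi> \<omega> l \<in> ell2"
  using xi_ball ell2_unit_ballD by blast

lemma Q_abs_le_1: "\<omega> \<in> space M \<Longrightarrow> \<bar>Q \<omega> l l'\<bar> \<le> 1"
  using xi_ball ell2_unit_ball_inner_abs_le by blast

lemma Q_power_abs_le_1: "\<omega> \<in> space M \<Longrightarrow> \<bar>Q \<omega> l l' ^ p\<bar> \<le> 1"
  using Q_abs_le_1[of \<omega> l l'] by (simp add: power_abs power_le_one)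

lemma Q_commute: "Q \<omega> l l' = Q \<omega> l' l"
  by (rule ell2_inner_commute)

lemma space_F: "space F = space M"
  by (simp add: gen_algebra_def)

lemma pair_measurable: "(\<lambda>\<omega>. (w \<omega>, \<xi> \<omega>)) \<in> M \<rightarrow>\<^sub>M seq_space \<Otimes>\<^sub>M Pi\<^sub>M UNIV (\<lambda>_. seq_space)"
  using atomic unfolding random_atomic_measure_def by (intro measurable_Pair) auto

lemma subalgebra_F: "subalgebra M F"
  unfolding subalgebra_def
proof
  show "sets F \<subseteq> sets M"
  proof -
    have "(\<lambda>\<omega>. (w \<omega>, \<xi> \<omega>)) \<in> space M \<rightarrow> space (seq_space \<Otimes>\<^sub>M Pi\<^sub>M UNIV (\<lambda>_. seq_space))"
      using measurable_space[OF pair_measurable] by auto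
    then show ?thesis
      unfolding gen_algebra_def by (auto simp: sets_vimage_algebra2 intro: measurable_sets[OF pair_measurable])
  qed
qed (simp add: space_F)

lemma F_measurable_w: "(\<lambda>\<omega>. w \<omega> l) \<in> borel_measurable F"
  and F_measurable_xi: "(\<lambda>\<omega>. \<xi> \<omega> l i) \<in> borel_measurable F"
proof -
  have m: "(\<lambda>\<omega>. (w \<omega>, \<xi> \<omega>)) \<in> F \<rightarrow>\<^sub>M seq_space \<Otimes>\<^sub>M Pi\<^sub>M UNIV (\<lambda>_. seq_space)"
    unfolding gen_algebra_def
    by (rule measurable_vimage_algebra1) (use measurable_space[OF pair_measurable] in auto)
  have 1: "(\<lambda>z. fst z l) \<in> borel_measurable (seq_space \<Otimes>\<^sub>M Pi\<^sub>M UNIV (\<lambda>_. seq_space))"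
    by measurable
  have 2: "(\<lambda>z. snd z l i) \<in> borel_measurable (seq_space \<Otimes>\<^sub>M Pi\<^sub>M UNIV (\<lambda>_. seq_space))"
  proof -
    have "(\<lambda>z. snd z l) \<in> seq_space \<Otimes>\<^sub>M Pi\<^sub>M UNIV (\<lambda>_. seq_space) \<rightarrow>\<^sub>M seq_space"
      by (rule measurable_compose[OF measurable_snd], rule measurable_component_singleton) simp
    then show ?thesis
      by (rule measurable_compose) (rule measurable_component_singleton, simp)
  qed
  show "(\<lambda>\<omega>. w \<omega> l) \<in> borel_measurable F" "(\<lambda>\<omega>. \<xi> \<omega> l i) \<in> borel_measurable F"
    using measurable_compose[OF m 1] measurable_compose[OF m 2] by simp_all
qed

lemma F_measurable_Q: "(\<lambda>\<omega>. Q \<omega> l l') \<in> borel_measurable F"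
  unfolding ell2_inner_def
  by (intro borel_measurable_suminf borel_measurable_times F_measurable_xi)

lemma measurable_w[measurable]: "(\<lambda>\<omega>. w \<omega> l) \<in> borel_measurable M"
  and measurable_xi[measurable]: "(\<lambda>\<omega>. \<xi> \<omega> l i) \<in> borel_measurable M"
  and measurable_Q[measurable]: "(\<lambda>\<omega>. Q \<omega> l l') \<in> borel_measurable M"
  by (rule measurable_from_subalg[OF subalgebra_F], rule F_measurable_w F_measurable_xi F_measurable_Q)+

end

locale gaussian_field = random_atoms M w \<xi> for M :: "'a measure" and w \<xi> +
  fixes p :: nat and h :: "'a \<Rightarrow> nat \<Rightarrow> real"
  assumes gaussian: "cond_centered_gaussian M F h (\<lambda>\<omega> l l'. Q \<omega> l l' ^ p)"
begin

lemma measurable_h[measurable]: "(\<lambda>\<omega>. h \<omega> l) \<in> borel_measurable M"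
proof -
  have "h \<in> M \<rightarrow>\<^sub>M seq_space"
    using gaussian by (simp add: cond_centered_gaussian_def)
  then show ?thesis by (rule measurable_compose) measurable
qed

text \<open>The hypothesis only speaks of conditional probabilities of Borel sets. On the event
  \<open>A\<close> it says that the linear combination has the law of \<open>sqrt V\<close> times an
  independent standard normal variable; once the two laws are known to be equal, the exponential can
  be integrated against both.\<close>

lemma cond_exp_mgf_indicator:
  fixes a :: "nat \<Rightarrow> real" and m :: nat
  assumes A: "A \<in> sets F"
  defines "V \<equiv> \<lambda>\<omega>. \<Sum>l<m. \<Sum>l'<m. a l * a l' * Q \<omega> l l' ^ p"
  shows "(\<integral>\<^sup>+\<omega>. indicator A \<omega> * ennreal (exp (\<Sum>l<m. a l * h \<omega> l)) \<partial>M) =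
    (\<integral>\<^sup>+\<omega>. indicator A \<omega> * ennreal (exp (V \<omega> / 2)) \<partial>M)"
proof -
  interpret fs: finite_measure_subalgebra M F
    by standard (rule subalgebra_F)
  interpret N: prob_space std_normal by (rule prob_space_normal_density) simp
  interpret MN: pair_sigma_finite M std_normal ..
  have AM[measurable]: "A \<in> sets M" using A subalgebra_F by (auto simp: subalgebra_def)
  have V[measurable]: "V \<in> borel_measurable M"
    unfolding V_def by measurable
  have V0: "0 \<le> V \<omega>" if "\<omega> \<in> space M" for \<omega>
    unfolding V_def using that by (intro inner_power_psd xi_ell2)
  define X where "X \<omega> = (\<Sum>l<m. a l * h \<omega> l)" for \<omega>
  have X[measurable]: "X \<in> borel_measurable M"
    unfolding X_def by measurable
  define Y where "Y = (\<lambda>(\<omega>, z). sqrt (V \<omega>) * z)"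
  have Y[measurable]: "Y \<in> borel_measurable (M \<Otimes>\<^sub>M std_normal)"
    unfolding Y_def by measurable
  define A' where "A' = A \<times> (UNIV :: real set)"
  have [measurable]: "A' \<in> sets (M \<Otimes>\<^sub>M std_normal)"
    unfolding A'_def by measurable
  have eq: "(\<integral>\<^sup>+\<omega>. indicator A \<omega> * indicator B (X \<omega>) \<partial>M) =
     (\<integral>\<^sup>+z. indicator A' z * indicator B (Y z) \<partial>(M \<Otimes>\<^sub>M std_normal))"
    if [measurable]: "B \<in> sets borel" for B
  proof -
    have meas: "(\<lambda>\<omega>. measure (centered_normal (V \<omega>)) B) \<in> borel_measurable M"
    proof (subst measurable_cong)
      fix \<omega> assume \<omega>: "\<omega> \<in> space M"
      show "measure (centered_normal (V \<omega>)) B = (\<integral>z. indicator B (Y (\<omega>, z)) \<partial>std_normal)"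
        using V0[OF \<omega>]
        by (simp add: centered_normal_eq_distr measure_distr Y_def indicator_vimage[symmetric] vimage_def)
    qed measurable
    have cn: "ennreal (measure (centered_normal (V \<omega>)) B) = (\<integral>\<^sup>+z. indicator B (Y (\<omega>, z)) \<partial>std_normal)"
      if \<omega>: "\<omega> \<in> space M" for \<omega>
    proof -
      have "ennreal (measure (centered_normal (V \<omega>)) B) = emeasure (centered_normal (V \<omega>)) B"
        using V0[OF \<omega>] by (simp add: centered_normal_eq_distr measure_distr emeasure_distr N.emeasure_eq_measure)
      also have "\<dots> = (\<integral>\<^sup>+z. indicator B z \<partial>centered_normal (V \<omega>))"
        using V0[OF \<omega>] by (subst nn_integral_indicator) (auto simp: centered_normal_eq_distr)
      also have "\<dots> = (\<integral>\<^sup>+z. indicator B (Y (\<omega>, z)) \<partial>std_normal)"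
        unfolding centered_normal_eq_distr[OF V0[OF \<omega>]] Y_def by (subst nn_integral_distr) auto
      finally show ?thesis .
    qed
    have int: "integrable M (\<lambda>\<omega>. indicator B (X \<omega>) :: real)"
      by (rule integrable_const_bound[where B = 1]) auto
    have ae: "AE \<omega> in M. real_cond_exp M F (\<lambda>\<omega>. indicator B (X \<omega>)) \<omega> = measure (centered_normal (V \<omega>)) B"
      using gaussian unfolding cond_centered_gaussian_def X_def V_def by auto
    have "(\<integral>\<^sup>+\<omega>. indicator A \<omega> * indicator B (X \<omega>) \<partial>M) = (\<integral>\<^sup>+\<omega>. ennreal (indicator A \<omega> * indicator B (X \<omega>)) \<partial>M)"
      by (intro nn_integral_cong) (auto split: split_indicator)
    also have "\<dots> = ennreal (\<integral>\<omega>. indicator A \<omega> * indicator B (X \<omega>) \<partial>M)"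
      by (intro nn_integral_eq_integral integrable_const_bound[where B = 1]) (auto split: split_indicator)
    also have "(\<integral>\<omega>. indicator A \<omega> * indicator B (X \<omega>) \<partial>M) =
      (\<integral>\<omega>. indicator A \<omega> * real_cond_exp M F (\<lambda>\<omega>. indicator B (X \<omega>)) \<omega> \<partial>M)"
      using fs.real_cond_exp_intA[OF int A] by (simp add: set_lebesgue_integral_def)
    also have "\<dots> = (\<integral>\<omega>. indicator A \<omega> * measure (centered_normal (V \<omega>)) B \<partial>M)"
      using ae meas by (intro integral_cong_AE) auto
    also have "ennreal \<dots> = (\<integral>\<^sup>+\<omega>. ennreal (indicator A \<omega> * measure (centered_normal (V \<omega>)) B) \<partial>M)"
    proof (intro nn_integral_eq_integral[symmetric] integrable_const_bound[where B = 1])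
      show "AE \<omega> in M. norm (indicator A \<omega> * measure (centered_normal (V \<omega>)) B) \<le> 1"
      proof (intro AE_I2)
        fix \<omega> assume "\<omega> \<in> space M"
        then have "measure (centered_normal (V \<omega>)) B \<le> 1"
          using V0 by (simp add: centered_normal_eq_distr measure_distr)
        then show "norm (indicator A \<omega> * measure (centered_normal (V \<omega>)) B) \<le> 1"
          by (simp split: split_indicator)
      qed
    qed (use meas in auto)
    also have "\<dots> = (\<integral>\<^sup>+\<omega>. \<integral>\<^sup>+z. indicator A' (\<omega>, z) * indicator B (Y (\<omega>, z)) \<partial>std_normal \<partial>M)"
    proof (intro nn_integral_cong)
      fix \<omega> assume "\<omega> \<in> space M"
      then show "ennreal (indicator A \<omega> * measure (centered_normal (V \<omega>)) B) =
          (\<integral>\<^sup>+z. indicator A' (\<omega>, z) * indicator B (Y (\<omega>, z)) \<partial>std_normal)"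
        using cn by (auto simp: A'_def split: split_indicator)
    qed
    also have "\<dots> = (\<integral>\<^sup>+z. indicator A' z * indicator B (Y z) \<partial>(M \<Otimes>\<^sub>M std_normal))"
      by (rule N.nn_integral_fst) measurable
    finally show ?thesis .
  qed
  have "distr (density M (indicator A)) borel X = distr (density (M \<Otimes>\<^sub>M std_normal) (indicator A')) borel Y"
  proof (rule measure_eqI)
    fix B assume "B \<in> sets (distr (density M (indicator A)) borel X)"
    then have [measurable]: "B \<in> sets borel" by simp
    show "emeasure (distr (density M (indicator A)) borel X) B =
      emeasure (distr (density (M \<Otimes>\<^sub>M std_normal) (indicator A')) borel Y) B"
      using eq[of B] by (simp add: nn_integral_indicator[symmetric] nn_integral_distr nn_integral_density
          del: nn_integral_indicator)
  qed simp
  then have "(\<integral>\<^sup>+x. ennreal (exp x) \<partial>distr (density M (indicator A)) borel X) =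
    (\<integral>\<^sup>+x. ennreal (exp x) \<partial>distr (density (M \<Otimes>\<^sub>M std_normal) (indicator A')) borel Y)"
    by simp
  then have "(\<integral>\<^sup>+\<omega>. indicator A \<omega> * ennreal (exp (X \<omega>)) \<partial>M) =
    (\<integral>\<^sup>+z. indicator A' z * ennreal (exp (Y z)) \<partial>(M \<Otimes>\<^sub>M std_normal))"
    by (simp add: nn_integral_distr nn_integral_density)
  also have "\<dots> = (\<integral>\<^sup>+\<omega>. \<integral>\<^sup>+z. indicator A' (\<omega>, z) * ennreal (exp (Y (\<omega>, z))) \<partial>std_normal \<partial>M)"
    by (rule N.nn_integral_fst[symmetric]) measurable
  also have "\<dots> = (\<integral>\<^sup>+\<omega>. indicator A \<omega> * ennreal (exp (V \<omega> / 2)) \<partial>M)"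
  proof (intro nn_integral_cong)
    fix \<omega> assume "\<omega> \<in> space M"
    then show "(\<integral>\<^sup>+z. indicator A' (\<omega>, z) * ennreal (exp (Y (\<omega>, z))) \<partial>std_normal) =
        indicator A \<omega> * ennreal (exp (V \<omega> / 2))"
      using V0[of \<omega>] nn_integral_exp_std_normal[of "sqrt (V \<omega>)"]
      by (auto simp: A'_def Y_def split: split_indicator)
  qed
  finally show ?thesis by (simp add: X_def)
qed

text \<open>Used as densities, the two exponentials induce the same measure on \<open>F\<close>, so
  the identity passes from sets to \<open>F\<close>-measurable functions. The map \<open>l\<close>
  may repeat values, since replicas may share an atom; coefficients that belong to the same atom are
  added up.\<close>

lemma cond_exp_mgf:
  fixes a :: "'i \<Rightarrow> real" and l :: "'i \<Rightarrow> nat"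
  assumes Y: "Y \<in> borel_measurable F" and I: "finite I"
  shows "(\<integral>\<^sup>+\<omega>. Y \<omega> * ennreal (exp (\<Sum>i\<in>I. a i * h \<omega> (l i))) \<partial>M) =
    (\<integral>\<^sup>+\<omega>. Y \<omega> * ennreal (exp ((\<Sum>i\<in>I. \<Sum>j\<in>I. a i * a j * Q \<omega> (l i) (l j) ^ p) / 2)) \<partial>M)"
proof -
  define m where "m = Suc (Max (insert 0 (l ` I)))"
  have lm: "l i < m" if "i \<in> I" for i
    using that I by (auto simp: m_def less_Suc_eq_le intro!: Max_ge)
  define a' where "a' k = (\<Sum>i\<in>I. if l i = k then a i else 0)" for k
  have regroup: "(\<Sum>k<m. a' k * z k) = (\<Sum>i\<in>I. a i * z (l i))" for z :: "nat \<Rightarrow> real"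
  proof -
    have "(\<Sum>k<m. a' k * z k) = (\<Sum>k<m. \<Sum>i\<in>I. if l i = k then a i * z k else 0)"
      by (auto simp: a'_def sum_distrib_right intro!: sum.cong)
    also have "\<dots> = (\<Sum>i\<in>I. \<Sum>k<m. if l i = k then a i * z k else 0)"
      by (rule sum.swap)
    also have "\<dots> = (\<Sum>i\<in>I. a i * z (l i))"
      using lm by (intro sum.cong) auto
    finally show ?thesis .
  qed
  define X where "X \<omega> = ennreal (exp (\<Sum>k<m. a' k * h \<omega> k))" for \<omega>
  define W where "W \<omega> = ennreal (exp ((\<Sum>k<m. \<Sum>k'<m. a' k * a' k' * Q \<omega> k k' ^ p) / 2))" for \<omega>
  have [measurable]: "X \<in> borel_measurable M" "W \<in> borel_measurable M"
    unfolding X_def W_def by measurable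
  have YM[measurable]: "Y \<in> borel_measurable M"
    using measurable_from_subalg[OF subalgebra_F Y] .
  have sub: "subalgebra (density M X) F" "subalgebra (density M W) F"
    using subalgebra_F by (auto simp: subalgebra_def)
  have "restr_to_subalg (density M X) F = restr_to_subalg (density M W) F"
  proof (rule measure_eqI)
    show "sets (restr_to_subalg (density M X) F) = sets (restr_to_subalg (density M W) F)"
      using sub by (simp add: sets_restr_to_subalg)
    fix A assume "A \<in> sets (restr_to_subalg (density M X) F)"
    then have A: "A \<in> sets F" using sub by (simp add: sets_restr_to_subalg)
    then have [measurable]: "A \<in> sets M" using subalgebra_F by (auto simp: subalgebra_def)
    show "emeasure (restr_to_subalg (density M X) F) A = emeasure (restr_to_subalg (density M W) F) A"
      using cond_exp_mgf_indicator[OF A, where a = a' and m = m] sub A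
      by (simp add: emeasure_restr_to_subalg emeasure_density X_def W_def mult.commute)
  qed
  then have "(\<integral>\<^sup>+\<omega>. Y \<omega> \<partial>density M X) = (\<integral>\<^sup>+\<omega>. Y \<omega> \<partial>density M W)"
    using nn_integral_subalgebra2[OF sub(1) Y] nn_integral_subalgebra2[OF sub(2) Y] by simp
  then have "(\<integral>\<^sup>+\<omega>. Y \<omega> * X \<omega> \<partial>M) = (\<integral>\<^sup>+\<omega>. Y \<omega> * W \<omega> \<partial>M)"
    by (simp add: nn_integral_density mult.commute)
  moreover have "(\<Sum>k<m. \<Sum>k'<m. a' k * a' k' * Q \<omega> k k' ^ p) =
      (\<Sum>i\<in>I. \<Sum>j\<in>I. a i * a j * Q \<omega> (l i) (l j) ^ p)" for \<omega>
    using regroup[of "\<lambda>k. \<Sum>k'<m. a' k' * Q \<omega> k k' ^ p"] regroup[of "\<lambda>k'. Q \<omega> (l i) k' ^ p" for i]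
    by (simp add: sum_distrib_left mult.assoc)
  ultimately show ?thesis
    by (simp add: X_def W_def regroup)
qed

end

section \<open>The Cameron-Martin formula\<close>

text \<open>The points are stored by coordinates: overlaps are measurable functions of these, and
  every component except the field values is bounded by 1, which keeps the generating function of
  the whole array finite.\<close>

definition arr :: "(nat \<Rightarrow> real) \<Rightarrow> (nat \<Rightarrow> point) \<Rightarrow> (nat \<Rightarrow> real) \<Rightarrow> nat + (nat \<times> nat) + nat \<Rightarrow> real" where
  "arr v x h = case_sum v (case_sum (\<lambda>(l, i). x l i) h)"

lemma sum_arr:
  assumes "finite J"
  shows "(\<Sum>k\<in>J. a k * arr v x h k) =
    (\<Sum>k\<in>J. a k * arr v x (\<lambda>_. 0) k) + (\<Sum>j\<in>{j. Inr (Inr j) \<in> J}. a (Inr (Inr j)) * h j)"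
proof -
  have inj: "inj_on (\<lambda>j. Inr (Inr j) :: nat + (nat \<times> nat) + nat) {j. Inr (Inr j) \<in> J}"
    by (auto simp: inj_on_def)
  have "a k * arr v x h k = a k * arr v x (\<lambda>_. 0) k + (case k of Inr (Inr j) \<Rightarrow> a k * h j | _ \<Rightarrow> 0)" for k
    by (simp add: arr_def split: sum.split prod.split)
  then have "(\<Sum>k\<in>J. a k * arr v x h k) =
    (\<Sum>k\<in>J. a k * arr v x (\<lambda>_. 0) k) + (\<Sum>k\<in>J. case k of Inr (Inr j) \<Rightarrow> a k * h j | _ \<Rightarrow> 0)"
    by (simp add: sum.distrib)
  also have "(\<Sum>k\<in>J. case k of Inr (Inr j) \<Rightarrow> a k * h j | _ \<Rightarrow> 0) =
    (\<Sum>k\<in>(\<lambda>j. Inr (Inr j)) ` {j. Inr (Inr j) \<in> J}. case k of Inr (Inr j) \<Rightarrow> a k * h j | _ \<Rightarrow> 0)"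
    using assms by (intro sum.mono_neutral_right) (auto split: sum.split)
  also have "\<dots> = (\<Sum>j\<in>{j. Inr (Inr j) \<in> J}. a (Inr (Inr j)) * h j)"
    by (subst sum.reindex[OF inj]) simp
  finally show ?thesis .
qed

lemma (in random_atoms) arr0_bound:
  assumes "\<omega> \<in> space M"
  shows "\<bar>arr (w \<omega>) (\<xi> \<omega>) (\<lambda>_. 0) k\<bar> \<le> 1"
proof (cases k)
  case (Inl l)
  then show ?thesis using w_nonneg[OF assms, of l] w_le_1[OF assms, of l] by (simp add: arr_def)
next
  case (Inr r)
  then show ?thesis
    using ell2_unit_ball_coord_abs_le[OF xi_ball[OF assms]] by (cases r) (auto simp: arr_def)
qed

context gaussian_field
begin

lemma measurable_arr:
  assumes [measurable]: "\<And>j. (\<lambda>\<omega>. h' \<omega> j) \<in> borel_measurable M"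
  shows "(\<lambda>\<omega>. arr (w \<omega>) (\<xi> \<omega>) (h' \<omega>) k) \<in> borel_measurable M"
proof (cases k)
  case (Inr r)
  then show ?thesis by (cases r) (auto simp: arr_def split: prod.split)
qed (simp add: arr_def)

lemma F_measurable_arr0: "(\<lambda>\<omega>. arr (w \<omega>) (\<xi> \<omega>) (\<lambda>_. 0) k) \<in> borel_measurable F"
proof (cases k)
  case (Inr r)
  then show ?thesis by (cases r) (auto simp: arr_def F_measurable_xi split: prod.split)
qed (simp add: arr_def F_measurable_w)

lemma F_measurable_exp:
  assumes "u \<in> borel_measurable F"
  shows "(\<lambda>\<omega>. ennreal (exp (u \<omega>))) \<in> borel_measurable F"
  using assms by measurable

text \<open>For variable \<Phi> both sides are integrals against finite measures on arrays. Their
  generating functions agree: the exponential weight on the left and the test exponential form one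
  Gaussian linear combination, and the mixed part of its variance is what the shift \<kappa>
  contributes on the right.\<close>

lemma cameron_martin:
  fixes s :: "'i \<Rightarrow> real" and l :: "'i \<Rightarrow> nat" and I :: "'i set"
    and \<Phi> :: "(nat + (nat \<times> nat) + nat \<Rightarrow> real) \<Rightarrow> ennreal"
  defines "\<kappa> \<equiv> \<lambda>\<omega> j. \<Sum>i\<in>I. s i * Q \<omega> (l i) j ^ p"
    and "V \<equiv> \<lambda>\<omega>. \<Sum>i\<in>I. \<Sum>j\<in>I. s i * s j * Q \<omega> (l i) (l j) ^ p"
  assumes I: "finite I" and \<Phi>[measurable]: "\<Phi> \<in> borel_measurable (Pi\<^sub>M UNIV (\<lambda>_. borel))"
  shows "(\<integral>\<^sup>+\<omega>. \<Phi> (arr (w \<omega>) (\<xi> \<omega>) (h \<omega>)) * ennreal (exp (\<Sum>i\<in>I. s i * h \<omega> (l i))) \<partial>M) =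
    (\<integral>\<^sup>+\<omega>. \<Phi> (arr (w \<omega>) (\<xi> \<omega>) (\<lambda>j. h \<omega> j + \<kappa> \<omega> j)) * ennreal (exp (V \<omega> / 2)) \<partial>M)"
proof -
  have \<kappa>F: "(\<lambda>\<omega>. \<kappa> \<omega> j) \<in> borel_measurable F" for j
    unfolding \<kappa>_def by (intro borel_measurable_sum borel_measurable_times borel_measurable_power F_measurable_Q) simp
  have VF: "V \<in> borel_measurable F"
    unfolding V_def by (intro borel_measurable_sum borel_measurable_times borel_measurable_power F_measurable_Q) simp_all
  note [measurable] = measurable_from_subalg[OF subalgebra_F \<kappa>F] measurable_from_subalg[OF subalgebra_F VF]
  define U where "U \<omega> = (\<Sum>i\<in>I. s i * h \<omega> (l i))" for \<omega>
  have [measurable]: "U \<in> borel_measurable M" unfolding U_def by measurable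
  define X where "X \<omega> = arr (w \<omega>) (\<xi> \<omega>) (h \<omega>)" for \<omega>
  define Y where "Y \<omega> = arr (w \<omega>) (\<xi> \<omega>) (\<lambda>j. h \<omega> j + \<kappa> \<omega> j)" for \<omega>
  have mX[measurable]: "(\<lambda>\<omega>. X \<omega> k) \<in> borel_measurable M" for k
    unfolding X_def by (rule measurable_arr) measurable
  have mY[measurable]: "(\<lambda>\<omega>. Y \<omega> k) \<in> borel_measurable M" for k
    unfolding Y_def by (rule measurable_arr) measurable
  have [measurable]: "X \<in> M \<rightarrow>\<^sub>M Pi\<^sub>M UNIV (\<lambda>_. borel)" "Y \<in> M \<rightarrow>\<^sub>M Pi\<^sub>M UNIV (\<lambda>_. borel)"
    by (rule measurable_PiM_single'; simp)+
  \<comment> \<open>Exponent reached from both sides. The quadratic form over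
    \<open>J3 <+> I\<close> contains the mixed term twice, which after halving is the sum with
    \<open>\<kappa>\<close>.\<close>
  define R where "R J a \<omega> = (\<Sum>k\<in>J. a k * arr (w \<omega>) (\<xi> \<omega>) (\<lambda>_. 0) k) +
      ((\<Sum>j\<in>{j. Inr (Inr j) \<in> J}. \<Sum>j'\<in>{j. Inr (Inr j) \<in> J}. a (Inr (Inr j)) * a (Inr (Inr j')) * Q \<omega> j j' ^ p) / 2 +
       (\<Sum>j\<in>{j. Inr (Inr j) \<in> J}. a (Inr (Inr j)) * \<kappa> \<omega> j) + V \<omega> / 2)"
    for J and a :: "nat + (nat \<times> nat) + nat \<Rightarrow> real" and \<omega>
  have fJ3: "finite {j. Inr (Inr j) \<in> J}" if "finite J" for J :: "(nat + (nat \<times> nat) + nat) set"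
    using finite_vimageI[OF that, of "\<lambda>j. Inr (Inr j)"] by (simp add: vimage_def inj_on_def)
  have eX: "(\<integral>\<^sup>+\<omega>. ennreal (exp (\<Sum>k\<in>J. a k * X \<omega> k)) \<partial>density M (\<lambda>\<omega>. ennreal (exp (U \<omega>)))) = (\<integral>\<^sup>+\<omega>. ennreal (exp (R J a \<omega>)) \<partial>M)"
    if J: "finite J" for J a
  proof -
    define J3 where "J3 = {j. Inr (Inr j) \<in> J}"
    have J3: "finite J3" using fJ3[OF J] by (simp add: J3_def)
    define P where "P \<omega> = (\<Sum>k\<in>J. a k * arr (w \<omega>) (\<xi> \<omega>) (\<lambda>_. 0) k)" for \<omega>
    have PF: "P \<in> borel_measurable F"
      unfolding P_def by (intro borel_measurable_sum borel_measurable_times F_measurable_arr0) simp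
    define c where "c = case_sum (\<lambda>j. a (Inr (Inr j))) s"
    define r where "r = case_sum (\<lambda>j. j) l"
    have fin: "finite (J3 <+> I)" using J3 I by simp
    have comb: "U \<omega> + (\<Sum>k\<in>J. a k * X \<omega> k) = P \<omega> + (\<Sum>i\<in>J3 <+> I. c i * h \<omega> (r i))" for \<omega>
      unfolding X_def sum_arr[OF J, where h = "h \<omega>"] using J3 I
      by (simp add: sum.Plus c_def r_def U_def P_def J3_def)
    have quad: "P \<omega> + (\<Sum>i\<in>J3 <+> I. \<Sum>j\<in>J3 <+> I. c i * c j * Q \<omega> (r i) (r j) ^ p) / 2 = R J a \<omega>" for \<omega>
    proof -
      define C1 where "C1 = (\<Sum>j\<in>J3. a (Inr (Inr j)) * \<kappa> \<omega> j)"
      have c1: "(\<Sum>j\<in>J3. \<Sum>i\<in>I. a (Inr (Inr j)) * s i * Q \<omega> j (l i) ^ p) = C1"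
        unfolding C1_def \<kappa>_def by (simp add: sum_distrib_left mult.assoc Q_commute)
      have c2: "(\<Sum>i\<in>I. \<Sum>j\<in>J3. s i * a (Inr (Inr j)) * Q \<omega> (l i) j ^ p) = C1"
        unfolding C1_def \<kappa>_def by (subst sum.swap) (simp add: sum_distrib_left mult_ac)
      show ?thesis
        unfolding sum.Plus[OF J3 I] using c1 c2
        by (simp add: c_def r_def sum.distrib R_def P_def V_def J3_def[symmetric] C1_def[symmetric])
    qed
    have "(\<integral>\<^sup>+\<omega>. ennreal (exp (\<Sum>k\<in>J. a k * X \<omega> k)) \<partial>density M (\<lambda>\<omega>. ennreal (exp (U \<omega>)))) =
      (\<integral>\<^sup>+\<omega>. ennreal (exp (P \<omega>)) * ennreal (exp (\<Sum>i\<in>J3 <+> I. c i * h \<omega> (r i))) \<partial>M)"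
      by (subst nn_integral_density) (auto simp: ennreal_mult[symmetric] exp_add[symmetric] comb)
    also have "\<dots> = (\<integral>\<^sup>+\<omega>. ennreal (exp (P \<omega>)) *
      ennreal (exp ((\<Sum>i\<in>J3 <+> I. \<Sum>j\<in>J3 <+> I. c i * c j * Q \<omega> (r i) (r j) ^ p) / 2)) \<partial>M)"
      by (rule cond_exp_mgf[OF F_measurable_exp[OF PF] fin])
    also have "\<dots> = (\<integral>\<^sup>+\<omega>. ennreal (exp (R J a \<omega>)) \<partial>M)"
      by (simp only: ennreal_mult[symmetric] exp_ge_zero exp_add[symmetric] quad)
    finally show ?thesis .
  qed
  have eY: "(\<integral>\<^sup>+\<omega>. ennreal (exp (\<Sum>k\<in>J. a k * Y \<omega> k)) \<partial>density M (\<lambda>\<omega>. ennreal (exp (V \<omega> / 2)))) = (\<integral>\<^sup>+\<omega>. ennreal (exp (R J a \<omega>)) \<partial>M)"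
    if J: "finite J" for J a
  proof -
    define J3 where "J3 = {j. Inr (Inr j) \<in> J}"
    have J3: "finite J3" using fJ3[OF J] by (simp add: J3_def)
    define P where "P \<omega> = (\<Sum>k\<in>J. a k * arr (w \<omega>) (\<xi> \<omega>) (\<lambda>_. 0) k) + V \<omega> / 2 + (\<Sum>j\<in>J3. a (Inr (Inr j)) * \<kappa> \<omega> j)" for \<omega>
    have PF: "P \<in> borel_measurable F"
      unfolding P_def by (intro borel_measurable_add borel_measurable_sum borel_measurable_times borel_measurable_divide VF \<kappa>F F_measurable_arr0) simp_all
    have comb: "V \<omega> / 2 + (\<Sum>k\<in>J. a k * Y \<omega> k) = P \<omega> + (\<Sum>j\<in>J3. a (Inr (Inr j)) * h \<omega> j)" for \<omega>
      unfolding Y_def sum_arr[OF J, where h = "\<lambda>j. h \<omega> j + \<kappa> \<omega> j"]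
      by (simp add: P_def J3_def distrib_left sum.distrib)
    have "(\<integral>\<^sup>+\<omega>. ennreal (exp (\<Sum>k\<in>J. a k * Y \<omega> k)) \<partial>density M (\<lambda>\<omega>. ennreal (exp (V \<omega> / 2)))) =
      (\<integral>\<^sup>+\<omega>. ennreal (exp (P \<omega>)) * ennreal (exp (\<Sum>j\<in>J3. a (Inr (Inr j)) * h \<omega> j)) \<partial>M)"
      by (subst nn_integral_density) (auto simp: ennreal_mult[symmetric] exp_add[symmetric] comb)
    also have "\<dots> = (\<integral>\<^sup>+\<omega>. ennreal (exp (P \<omega>)) *
      ennreal (exp ((\<Sum>j\<in>J3. \<Sum>j'\<in>J3. a (Inr (Inr j)) * a (Inr (Inr j')) * Q \<omega> j j' ^ p) / 2)) \<partial>M)"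
      by (rule cond_exp_mgf[OF F_measurable_exp[OF PF] J3])
    also have "\<dots> = (\<integral>\<^sup>+\<omega>. ennreal (exp (R J a \<omega>)) \<partial>M)"
      by (simp add: ennreal_mult[symmetric] exp_add[symmetric] R_def P_def J3_def add_ac)
    finally show ?thesis .
  qed
  have fin: "(\<integral>\<^sup>+\<omega>. ennreal (exp (R J a \<omega>)) \<partial>M) < \<infinity>" if J: "finite J" for J a
  proof -
    define J3 where "J3 = {j. Inr (Inr j) \<in> J}"
    have le: "x * y \<le> \<bar>x\<bar>" if "\<bar>y\<bar> \<le> 1" for x y :: real
    proof -
      have "x * y \<le> \<bar>x\<bar> * \<bar>y\<bar>" by (metis abs_ge_self abs_mult)
      also have "\<dots> \<le> \<bar>x\<bar>" using that by (simp add: mult_left_le)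
      finally show ?thesis .
    qed
    define b where "b = (\<Sum>k\<in>J. \<bar>a k\<bar>) + ((\<Sum>j\<in>J3. \<Sum>j'\<in>J3. \<bar>a (Inr (Inr j)) * a (Inr (Inr j'))\<bar>) / 2 +
       (\<Sum>j\<in>J3. \<Sum>i\<in>I. \<bar>a (Inr (Inr j)) * s i\<bar>) + (\<Sum>i\<in>I. \<Sum>j\<in>I. \<bar>s i * s j\<bar>) / 2)"
    have "R J a \<omega> \<le> b" if "\<omega> \<in> space M" for \<omega>
      unfolding R_def b_def J3_def[symmetric] V_def \<kappa>_def sum_distrib_left mult.assoc[symmetric]
      using that
      by (intro add_mono divide_right_mono sum_mono le arr0_bound Q_power_abs_le_1) auto
    then have "(\<integral>\<^sup>+\<omega>. ennreal (exp (R J a \<omega>)) \<partial>M) \<le> (\<integral>\<^sup>+\<omega>. ennreal (exp b) \<partial>M)"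
      by (intro nn_integral_mono) auto
    also have "\<dots> < \<infinity>" by (simp add: emeasure_space_1)
    finally show ?thesis .
  qed
  have "distr (density M (\<lambda>\<omega>. ennreal (exp (U \<omega>)))) (Pi\<^sub>M UNIV (\<lambda>_. borel)) X =
    distr (density M (\<lambda>\<omega>. ennreal (exp (V \<omega> / 2)))) (Pi\<^sub>M UNIV (\<lambda>_. borel)) Y"
    by (rule distr_PiM_eq_of_mgf) (simp_all add: eX eY fin[simplified])
  then have "(\<integral>\<^sup>+z. \<Phi> z \<partial>distr (density M (\<lambda>\<omega>. ennreal (exp (U \<omega>)))) (Pi\<^sub>M UNIV (\<lambda>_. borel)) X) =
    (\<integral>\<^sup>+z. \<Phi> z \<partial>distr (density M (\<lambda>\<omega>. ennreal (exp (V \<omega> / 2)))) (Pi\<^sub>M UNIV (\<lambda>_. borel)) Y)"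
    by simp
  then show ?thesis
    by (simp add: nn_integral_distr nn_integral_density X_def[symmetric] Y_def[symmetric] U_def[symmetric] mult.commute)
qed

end

section \<open>Replica averages under the change of density\<close>

definition ovl :: "nat \<Rightarrow> (nat \<times> nat \<Rightarrow> real) \<Rightarrow> (nat \<Rightarrow> nat) \<Rightarrow> nat \<times> nat \<Rightarrow> real" where
  "ovl n q l = (\<lambda>(i, j) \<in> {..<n} \<times> {..<n}. q (l i, l j))"

text \<open>Companion of \<open>bracket\<close> for nonnegative functions of the labels instead of
  the points. With values in \<open>ennreal\<close> it has no summability conditions and commutes
  with the expectation.\<close>

definition navg :: "(nat \<Rightarrow> real) \<Rightarrow> nat \<Rightarrow> ((nat \<Rightarrow> nat) \<Rightarrow> ennreal) \<Rightarrow> ennreal" where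
  "navg v n f = (\<integral>\<^sup>+l. ennreal (\<Prod>i<n. v (l i)) * f l \<partial>count_space ({..<n} \<rightarrow>\<^sub>E UNIV))"

text \<open>The factor by which the change of density and the shift of the field by its covariance with
  \<open>\<Sum>i<n. s i * h (l i)\<close> change the replica weights.\<close>

definition shift_factor ::
    "nat \<Rightarrow> nat \<Rightarrow> (nat \<Rightarrow> real) \<Rightarrow> (nat \<Rightarrow> real) \<Rightarrow> (nat \<times> nat \<Rightarrow> real) \<Rightarrow> (nat \<Rightarrow> nat) \<Rightarrow> real" where
  "shift_factor p n s v q l =
     exp (\<Sum>i<n. \<Sum>j<n. s i * q (l i, l j) ^ p) / (\<Sum>k. v k * exp (\<Sum>i<n. s i * q (l i, k) ^ p)) ^ n"

text \<open>Changes of density compose: shifting the field by a bounded \<kappa> is a second change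
  of density applied to the weights already tilted by \<open>h\<close>.\<close>

lemma tilted_shift:
  assumes v: "\<And>k. 0 \<le> v k" "\<And>k. \<bar>\<kappa> k\<bar> \<le> c" and sm: "summable (\<lambda>k. v k * exp (t * h k))"
    and pos: "0 < (\<Sum>k. v k * exp (t * h k))"
  shows "tilted v (\<lambda>k. h k + \<kappa> k) t k =
    tilted v h t k * exp (t * \<kappa> k) / (\<Sum>j. tilted v h t j * exp (t * \<kappa> j))"
proof -
  define Z where "Z = (\<Sum>k. v k * exp (t * h k))"
  have sm2: "summable (\<lambda>k. v k * exp (t * h k) * exp (t * \<kappa> k))"
  proof (rule summable_comparison_test)
    show "summable (\<lambda>k. v k * exp (t * h k) * exp (\<bar>t\<bar> * c))"
      using sm by (rule summable_mult2)
    have "t * \<kappa> k \<le> \<bar>t\<bar> * c" for k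
    proof -
      have "t * \<kappa> k \<le> \<bar>t\<bar> * \<bar>\<kappa> k\<bar>" by (metis abs_ge_self abs_mult)
      also have "\<dots> \<le> \<bar>t\<bar> * c" using v(2) by (intro mult_left_mono) auto
      finally show ?thesis .
    qed
    then show "\<exists>N. \<forall>k\<ge>N. norm (v k * exp (t * h k) * exp (t * \<kappa> k)) \<le> v k * exp (t * h k) * exp (\<bar>t\<bar> * c)"
      using v(1) by (intro exI[of _ 0]) (auto simp: abs_mult intro!: mult_left_mono)
  qed
  have "(\<Sum>j. tilted v h t j * exp (t * \<kappa> j)) = (\<Sum>j. v j * exp (t * h j) * exp (t * \<kappa> j)) / Z"
    using suminf_divide[OF sm2, of Z] by (simp add: tilted_def Z_def mult_ac)
  moreover have e: "v k * exp (t * (h k + \<kappa> k)) = v k * exp (t * h k) * exp (t * \<kappa> k)" for k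
    by (simp add: distrib_left exp_add)
  have "tilted v (\<lambda>k. h k + \<kappa> k) t k = v k * exp (t * h k) * exp (t * \<kappa> k) / (\<Sum>j. v j * exp (t * h j) * exp (t * \<kappa> j))"
    unfolding tilted_def e ..
  moreover have "tilted v h t k = v k * exp (t * h k) / Z"
    by (simp add: tilted_def Z_def)
  ultimately show ?thesis
    using pos by (simp add: Z_def[symmetric])
qed

lemma countable_PiE_nat: "countable ({..<n::nat} \<rightarrow>\<^sub>E (UNIV :: nat set))"
  by (intro countable_PiE) auto

context random_atoms
begin

definition Qm :: "'a \<Rightarrow> nat \<times> nat \<Rightarrow> real" where
  "Qm \<omega> = (\<lambda>(l, l'). Q \<omega> l l')"

lemma Qm_eq: "Qm = Q_mat \<xi>"
  by (simp add: fun_eq_iff Qm_def Q_mat_def)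

lemma Qm_apply[simp]: "Qm \<omega> (l, l') = Q \<omega> l l'"
  by (simp add: Qm_def)

lemma w_pos_ex: assumes "\<omega> \<in> space M" shows "\<exists>l. 0 < w \<omega> l"
proof (rule ccontr)
  assume "\<not> ?thesis"
  then have "w \<omega> = (\<lambda>_. 0)"
    using w_nonneg[OF assms] by (auto simp: fun_eq_iff not_less intro: antisym)
  then show False using w_sums[OF assms] by (simp add: sums_iff)
qed

end

context gaussian_field
begin

text \<open>Given the atoms, each exponential has mean at most exp(t^2/2) because self-overlaps are
  at most 1. The expectation of the normalising sum is therefore finite.\<close>

lemma AE_summable_tilt: "AE \<omega> in M. summable (\<lambda>k. w \<omega> k * exp (t * h \<omega> k))"
proof -
  have le: "(\<integral>\<^sup>+\<omega>. ennreal (w \<omega> k * exp (t * h \<omega> k)) \<partial>M) \<le> ennreal (exp (t\<^sup>2 / 2)) * (\<integral>\<^sup>+\<omega>. ennreal (w \<omega> k) \<partial>M)" for k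
  proof -
    have wF: "(\<lambda>\<omega>. ennreal (w \<omega> k)) \<in> borel_measurable F"
      using F_measurable_w by measurable
    have "(\<integral>\<^sup>+\<omega>. ennreal (w \<omega> k * exp (t * h \<omega> k)) \<partial>M) = (\<integral>\<^sup>+\<omega>. ennreal (w \<omega> k) * ennreal (exp (\<Sum>i\<in>{()}. t * h \<omega> k)) \<partial>M)"
      by (intro nn_integral_cong) (simp add: ennreal_mult w_nonneg)
    also have "\<dots> = (\<integral>\<^sup>+\<omega>. ennreal (w \<omega> k) * ennreal (exp ((\<Sum>i\<in>{()}. \<Sum>j\<in>{()}. t * t * Q \<omega> k k ^ p) / 2)) \<partial>M)"
      by (rule cond_exp_mgf[OF wF]) simp
    also have "\<dots> \<le> (\<integral>\<^sup>+\<omega>. ennreal (exp (t\<^sup>2 / 2)) * ennreal (w \<omega> k) \<partial>M)"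
    proof (intro nn_integral_mono)
      fix \<omega> assume \<omega>: "\<omega> \<in> space M"
      have "t\<^sup>2 * Q \<omega> k k ^ p \<le> t\<^sup>2"
        using Q_power_abs_le_1[OF \<omega>, of k k p] by (intro mult_left_le) auto
      then show "ennreal (w \<omega> k) * ennreal (exp ((\<Sum>i\<in>{()}. \<Sum>j\<in>{()}. t * t * Q \<omega> k k ^ p) / 2))
          \<le> ennreal (exp (t\<^sup>2 / 2)) * ennreal (w \<omega> k)"
        by (subst mult.commute, intro mult_right_mono) (auto simp: power2_eq_square)
    qed
    also have "\<dots> = ennreal (exp (t\<^sup>2 / 2)) * (\<integral>\<^sup>+\<omega>. ennreal (w \<omega> k) \<partial>M)"
      by (rule nn_integral_cmult) simp
    finally show ?thesis .
  qed
  have "(\<integral>\<^sup>+\<omega>. (\<Sum>k. ennreal (w \<omega> k * exp (t * h \<omega> k))) \<partial>M) = (\<Sum>k. \<integral>\<^sup>+\<omega>. ennreal (w \<omega> k * exp (t * h \<omega> k)) \<partial>M)"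
    by (rule nn_integral_suminf) simp
  also have "\<dots> \<le> (\<Sum>k. ennreal (exp (t\<^sup>2 / 2)) * (\<integral>\<^sup>+\<omega>. ennreal (w \<omega> k) \<partial>M))"
    by (intro suminf_le le) auto
  also have "\<dots> = ennreal (exp (t\<^sup>2 / 2)) * (\<integral>\<^sup>+\<omega>. (\<Sum>k. ennreal (w \<omega> k)) \<partial>M)"
    by (simp add: nn_integral_suminf)
  also have "(\<integral>\<^sup>+\<omega>. (\<Sum>k. ennreal (w \<omega> k)) \<partial>M) = (\<integral>\<^sup>+\<omega>. 1 \<partial>M)"
  proof (intro nn_integral_cong)
    fix \<omega> assume \<omega>: "\<omega> \<in> space M"
    show "(\<Sum>k. ennreal (w \<omega> k)) = 1"
      by (subst suminf_ennreal_eq[OF w_nonneg[OF \<omega>] w_sums[OF \<omega>]]) simp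
  qed
  finally have "(\<integral>\<^sup>+\<omega>. (\<Sum>k. ennreal (w \<omega> k * exp (t * h \<omega> k))) \<partial>M) \<le> ennreal (exp (t\<^sup>2 / 2))"
    by (simp add: emeasure_space_1)
  then have "(\<integral>\<^sup>+\<omega>. (\<Sum>k. ennreal (w \<omega> k * exp (t * h \<omega> k))) \<partial>M) \<noteq> \<infinity>"
    by (auto simp: top_unique)
  then have "AE \<omega> in M. (\<Sum>k. ennreal (w \<omega> k * exp (t * h \<omega> k))) \<noteq> \<infinity>"
    by (intro nn_integral_noteq_infinite) auto
  then show ?thesis
  proof (rule AE_mp, intro AE_I2 impI)
    fix \<omega> assume "\<omega> \<in> space M" "(\<Sum>k. ennreal (w \<omega> k * exp (t * h \<omega> k))) \<noteq> \<infinity>"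
    then show "summable (\<lambda>k. w \<omega> k * exp (t * h \<omega> k))"
      by (intro summable_suminf_not_top) (auto simp: w_nonneg)
  qed
qed

lemma tilt_sum_pos:
  assumes "\<omega> \<in> space M" "summable (\<lambda>k. w \<omega> k * exp (t * h \<omega> k))"
  shows "0 < (\<Sum>k. w \<omega> k * exp (t * h \<omega> k))"
proof -
  obtain l where "0 < w \<omega> l" using w_pos_ex[OF assms(1)] by auto
  then show ?thesis
    using assms w_nonneg by (intro suminf_pos2[of _ l]) auto
qed

lemma tilted_measurable[measurable]: "(\<lambda>\<omega>. tilted (w \<omega>) (h \<omega>) t k) \<in> borel_measurable M"
  unfolding tilted_def by measurable

lemma tilted_nonneg:
  assumes "\<omega> \<in> space M" "summable (\<lambda>k. w \<omega> k * exp (t * h \<omega> k))"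
  shows "0 \<le> tilted (w \<omega>) (h \<omega>) t k"
  unfolding tilted_def using tilt_sum_pos[OF assms] w_nonneg[OF assms(1)] by simp

text \<open>Cameron-Martin is applied for each tuple of labels separately. The shift multiplies each
  of the n tilted weights by an exponential and divides it by the same normalising sum; together
  these changes are \<open>shift_factor\<close>.\<close>

theorem tilted_mgf:
  fixes f :: "(nat \<times> nat \<Rightarrow> real) \<Rightarrow> ennreal" and s :: "nat \<Rightarrow> real"
  assumes f[measurable]: "f \<in> borel_measurable (Pi\<^sub>M ({..<n} \<times> {..<n}) (\<lambda>_. borel))"
  shows "(\<integral>\<^sup>+\<omega>. navg (tilted (w \<omega>) (h \<omega>) t) n (\<lambda>l. f (ovl n (Qm \<omega>) l) * ennreal (exp (\<Sum>i<n. s i * h \<omega> (l i)))) \<partial>M) =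
    (\<integral>\<^sup>+\<omega>. navg (tilted (w \<omega>) (h \<omega>) t) n (\<lambda>l. f (ovl n (Qm \<omega>) l) *
        (ennreal (exp ((\<Sum>i<n. \<Sum>j<n. s i * s j * Q \<omega> (l i) (l j) ^ p) / 2)) *
         ennreal (shift_factor p n (\<lambda>i. t * s i) (tilted (w \<omega>) (h \<omega>) t) (Qm \<omega>) l))) \<partial>M)"
proof -
  have ovlm[measurable]: "(\<lambda>\<omega>. ovl n (Qm \<omega>) l) \<in> M \<rightarrow>\<^sub>M Pi\<^sub>M ({..<n} \<times> {..<n}) (\<lambda>_. borel)" for l
    unfolding ovl_def by (rule measurable_restrict) (auto split: prod.split)
  have sfm[measurable]: "(\<lambda>\<omega>. shift_factor p n s' (tilted (w \<omega>) (h \<omega>) t) (Qm \<omega>) l) \<in> borel_measurable M" for l s'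
    unfolding shift_factor_def Qm_apply by measurable
  have *: "(\<integral>\<^sup>+\<omega>. ennreal (\<Prod>i<n. tilted (w \<omega>) (h \<omega>) t (l i)) * (f (ovl n (Qm \<omega>) l) * ennreal (exp (\<Sum>i<n. s i * h \<omega> (l i)))) \<partial>M) =
    (\<integral>\<^sup>+\<omega>. ennreal (\<Prod>i<n. tilted (w \<omega>) (h \<omega>) t (l i)) * (f (ovl n (Qm \<omega>) l) *
        (ennreal (exp ((\<Sum>i<n. \<Sum>j<n. s i * s j * Q \<omega> (l i) (l j) ^ p) / 2)) *
         ennreal (shift_factor p n (\<lambda>i. t * s i) (tilted (w \<omega>) (h \<omega>) t) (Qm \<omega>) l))) \<partial>M)" for l
  proof -
    \<comment> \<open>The normalising sum involves the field at all atoms, so the functional depends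
      on the entire array and not only on the n labels.\<close>
    define \<Phi> where "\<Phi> z = ennreal (\<Prod>i<n. tilted (\<lambda>k. z (Inl k)) (\<lambda>k. z (Inr (Inr k))) t (l i)) *
      f (\<lambda>(i, j) \<in> {..<n} \<times> {..<n}. ell2_inner (\<lambda>r. z (Inr (Inl (l i, r)))) (\<lambda>r. z (Inr (Inl (l j, r)))))"
      for z :: "nat + nat \<times> nat + nat \<Rightarrow> real"
    have c[measurable]: "(\<lambda>z. z k) \<in> borel_measurable (Pi\<^sub>M UNIV (\<lambda>_. borel))" for k :: "nat + nat \<times> nat + nat"
      by (rule measurable_component_singleton) simp
    have [measurable]: "(\<lambda>z. (\<lambda>(i, j) \<in> {..<n} \<times> {..<n}. ell2_inner (\<lambda>r. z (Inr (Inl (l i, r)))) (\<lambda>r. z (Inr (Inl (l j, r))))))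
      \<in> Pi\<^sub>M UNIV (\<lambda>_. borel) \<rightarrow>\<^sub>M Pi\<^sub>M ({..<n} \<times> {..<n}) (\<lambda>_. borel :: real measure)"
      unfolding ell2_inner_def by (rule measurable_restrict) (auto split: prod.split)
    have \<Phi>[measurable]: "\<Phi> \<in> borel_measurable (Pi\<^sub>M UNIV (\<lambda>_. borel))"
      unfolding \<Phi>_def tilted_def by measurable
    have \<Phi>_arr: "\<Phi> (arr (w \<omega>) (\<xi> \<omega>) h') = ennreal (\<Prod>i<n. tilted (w \<omega>) h' t (l i)) * f (ovl n (Qm \<omega>) l)" for h' \<omega>
      by (simp add: \<Phi>_def arr_def ovl_def cong: restrict_cong)
    have "(\<integral>\<^sup>+\<omega>. ennreal (\<Prod>i<n. tilted (w \<omega>) (h \<omega>) t (l i)) * (f (ovl n (Qm \<omega>) l) * ennreal (exp (\<Sum>i<n. s i * h \<omega> (l i)))) \<partial>M) =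
      (\<integral>\<^sup>+\<omega>. \<Phi> (arr (w \<omega>) (\<xi> \<omega>) (h \<omega>)) * ennreal (exp (\<Sum>i<n. s i * h \<omega> (l i))) \<partial>M)"
      by (simp add: \<Phi>_arr mult.assoc)
    also have "\<dots> = (\<integral>\<^sup>+\<omega>. \<Phi> (arr (w \<omega>) (\<xi> \<omega>) (\<lambda>j. h \<omega> j + (\<Sum>i<n. s i * Q \<omega> (l i) j ^ p))) *
      ennreal (exp ((\<Sum>i<n. \<Sum>j<n. s i * s j * Q \<omega> (l i) (l j) ^ p) / 2)) \<partial>M)"
      by (rule cameron_martin) (simp_all add: \<Phi>)
    also have "\<dots> = (\<integral>\<^sup>+\<omega>. ennreal (\<Prod>i<n. tilted (w \<omega>) (h \<omega>) t (l i)) * (f (ovl n (Qm \<omega>) l) *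
        (ennreal (exp ((\<Sum>i<n. \<Sum>j<n. s i * s j * Q \<omega> (l i) (l j) ^ p) / 2)) *
         ennreal (shift_factor p n (\<lambda>i. t * s i) (tilted (w \<omega>) (h \<omega>) t) (Qm \<omega>) l))) \<partial>M)"
    proof (rule nn_integral_cong_AE, rule AE_mp[OF AE_summable_tilt[of t]], intro AE_I2 impI)
      fix \<omega> assume True: "\<omega> \<in> space M" and elim: "summable (\<lambda>k. w \<omega> k * exp (t * h \<omega> k))"
        define \<kappa> where "\<kappa> j = (\<Sum>i<n. s i * Q \<omega> (l i) j ^ p)" for j
        define x where "x = (\<Sum>j. tilted (w \<omega>) (h \<omega>) t j * exp (t * \<kappa> j))"
        have k: "\<bar>\<kappa> j\<bar> \<le> (\<Sum>i<n. \<bar>s i\<bar>)" for j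
          unfolding \<kappa>_def
          by (intro order_trans[OF sum_abs] sum_mono)
            (use Q_power_abs_le_1[OF True] in \<open>auto simp: abs_mult intro!: mult_left_le\<close>)
        have "tilted (w \<omega>) (\<lambda>j. h \<omega> j + \<kappa> j) t j = tilted (w \<omega>) (h \<omega>) t j * exp (t * \<kappa> j) / x" for j
          unfolding x_def by (rule tilted_shift[OF w_nonneg[OF True] k elim tilt_sum_pos[OF True elim]])
        then have "(\<Prod>i<n. tilted (w \<omega>) (\<lambda>j. h \<omega> j + \<kappa> j) t (l i)) =
          (\<Prod>i<n. tilted (w \<omega>) (h \<omega>) t (l i)) * (exp (\<Sum>i<n. t * \<kappa> (l i)) / x ^ n)"
          by (simp add: prod_dividef prod.distrib exp_sum)
        also have "exp (\<Sum>i<n. t * \<kappa> (l i)) / x ^ n = shift_factor p n (\<lambda>i. t * s i) (tilted (w \<omega>) (h \<omega>) t) (Qm \<omega>) l"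
          unfolding shift_factor_def x_def \<kappa>_def
          by (subst sum.swap) (simp add: sum_distrib_left mult.assoc)
        finally have "(\<Prod>i<n. tilted (w \<omega>) (\<lambda>j. h \<omega> j + \<kappa> j) t (l i)) =
          (\<Prod>i<n. tilted (w \<omega>) (h \<omega>) t (l i)) * shift_factor p n (\<lambda>i. t * s i) (tilted (w \<omega>) (h \<omega>) t) (Qm \<omega>) l" .
        moreover have "0 \<le> (\<Prod>i<n. tilted (w \<omega>) (h \<omega>) t (l i))"
          by (intro prod_nonneg tilted_nonneg True elim ballI)
        ultimately show "\<Phi> (arr (w \<omega>) (\<xi> \<omega>) (\<lambda>j. h \<omega> j + (\<Sum>i<n. s i * Q \<omega> (l i) j ^ p))) *
          ennreal (exp ((\<Sum>i<n. \<Sum>j<n. s i * s j * Q \<omega> (l i) (l j) ^ p) / 2)) =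
          ennreal (\<Prod>i<n. tilted (w \<omega>) (h \<omega>) t (l i)) * (f (ovl n (Qm \<omega>) l) *
        (ennreal (exp ((\<Sum>i<n. \<Sum>j<n. s i * s j * Q \<omega> (l i) (l j) ^ p) / 2)) *
         ennreal (shift_factor p n (\<lambda>i. t * s i) (tilted (w \<omega>) (h \<omega>) t) (Qm \<omega>) l)))"

          unfolding \<Phi>_arr \<kappa>_def[symmetric] by (simp add: ennreal_mult' mult_ac)
    qed
    finally show ?thesis .
  qed
  show ?thesis
    unfolding navg_def
    by (subst (1 2) nn_integral_count_space_nn_integral[OF countable_PiE_nat]) (auto simp: *)
qed

end

section \<open>Sorting the weights\<close>

definition precedes :: "(nat \<Rightarrow> real) \<Rightarrow> nat \<Rightarrow> nat \<Rightarrow> bool" where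
  "precedes v j l \<longleftrightarrow> v l < v j \<or> v l = v j \<and> j < l"

text \<open>The total order \<open>precedes v\<close> on an infinite set has the order type of the
  naturals exactly if all initial segments are finite; this is when a sorting permutation
  exists.\<close>

definition sortable :: "(nat \<Rightarrow> real) \<Rightarrow> bool" where
  "sortable v \<longleftrightarrow> (\<forall>l. finite {j. precedes v j l})"

definition sorting :: "(nat \<Rightarrow> real) \<Rightarrow> (nat \<Rightarrow> nat) \<Rightarrow> bool" where
  "sorting v \<pi> \<longleftrightarrow> bij \<pi> \<and> (\<forall>l l'. l < l' \<longrightarrow> precedes v (\<pi> l) (\<pi> l'))"

lemma decreasing_perm_eq: "decreasing_perm v = (THE \<pi>. sorting v \<pi>)"
  by (simp add: decreasing_perm_def sorting_def precedes_def)

lemma precedes_trans: "precedes v i j \<Longrightarrow> precedes v j k \<Longrightarrow> precedes v i k"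
  and precedes_irrefl: "\<not> precedes v i i"
  and precedes_total: "i \<noteq> j \<Longrightarrow> precedes v i j \<or> precedes v j i"
  by (auto simp: precedes_def)

lemma sorting_predecessors:
  assumes "sorting v \<pi>"
  shows "{j. precedes v j (\<pi> k)} = \<pi> ` {..<k}"
proof safe
  have \<pi>: "bij \<pi>" "\<And>l l'. l < l' \<Longrightarrow> precedes v (\<pi> l) (\<pi> l')"
    using assms by (auto simp: sorting_def)
  fix j assume j: "precedes v j (\<pi> k)"
  obtain i where i: "j = \<pi> i" using \<pi>(1) by (metis bij_pointE)
  have "\<not> k \<le> i"
    using \<pi>(2)[of k i] j precedes_trans precedes_irrefl i by (metis le_eq_less_or_eq)
  then show "j \<in> \<pi> ` {..<k}" using i by auto
next
  fix i assume "i < k"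
  then show "precedes v (\<pi> i) (\<pi> k)" using assms by (auto simp: sorting_def)
qed

lemma sorting_rank:
  assumes "sorting v \<pi>"
  shows "card {j. precedes v j l} = k \<longleftrightarrow> \<pi> k = l"
proof -
  have b: "bij \<pi>" using assms by (simp add: sorting_def)
  then obtain i where i: "l = \<pi> i" by (metis bij_pointE)
  have "card {j. precedes v j l} = i"
    unfolding i sorting_predecessors[OF assms] using b
    by (subst card_image) (auto intro: inj_on_subset dest: bij_is_inj)
  then show ?thesis using b i by (auto dest: bij_is_inj injD)
qed

lemma sorting_imp_sortable: "sorting v \<pi> \<Longrightarrow> sortable v"
  unfolding sortable_def
proof
  fix l assume s: "sorting v \<pi>"
  then obtain i where "l = \<pi> i" by (metis bij_pointE sorting_def)
  then show "finite {j. precedes v j l}" using sorting_predecessors[OF s] by simp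
qed

lemma sorting_unique: "sorting v \<pi> \<Longrightarrow> sorting v \<pi>' \<Longrightarrow> \<pi> = \<pi>'"
  using sorting_rank by (metis ext)

text \<open>The number of predecessors is an injective rank with downward closed range. An infinite
  downward closed set of naturals contains every natural number, so the rank is a bijection, and its
  inverse lists the weights in order.\<close>

lemma sortable_imp_ex_sorting:
  assumes "sortable v"
  shows "\<exists>\<pi>. sorting v \<pi>"
proof -
  define r where "r l = card {j. precedes v j l}" for l
  have fin: "finite {j. precedes v j l}" for l using assms by (simp add: sortable_def)
  have mono: "r j < r l" if "precedes v j l" for j l
    unfolding r_def
  proof (rule psubset_card_mono[OF fin])
    show "{i. precedes v i j} \<subset> {i. precedes v i l}"
      using that precedes_trans precedes_irrefl by blast
  qed
  have inj: "inj r"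
    by (rule injI) (metis mono precedes_total less_irrefl)
  have down: "k \<in> range r" if "k \<le> r l" for k l
  proof (cases "k = r l")
    case False
    have eq: "r ` {j. precedes v j l} = {..<r l}"
    proof (rule card_subset_eq)
      show "r ` {j. precedes v j l} \<subseteq> {..<r l}" using mono by auto
      show "card (r ` {j. precedes v j l}) = card {..<r l}"
        using inj by (subst card_image) (auto simp: r_def intro: inj_on_subset)
    qed simp
    have "k \<in> r ` {j. precedes v j l}" unfolding eq using False that by simp
    then show ?thesis by blast
  qed simp
  have "surj r"
    unfolding surj_def
  proof
    fix k
    have "infinite (range r)" using inj by (simp add: finite_image_iff)
    then obtain l where "k \<le> r l"
      by (metis finite_nat_set_iff_bounded_le nat_le_linear rangeE)
    then show "\<exists>l. k = r l" using down by blast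
  qed
  then have b: "bij r" using inj by (simp add: bij_def)
  have "sorting v (inv r)"
    unfolding sorting_def
  proof (intro conjI allI impI)
    show "bij (inv r)" using b by (rule bij_imp_bij_inv)
    fix l l' :: nat assume "l < l'"
    then have lt: "r (inv r l) < r (inv r l')" using b by (simp add: bij_is_surj surj_f_inv_f)
    then have "inv r l \<noteq> inv r l'" by auto
    then show "precedes v (inv r l) (inv r l')"
      using precedes_total mono lt by (metis less_asym)
  qed
  then show ?thesis by blast
qed

lemma sorting_decreasing_perm: "sortable v \<Longrightarrow> sorting v (decreasing_perm v)"
  unfolding decreasing_perm_eq using sortable_imp_ex_sorting sorting_unique by (metis theI)

lemma decreasing_perm_eqI: "sorting v \<pi> \<Longrightarrow> decreasing_perm v = \<pi>"
  using sorting_decreasing_perm sorting_imp_sortable sorting_unique by blast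

text \<open>Where no sorting exists the definite description has an empty predicate, so its value
  does not depend on \<open>v\<close>. This makes \<open>decreasing_perm\<close> measurable
  everywhere and not only almost surely.\<close>

lemma decreasing_perm_not_sortable: "\<not> sortable v \<Longrightarrow> decreasing_perm v = (THE \<pi>. False)"
proof -
  assume "\<not> sortable v"
  then have "sorting v = (\<lambda>_. False)" using sorting_imp_sortable by (auto simp: fun_eq_iff)
  then show ?thesis by (simp add: decreasing_perm_eq)
qed

lemma sortableI:
  assumes nonneg: "\<And>l. 0 \<le> v l" and sm: "summable v"
    and zero: "\<And>l. v l = 0 \<Longrightarrow> finite {j. 0 < v j}"
  shows "sortable v"
  unfolding sortable_def
proof
  fix l
  show "finite {j. precedes v j l}"
  proof (cases "v l = 0")
    case True
    have "{j. precedes v j l} \<subseteq> {j. 0 < v j} \<union> {..<l}"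
      using True by (auto simp: precedes_def)
    then show ?thesis using zero[OF True] by (metis finite_Un finite_lessThan finite_subset)
  next
    case False
    then have "0 < v l" using nonneg[of l] by simp
    then have "\<forall>\<^sub>F j in sequentially. v j < v l"
      using summable_LIMSEQ_zero[OF sm] by (intro order_tendstoD(2)) auto
    then obtain N where N: "\<And>j. j \<ge> N \<Longrightarrow> v j < v l" by (auto simp: eventually_sequentially)
    have "{j. precedes v j l} \<subseteq> {..<N}"
      using N by (fastforce simp: precedes_def not_le[symmetric])
    then show ?thesis by (rule finite_subset) simp
  qed
qed

text \<open>The index at position \<open>k\<close> is \<open>l\<close> if and only if
  \<open>l\<close> has rank \<open>k\<close>. Ranks are counted in \<open>ennreal\<close>, so that
  infinitely many predecessors show up as the value infinity and the event \<open>sortable\<close>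
  is measurable as well.\<close>

lemma measurable_decreasing_perm:
  assumes [measurable]: "\<And>l. (\<lambda>\<omega>. v \<omega> l) \<in> borel_measurable M"
  shows "(\<lambda>\<omega>. decreasing_perm (v \<omega>) k) \<in> M \<rightarrow>\<^sub>M count_space UNIV"
proof -
  define e where "e \<omega> l = (\<Sum>j. if precedes (v \<omega>) j l then 1 else 0 :: ennreal)" for \<omega> l
  have [measurable]: "(\<lambda>\<omega>. e \<omega> l) \<in> borel_measurable M" for l
    unfolding e_def precedes_def by measurable
  have e: "e \<omega> l = emeasure (count_space UNIV) {j. precedes (v \<omega>) j l}" for \<omega> l
    unfolding e_def by (subst nn_integral_indicator[symmetric])
      (auto simp: nn_integral_count_space_nat indicator_def intro!: arg_cong[where f = suminf])
  have fin: "finite {j. precedes (v \<omega>) j l} \<longleftrightarrow> e \<omega> l < \<infinity>" for \<omega> l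
    unfolding e by (cases "finite {j. precedes (v \<omega>) j l}") (auto simp: ennreal_of_nat_eq_real_of_nat)
  have eq: "decreasing_perm (v \<omega>) k = l \<longleftrightarrow>
    (if \<forall>l. e \<omega> l < \<infinity> then e \<omega> l = of_nat k else (THE \<pi>. False) k = l)" for \<omega> l
  proof (cases "sortable (v \<omega>)")
    case True
    then have "finite {j. precedes (v \<omega>) j l}" by (simp add: sortable_def)
    then have "e \<omega> l = of_nat (card {j. precedes (v \<omega>) j l})" unfolding e by simp
    then show ?thesis
      using True sorting_rank[OF sorting_decreasing_perm[OF True], of l k]
      by (auto simp: sortable_def fin)
  next
    case False
    then show ?thesis by (auto simp: decreasing_perm_not_sortable sortable_def fin)
  qed
  show ?thesis
  proof (rule measurable_count_space_eq2_countable[THEN iffD2], intro conjI ballI)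
    fix l :: nat
    have "(\<lambda>\<omega>. decreasing_perm (v \<omega>) k) -` {l} \<inter> space M = {\<omega> \<in> space M. decreasing_perm (v \<omega>) k = l}"
      by auto
    also have "\<dots> \<in> sets M" unfolding eq by measurable
    finally show "(\<lambda>\<omega>. decreasing_perm (v \<omega>) k) -` {l} \<inter> space M \<in> sets M" .
  qed auto
qed

lemma navg_bij:
  assumes "bij \<pi>"
  shows "navg v n G = navg (\<lambda>k. v (\<pi> k)) n (\<lambda>l. G (\<lambda>i\<in>{..<n}. \<pi> (l i)))"
proof -
  have b: "bij_betw (\<lambda>l. \<lambda>i\<in>{..<n}. \<pi> (l i)) ({..<n} \<rightarrow>\<^sub>E UNIV) ({..<n} \<rightarrow>\<^sub>E UNIV)"
    using assms
    by (intro bij_betw_byWitness[where f' = "\<lambda>l. \<lambda>i\<in>{..<n}. inv \<pi> (l i)"])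
      (auto simp: PiE_def extensional_def fun_eq_iff bij_is_surj surj_f_inv_f bij_is_inj inv_f_f)
  show ?thesis
    unfolding navg_def by (subst nn_integral_bij_count_space[OF b, symmetric]) simp
qed

lemma suminf_bij:
  fixes f :: "nat \<Rightarrow> real"
  assumes "bij \<pi>" "summable f" "\<And>k. 0 \<le> f k"
  shows "(\<Sum>k. f (\<pi> k)) = (\<Sum>k. f k)" "summable (\<lambda>k. f (\<pi> k))"
  using suminf_reindex[OF assms(2) bij_is_inj[OF assms(1)] assms(3)]
    summable_reindex[OF assms(2) bij_is_inj[OF assms(1)] assms(3)] bij_is_surj[OF assms(1)]
  by (auto simp: o_def)

lemma distr_PiM_eq_iff_same_fdd:
  fixes X Y :: "'a \<Rightarrow> 'i \<Rightarrow> real"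
  assumes X[measurable]: "\<And>i. (\<lambda>\<omega>. X \<omega> i) \<in> borel_measurable M"
    and Y[measurable]: "\<And>i. (\<lambda>\<omega>. Y \<omega> i) \<in> borel_measurable M"
    and M: "prob_space M"
  shows "same_fdd M X Y \<longleftrightarrow> distr M (Pi\<^sub>M UNIV (\<lambda>_. borel)) X = distr M (Pi\<^sub>M UNIV (\<lambda>_. borel)) Y"
proof
  have mX[measurable]: "X \<in> M \<rightarrow>\<^sub>M Pi\<^sub>M UNIV (\<lambda>_. borel)" and mY[measurable]: "Y \<in> M \<rightarrow>\<^sub>M Pi\<^sub>M UNIV (\<lambda>_. borel)"
    by (rule measurable_PiM_single'; simp)+
  have mr[measurable]: "(\<lambda>x. restrict x J) \<in> Pi\<^sub>M UNIV (\<lambda>_. borel) \<rightarrow>\<^sub>M Pi\<^sub>M J (\<lambda>_. borel :: real measure)" for J :: "'i set"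
    by (rule measurable_restrict_subset) simp
  {
    assume "distr M (Pi\<^sub>M UNIV (\<lambda>_. borel)) X = distr M (Pi\<^sub>M UNIV (\<lambda>_. borel)) Y"
    then have "distr (distr M (Pi\<^sub>M UNIV (\<lambda>_. borel)) X) (Pi\<^sub>M J (\<lambda>_. borel)) (\<lambda>x. restrict x J) =
      distr (distr M (Pi\<^sub>M UNIV (\<lambda>_. borel)) Y) (Pi\<^sub>M J (\<lambda>_. borel)) (\<lambda>x. restrict x J)" for J by simp
    then show "same_fdd M X Y"
      unfolding same_fdd_def by (simp add: distr_distr o_def)
  }
  assume fdd: "same_fdd M X Y"
  show "distr M (Pi\<^sub>M UNIV (\<lambda>_. borel)) X = distr M (Pi\<^sub>M UNIV (\<lambda>_. borel)) Y"
  proof (rule measure_eqI_PiM_infinite)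
    fix E :: "'i \<Rightarrow> real set" and J assume J: "finite J" "\<And>i. i \<in> J \<Longrightarrow> E i \<in> sets borel"
    have [measurable]: "prod_emb UNIV (\<lambda>_. borel) J (Pi\<^sub>E J E) \<in> sets (Pi\<^sub>M UNIV (\<lambda>_. borel))"
      using J by (intro sets_PiM_I) auto
    have [measurable]: "Pi\<^sub>E J E \<in> sets (Pi\<^sub>M J (\<lambda>_. borel))"
      using J by (intro sets_PiM_I_finite) auto
    have *: "emeasure (distr M (Pi\<^sub>M UNIV (\<lambda>_. borel)) Z) (prod_emb UNIV (\<lambda>_. borel) J (Pi\<^sub>E J E)) =
      emeasure (distr M (Pi\<^sub>M J (\<lambda>_. borel)) (\<lambda>\<omega>. restrict (Z \<omega>) J)) (Pi\<^sub>E J E)"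
      if [measurable]: "Z \<in> M \<rightarrow>\<^sub>M Pi\<^sub>M UNIV (\<lambda>_. borel)" for Z
    proof -
      have [measurable]: "(\<lambda>\<omega>. restrict (Z \<omega>) J) \<in> M \<rightarrow>\<^sub>M Pi\<^sub>M J (\<lambda>_. borel)"
        using measurable_compose[OF that mr] .
      show ?thesis
        by (simp add: emeasure_distr) (auto intro!: arg_cong[where f = "emeasure M"] simp: prod_emb_def)
    qed
    show "emeasure (distr M (Pi\<^sub>M UNIV (\<lambda>_. borel)) X) (prod_emb UNIV (\<lambda>_. borel) J (Pi\<^sub>E J E)) =
      emeasure (distr M (Pi\<^sub>M UNIV (\<lambda>_. borel)) Y) (prod_emb UNIV (\<lambda>_. borel) J (Pi\<^sub>E J E))"
      unfolding *[OF mX] *[OF mY] using fdd J(1) by (simp add: same_fdd_def)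
  next
    interpret prob_space M by fact
    interpret D: prob_space "distr M (Pi\<^sub>M UNIV (\<lambda>_. borel)) X" by (rule prob_space_distr) simp
    show "finite_measure (distr M (Pi\<^sub>M UNIV (\<lambda>_. borel)) X)" by (rule D.finite_measure_axioms)
  qed simp_all
qed

section \<open>Replicas\<close>

text \<open>Quantile function of the weights: it turns a uniform variable into a random index with
  law \<open>v\<close>. Replicas become functions on one fixed product space, whatever the weights
  are.\<close>

definition label :: "(nat \<Rightarrow> real) \<Rightarrow> real \<Rightarrow> nat" where
  "label v x = (LEAST l. x < (\<Sum>j\<le>l. v j))"

abbreviation unif :: "real measure" where
  "unif \<equiv> uniform_measure lborel {0..1}"

abbreviation unifs :: "(nat \<Rightarrow> real) measure" where
  "unifs \<equiv> Pi\<^sub>M UNIV (\<lambda>_. unif)"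

definition labels :: "nat \<Rightarrow> (nat \<Rightarrow> real) \<Rightarrow> (nat \<Rightarrow> real) \<Rightarrow> nat \<Rightarrow> nat" where
  "labels n v u = (\<lambda>i\<in>{..<n}. label v (u i))"

lemma prob_space_unif: "prob_space unif"
  by (rule prob_space_uniform_measure) auto

interpretation unif: prob_space unif
  by (rule prob_space_unif)

interpretation unifs: product_prob_space "\<lambda>_::nat. unif" UNIV ..

lemma measurable_label:
  assumes [measurable]: "\<And>l. (\<lambda>z. v z l) \<in> borel_measurable M" "X \<in> borel_measurable M"
  shows "(\<lambda>z. label (v z) (X z)) \<in> M \<rightarrow>\<^sub>M count_space UNIV"
  unfolding label_def by measurable

lemma measurable_label'[measurable]: "label v \<in> borel \<rightarrow>\<^sub>M count_space UNIV"
  by (rule measurable_label) auto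

lemma emeasure_unif_label:
  assumes v: "\<And>l. 0 \<le> v l" "v sums 1"
  shows "emeasure unif {x. label v x = l} = ennreal (v l)"
proof -
  define S where "S k = (\<Sum>j<k. v j)" for k
  have mono: "S i \<le> S j" if "i \<le> j" for i j
    unfolding S_def using that v(1) by (intro sum_mono2) auto
  have S1: "S k \<le> 1" for k
    unfolding S_def using sum_le_suminf[of v "{..<k}"] v by (auto simp: sums_iff)
  have S0: "0 \<le> S k" for k
    unfolding S_def using v(1) by (intro sum_nonneg) auto
  have lab: "label v x = l \<longleftrightarrow> S l \<le> x \<and> x < S (Suc l)" if x: "0 \<le> x" "x < 1" for x
  proof -
    have "S \<longlonglongrightarrow> 1" using v(2) by (simp add: sums_def S_def[abs_def])
    then obtain k where "x < S k"
      using order_tendstoD(1)[of S 1 sequentially x] x by (auto simp: eventually_sequentially)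
    then have ex: "\<exists>k. x < S (Suc k)"
      using mono[of k "Suc k"] by (meson le_less_trans less_le_trans not_less le_SucI order_refl)
    have lv: "label v x = (LEAST k. x < S (Suc k))"
      by (simp add: label_def S_def lessThan_Suc_atMost)
    show ?thesis
    proof
      assume l: "label v x = l"
      have "x < S (Suc l)" using LeastI_ex[OF ex] l lv by simp
      moreover have "S l \<le> x"
      proof (cases l)
        case 0 then show ?thesis using x by (simp add: S_def)
      next
        case (Suc k)
        then have "\<not> x < S (Suc k)" using l lv by (metis lessI not_less_Least)
        then show ?thesis using Suc by simp
      qed
      ultimately show "S l \<le> x \<and> x < S (Suc l)" by simp
    next
      assume a: "S l \<le> x \<and> x < S (Suc l)"
      show "label v x = l"
        unfolding lv
      proof (rule Least_equality)
        fix y assume "x < S (Suc y)"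
        then have "\<not> Suc y \<le> l" using a mono[of "Suc y" l] by linarith
        then show "l \<le> y" by simp
      qed (use a in simp)
    qed
  qed
  have "emeasure unif {x. label v x = l} = emeasure lborel ({0..1} \<inter> {x. label v x = l})"
    by (subst emeasure_uniform_measure) (auto simp: divide_ennreal_def)
  also have "\<dots> = emeasure lborel ({S l..<S (Suc l)})"
  \<comment> \<open>At \<open>x = 1\<close> no partial sum exceeds \<open>x\<close> and the
    \<open>LEAST\<close> in \<open>label\<close> is unspecified; this single point is null.\<close>
  proof (rule emeasure_eq_AE)
    show "AE x in lborel. (x \<in> {0..1} \<inter> {x. label v x = l}) = (x \<in> {S l..<S (Suc l)})"
      using AE_lborel_singleton[of 1]
    proof eventually_elim
      case (elim x)
      show ?case
      proof (cases "0 \<le> x \<and> x < 1")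
        case True then show ?thesis using lab by auto
      next
        case False
        then have "x < 0 \<or> x > 1" using elim by auto
        then show ?thesis using S0[of l] S1[of "Suc l"] by auto
      qed
    qed
  qed auto
  also have "\<dots> = ennreal (v l)"
    using mono[of l "Suc l"] by (simp add: S_def)
  finally show ?thesis .
qed

lemma measurable_labels[measurable]: "labels n v \<in> unifs \<rightarrow>\<^sub>M count_space ({..<n} \<rightarrow>\<^sub>E UNIV)"
proof (subst measurable_count_space_eq_countable[OF countable_PiE_nat], intro conjI ballI)
  fix l :: "nat \<Rightarrow> nat" assume "l \<in> {..<n} \<rightarrow>\<^sub>E UNIV"
  then have "labels n v -` {l} \<inter> space unifs = {u \<in> space unifs. \<forall>i\<in>{..<n}. label v (u i) = l i}"
    by (auto simp: labels_def PiE_def extensional_def fun_eq_iff)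
  also have "\<dots> \<in> sets unifs" by measurable
  finally show "labels n v -` {l} \<inter> space unifs \<in> sets unifs" .
qed (auto simp: countable_PiE_nat labels_def)

lemma distr_labels:
  assumes v: "\<And>l. 0 \<le> v l" "v sums 1"
  shows "distr unifs (count_space ({..<n} \<rightarrow>\<^sub>E UNIV)) (labels n v) =
    density (count_space ({..<n} \<rightarrow>\<^sub>E UNIV)) (\<lambda>l. ennreal (\<Prod>i<n. v (l i)))"
proof (rule measure_eqI_countable)
  show "countable ({..<n} \<rightarrow>\<^sub>E (UNIV :: nat set))" by (rule countable_PiE_nat)
  fix l :: "nat \<Rightarrow> nat" assume l: "l \<in> {..<n} \<rightarrow>\<^sub>E UNIV"
  have "labels n v -` {l} \<inter> space unifs = {u \<in> space unifs. \<forall>i\<in>{..<n}. u i \<in> {x. label v x = l i}}"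
    using l by (auto simp: labels_def PiE_def extensional_def fun_eq_iff)
  moreover have "emeasure unifs {u \<in> space unifs. \<forall>i\<in>{..<n}. u i \<in> {x. label v x = l i}} =
    (\<Prod>i<n. emeasure unif {x. label v x = l i})"
    by (rule unifs.emeasure_PiM_Collect) auto
  ultimately have "emeasure (distr unifs (count_space ({..<n} \<rightarrow>\<^sub>E UNIV)) (labels n v)) {l} = (\<Prod>i<n. ennreal (v (l i)))"
    using l by (simp add: emeasure_distr emeasure_unif_label[OF v])
  also have "\<dots> = ennreal (\<Prod>i<n. v (l i))"
    using v(1) by (intro prod_ennreal) auto
  also have "\<dots> = emeasure (density (count_space ({..<n} \<rightarrow>\<^sub>E UNIV)) (\<lambda>l. ennreal (\<Prod>i<n. v (l i)))) {l}"
    using l by (simp add: emeasure_density nn_integral_count_space_indicator[symmetric] nn_integral_indicator_singleton')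
  finally show "emeasure (distr unifs (count_space ({..<n} \<rightarrow>\<^sub>E UNIV)) (labels n v)) {l} =
    emeasure (density (count_space ({..<n} \<rightarrow>\<^sub>E UNIV)) (\<lambda>l. ennreal (\<Prod>i<n. v (l i)))) {l}" .
qed auto

lemma navg_eq_labels:
  assumes "\<And>l. 0 \<le> v l" "v sums 1"
  shows "navg v n f = (\<integral>\<^sup>+u. f (labels n v u) \<partial>unifs)"
proof -
  have "navg v n f = (\<integral>\<^sup>+l. f l \<partial>distr unifs (count_space ({..<n} \<rightarrow>\<^sub>E UNIV)) (labels n v))"
    unfolding distr_labels[OF assms] navg_def by (subst nn_integral_density) auto
  then show ?thesis by (simp add: nn_integral_distr)
qed

lemma bracket_eq_labels:
  assumes v: "\<And>l. 0 \<le> v l" "v sums 1" and f: "\<And>l. \<bar>f (\<lambda>k. x (l k))\<bar> \<le> B"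
  shows "bracket v x n f = (\<integral>u. f (\<lambda>k. x (labels n v u k)) \<partial>unifs)"
proof -
  let ?P = "{..<n} \<rightarrow>\<^sub>E (UNIV :: nat set)"
  interpret D: prob_space "distr unifs (count_space ?P) (labels n v)"
    by (rule unifs.prob_space_distr) simp
  have "integrable (distr unifs (count_space ?P) (labels n v)) (\<lambda>l. f (\<lambda>k. x (l k)))"
    using f by (intro D.integrable_const_bound[where B = B]) auto
  then have int: "integrable (count_space ?P) (\<lambda>l. (\<Prod>k<n. v (l k)) * f (\<lambda>k. x (l k)))"
    unfolding distr_labels[OF v] using v(1) by (subst (asm) integrable_density) (auto intro!: prod_nonneg)
  then have "Infinite_Set_Sum.abs_summable_on (\<lambda>l. (\<Prod>k<n. v (l k)) * f (\<lambda>k. x (l k))) ?P"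
    by (simp add: Infinite_Set_Sum.abs_summable_on_def)
  then have "bracket v x n f = infsetsum (\<lambda>l. (\<Prod>k<n. v (l k)) * f (\<lambda>k. x (l k))) ?P"
    unfolding bracket_def by (simp add: infsetsum_infsum)
  also have "\<dots> = (\<integral>l. f (\<lambda>k. x (l k)) \<partial>density (count_space ?P) (\<lambda>l. ennreal (\<Prod>i<n. v (l i))))"
    unfolding infsetsum_def using v(1) by (subst integral_density) (auto intro!: prod_nonneg)
  also have "\<dots> = (\<integral>u. f (\<lambda>k. x (labels n v u k)) \<partial>unifs)"
    unfolding distr_labels[OF v, symmetric] by (subst integral_distr) auto
  finally show ?thesis .
qed

text \<open>Average over a single replica, written as an integral over its uniform variable because
  it arises by integrating that variable out.\<close>

definition savg :: "(nat \<Rightarrow> real) \<Rightarrow> (nat \<Rightarrow> real) \<Rightarrow> real" where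
  "savg v f = (\<integral>x. f (label v x) \<partial>unif)"

lemma savg_sums:
  assumes v: "\<And>l. 0 \<le> v l" "v sums 1" and f: "\<And>l. \<bar>f l\<bar> \<le> B"
  shows "(\<lambda>l. v l * f l) sums savg v f"
proof -
  have d: "distr unif (count_space UNIV) (label v) = density (count_space UNIV) (\<lambda>l. ennreal (v l))"
  proof (rule measure_eqI_countable)
    fix l :: nat
    have "emeasure (distr unif (count_space UNIV) (label v)) {l} = ennreal (v l)"
      using emeasure_unif_label[OF v, of l] by (simp add: emeasure_distr vimage_def)
    then show "emeasure (distr unif (count_space UNIV) (label v)) {l} = emeasure (density (count_space UNIV) (\<lambda>l. ennreal (v l))) {l}"
      by (simp add: emeasure_density nn_integral_indicator_singleton')
  qed auto
  interpret D: prob_space "distr unif (count_space UNIV) (label v)"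
    by (rule unif.prob_space_distr) simp
  have "integrable (distr unif (count_space UNIV) (label v)) f"
    using f by (intro D.integrable_const_bound[where B = B]) auto
  then have int: "integrable (count_space UNIV) (\<lambda>l. v l * f l)"
    unfolding d using v(1) by (subst (asm) integrable_density) auto
  have "savg v f = (\<integral>l. f l \<partial>distr unif (count_space UNIV) (label v))"
    unfolding savg_def by (subst integral_distr) auto
  also have "\<dots> = (\<integral>l. v l * f l \<partial>count_space UNIV)"
    unfolding d using v(1) by (subst integral_density) auto
  finally show ?thesis
    using sums_integral_count_space_nat[OF int] by simp
qed

lemma distr_unifs_perm:
  assumes "bij \<tau>"
  shows "distr unifs unifs (\<lambda>u. u \<circ> \<tau>) = unifs"
proof -
  have "distr (Pi\<^sub>M UNIV (\<lambda>_. unif)) (Pi\<^sub>M UNIV (\<lambda>_. unif)) (\<lambda>\<omega>. \<lambda>n\<in>UNIV. \<omega> (\<tau> n)) = (Pi\<^sub>M UNIV (\<lambda>_. unif))"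
    by (rule distr_PiM_reindex[OF prob_space_unif bij_is_inj[OF assms]]) simp
  then show ?thesis by (simp only: o_def restrict_UNIV)
qed

lemma distr_unifs_update:
  "distr (unif \<Otimes>\<^sub>M unifs) unifs (\<lambda>(x, u). u(m := x)) = unifs"
  using distr_pair_PiM_eq_PiM[of UNIV "\<lambda>_. unif" m, OF prob_space_unif prob_space_unif]
  by (simp only: insert_UNIV)

section \<open>The probability space carrying infinitely many replicas\<close>

context random_atoms
begin

abbreviation N :: "('a \<times> (nat \<Rightarrow> real)) measure" where
  "N \<equiv> M \<Otimes>\<^sub>M unifs"

definition lab :: "'a \<times> (nat \<Rightarrow> real) \<Rightarrow> nat \<Rightarrow> nat" where
  "lab z i = label (w (fst z)) (snd z i)"

definition R :: "'a \<times> (nat \<Rightarrow> real) \<Rightarrow> nat \<Rightarrow> nat \<Rightarrow> real" where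
  "R z i j = Q (fst z) (lab z i) (lab z j)"

definition RN :: "nat \<Rightarrow> 'a \<times> (nat \<Rightarrow> real) \<Rightarrow> nat \<times> nat \<Rightarrow> real" where
  "RN n z = (\<lambda>(i, j) \<in> {..<n} \<times> {..<n}. R z i j)"

sublocale MN: pair_prob_space M unifs
  by unfold_locales

lemma space_N_fst: "z \<in> space N \<Longrightarrow> fst z \<in> space M"
  by (auto simp: space_pair_measure)

lemma measurable_lab[measurable]: "(\<lambda>z. lab z i) \<in> N \<rightarrow>\<^sub>M count_space UNIV"
  unfolding lab_def by (rule measurable_label) measurable

lemma measurable_R[measurable]: "(\<lambda>z. R z i j) \<in> borel_measurable N"
proof -
  have "(\<lambda>z. Q (fst z) l (lab z j)) \<in> borel_measurable N" for l
    by (rule measurable_compose_countable[where g = "\<lambda>z. lab z j"]) measurable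
  then show ?thesis
    unfolding R_def by (rule measurable_compose_countable[where g = "\<lambda>z. lab z i"]) measurable
qed

lemma measurable_RN[measurable]: "RN n \<in> N \<rightarrow>\<^sub>M Pi\<^sub>M ({..<n} \<times> {..<n}) (\<lambda>_. borel)"
  unfolding RN_def[abs_def] by (rule measurable_restrict) (auto split: prod.split)

lemma R_abs_le_1: "z \<in> space N \<Longrightarrow> \<bar>R z i j\<bar> \<le> 1"
  unfolding R_def by (rule Q_abs_le_1) (rule space_N_fst)

lemma R_power_abs_le_1: "z \<in> space N \<Longrightarrow> \<bar>R z i j ^ p\<bar> \<le> 1"
  using R_abs_le_1[of z i j] by (simp add: power_abs power_le_one)

lemma integrable_N_bounded:
  fixes f :: "_ \<Rightarrow> real"
  assumes "f \<in> borel_measurable N" "\<And>z. z \<in> space N \<Longrightarrow> \<bar>f z\<bar> \<le> B"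
  shows "integrable N f"
  using assms by (intro MN.P.integrable_const_bound[where B = B]) auto

lemma measurable_labels_N[measurable]:
  "(\<lambda>z. labels n (w (fst z)) (snd z)) \<in> N \<rightarrow>\<^sub>M count_space ({..<n} \<rightarrow>\<^sub>E UNIV)"
proof (subst measurable_count_space_eq_countable[OF countable_PiE_nat], intro conjI ballI)
  fix l :: "nat \<Rightarrow> nat" assume "l \<in> {..<n} \<rightarrow>\<^sub>E UNIV"
  then have "(\<lambda>z. labels n (w (fst z)) (snd z)) -` {l} \<inter> space N = {z \<in> space N. \<forall>i\<in>{..<n}. lab z i = l i}"
    by (auto simp: labels_def lab_def PiE_def extensional_def fun_eq_iff)
  also have "\<dots> \<in> sets N" by measurable
  finally show "(\<lambda>z. labels n (w (fst z)) (snd z)) -` {l} \<inter> space N \<in> sets N" .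
qed (auto simp: labels_def)

lemma labels_eq_lab: "i < n \<Longrightarrow> labels n (w (fst z)) (snd z) i = lab z i"
  by (simp add: labels_def lab_def)

lemma nn_integral_navg_eq:
  assumes [measurable]: "\<And>l. (\<lambda>\<omega>. H \<omega> l) \<in> borel_measurable M"
  shows "(\<integral>\<^sup>+\<omega>. navg (w \<omega>) n (H \<omega>) \<partial>M) = (\<integral>\<^sup>+z. H (fst z) (labels n (w (fst z)) (snd z)) \<partial>N)"
proof -
  have [measurable]: "(\<lambda>z. H (fst z) (labels n (w (fst z)) (snd z))) \<in> borel_measurable N"
    by (rule measurable_compose_countable'[OF _ measurable_labels_N countable_PiE_nat]) measurable
  have "(\<integral>\<^sup>+\<omega>. navg (w \<omega>) n (H \<omega>) \<partial>M) = (\<integral>\<^sup>+\<omega>. \<integral>\<^sup>+u. H \<omega> (labels n (w \<omega>) u) \<partial>unifs \<partial>M)"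
    by (intro nn_integral_cong navg_eq_labels) (auto intro: w_nonneg w_sums)
  also have "\<dots> = (\<integral>\<^sup>+z. H (fst z) (labels n (w (fst z)) (snd z)) \<partial>N)"
    using unifs.nn_integral_fst[of "\<lambda>z. H (fst z) (labels n (w (fst z)) (snd z))" M] by simp
  finally show ?thesis .
qed

text \<open>The labels in \<open>bracket\<close> are \<open>undefined\<close> from position
  \<open>n\<close> on, while \<open>lab\<close> continues with further replicas; \<open>dep\<close>
  makes the two agree.\<close>

lemma mean_bracket_eq:
  assumes [measurable]: "\<And>l. (\<lambda>\<omega>. G (\<lambda>k. \<xi> \<omega> (l k))) \<in> borel_measurable M"
    and bound: "\<And>\<omega> l. \<omega> \<in> space M \<Longrightarrow> \<bar>G (\<lambda>k. \<xi> \<omega> (l k))\<bar> \<le> B"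
    and dep: "\<And>\<sigma> \<sigma>'. (\<And>k. k < n \<Longrightarrow> \<sigma> k = \<sigma>' k) \<Longrightarrow> G \<sigma> = G \<sigma>'"
  shows "mean_bracket M w \<xi> n G = (\<integral>z. G (\<lambda>k. \<xi> (fst z) (lab z k)) \<partial>N)"
proof -
  have m[measurable]: "(\<lambda>z. G (\<lambda>k. \<xi> (fst z) (labels n (w (fst z)) (snd z) k))) \<in> borel_measurable N"
    by (rule measurable_compose_countable'[OF _ measurable_labels_N countable_PiE_nat]) measurable
  have int: "integrable N (\<lambda>z. G (\<lambda>k. \<xi> (fst z) (labels n (w (fst z)) (snd z) k)))"
    by (rule integrable_N_bounded[OF m]) (rule bound, rule space_N_fst)
  have "mean_bracket M w \<xi> n G = (\<integral>\<omega>. \<integral>u. G (\<lambda>k. \<xi> \<omega> (labels n (w \<omega>) u k)) \<partial>unifs \<partial>M)"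
    unfolding mean_bracket_def
    by (intro Bochner_Integration.integral_cong bracket_eq_labels[where B = B])
      (auto intro: w_nonneg w_sums bound)
  also have "\<dots> = (\<integral>z. G (\<lambda>k. \<xi> (fst z) (labels n (w (fst z)) (snd z) k)) \<partial>N)"
    using MN.integral_fst'[OF int] by simp
  also have "\<dots> = (\<integral>z. G (\<lambda>k. \<xi> (fst z) (lab z k)) \<partial>N)"
    by (intro Bochner_Integration.integral_cong refl dep) (simp add: labels_eq_lab)
  finally show ?thesis .
qed

lemma distr_N_perm:
  assumes "bij \<tau>"
  shows "distr N N (\<lambda>z. (fst z, snd z \<circ> \<tau>)) = N"
proof -
  have [measurable]: "(\<lambda>u. u \<circ> \<tau>) \<in> unifs \<rightarrow>\<^sub>M unifs"
    by (rule measurable_PiM_single') (auto simp: space_PiM)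
  have "distr M M (\<lambda>x. x) \<Otimes>\<^sub>M distr unifs unifs (\<lambda>u. u \<circ> \<tau>) =
    distr N N (\<lambda>(x, u). (x, u \<circ> \<tau>))"
    by (rule pair_measure_distr) (auto simp: distr_unifs_perm[OF assms] intro: unifs.sigma_finite_measure_axioms)
  then show ?thesis
    by (simp add: distr_unifs_perm[OF assms] distr_id2 case_prod_beta')
qed

lemma lab_perm: "lab (fst z, snd z \<circ> \<tau>) i = lab z (\<tau> i)"
  by (simp add: lab_def)

lemma R_perm: "R (fst z, snd z \<circ> \<tau>) i j = R z (\<tau> i) (\<tau> j)"
  by (simp add: R_def lab_perm)

lemma lab_update: "lab (fst z, (snd z)(m := x)) i = (if i = m then label (w (fst z)) x else lab z i)"
  by (simp add: lab_def)

lemma measurable_N_update[measurable]: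
  "(\<lambda>(z, x). (fst z, (snd z)(m := x))) \<in> N \<Otimes>\<^sub>M unif \<rightarrow>\<^sub>M N"
proof -
  have "(\<lambda>z. (snd (fst z))(m := snd z)) \<in> N \<Otimes>\<^sub>M unif \<rightarrow>\<^sub>M unifs"
    by (rule measurable_PiM_single') (auto simp: space_pair_measure space_PiM)
  then show ?thesis by (simp add: case_prod_beta' measurable_Pair)
qed

text \<open>Redrawing the uniform variable of one replica preserves the law, so a fresh variable can
  be inserted at position \<open>m\<close> and integrated separately.\<close>

lemma distr_N_update: "distr (N \<Otimes>\<^sub>M unif) N (\<lambda>(z, x). (fst z, (snd z)(m := x))) = N"
proof (rule measure_eqI)
  fix A assume "A \<in> sets (distr (N \<Otimes>\<^sub>M unif) N (\<lambda>(z, x). (fst z, (snd z)(m := x))))"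
  then have A[measurable]: "A \<in> sets N" by simp
  have up[measurable]: "(\<lambda>(x, u). u(m := x)) \<in> unif \<Otimes>\<^sub>M unifs \<rightarrow>\<^sub>M unifs"
  proof -
    have "(\<lambda>z. (snd z)(m := fst z)) \<in> unif \<Otimes>\<^sub>M unifs \<rightarrow>\<^sub>M unifs"
      by (rule measurable_PiM_single') (auto simp: space_pair_measure space_PiM)
    then show ?thesis by (simp add: case_prod_beta')
  qed
  interpret S: pair_sigma_finite unif unifs ..
  have "emeasure (distr (N \<Otimes>\<^sub>M unif) N (\<lambda>(z, x). (fst z, (snd z)(m := x)))) A =
    (\<integral>\<^sup>+y. indicator A ((\<lambda>(z, x). (fst z, (snd z)(m := x))) y) \<partial>(N \<Otimes>\<^sub>M unif))"
    by (subst nn_integral_indicator[symmetric]) (auto simp: nn_integral_distr simp del: nn_integral_indicator)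
  also have "\<dots> = (\<integral>\<^sup>+z. \<integral>\<^sup>+x. indicator A (fst z, (snd z)(m := x)) \<partial>unif \<partial>N)"
    by (subst unif.nn_integral_fst[symmetric]) auto
  also have "\<dots> = (\<integral>\<^sup>+\<omega>. \<integral>\<^sup>+u. \<integral>\<^sup>+x. indicator A (\<omega>, u(m := x)) \<partial>unif \<partial>unifs \<partial>M)"
  proof -
    have "(\<lambda>z. \<integral>\<^sup>+x. indicator A ((\<lambda>(z, x). (fst z, (snd z)(m := x))) (z, x)) \<partial>unif) \<in> borel_measurable N"
      by (rule unif.borel_measurable_nn_integral_fst) measurable
    then show ?thesis by (subst unifs.nn_integral_fst[symmetric]) simp_all
  qed
  also have "\<dots> = (\<integral>\<^sup>+\<omega>. \<integral>\<^sup>+u. indicator A (\<omega>, u) \<partial>unifs \<partial>M)"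
  proof (rule nn_integral_cong)
    fix \<omega> assume \<omega>: "\<omega> \<in> space M"
    have [measurable]: "(\<lambda>u. indicator A (\<omega>, u) :: ennreal) \<in> borel_measurable unifs"
      using \<omega> by measurable
    have "(\<integral>\<^sup>+u. indicator A (\<omega>, u) \<partial>unifs) =
      (\<integral>\<^sup>+u. indicator A (\<omega>, u) \<partial>distr (unif \<Otimes>\<^sub>M unifs) unifs (\<lambda>(x, u). u(m := x)))"
      by (simp add: distr_unifs_update)
    also have "\<dots> = (\<integral>\<^sup>+y. indicator A (\<omega>, (\<lambda>(x, u). u(m := x)) y) \<partial>(unif \<Otimes>\<^sub>M unifs))"
      by (subst nn_integral_distr) auto
    also have "\<dots> = (\<integral>\<^sup>+u. \<integral>\<^sup>+x. indicator A (\<omega>, u(m := x)) \<partial>unif \<partial>unifs)"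
      by (subst S.nn_integral_snd[symmetric]) auto
    finally show "(\<integral>\<^sup>+u. \<integral>\<^sup>+x. indicator A (\<omega>, u(m := x)) \<partial>unif \<partial>unifs) = (\<integral>\<^sup>+u. indicator A (\<omega>, u) \<partial>unifs)" ..
  qed
  also have "\<dots> = emeasure N A"
    by (subst unifs.nn_integral_fst) (auto simp: )
  finally show "emeasure (distr (N \<Otimes>\<^sub>M unif) N (\<lambda>(z, x). (fst z, (snd z)(m := x)))) A = emeasure N A" .
qed simp

lemma measurable_savg[measurable (raw)]:
  assumes [measurable]: "\<And>j. (\<lambda>z. \<phi> z j) \<in> borel_measurable N"
  shows "(\<lambda>z. savg (w (fst z)) (\<phi> z)) \<in> borel_measurable N"
proof -
  have l[measurable]: "(\<lambda>y. label (w (fst (fst y))) (snd y)) \<in> N \<Otimes>\<^sub>M unif \<rightarrow>\<^sub>M count_space UNIV"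
    by (rule measurable_label) measurable
  have "(\<lambda>y. \<phi> (fst y) (label (w (fst (fst y))) (snd y))) \<in> borel_measurable (N \<Otimes>\<^sub>M unif)"
    by (rule measurable_compose_countable[OF _ l]) measurable
  then have "(\<lambda>(z, x). \<phi> z (label (w (fst z)) x)) \<in> borel_measurable (N \<Otimes>\<^sub>M unif)"
    by (simp add: case_prod_beta')
  then show ?thesis
    unfolding savg_def by (rule unif.borel_measurable_lebesgue_integral)
qed

lemma savg_abs_le:
  assumes "\<And>j. \<bar>\<phi> j\<bar> \<le> C"
  shows "\<bar>savg v \<phi>\<bar> \<le> C"
proof -
  have m: "(\<lambda>x. \<phi> (label v x)) \<in> borel_measurable unif"
    by (rule measurable_compose[where N = "count_space UNIV"]) auto
  have "\<bar>savg v \<phi>\<bar> \<le> (\<integral>x. \<bar>\<phi> (label v x)\<bar> \<partial>unif)"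
    unfolding savg_def using integral_norm_bound[of unif "\<lambda>x. \<phi> (label v x)"] by simp
  also have "\<dots> \<le> (\<integral>x. C \<partial>unif)"
    using assms m order_trans[OF abs_ge_zero assms]
    by (intro Bochner_Integration.integral_mono unif.integrable_const_bound[where B = C]) auto
  finally show ?thesis by (simp add: unif.prob_space)
qed

text \<open>Replica \<open>m\<close> enters the integrand only through \<open>lab z m\<close>. After
  its variable has been redrawn, Fubini replaces the value of \<phi> there by the average over one
  replica.\<close>

lemma integral_peel:
  assumes G[measurable]: "G \<in> borel_measurable N" "\<And>z. z \<in> space N \<Longrightarrow> \<bar>G z\<bar> \<le> B"
    and Gm: "\<And>z x. G (fst z, (snd z)(m := x)) = G z"
    and \<phi>[measurable]: "\<And>j. (\<lambda>z. \<phi> z j) \<in> borel_measurable N" "\<And>z j. z \<in> space N \<Longrightarrow> \<bar>\<phi> z j\<bar> \<le> C"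
    and \<phi>m: "\<And>z x j. \<phi> (fst z, (snd z)(m := x)) j = \<phi> z j"
  shows "(\<integral>z. G z * \<phi> z (lab z m) \<partial>N) = (\<integral>z. G z * savg (w (fst z)) (\<phi> z) \<partial>N)"
proof -
  have NU: "pair_sigma_finite N unif"
    unfolding pair_sigma_finite_def
    using MN.P.sigma_finite_measure_axioms unif.sigma_finite_measure_axioms by (rule conjI)
  have pr: "prob_space (N \<Otimes>\<^sub>M unif)"
    by (rule prob_space_pair) (rule MN.P.prob_space_axioms prob_space_unif)+
  define H where "H z = G z * \<phi> z (lab z m)" for z
  have H[measurable]: "H \<in> borel_measurable N"
    unfolding H_def
    by (rule borel_measurable_times[OF G(1) measurable_compose_countable[OF \<phi>(1) measurable_lab]])
  have [measurable]: "(\<lambda>y. H (fst (fst y), (snd (fst y))(m := snd y))) \<in> borel_measurable (N \<Otimes>\<^sub>M unif)"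
    using measurable_compose[OF measurable_N_update H] by (simp add: case_prod_beta')
  have "0 \<le> B" if "z \<in> space N" for z using G(2)[OF that] by simp
  then have Hb: "\<bar>H z\<bar> \<le> B * C" if "z \<in> space N" for z
    unfolding H_def abs_mult using that by (intro mult_mono G \<phi>) auto
  have int: "integrable (N \<Otimes>\<^sub>M unif) (\<lambda>y. H (fst (fst y), (snd (fst y))(m := snd y)))"
  proof (rule finite_measure.integrable_const_bound[OF prob_space.finite_measure[OF pr], where B = "B * C"])
    show "AE y in N \<Otimes>\<^sub>M unif. norm (H (fst (fst y), (snd (fst y))(m := snd y))) \<le> B * C"
      using measurable_space[OF measurable_N_update] by (intro AE_I2) (auto intro!: Hb)
  qed measurable
  have "(\<integral>z. H z \<partial>N) = (\<integral>z. H z \<partial>distr (N \<Otimes>\<^sub>M unif) N (\<lambda>(z, x). (fst z, (snd z)(m := x))))"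
    by (simp add: distr_N_update)
  also have "\<dots> = (\<integral>y. H (fst (fst y), (snd (fst y))(m := snd y)) \<partial>(N \<Otimes>\<^sub>M unif))"
    by (subst integral_distr) (auto simp: case_prod_beta')
  also have "\<dots> = (\<integral>z. \<integral>x. H (fst z, (snd z)(m := x)) \<partial>unif \<partial>N)"
    using pair_sigma_finite.integral_fst'[OF NU int] by simp
  also have "\<dots> = (\<integral>z. G z * savg (w (fst z)) (\<phi> z) \<partial>N)"
    by (simp add: H_def Gm \<phi>m lab_update savg_def)
  finally show ?thesis by (simp add: H_def)
qed

end

section \<open>The Ghirlanda-Guerra identities in terms of replicas\<close>

text \<open>Approximation together with the derivative: Weierstrass is applied to the derivative,
  and the approximating polynomial is integrated. Both estimates are needed, since the identities
  for polynomials involve the polynomial and its derivative.\<close>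

lemma poly_approx_inverse_power:
  fixes c C \<epsilon> :: real
  assumes c: "0 < c" "c \<le> C" and \<epsilon>: "0 < \<epsilon>"
  obtains d :: nat and \<alpha> :: "nat \<Rightarrow> real" where
    "\<And>x. x \<in> {c..C} \<Longrightarrow> \<bar>(\<Sum>k\<le>d. \<alpha> k * x ^ k) - 1 / x ^ n\<bar> \<le> \<epsilon>"
    "\<And>x. x \<in> {c..C} \<Longrightarrow> \<bar>(\<Sum>k\<le>d. \<alpha> k * (real k * x ^ (k - 1))) + real n / x ^ Suc n\<bar> \<le> \<epsilon>"
proof -
  \<comment> \<open>Small enough for the derivative itself and for the error accumulated when
    integrating over an interval of length C - c.\<close>
  define \<delta> where "\<delta> = \<epsilon> / (1 + (C - c))"
  have \<delta>: "0 < \<delta>" "\<delta> \<le> \<epsilon>" "\<delta> * (C - c) \<le> \<epsilon>"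
    using c \<epsilon> by (auto simp: \<delta>_def field_simps)
  have "continuous_on {c..C} (\<lambda>x. - (real n / x ^ Suc n))"
    using c by (intro continuous_intros) auto
  from Stone_Weierstrass_real_polynomial_function[OF compact_Icc this \<delta>(1)]
  obtain g where g: "real_polynomial_function g" "\<And>x. x \<in> {c..C} \<Longrightarrow> \<bar>- (real n / x ^ Suc n) - g x\<bar> < \<delta>"
    by blast
  obtain a d where ad: "g = (\<lambda>x. \<Sum>i\<le>d. a i * x ^ i)"
    using g(1) real_polynomial_function_iff_sum by blast
  \<comment> \<open>Constant of integration that makes the approximation exact at the left
    endpoint.\<close>
  define K where "K = 1 / c ^ n - (\<Sum>k\<le>d. a k / real (Suc k) * c ^ Suc k)"
  define \<alpha> where "\<alpha> k = (case k of 0 \<Rightarrow> K | Suc j \<Rightarrow> a j / real (Suc j))" for k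
  define \<psi> where "\<psi> x = (\<Sum>k\<le>Suc d. \<alpha> k * x ^ k)" for x
  have \<psi>': "(\<Sum>k\<le>Suc d. \<alpha> k * (real k * x ^ (k - 1))) = g x" for x
    unfolding sum.atMost_Suc_shift by (simp add: \<alpha>_def ad)
  have \<psi>c: "\<psi> c = 1 / c ^ n"
    unfolding \<psi>_def sum.atMost_Suc_shift by (simp add: \<alpha>_def K_def)
  have der: "(\<psi> has_field_derivative g x) (at x)" for x
    unfolding \<psi>_def \<psi>'[symmetric] by (intro DERIV_sum DERIV_cmult) (auto intro!: derivative_eq_intros)
  have "\<bar>\<psi> x - 1 / x ^ n\<bar> \<le> \<epsilon>" if x: "x \<in> {c..C}" for x
  proof -
    have "norm ((\<psi> x - 1 / x ^ n) - (\<psi> c - 1 / c ^ n)) \<le> \<delta> * norm (x - c)"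
    proof (rule field_differentiable_bound[where S = "{c..C}" and f' = "\<lambda>x. g x + real n / x ^ Suc n"])
      fix z assume z: "z \<in> {c..C}"
      then have "z > 0" using c by simp
      then have "((\<lambda>x. 1 / x ^ n) has_field_derivative - (real n / z ^ Suc n)) (at z)"
      proof (cases n)
        case (Suc m)
        have "((\<lambda>x. x ^ n) has_field_derivative real n * z ^ m) (at z)"
          using DERIV_pow[of n z] Suc by simp
        from DERIV_divide[OF DERIV_const[of 1] this]
        have "((\<lambda>x. 1 / x ^ n) has_field_derivative (0 * z ^ n - 1 * (real n * z ^ m)) / (z ^ n * z ^ n)) (at z)"
          using \<open>z > 0\<close> by simp
        also have "(0 * z ^ n - 1 * (real n * z ^ m)) / (z ^ n * z ^ n) = - (real n / z ^ Suc n)"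
          using \<open>z > 0\<close> Suc by (simp add: field_simps)
        finally show ?thesis .
      qed auto
      from has_field_derivative_at_within[OF DERIV_diff[OF der this]]
      show "((\<lambda>x. \<psi> x - 1 / x ^ n) has_field_derivative g z + real n / z ^ Suc n) (at z within {c..C})"
        by (simp only: diff_minus_eq_add)
      show "norm (g z + real n / z ^ Suc n) \<le> \<delta>"
        using g(2)[OF z] by simp
    qed (use x c in auto)
    also have "\<dots> \<le> \<delta> * (C - c)" using x \<delta> by (intro mult_left_mono) auto
    finally show ?thesis using \<psi>c \<delta>(3) by simp
  qed
  moreover have "\<bar>g x + real n / x ^ Suc n\<bar> \<le> \<epsilon>" if "x \<in> {c..C}" for x
    using g(2)[OF that] \<delta>(2) by linarith
  ultimately show ?thesis
    using that[of \<alpha> "Suc d"] unfolding \<psi>_def \<psi>' by blast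
qed

context random_atoms
begin

lemma integral_N_perm:
  assumes "bij \<tau>" "\<Phi> \<in> borel_measurable N"
  shows "(\<integral>z. \<Phi> (fst z, snd z \<circ> \<tau>) \<partial>N) = (\<integral>z. \<Phi> z \<partial>N :: real)"
proof -
  have m: "(\<lambda>z. (fst z, snd z \<circ> \<tau>)) \<in> N \<rightarrow>\<^sub>M N"
  proof (rule measurable_Pair)
    show "(\<lambda>z. snd z \<circ> \<tau>) \<in> N \<rightarrow>\<^sub>M unifs"
      by (rule measurable_PiM_single') (auto simp: space_PiM)
  qed simp
  show ?thesis
    using integral_distr[OF m assms(2)] by (simp add: distr_N_perm[OF assms(1)])
qed

definition indep_from :: "nat \<Rightarrow> ('a \<times> (nat \<Rightarrow> real) \<Rightarrow> 'b) \<Rightarrow> bool" where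
  "indep_from n G \<longleftrightarrow> (\<forall>m\<ge>n. \<forall>z x. G (fst z, (snd z)(m := x)) = G z)"

lemma indep_from_R: "i < n \<Longrightarrow> j < n \<Longrightarrow> indep_from n (\<lambda>z. R z i j)"
  by (auto simp: indep_from_def R_def lab_update)

lemma indep_from_RN: "indep_from n (RN n)"
  by (auto simp: indep_from_def RN_def R_def lab_update fun_eq_iff restrict_def)

text \<open>Given the atoms and the first \<open>n\<close> replicas, the further ones are
  independent, so the average of a product over distinct further replicas is the product of the
  averages.\<close>

lemma integral_peel_prod:
  assumes "G \<in> borel_measurable N" "\<And>z. z \<in> space N \<Longrightarrow> \<bar>G z\<bar> \<le> B" "indep_from n G"
    and \<phi>: "\<And>c j. (\<lambda>z. \<phi> c z j) \<in> borel_measurable N" "\<And>c z j. z \<in> space N \<Longrightarrow> \<bar>\<phi> c z j\<bar> \<le> C"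
      "\<And>c. indep_from n (\<phi> c)"
  shows "(\<integral>z. G z * (\<Prod>c<k. \<phi> c z (lab z (n + c))) \<partial>N) = (\<integral>z. G z * (\<Prod>c<k. savg (w (fst z)) (\<phi> c z)) \<partial>N)"
  using assms(1-3)
proof (induction k arbitrary: G B)
  case (Suc k)
  note [measurable] = Suc.prems(1) \<phi>(1)
  have l[measurable]: "(\<lambda>z. \<phi> c z (lab z (n + c))) \<in> borel_measurable N" for c
    by (rule measurable_compose_countable[OF \<phi>(1) measurable_lab])
  have s[measurable]: "(\<lambda>z. savg (w (fst z)) (\<phi> c z)) \<in> borel_measurable N" for c
    by (rule measurable_savg[OF \<phi>(1)])
  have up: "w (fst (fst z, u)) = w (fst z)" for z u by simp
  have "(\<integral>z. G z * (\<Prod>c<Suc k. \<phi> c z (lab z (n + c))) \<partial>N) =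
    (\<integral>z. (G z * (\<Prod>c<k. \<phi> c z (lab z (n + c)))) * \<phi> k z (lab z (n + k)) \<partial>N)"
    by (simp add: mult_ac)
  also have "\<dots> = (\<integral>z. (G z * (\<Prod>c<k. \<phi> c z (lab z (n + c)))) * savg (w (fst z)) (\<phi> k z) \<partial>N)"
  proof (rule integral_peel[where B = "B * C ^ k" and C = C])
    show "\<bar>G z * (\<Prod>c<k. \<phi> c z (lab z (n + c)))\<bar> \<le> B * C ^ k" if z: "z \<in> space N" for z
    proof -
      have "(\<Prod>c<k. \<bar>\<phi> c z (lab z (n + c))\<bar>) \<le> (\<Prod>c<k. C)"
        using \<phi>(2)[OF z] by (intro prod_mono) auto
      then show ?thesis
        unfolding abs_mult abs_prod using Suc.prems(2)[OF z]
        by (intro mult_mono) (auto intro: prod_nonneg order_trans[OF abs_ge_zero])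
    qed
    show "G (fst z, (snd z)(n + k := x)) * (\<Prod>c<k. \<phi> c (fst z, (snd z)(n + k := x)) (lab (fst z, (snd z)(n + k := x)) (n + c))) =
      G z * (\<Prod>c<k. \<phi> c z (lab z (n + c)))" for z x
      using Suc.prems(3) \<phi>(3) by (intro arg_cong2[where f = "(*)"] prod.cong) (auto simp: indep_from_def lab_update)
    show "\<phi> k (fst z, (snd z)(n + k := x)) j = \<phi> k z j" for z x j
      using \<phi>(3)[of k] by (auto simp: indep_from_def)
  qed (use \<phi> in auto)
  also have "\<dots> = (\<integral>z. (G z * savg (w (fst z)) (\<phi> k z)) * (\<Prod>c<k. \<phi> c z (lab z (n + c))) \<partial>N)"
    by (simp add: mult_ac)
  also have "\<dots> = (\<integral>z. (G z * savg (w (fst z)) (\<phi> k z)) * (\<Prod>c<k. savg (w (fst z)) (\<phi> c z)) \<partial>N)"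
  proof (rule Suc.IH)
    show "\<bar>G z * savg (w (fst z)) (\<phi> k z)\<bar> \<le> B * C" if z: "z \<in> space N" for z
    proof -
      have "\<bar>savg (w (fst z)) (\<phi> k z)\<bar> \<le> C"
        by (rule savg_abs_le) (rule \<phi>(2)[OF z])
      then show ?thesis
        unfolding abs_mult using Suc.prems(2)[OF z]
        by (intro mult_mono) (auto intro: order_trans[OF abs_ge_zero])
    qed
    show "indep_from n (\<lambda>z. G z * savg (w (fst z)) (\<phi> k z))"
      using Suc.prems(3) \<phi>(3) by (simp add: indep_from_def)
  qed measurable
  finally show ?case by (simp add: mult_ac)
qed simp

definition mom :: "nat \<Rightarrow> real" where
  "mom p = (\<integral>z. R z 0 1 ^ p \<partial>N)"

lemma mean_bracket_overlap_power: "mean_bracket M w \<xi> 2 (\<lambda>\<sigma>. overlap \<sigma> 0 1 ^ p) = mom p"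
proof -
  have "mean_bracket M w \<xi> 2 (\<lambda>\<sigma>. overlap \<sigma> 0 1 ^ p) = (\<integral>z. overlap (\<lambda>k. \<xi> (fst z) (lab z k)) 0 1 ^ p \<partial>N)"
    by (rule mean_bracket_eq[where B = 1]) (auto simp: overlap_def intro: Q_power_abs_le_1)
  then show ?thesis by (simp add: mom_def R_def overlap_def)
qed

lemma overlaps_eq_RN: "overlaps n (\<lambda>k. \<xi> (fst z) (lab z k)) = RN n z"
  by (simp add: overlaps_def RN_def R_def overlap_def)

lemma measurable_overlaps: "(\<lambda>\<omega>. overlaps n (\<lambda>k. \<xi> \<omega> (l k))) \<in> M \<rightarrow>\<^sub>M Pi\<^sub>M ({..<n} \<times> {..<n}) (\<lambda>_. borel)"
  unfolding overlaps_def overlap_def by (rule measurable_restrict) (auto split: prod.split)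

lemma overlaps_cong: "(\<And>k. k < n \<Longrightarrow> \<sigma> k = \<sigma>' k) \<Longrightarrow> overlaps n \<sigma> = overlaps n \<sigma>'"
  by (auto simp: overlaps_def overlap_def intro!: restrict_ext)

lemma mean_bracket_overlaps:
  assumes f[measurable]: "f \<in> borel_measurable (Pi\<^sub>M ({..<n} \<times> {..<n}) (\<lambda>_. borel))" and B: "\<And>R. \<bar>f R\<bar> \<le> B"
  shows "mean_bracket M w \<xi> n (\<lambda>\<sigma>. f (overlaps n \<sigma>)) = (\<integral>z. f (RN n z) \<partial>N)"
    and "l < n' \<Longrightarrow> n \<le> n' \<Longrightarrow> 0 < n' \<Longrightarrow> mean_bracket M w \<xi> n' (\<lambda>\<sigma>. f (overlaps n \<sigma>) * overlap \<sigma> 0 l ^ p) = (\<integral>z. f (RN n z) * R z 0 l ^ p \<partial>N)"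
proof -
  note [measurable] = measurable_overlaps
  have "mean_bracket M w \<xi> n (\<lambda>\<sigma>. f (overlaps n \<sigma>)) = (\<integral>z. f (overlaps n (\<lambda>k. \<xi> (fst z) (lab z k))) \<partial>N)"
    by (rule mean_bracket_eq[where B = B]) (auto intro: B overlaps_cong arg_cong[where f = f])
  then show "mean_bracket M w \<xi> n (\<lambda>\<sigma>. f (overlaps n \<sigma>)) = (\<integral>z. f (RN n z) \<partial>N)"
    by (simp add: overlaps_eq_RN)
  assume ln: "l < n'" "n \<le> n'" "0 < n'"
  have "mean_bracket M w \<xi> n' (\<lambda>\<sigma>. f (overlaps n \<sigma>) * overlap \<sigma> 0 l ^ p) =
    (\<integral>z. f (overlaps n (\<lambda>k. \<xi> (fst z) (lab z k))) * overlap (\<lambda>k. \<xi> (fst z) (lab z k)) 0 l ^ p \<partial>N)"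
  proof (rule mean_bracket_eq[where B = "B * 1"])
    show "(\<lambda>\<omega>. f (overlaps n (\<lambda>k. \<xi> \<omega> (la k))) * overlap (\<lambda>k. \<xi> \<omega> (la k)) 0 l ^ p) \<in> borel_measurable M" for la
      unfolding overlap_def by measurable
    show "\<bar>f (overlaps n (\<lambda>k. \<xi> \<omega> (la k))) * overlap (\<lambda>k. \<xi> \<omega> (la k)) 0 l ^ p\<bar> \<le> B * 1" if "\<omega> \<in> space M" for \<omega> la
      unfolding abs_mult overlap_def using that B order_trans[OF abs_ge_zero B]
      by (intro mult_mono Q_power_abs_le_1) auto
    show "f (overlaps n \<sigma>) * overlap \<sigma> 0 l ^ p = f (overlaps n \<sigma>') * overlap \<sigma>' 0 l ^ p"
      if "\<And>k. k < n' \<Longrightarrow> \<sigma> k = \<sigma>' k" for \<sigma> \<sigma>'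
      using that ln overlaps_cong[of n \<sigma> \<sigma>'] by (simp add: overlap_def)
  qed
  then show "mean_bracket M w \<xi> n' (\<lambda>\<sigma>. f (overlaps n \<sigma>) * overlap \<sigma> 0 l ^ p) = (\<integral>z. f (RN n z) * R z 0 l ^ p \<partial>N)"
    by (simp add: overlaps_eq_RN) (simp add: R_def overlap_def)
qed

lemma ghirlanda_guerra_iff:
  "ghirlanda_guerra M w \<xi> \<longleftrightarrow> (\<forall>n\<ge>2. \<forall>f \<in> borel_measurable (Pi\<^sub>M ({..<n} \<times> {..<n}) (\<lambda>_. borel)). \<forall>p\<ge>1.
    (\<exists>B. \<forall>R. \<bar>f R\<bar> \<le> B) \<longrightarrow>
    real n * (\<integral>z. f (RN n z) * R z 0 n ^ p \<partial>N) =
      (\<integral>z. f (RN n z) \<partial>N) * mom p + (\<Sum>l=1..<n. \<integral>z. f (RN n z) * R z 0 l ^ p \<partial>N))"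
  unfolding ghirlanda_guerra_def mean_bracket_overlap_power
proof (intro all_cong ball_cong refl imp_cong)
  fix n :: nat and f :: "(nat \<times> nat \<Rightarrow> real) \<Rightarrow> real" and p :: nat
  assume n: "2 \<le> n" and f: "f \<in> borel_measurable (Pi\<^sub>M ({..<n} \<times> {..<n}) (\<lambda>_. borel))" and "\<exists>B. \<forall>R. \<bar>f R\<bar> \<le> B"
  then obtain B where B: "\<And>R. \<bar>f R\<bar> \<le> B" by blast
  have 1: "mean_bracket M w \<xi> (n + 1) (\<lambda>\<sigma>. f (overlaps n \<sigma>) * overlap \<sigma> 0 n ^ p) = (\<integral>z. f (RN n z) * R z 0 n ^ p \<partial>N)"
    by (rule mean_bracket_overlaps(2)[OF f B]) auto
  have 2: "(\<Sum>l=1..<n. mean_bracket M w \<xi> n (\<lambda>\<sigma>. f (overlaps n \<sigma>) * overlap \<sigma> 0 l ^ p)) = (\<Sum>l=1..<n. \<integral>z. f (RN n z) * R z 0 l ^ p \<partial>N)"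
    using n by (intro sum.cong refl mean_bracket_overlaps(2)[OF f B]) auto
  show "(mean_bracket M w \<xi> (n + 1) (\<lambda>\<sigma>. f (overlaps n \<sigma>) * overlap \<sigma> 0 n ^ p) =
      1 / real n * mean_bracket M w \<xi> n (\<lambda>\<sigma>. f (overlaps n \<sigma>)) * mom p +
      1 / real n * (\<Sum>l=1..<n. mean_bracket M w \<xi> n (\<lambda>\<sigma>. f (overlaps n \<sigma>) * overlap \<sigma> 0 l ^ p))) \<longleftrightarrow>
    (real n * (\<integral>z. f (RN n z) * R z 0 n ^ p \<partial>N) =
      (\<integral>z. f (RN n z) \<partial>N) * mom p + (\<Sum>l=1..<n. \<integral>z. f (RN n z) * R z 0 l ^ p \<partial>N))"
    unfolding 1 2 mean_bracket_overlaps(1)[OF f B] using n by (auto simp: field_simps)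
qed

text \<open>Replicas are exchangeable, so the distinguished replica 0 of the definition can be any
  \<open>i < n\<close>. The bound on \<open>f\<close> is required only on arrays of actual
  overlaps.\<close>

lemma ghirlanda_guerra_N:
  assumes gg: "ghirlanda_guerra M w \<xi>" and n: "2 \<le> n" "i < n" "1 \<le> p"
    and f: "f \<in> borel_measurable (Pi\<^sub>M ({..<n} \<times> {..<n}) (\<lambda>_. borel))"
    and B: "\<And>z. z \<in> space N \<Longrightarrow> \<bar>f (RN n z)\<bar> \<le> B"
  shows "real n * (\<integral>z. f (RN n z) * R z i n ^ p \<partial>N) =
      (\<integral>z. f (RN n z) \<partial>N) * mom p + (\<Sum>l\<in>{..<n} - {i}. \<integral>z. f (RN n z) * R z i l ^ p \<partial>N)"
proof -
  define \<tau> where "\<tau> = Transposition.transpose 0 i"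
  have \<tau>: "bij \<tau>" "\<tau> n = n" "\<tau> i = 0" "\<tau> 0 = i" "\<And>k. k < n \<Longrightarrow> \<tau> k < n" "\<And>k. \<tau> (\<tau> k) = k"
    using n by (auto simp: \<tau>_def Transposition.transpose_def)
  \<comment> \<open>The truncation supplies the global bound that the definition of the identities
    asks for, and changes nothing on actual overlaps. Exponentials of overlaps, used as test
    functions later, are unbounded on the space of all arrays.\<close>
  define g where "g r = max (- \<bar>B\<bar>) (min \<bar>B\<bar> (f (\<lambda>(a, b) \<in> {..<n} \<times> {..<n}. r (\<tau> a, \<tau> b))))" for r
  have g[measurable]: "g \<in> borel_measurable (Pi\<^sub>M ({..<n} \<times> {..<n}) (\<lambda>_. borel))"
  proof -
    have "(\<lambda>r. (\<lambda>(a, b) \<in> {..<n} \<times> {..<n}. r (\<tau> a, \<tau> b))) \<in> Pi\<^sub>M ({..<n} \<times> {..<n}) (\<lambda>_. borel) \<rightarrow>\<^sub>M Pi\<^sub>M ({..<n} \<times> {..<n}) (\<lambda>_. borel :: real measure)"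
      by (rule measurable_restrict) (use \<tau> in \<open>auto split: prod.split intro!: measurable_component_singleton\<close>)
    then show ?thesis
      unfolding g_def using measurable_compose[OF _ f] by measurable
  qed
  have gB: "\<bar>g r\<bar> \<le> \<bar>B\<bar>" for r by (auto simp: g_def)
  have g_eq: "g (RN n z) = f (RN n (fst z, snd z \<circ> \<tau>))" if "z \<in> space N" for z
  proof -
    have "(\<lambda>(a, b) \<in> {..<n} \<times> {..<n}. RN n z (\<tau> a, \<tau> b)) = RN n (fst z, snd z \<circ> \<tau>)"
      using \<tau> by (auto simp: RN_def R_perm fun_eq_iff restrict_def)
    moreover have "(fst z, snd z \<circ> \<tau>) \<in> space N" using that by (auto simp: space_pair_measure space_PiM)
    ultimately show ?thesis using B[of "(fst z, snd z \<circ> \<tau>)"] by (simp add: g_def abs_le_iff)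
  qed
  note [measurable] = f
  have r: "(\<integral>z. g (RN n z) * R z 0 l ^ p \<partial>N) = (\<integral>z. f (RN n z) * R z i (\<tau> l) ^ p \<partial>N)" for l
  proof -
    have "(\<integral>z. g (RN n z) * R z 0 l ^ p \<partial>N) =
      (\<integral>z. f (RN n (fst z, snd z \<circ> \<tau>)) * R (fst z, snd z \<circ> \<tau>) i (\<tau> l) ^ p \<partial>N)"
      using \<tau> by (intro Bochner_Integration.integral_cong refl) (simp add: g_eq R_perm)
    also have "\<dots> = (\<integral>z. f (RN n z) * R z i (\<tau> l) ^ p \<partial>N)"
      by (rule integral_N_perm[OF \<tau>(1), of "\<lambda>z. f (RN n z) * R z i (\<tau> l) ^ p"]) measurable
    finally show ?thesis .
  qed
  have r0: "(\<integral>z. g (RN n z) \<partial>N) = (\<integral>z. f (RN n z) \<partial>N)"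
  proof -
    have "(\<integral>z. g (RN n z) \<partial>N) = (\<integral>z. f (RN n (fst z, snd z \<circ> \<tau>)) \<partial>N)"
      by (intro Bochner_Integration.integral_cong refl) (simp add: g_eq)
    also have "\<dots> = (\<integral>z. f (RN n z) \<partial>N)"
      by (rule integral_N_perm[OF \<tau>(1), of "\<lambda>z. f (RN n z)"]) measurable
    finally show ?thesis .
  qed
  have "real n * (\<integral>z. g (RN n z) * R z 0 n ^ p \<partial>N) =
      (\<integral>z. g (RN n z) \<partial>N) * mom p + (\<Sum>l=1..<n. \<integral>z. g (RN n z) * R z 0 l ^ p \<partial>N)"
    using gg n g gB unfolding ghirlanda_guerra_iff by blast
  also have "(\<Sum>l=1..<n. \<integral>z. g (RN n z) * R z 0 l ^ p \<partial>N) = (\<Sum>l\<in>{..<n} - {i}. \<integral>z. f (RN n z) * R z i l ^ p \<partial>N)"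
    unfolding r
  proof (rule sum.reindex_bij_witness[where i = \<tau> and j = \<tau>])
    show "\<tau> b \<in> {1..<n}" if "b \<in> {..<n} - {i}" for b
      using that \<tau>(4) \<tau>(5)[of b] \<tau>(6)[of b] by (cases "\<tau> b") auto
    show "\<tau> l \<in> {..<n} - {i}" if "l \<in> {1..<n}" for l
    proof -
      have "\<tau> l \<noteq> i"
      proof
        assume "\<tau> l = i"
        then have "l = \<tau> i" using \<tau>(6)[of l] by simp
        then show False using \<tau>(3) that by simp
      qed
      then show ?thesis using that \<tau>(5)[of l] by simp
    qed
  qed (use \<tau>(6) in auto)
  finally show ?thesis unfolding r r0 \<tau>(2) .
qed

end

section \<open>Constancy of the tilted averages\<close>

context random_atoms
begin

lemma savg_w_sums:
  assumes "\<omega> \<in> space M" "\<And>l. \<bar>f l\<bar> \<le> B"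
  shows "(\<lambda>l. w \<omega> l * f l) sums savg (w \<omega>) f"
  by (rule savg_sums) (use assms w_nonneg w_sums in auto)

lemma savg_bounds:
  assumes z: "\<omega> \<in> space M" and f: "\<And>l. a \<le> f l" "\<And>l. f l \<le> b"
  shows "a \<le> savg (w \<omega>) f" "savg (w \<omega>) f \<le> b"
proof -
  have "\<bar>f l\<bar> \<le> max \<bar>a\<bar> \<bar>b\<bar>" for l using f[of l] by (auto simp: abs_le_iff)
  then have s: "(\<lambda>l. w \<omega> l * f l) sums savg (w \<omega>) f" by (rule savg_w_sums[OF z])
  have a: "(\<lambda>l. w \<omega> l * a) sums a" "(\<lambda>l. w \<omega> l * b) sums b"
    using sums_mult2[OF w_sums[OF z], of a] sums_mult2[OF w_sums[OF z], of b] by simp_all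
  show "a \<le> savg (w \<omega>) f" "savg (w \<omega>) f \<le> b"
    by (rule sums_le[OF _ a(1) s] sums_le[OF _ s a(2)], intro mult_left_mono f w_nonneg[OF z])+
qed

section \<open>The identities for the denominator of the tilting factor\<close>

context
  fixes n i p :: nat and s :: "nat \<Rightarrow> real"
begin

definition gibbs :: "'a \<times> (nat \<Rightarrow> real) \<Rightarrow> nat \<Rightarrow> real" where
  "gibbs z j = exp (\<Sum>a<n. s a * Q (fst z) (lab z a) j ^ p)"

definition covi :: "'a \<times> (nat \<Rightarrow> real) \<Rightarrow> nat \<Rightarrow> real" where
  "covi z j = Q (fst z) (lab z i) j ^ p"

definition gbd where "gbd = exp (\<Sum>a<n. \<bar>s a\<bar>)"

lemma gbd_ge_1: "1 \<le> gbd" by (simp add: gbd_def sum_nonneg)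

lemma gibbs_bounds:
  assumes "z \<in> space N"
  shows "1 / gbd \<le> gibbs z j" "gibbs z j \<le> gbd" "\<bar>gibbs z j\<bar> \<le> gbd"
proof -
  have "\<bar>\<Sum>a<n. s a * Q (fst z) (lab z a) j ^ p\<bar> \<le> (\<Sum>a<n. \<bar>s a\<bar>)"
    using Q_power_abs_le_1[OF space_N_fst[OF assms]]
    by (intro order_trans[OF sum_abs] sum_mono) (auto simp: abs_mult intro!: mult_left_le)
  then have "- (\<Sum>a<n. \<bar>s a\<bar>) \<le> (\<Sum>a<n. s a * Q (fst z) (lab z a) j ^ p)" "(\<Sum>a<n. s a * Q (fst z) (lab z a) j ^ p) \<le> (\<Sum>a<n. \<bar>s a\<bar>)"
    by linarith+
  then show "1 / gbd \<le> gibbs z j" "gibbs z j \<le> gbd"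
    by (simp_all add: gibbs_def gbd_def exp_minus[symmetric] divide_inverse del: exp_minus)
  then show "\<bar>gibbs z j\<bar> \<le> gbd" by (simp add: gibbs_def)
qed

lemma covi_bound: "z \<in> space N \<Longrightarrow> \<bar>covi z j\<bar> \<le> 1"
  unfolding covi_def by (intro Q_power_abs_le_1 space_N_fst)

lemma measurable_Q_lab[measurable]: "(\<lambda>z. Q (fst z) (lab z a) j) \<in> borel_measurable N"
  by (rule measurable_compose_countable[OF _ measurable_lab]) measurable

lemma measurable_gibbs[measurable]: "(\<lambda>z. gibbs z j) \<in> borel_measurable N"
  and measurable_covi[measurable]: "(\<lambda>z. covi z j) \<in> borel_measurable N"
  unfolding gibbs_def covi_def by measurable

lemma indep_gibbs: "indep_from n gibbs"
  by (auto simp: indep_from_def gibbs_def[abs_def] lab_update)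

lemma indep_covi: "i < n \<Longrightarrow> indep_from n covi"
  by (auto simp: indep_from_def covi_def[abs_def] lab_update)

text \<open>The base of the denominator of \<open>shift_factor\<close> for the original weights;
  \<open>gcov\<close> is its partial derivative in \<open>s i\<close>, and \<open>cav\<close> is the
  value of \<open>gcov\<close> at \<open>s = 0\<close>.\<close>

definition gav where "gav z = savg (w (fst z)) (gibbs z)"
definition gcov where "gcov z = savg (w (fst z)) (\<lambda>j. gibbs z j * covi z j)"
definition cav where "cav z = savg (w (fst z)) (covi z)"
text \<open>In these terms the identity for replica \<open>i\<close> says that \<open>ggr\<close>
  and \<open>n * cav\<close> have the same mean against every test function of the first
  \<open>n\<close> overlaps.\<close>

definition ggr where "ggr z = (\<Sum>l\<in>{..<n} - {i}. R z i l ^ p) + mom p"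

lemma measurable_gav[measurable]:
  "gav \<in> borel_measurable N" "gcov \<in> borel_measurable N" "cav \<in> borel_measurable N" "ggr \<in> borel_measurable N"
  unfolding gav_def[abs_def] gcov_def[abs_def] cav_def[abs_def] ggr_def[abs_def] by measurable

lemma gav_bounds:
  assumes "z \<in> space N"
  shows "gav z \<in> {1 / gbd..gbd}" "\<bar>gcov z\<bar> \<le> gbd" "\<bar>cav z\<bar> \<le> 1"
proof -
  show "gav z \<in> {1 / gbd..gbd}"
    unfolding gav_def using savg_bounds[OF space_N_fst[OF assms] gibbs_bounds(1,2)[OF assms]] by simp
  show "\<bar>gcov z\<bar> \<le> gbd"
    unfolding gcov_def
  proof (rule savg_abs_le)
    show "\<bar>gibbs z j * covi z j\<bar> \<le> gbd" for j
      unfolding abs_mult using mult_mono[OF gibbs_bounds(3)[OF assms] covi_bound[OF assms]] gbd_ge_1 by simp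
  qed
  show "\<bar>cav z\<bar> \<le> 1"
    unfolding cav_def by (rule savg_abs_le) (rule covi_bound[OF assms])
qed

lemma mom_bound: "\<bar>mom p\<bar> \<le> 1"
proof -
  have "\<bar>mom p\<bar> \<le> (\<integral>z. \<bar>R z 0 1 ^ p\<bar> \<partial>N)"
    unfolding mom_def using integral_norm_bound[of N "\<lambda>z. R z 0 1 ^ p"] by simp
  also have "\<dots> \<le> (\<integral>z. 1 \<partial>N)"
    by (intro Bochner_Integration.integral_mono integrable_N_bounded[where B = 1]) (auto intro: R_power_abs_le_1)
  finally show ?thesis by (simp add: MN.P.prob_space)
qed

lemma ggr_bound: assumes n: "i < n" and "z \<in> space N" shows "\<bar>ggr z\<bar> \<le> real n"
proof -
  have "\<bar>ggr z\<bar> \<le> \<bar>\<Sum>l\<in>{..<n} - {i}. R z i l ^ p\<bar> + 1"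
    using mom_bound by (auto simp: ggr_def)
  also have "\<bar>\<Sum>l\<in>{..<n} - {i}. R z i l ^ p\<bar> \<le> (\<Sum>l\<in>{..<n} - {i}. 1)"
    by (intro order_trans[OF sum_abs] sum_mono R_power_abs_le_1[OF assms(2)])
  finally show ?thesis using n by (simp add: of_nat_diff)
qed

lemma gav_pow_bound:
  assumes z: "z \<in> space N"
  shows "\<bar>gav z ^ k\<bar> \<le> gbd ^ k"
  unfolding power_abs using gav_bounds(1)[OF z] gbd_ge_1 order_trans[of 0 "1 / gbd" "gav z"]
  by (intro power_mono) auto

lemma gav_pos: "z \<in> space N \<Longrightarrow> 0 < gav z"
  using gav_bounds(1) gbd_ge_1 less_le_trans[of 0 "1 / gbd" "gav z"] by auto

context
  fixes f :: "(nat \<times> nat \<Rightarrow> real) \<Rightarrow> real" and B :: real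
  assumes gg: "ghirlanda_guerra M w \<xi>" and n: "2 \<le> n" "i < n" "1 \<le> p"
    and f[measurable]: "f \<in> borel_measurable (Pi\<^sub>M ({..<n} \<times> {..<n}) (\<lambda>_. borel))"
    and B: "\<And>z. z \<in> space N \<Longrightarrow> \<bar>f (RN n z)\<bar> \<le> B"
begin

lemma B_nonneg: "0 \<le> B"
proof -
  obtain z where "z \<in> space N" using MN.P.not_empty by blast
  then show ?thesis using B by (meson abs_ge_zero order_trans)
qed

lemma integrable_f:
  assumes [measurable]: "g \<in> borel_measurable N" and "\<And>z. z \<in> space N \<Longrightarrow> \<bar>g z\<bar> \<le> K"
  shows "integrable N (\<lambda>z. f (RN n z) * g z)"
  by (rule integrable_N_bounded[where B = "B * K"])
    (use assms B B_nonneg in \<open>auto simp: abs_mult intro!: mult_mono\<close>)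

text \<open>The identity is applied with n + k replicas and a test function carrying a factor
  \<open>gibbs\<close> for each of the k additional ones. Averaging these out gives powers of
  \<open>gav\<close>: the new replica yields \<open>cav\<close>, the first \<open>n\<close> replicas
  yield \<open>ggr\<close>, and each of the k additional ones has its factor replaced by
  \<open>gcov\<close>.\<close>

lemma gg_monomial:
  "(\<integral>z. f (RN n z) * (real (n + k) * (gav z ^ k * cav z)) \<partial>N) =
   (\<integral>z. f (RN n z) * (gav z ^ k * ggr z) \<partial>N) + (\<integral>z. f (RN n z) * (real k * gav z ^ (k - 1) * gcov z) \<partial>N)"
proof -
  define g where "g r = f (\<lambda>(a, b) \<in> {..<n} \<times> {..<n}. r (a, b)) *
    (\<Prod>c<k. exp (\<Sum>a<n. s a * r (a, n + c) ^ p))" for r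
  have g[measurable]: "g \<in> borel_measurable (Pi\<^sub>M ({..<n + k} \<times> {..<n + k}) (\<lambda>_. borel))"
  proof -
    have "(\<lambda>r. \<lambda>(a, b) \<in> {..<n} \<times> {..<n}. r (a, b)) \<in> Pi\<^sub>M ({..<n + k} \<times> {..<n + k}) (\<lambda>_. borel) \<rightarrow>\<^sub>M Pi\<^sub>M ({..<n} \<times> {..<n}) (\<lambda>_. borel :: real measure)"
      by (rule measurable_restrict) (auto split: prod.split intro!: measurable_component_singleton)
    then have [measurable]: "(\<lambda>r. f (\<lambda>(a, b) \<in> {..<n} \<times> {..<n}. r (a, b))) \<in> borel_measurable (Pi\<^sub>M ({..<n + k} \<times> {..<n + k}) (\<lambda>_. borel))"
      by (rule measurable_compose) (rule f)
    have [measurable]: "(\<lambda>r. \<Prod>c<k. exp (\<Sum>a<n. s a * r (a, n + c) ^ p)) \<in> borel_measurable (Pi\<^sub>M ({..<n + k} \<times> {..<n + k}) (\<lambda>_. borel))"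
      by (intro borel_measurable_prod borel_measurable_exp[THEN measurable_compose_rev] borel_measurable_sum
          borel_measurable_times borel_measurable_const borel_measurable_power measurable_component_singleton) auto
    show ?thesis unfolding g_def by measurable
  qed
  have g_eq: "g (RN (n + k) z) = f (RN n z) * (\<Prod>c<k. gibbs z (lab z (n + c)))" for z
  proof -
    have "(\<lambda>(a, b) \<in> {..<n} \<times> {..<n}. RN (n + k) z (a, b)) = RN n z"
      by (auto simp: RN_def fun_eq_iff restrict_def)
    moreover have "RN (n + k) z (a, n + c) = Q (fst z) (lab z a) (lab z (n + c))" if "a < n" "c < k" for a c
      using that by (simp add: RN_def R_def)
    ultimately show ?thesis
      by (simp add: g_def gibbs_def)
  qed
  have exk: "\<bar>\<Prod>c<k. gibbs z (lab z (n + c))\<bar> \<le> gbd ^ k" if z: "z \<in> space N" for z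
  proof -
    have "(\<Prod>c<k. \<bar>gibbs z (lab z (n + c))\<bar>) \<le> (\<Prod>c<k. gbd)"
      using gibbs_bounds(3)[OF z] by (intro prod_mono) auto
    then show ?thesis by (simp add: abs_prod)
  qed
  have gB: "\<bar>g (RN (n + k) z)\<bar> \<le> B * gbd ^ k" if z: "z \<in> space N" for z
    unfolding g_eq abs_mult using B[OF z] exk[OF z] B_nonneg by (intro mult_mono) auto
  have exl[measurable]: "(\<lambda>z. gibbs z (lab z m)) \<in> borel_measurable N" for m
    by (rule measurable_compose_countable[OF measurable_gibbs measurable_lab])
  have GG: "real (n + k) * (\<integral>z. g (RN (n + k) z) * R z i (n + k) ^ p \<partial>N) =
      (\<integral>z. g (RN (n + k) z) \<partial>N) * mom p + (\<Sum>l\<in>{..<n + k} - {i}. \<integral>z. g (RN (n + k) z) * R z i l ^ p \<partial>N)"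
    using n by (intro ghirlanda_guerra_N[OF gg _ _ _ g gB]) auto
  have P: "(\<integral>z. f (RN n z) * h z * (\<Prod>c<k'. \<phi> c z (lab z (n + c))) \<partial>N) =
      (\<integral>z. f (RN n z) * h z * (\<Prod>c<k'. savg (w (fst z)) (\<phi> c z)) \<partial>N)"
    if "\<And>c j. (\<lambda>z. \<phi> c z j) \<in> borel_measurable N" "\<And>c z j. z \<in> space N \<Longrightarrow> \<bar>\<phi> c z j\<bar> \<le> gbd" "\<And>c. indep_from n (\<phi> c)"
      "h \<in> borel_measurable N" "\<And>z. z \<in> space N \<Longrightarrow> \<bar>h z\<bar> \<le> 1" "indep_from n h"
    for \<phi> h k'
  proof (rule integral_peel_prod[where B = "B * 1" and C = gbd])
    show "\<bar>f (RN n z) * h z\<bar> \<le> B * 1" if "z \<in> space N" for z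
      unfolding abs_mult using \<open>\<And>z. z \<in> space N \<Longrightarrow> \<bar>h z\<bar> \<le> 1\<close>[OF that] B[OF that] B_nonneg by (intro mult_mono) auto
    show "indep_from n (\<lambda>z. f (RN n z) * h z)"
      using \<open>indep_from n h\<close> indep_from_RN[of n] by (simp add: indep_from_def)
  qed (use that in auto)
  have one: "\<bar>1 :: real\<bar> \<le> 1" "indep_from n (\<lambda>_. 1 :: real)" by (auto simp: indep_from_def)
  have Rl: "R z i m = Q (fst z) (lab z i) (lab z m)" for z m by (simp add: R_def)
  have t1: "(\<integral>z. g (RN (n + k) z) * R z i (n + k) ^ p \<partial>N) = (\<integral>z. f (RN n z) * (gav z ^ k * cav z) \<partial>N)"
  proof -
    define \<phi> where "\<phi> c = (if c < k then gibbs else covi)" for c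
    have "(\<integral>z. g (RN (n + k) z) * R z i (n + k) ^ p \<partial>N) = (\<integral>z. f (RN n z) * 1 * (\<Prod>c<Suc k. \<phi> c z (lab z (n + c))) \<partial>N)"
      by (simp add: g_eq \<phi>_def covi_def Rl mult.assoc)
    also have "\<dots> = (\<integral>z. f (RN n z) * 1 * (\<Prod>c<Suc k. savg (w (fst z)) (\<phi> c z)) \<partial>N)"
    proof (rule P)
      show "\<bar>\<phi> c z j\<bar> \<le> gbd" if "z \<in> space N" for c z j
        using gibbs_bounds(3)[OF that, of j] order_trans[OF covi_bound[OF that] gbd_ge_1, of j] by (simp add: \<phi>_def)
    qed (use one indep_gibbs indep_covi[OF n(2)] in \<open>auto simp: \<phi>_def\<close>)
    also have "\<dots> = (\<integral>z. f (RN n z) * (gav z ^ k * cav z) \<partial>N)"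
      by (simp add: \<phi>_def gav_def cav_def mult.assoc)
    finally show ?thesis .
  qed
  have t2: "(\<integral>z. g (RN (n + k) z) \<partial>N) = (\<integral>z. f (RN n z) * gav z ^ k \<partial>N)"
  proof -
    have "(\<integral>z. g (RN (n + k) z) \<partial>N) = (\<integral>z. f (RN n z) * 1 * (\<Prod>c<k. gibbs z (lab z (n + c))) \<partial>N)"
      by (simp add: g_eq)
    also have "\<dots> = (\<integral>z. f (RN n z) * 1 * (\<Prod>c<k. savg (w (fst z)) (gibbs z)) \<partial>N)"
      by (rule P) (use one gibbs_bounds indep_gibbs in auto)
    finally show ?thesis by (simp add: gav_def)
  qed
  have t3: "(\<integral>z. g (RN (n + k) z) * R z i l ^ p \<partial>N) = (\<integral>z. f (RN n z) * (gav z ^ k * R z i l ^ p) \<partial>N)"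
    if l: "l < n" for l
  proof -
    have "(\<integral>z. g (RN (n + k) z) * R z i l ^ p \<partial>N) = (\<integral>z. f (RN n z) * R z i l ^ p * (\<Prod>c<k. gibbs z (lab z (n + c))) \<partial>N)"
      by (simp add: g_eq mult_ac)
    also have "\<dots> = (\<integral>z. f (RN n z) * R z i l ^ p * (\<Prod>c<k. savg (w (fst z)) (gibbs z)) \<partial>N)"
      by (rule P) (use one gibbs_bounds indep_gibbs indep_from_R[OF n(2) l] R_power_abs_le_1 in \<open>auto simp: indep_from_def\<close>)
    finally show ?thesis by (simp add: gav_def mult_ac)
  qed
  have t4: "(\<integral>z. g (RN (n + k) z) * R z i (n + c0) ^ p \<partial>N) = (\<integral>z. f (RN n z) * (gav z ^ (k - 1) * gcov z) \<partial>N)"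
    if c0: "c0 < k" for c0
  proof -
    define \<phi> where "\<phi> c = (if c = c0 then (\<lambda>z j. gibbs z j * covi z j) else gibbs)" for c
    have prod: "(\<Prod>c<k. u c) = u c0 * (\<Prod>c\<in>{..<k} - {c0}. u c)" for u :: "nat \<Rightarrow> real"
      using c0 by (simp add: prod.remove)
    have "(\<integral>z. g (RN (n + k) z) * R z i (n + c0) ^ p \<partial>N) = (\<integral>z. f (RN n z) * 1 * (\<Prod>c<k. \<phi> c z (lab z (n + c))) \<partial>N)"
      unfolding g_eq prod by (simp add: \<phi>_def covi_def Rl mult_ac)
    also have "\<dots> = (\<integral>z. f (RN n z) * 1 * (\<Prod>c<k. savg (w (fst z)) (\<phi> c z)) \<partial>N)"
    proof (rule P)
      show "\<bar>\<phi> c z j\<bar> \<le> gbd" if "z \<in> space N" for c z j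
        using gibbs_bounds(3)[OF that] mult_mono[OF gibbs_bounds(3)[OF that] covi_bound[OF that], of j j] gbd_ge_1
        by (auto simp: \<phi>_def abs_mult)
    qed (use one indep_gibbs indep_covi[OF n(2)] in \<open>auto simp: \<phi>_def indep_from_def\<close>)
    also have "\<dots> = (\<integral>z. f (RN n z) * (gav z ^ (k - 1) * gcov z) \<partial>N)"
      unfolding prod using c0 by (simp add: \<phi>_def gav_def gcov_def mult_ac card_Diff_singleton)
    finally show ?thesis .
  qed
  have split: "{..<n + k} - {i} = ({..<n} - {i}) \<union> (\<lambda>c. n + c) ` {..<k}"
  proof -
    have "x \<in> (\<lambda>c. n + c) ` {..<k}" if "x < n + k" "\<not> x < n" for x
      using that by (intro image_eqI[of _ _ "x - n"]) auto
    then show ?thesis using n by auto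
  qed
  have "(\<Sum>l\<in>{..<n + k} - {i}. \<integral>z. g (RN (n + k) z) * R z i l ^ p \<partial>N) =
    (\<Sum>l\<in>{..<n} - {i}. \<integral>z. g (RN (n + k) z) * R z i l ^ p \<partial>N) + (\<Sum>c<k. \<integral>z. g (RN (n + k) z) * R z i (n + c) ^ p \<partial>N)"
    unfolding split by (subst sum.union_disjoint) (auto simp: sum.reindex)
  also have "\<dots> = (\<Sum>l\<in>{..<n} - {i}. \<integral>z. f (RN n z) * (gav z ^ k * R z i l ^ p) \<partial>N) + real k * (\<integral>z. f (RN n z) * (gav z ^ (k - 1) * gcov z) \<partial>N)"
    using t3 t4 by simp
  also have "(\<Sum>l\<in>{..<n} - {i}. \<integral>z. f (RN n z) * (gav z ^ k * R z i l ^ p) \<partial>N) =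
    (\<integral>z. (\<Sum>l\<in>{..<n} - {i}. f (RN n z) * (gav z ^ k * R z i l ^ p)) \<partial>N)"
  proof (rule Bochner_Integration.integral_sum[symmetric])
    show "integrable N (\<lambda>z. f (RN n z) * (gav z ^ k * R z i l ^ p))" for l
    proof (rule integrable_f[where K = "gbd ^ k * 1"])
      show "\<bar>gav z ^ k * R z i l ^ p\<bar> \<le> gbd ^ k * 1" if z: "z \<in> space N" for z
        unfolding abs_mult power_abs[of "gav z"]
        using gav_bounds(1)[OF z] gbd_ge_1 order_trans[of 0 "1 / gbd" "gav z"]
        by (intro mult_mono power_mono R_power_abs_le_1[OF z]) auto
    qed measurable
  qed
  finally have sum: "(\<Sum>l\<in>{..<n + k} - {i}. \<integral>z. g (RN (n + k) z) * R z i l ^ p \<partial>N) =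
    (\<integral>z. (\<Sum>l\<in>{..<n} - {i}. f (RN n z) * (gav z ^ k * R z i l ^ p)) \<partial>N) + real k * (\<integral>z. f (RN n z) * (gav z ^ (k - 1) * gcov z) \<partial>N)" .
  have Sk: "\<bar>gav z ^ k\<bar> \<le> gbd ^ k" if z: "z \<in> space N" for z
    unfolding power_abs using gav_bounds(1)[OF z] gbd_ge_1 order_trans[of 0 "1 / gbd" "gav z"] by (intro power_mono) auto
  have i1: "integrable N (\<lambda>z. f (RN n z) * gav z ^ k)"
    by (rule integrable_f[OF _ Sk]) measurable
  have i2: "integrable N (\<lambda>z. \<Sum>l\<in>{..<n} - {i}. f (RN n z) * (gav z ^ k * R z i l ^ p))"
  proof (rule Bochner_Integration.integrable_sum, rule integrable_f[where K = "gbd ^ k * 1"])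
    show "\<bar>gav z ^ k * R z i l ^ p\<bar> \<le> gbd ^ k * 1" if z: "z \<in> space N" for z l
      unfolding abs_mult using Sk[OF z] gbd_ge_1 by (intro mult_mono R_power_abs_le_1[OF z]) auto
  qed measurable
  have "(\<integral>z. f (RN n z) * (gav z ^ k * ggr z) \<partial>N) =
    (\<integral>z. (\<Sum>l\<in>{..<n} - {i}. f (RN n z) * (gav z ^ k * R z i l ^ p)) + mom p * (f (RN n z) * gav z ^ k) \<partial>N)"
    by (simp add: ggr_def distrib_left sum_distrib_left mult_ac)
  also have "\<dots> = (\<integral>z. (\<Sum>l\<in>{..<n} - {i}. f (RN n z) * (gav z ^ k * R z i l ^ p)) \<partial>N) + mom p * (\<integral>z. f (RN n z) * gav z ^ k \<partial>N)"
    using i1 i2 by simp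
  finally have ggr: "(\<integral>z. f (RN n z) * (gav z ^ k * ggr z) \<partial>N) =
    (\<integral>z. (\<Sum>l\<in>{..<n} - {i}. f (RN n z) * (gav z ^ k * R z i l ^ p)) \<partial>N) + mom p * (\<integral>z. f (RN n z) * gav z ^ k \<partial>N)" .
  have "(\<integral>z. f (RN n z) * (real (n + k) * (gav z ^ k * cav z)) \<partial>N) = real (n + k) * (\<integral>z. f (RN n z) * (gav z ^ k * cav z) \<partial>N)"
    by (simp add: mult_ac del: of_nat_add)
  moreover have "(\<integral>z. f (RN n z) * (real k * gav z ^ (k - 1) * gcov z) \<partial>N) = real k * (\<integral>z. f (RN n z) * (gav z ^ (k - 1) * gcov z) \<partial>N)"
    by (simp add: mult_ac)
  ultimately show ?thesis
    using GG unfolding t1 t2 sum ggr by (simp add: mult.commute)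
qed

text \<open>By linearity in the monomials, the identity has the form (n psi + x psi')
  \<open>cav\<close> = psi \<open>ggr\<close> + psi' \<open>gcov\<close> in the mean, for every
  polynomial psi in x = \<open>gav\<close>.\<close>

lemma gg_poly:
  "(\<integral>z. f (RN n z) * ((real n * (\<Sum>k\<le>d. \<alpha> k * gav z ^ k) + gav z * (\<Sum>k\<le>d. \<alpha> k * (real k * gav z ^ (k - 1)))) * cav z
      - (\<Sum>k\<le>d. \<alpha> k * gav z ^ k) * ggr z - (\<Sum>k\<le>d. \<alpha> k * (real k * gav z ^ (k - 1))) * gcov z) \<partial>N) = 0"
proof -
  define u where "u k z = real (n + k) * (gav z ^ k * cav z) - gav z ^ k * ggr z - real k * gav z ^ (k - 1) * gcov z" for k z
  have [measurable]: "u k \<in> borel_measurable N" for k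
    unfolding u_def by measurable
  have i1: "integrable N (\<lambda>z. f (RN n z) * (real (n + k) * (gav z ^ k * cav z)))" for k
  proof (rule integrable_f[where K = "real (n + k) * (gbd ^ k * 1)"])
    show "\<bar>real (n + k) * (gav z ^ k * cav z)\<bar> \<le> real (n + k) * (gbd ^ k * 1)" if z: "z \<in> space N" for z
      unfolding abs_mult using gav_pow_bound[OF z] gav_bounds(3)[OF z] gbd_ge_1 by (intro mult_mono) auto
  qed measurable
  have i2: "integrable N (\<lambda>z. f (RN n z) * (gav z ^ k * ggr z))" for k
  proof (rule integrable_f[where K = "gbd ^ k * real n"])
    show "\<bar>gav z ^ k * ggr z\<bar> \<le> gbd ^ k * real n" if z: "z \<in> space N" for z
      unfolding abs_mult using gav_pow_bound[OF z] ggr_bound[OF n(2) z] gbd_ge_1 by (intro mult_mono) auto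
  qed measurable
  have i3: "integrable N (\<lambda>z. f (RN n z) * (real k * gav z ^ (k - 1) * gcov z))" for k
  proof (rule integrable_f[where K = "real k * gbd ^ (k - 1) * gbd"])
    show "\<bar>real k * gav z ^ (k - 1) * gcov z\<bar> \<le> real k * gbd ^ (k - 1) * gbd" if z: "z \<in> space N" for z
      unfolding abs_mult using gav_pow_bound[OF z] gav_bounds(2)[OF z] gbd_ge_1 by (intro mult_mono) auto
  qed measurable
  have iu: "integrable N (\<lambda>z. f (RN n z) * u k z)" and u0: "(\<integral>z. f (RN n z) * u k z \<partial>N) = 0" for k
    using gg_monomial[of k] i1[of k] i2[of k] i3[of k] by (simp_all add: u_def right_diff_distrib)
  have "(\<integral>z. (\<Sum>k\<le>d. \<alpha> k * (f (RN n z) * u k z)) \<partial>N) = (\<Sum>k\<le>d. \<integral>z. \<alpha> k * (f (RN n z) * u k z) \<partial>N)"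
    using iu by (intro Bochner_Integration.integral_sum) simp
  then have "(\<integral>z. (\<Sum>k\<le>d. \<alpha> k * (f (RN n z) * u k z)) \<partial>N) = 0"
    by (simp add: u0)
  moreover have "(\<Sum>k\<le>d. \<alpha> k * (f (RN n z) * u k z)) = f (RN n z) * ((real n * (\<Sum>k\<le>d. \<alpha> k * gav z ^ k) + gav z * (\<Sum>k\<le>d. \<alpha> k * (real k * gav z ^ (k - 1)))) * cav z
      - (\<Sum>k\<le>d. \<alpha> k * gav z ^ k) * ggr z - (\<Sum>k\<le>d. \<alpha> k * (real k * gav z ^ (k - 1))) * gcov z)" for z
  proof -
    have e: "real (n + k) * (gav z ^ k * cav z) = real n * gav z ^ k * cav z + gav z * (real k * gav z ^ (k - 1)) * cav z" for k
      by (cases k) (auto simp: algebra_simps)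
    have e2: "\<alpha> k * (f (RN n z) * u k z) = f (RN n z) * (real n * (\<alpha> k * gav z ^ k) * cav z + gav z * (\<alpha> k * (real k * gav z ^ (k - 1))) * cav z
        - \<alpha> k * gav z ^ k * ggr z - \<alpha> k * (real k * gav z ^ (k - 1)) * gcov z)" for k
      unfolding u_def e by (simp add: algebra_simps)
    show ?thesis
      by (simp only: e2 sum_distrib_left[symmetric] sum_distrib_right[symmetric] sum.distrib sum_subtractf distrib_right)
  qed
  ultimately show ?thesis by simp
qed

text \<open>For psi(x) = x^-n the coefficient n psi + x psi' of \<open>cav\<close> is zero, so the
  average over a new replica disappears. As \<open>gav\<close> stays in a compact interval away from
  0, this psi and its derivative are uniform limits of polynomials and their derivatives.\<close>

lemma gg_inverse_power:
  "(\<integral>z. f (RN n z) * (real n * gcov z / gav z ^ Suc n - ggr z / gav z ^ n) \<partial>N) = 0"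
proof -
  define h where "h z = real n * gcov z / gav z ^ Suc n - ggr z / gav z ^ n" for z
  have [measurable]: "h \<in> borel_measurable N"
    unfolding h_def by measurable
  \<comment> \<open>The three summands bound the effect of an error \<epsilon> in psi and psi' on
    the terms with \<open>cav\<close>, \<open>ggr\<close> and \<open>gcov\<close>.\<close>
  define K where "K = (real n + gbd) + real n + gbd"
  have K: "0 < K" using gbd_ge_1 by (simp add: K_def add_nonneg_pos)
  have bound: "\<bar>\<integral>z. f (RN n z) * h z \<partial>N\<bar> \<le> B * (K * \<epsilon>)" if \<epsilon>: "0 < \<epsilon>" for \<epsilon>
  proof -
    have c: "0 < 1 / gbd" "1 / gbd \<le> gbd"
      using gbd_ge_1 mult_mono[of 1 gbd 1 gbd] by (auto simp: field_simps)
    obtain \<alpha> d where \<psi>: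
      "\<And>x. x \<in> {1 / gbd..gbd} \<Longrightarrow> \<bar>(\<Sum>k\<le>d. \<alpha> k * x ^ k) - 1 / x ^ n\<bar> \<le> \<epsilon>"
      "\<And>x. x \<in> {1 / gbd..gbd} \<Longrightarrow> \<bar>(\<Sum>k\<le>d. \<alpha> k * (real k * x ^ (k - 1))) + real n / x ^ Suc n\<bar> \<le> \<epsilon>"
      by (rule poly_approx_inverse_power[OF c \<epsilon>, of n]) (rule that)
    define u where "u z = (\<Sum>k\<le>d. \<alpha> k * gav z ^ k)" for z
    define v where "v z = (\<Sum>k\<le>d. \<alpha> k * (real k * gav z ^ (k - 1)))" for z
    define hd where "hd z = (real n * u z + gav z * v z) * cav z - u z * ggr z - v z * gcov z" for z
    have [measurable]: "hd \<in> borel_measurable N"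
      unfolding hd_def u_def v_def by measurable
    have hd0: "(\<integral>z. f (RN n z) * hd z \<partial>N) = 0"
      unfolding hd_def u_def v_def by (rule gg_poly)
    have d: "\<bar>h z - hd z\<bar> \<le> K * \<epsilon>" if z: "z \<in> space N" for z
    proof -
      define a where "a = u z - 1 / gav z ^ n"
      define b where "b = v z + real n / gav z ^ Suc n"
      have ab: "\<bar>a\<bar> \<le> \<epsilon>" "\<bar>b\<bar> \<le> \<epsilon>"
        unfolding a_def b_def u_def v_def using \<psi> gav_bounds(1)[OF z] by blast+
      define P where "P = 1 / gav z ^ n"
      define P' where "P' = real n / gav z ^ Suc n"
      have xP: "gav z * P' = real n * P"
        using gav_pos[OF z] by (simp add: P_def P'_def)
      have uv: "u z = a + P" "v z = b - P'"
        by (simp_all add: a_def b_def P_def P'_def)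
      have "real n * u z + gav z * v z = real n * a + gav z * b"
        unfolding uv distrib_left right_diff_distrib xP by simp
      moreover have "h z = gcov z * P' - ggr z * P"
        by (simp add: h_def P_def P'_def)
      ultimately have e: "h z - hd z = - ((real n * a + gav z * b) * cav z) + a * ggr z + b * gcov z"
        by (simp add: hd_def uv algebra_simps)
      have "\<bar>(real n * a + gav z * b) * cav z\<bar> \<le> (real n * \<epsilon> + gbd * \<epsilon>) * 1"
        unfolding abs_mult
      proof (intro mult_mono)
        have "\<bar>real n * a\<bar> \<le> real n * \<epsilon>" using ab(1) by (simp add: abs_mult mult_left_mono)
        moreover have "\<bar>gav z * b\<bar> \<le> gbd * \<epsilon>"
          unfolding abs_mult using ab(2) gav_bounds(1)[OF z] gav_pos[OF z] by (intro mult_mono) auto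
        ultimately show "\<bar>real n * a + gav z * b\<bar> \<le> real n * \<epsilon> + gbd * \<epsilon>" by linarith
      qed (use gav_bounds(3)[OF z] \<epsilon> gbd_ge_1 in auto)
      moreover have "\<bar>a * ggr z\<bar> \<le> \<epsilon> * real n"
        unfolding abs_mult using ab(1) ggr_bound[OF n(2) z] \<epsilon> by (intro mult_mono) auto
      moreover have "\<bar>b * gcov z\<bar> \<le> \<epsilon> * gbd"
        unfolding abs_mult using ab(2) gav_bounds(2)[OF z] \<epsilon> by (intro mult_mono) auto
      ultimately show ?thesis
        unfolding e K_def by (simp add: algebra_simps abs_le_iff)
    qed
    have hb: "\<bar>h z\<bar> \<le> real n * gbd * gbd ^ Suc n + real n * gbd ^ n" if z: "z \<in> space N" for z
    proof -
      have inv: "1 / gav z ^ k \<le> gbd ^ k" for k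
      proof -
        have "1 / gav z \<le> gbd" using gav_bounds(1)[OF z] gav_pos[OF z] gbd_ge_1 by (simp add: field_simps)
        then have "(1 / gav z) ^ k \<le> gbd ^ k" using gav_pos[OF z] by (intro power_mono) auto
        then show ?thesis by (simp add: power_one_over)
      qed
      have "\<bar>real n * gcov z * (1 / gav z ^ Suc n)\<bar> \<le> real n * gbd * gbd ^ Suc n"
        unfolding abs_mult using gav_bounds(2)[OF z] inv[of "Suc n"] gav_pos[OF z] gbd_ge_1
        by (intro mult_mono) auto
      moreover have "\<bar>ggr z * (1 / gav z ^ n)\<bar> \<le> real n * gbd ^ n"
        unfolding abs_mult using ggr_bound[OF n(2) z] inv[of n] gav_pos[OF z] by (intro mult_mono) auto
      moreover have e: "h z = real n * gcov z * (1 / gav z ^ Suc n) - ggr z * (1 / gav z ^ n)"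
        by (simp add: h_def)
      ultimately show ?thesis
        unfolding e by (intro order_trans[OF abs_triangle_ineq4 add_mono])
    qed
    have ih: "integrable N (\<lambda>z. f (RN n z) * h z)"
      by (rule integrable_f[OF _ hb]) measurable
    have id: "integrable N (\<lambda>z. f (RN n z) * (h z - hd z))"
      by (rule integrable_f[OF _ d]) measurable
    have ihd: "integrable N (\<lambda>z. f (RN n z) * hd z)"
      using Bochner_Integration.integrable_diff[OF ih id] by (simp add: right_diff_distrib)
    have "(\<integral>z. f (RN n z) * h z \<partial>N) = (\<integral>z. f (RN n z) * (h z - hd z) \<partial>N)"
      using ih ihd hd0 by (simp add: right_diff_distrib)
    also have "\<bar>\<dots>\<bar> \<le> (\<integral>z. \<bar>f (RN n z) * (h z - hd z)\<bar> \<partial>N)"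
      using integral_norm_bound[of N "\<lambda>z. f (RN n z) * (h z - hd z)"] by simp
    also have "\<dots> \<le> (\<integral>z. B * (K * \<epsilon>) \<partial>N)"
    proof (intro Bochner_Integration.integral_mono)
      show "\<bar>f (RN n z) * (h z - hd z)\<bar> \<le> B * (K * \<epsilon>)" if "z \<in> space N" for z
        unfolding abs_mult using B[OF that] d[OF that] B_nonneg by (intro mult_mono) auto
    qed (use id in auto)
    finally show ?thesis by (simp add: MN.P.prob_space)
  qed
  have "\<bar>\<integral>z. f (RN n z) * h z \<partial>N\<bar> \<le> 0 + e" if "0 < e" for e
  proof -
    have "B * (K * (e / (K * (B + 1)))) \<le> e"
    proof -
      have "B * (K * (e / (K * (B + 1)))) = e * (B / (B + 1))" using K by simp
      also have "\<dots> \<le> e * 1" using B_nonneg that by (intro mult_left_mono) auto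
      finally show ?thesis by simp
    qed
    then show ?thesis
      using bound[of "e / (K * (B + 1))"] K B_nonneg that by simp
  qed
  then have "\<bar>\<integral>z. f (RN n z) * h z \<partial>N\<bar> \<le> 0"
    by (rule field_le_epsilon)
  then show ?thesis by (simp add: h_def)
qed

end

end

end

section \<open>Differentiation of the tilted averages\<close>

lemma DERIV_integral_bounded:
  fixes f f' :: "real \<Rightarrow> 'b \<Rightarrow> real"
  assumes fin: "finite_measure \<mu>"
    and meas: "\<And>t. f t \<in> borel_measurable \<mu>" "f' t0 \<in> borel_measurable \<mu>"
    and bd: "\<And>t x. \<bar>t - t0\<bar> < 1 \<Longrightarrow> x \<in> space \<mu> \<Longrightarrow> \<bar>f t x\<bar> \<le> C" "\<And>t x. \<bar>t - t0\<bar> < 1 \<Longrightarrow> x \<in> space \<mu> \<Longrightarrow> \<bar>f' t x\<bar> \<le> C'"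
    and der: "\<And>t x. \<bar>t - t0\<bar> < 1 \<Longrightarrow> x \<in> space \<mu> \<Longrightarrow> ((\<lambda>t. f t x) has_field_derivative f' t x) (at t)"
  shows "((\<lambda>t. \<integral>x. f t x \<partial>\<mu>) has_field_derivative (\<integral>x. f' t0 x \<partial>\<mu>)) (at t0)"
proof -
  interpret finite_measure \<mu> by fact
  note [measurable] = meas
  have at: "at (0::real) = at 0 within {-1<..<1}" by (rule at_within_open[symmetric]) auto
  have "((\<lambda>h. ((\<integral>x. f (t0 + h) x \<partial>\<mu>) - (\<integral>x. f t0 x \<partial>\<mu>)) / h) \<longlongrightarrow> (\<integral>x. f' t0 x \<partial>\<mu>)) (at 0)"
    unfolding at
  \<comment> \<open>Dominated convergence is a statement about sequences. The mean value inequality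
    bounds the difference quotients by \<open>C'\<close>.\<close>
  proof (subst tendsto_at_iff_sequentially, intro allI impI)
    fix X :: "nat \<Rightarrow> real" assume X: "\<forall>i. X i \<in> {-1<..<1} - {0}" "X \<longlonglongrightarrow> 0"
    have X1: "\<bar>(t0 + X i) - t0\<bar> < 1" "X i \<noteq> 0" for i
      using X(1)[rule_format, of i] by auto
    have int: "integrable \<mu> (f t)" if "\<bar>t - t0\<bar> < 1" for t
      using bd(1)[OF that] by (intro integrable_const_bound[where B = C]) auto
    have "(\<lambda>i. \<integral>x. (f (t0 + X i) x - f t0 x) / X i \<partial>\<mu>) \<longlonglongrightarrow> (\<integral>x. f' t0 x \<partial>\<mu>)"
    proof (rule integral_dominated_convergence)
      show "integrable \<mu> (\<lambda>x. C')" by simp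
      show "AE x in \<mu>. (\<lambda>i. (f (t0 + X i) x - f t0 x) / X i) \<longlonglongrightarrow> f' t0 x"
      proof (rule AE_I2)
        fix x assume x: "x \<in> space \<mu>"
        have "((\<lambda>h. (f (t0 + h) x - f t0 x) / h) \<longlongrightarrow> f' t0 x) (at 0)"
          using der[of t0 x] x by (simp add: DERIV_def)
        then show "(\<lambda>i. (f (t0 + X i) x - f t0 x) / X i) \<longlonglongrightarrow> f' t0 x"
          unfolding at tendsto_at_iff_sequentially using X by (auto simp: o_def)
      qed
      show "AE x in \<mu>. norm ((f (t0 + X i) x - f t0 x) / X i) \<le> C'" for i
      proof (rule AE_I2)
        fix x assume x: "x \<in> space \<mu>"
        have "norm (f (t0 + X i) x - f t0 x) \<le> C' * norm ((t0 + X i) - t0)"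
        proof (rule field_differentiable_bound[where S = "ball t0 1"])
          fix t assume "t \<in> ball t0 1"
          then have t: "\<bar>t - t0\<bar> < 1" by (simp add: dist_real_def abs_minus_commute)
          show "((\<lambda>t. f t x) has_field_derivative f' t x) (at t within ball t0 1)"
            using der[OF t x] by (rule has_field_derivative_at_within)
          show "norm (f' t x) \<le> C'" using bd(2)[OF t x] by simp
        qed (use X1[of i] in \<open>auto simp: dist_real_def\<close>)
        then show "norm ((f (t0 + X i) x - f t0 x) / X i) \<le> C'"
          using X1[of i] by (simp add: divide_le_eq)
      qed
    qed measurable
    moreover have "(\<integral>x. (f (t0 + X i) x - f t0 x) / X i \<partial>\<mu>) = ((\<integral>x. f (t0 + X i) x \<partial>\<mu>) - (\<integral>x. f t0 x \<partial>\<mu>)) / X i" for i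
      using int[OF X1(1)[of i]] int[of t0] by simp
    ultimately show "((\<lambda>h. ((\<integral>x. f (t0 + h) x \<partial>\<mu>) - (\<integral>x. f t0 x \<partial>\<mu>)) / h) \<circ> X) \<longlonglongrightarrow> (\<integral>x. f' t0 x \<partial>\<mu>)"
      by (simp only: o_def)
  qed
  then show ?thesis by (simp add: DERIV_def)
qed

context random_atoms
begin

lemma gcov_sum:
  assumes z: "z \<in> space N"
  shows "(\<Sum>i<n. s i * gcov n i p s' z) = savg (w (fst z)) (\<lambda>j. gibbs n p s' z j * (\<Sum>i<n. s i * covi i p z j))"
proof -
  have m: "(\<lambda>x. g (label (w (fst z)) x)) \<in> borel_measurable unif" for g :: "nat \<Rightarrow> real"
    by (rule measurable_compose[where N = "count_space UNIV"]) auto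
  have "integrable unif (\<lambda>x. gibbs n p s' z (label (w (fst z)) x) * covi i p z (label (w (fst z)) x))" for i
  proof (rule unif.integrable_const_bound[where B = "gbd n s' * 1"])
    have "\<bar>gibbs n p s' z j * covi i p z j\<bar> \<le> gbd n s' * 1" for j
      unfolding abs_mult using order_trans[OF zero_le_one gbd_ge_1[of n s']]
      by (intro mult_mono gibbs_bounds(3)[OF z] covi_bound[OF z]) auto
    then show "AE x in unif. norm (gibbs n p s' z (label (w (fst z)) x) * covi i p z (label (w (fst z)) x)) \<le> gbd n s' * 1"
      by simp
  qed (rule m[of "\<lambda>j. gibbs n p s' z j * covi i p z j"])
  then show ?thesis
    unfolding gcov_def savg_def sum_distrib_left
    by (subst Bochner_Integration.integral_sum) (auto simp: mult_ac)
qed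

lemma gav_derivative:
  assumes z: "z \<in> space N"
  shows "((\<lambda>t. gav n p (\<lambda>a. t * s a) z) has_field_derivative (\<Sum>i<n. s i * gcov n i p (\<lambda>a. t0 * s a) z)) (at t0)"
proof -
  define c where "c j = (\<Sum>i<n. s i * covi i p z j)" for j
  define K where "K = (\<Sum>i<n. \<bar>s i\<bar>)"
  have cK: "\<bar>c j\<bar> \<le> K" for j
    unfolding c_def K_def using covi_bound[OF z]
    by (intro order_trans[OF sum_abs] sum_mono) (auto simp: abs_mult intro!: mult_left_le)
  have g: "gibbs n p (\<lambda>a. t * s a) z j = exp (t * c j)" for t j
    by (simp add: gibbs_def c_def covi_def sum_distrib_left mult.assoc)
  have tc: "t * c j \<le> (\<bar>t0\<bar> + 1) * K" if "\<bar>t - t0\<bar> < 1" for t j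
  proof -
    have "t * c j \<le> \<bar>t\<bar> * \<bar>c j\<bar>" by (metis abs_ge_self abs_mult)
    also have "\<dots> \<le> (\<bar>t0\<bar> + 1) * K" using that cK[of j] by (intro mult_mono) auto
    finally show ?thesis .
  qed
  have m: "(\<lambda>x. u (label (w (fst z)) x)) \<in> borel_measurable unif" for u :: "nat \<Rightarrow> real"
    by (rule measurable_compose[where N = "count_space UNIV"]) auto
  have "((\<lambda>t. \<integral>x. exp (t * c (label (w (fst z)) x)) \<partial>unif) has_field_derivative
    (\<integral>x. exp (t0 * c (label (w (fst z)) x)) * c (label (w (fst z)) x) \<partial>unif)) (at t0)"
  proof (rule DERIV_integral_bounded[where C = "exp ((\<bar>t0\<bar> + 1) * K)" and C' = "exp ((\<bar>t0\<bar> + 1) * K) * K"])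
    show "(\<lambda>x. exp (t * c (label (w (fst z)) x))) \<in> borel_measurable unif" for t
      by (rule m)
    show "(\<lambda>x. exp (t0 * c (label (w (fst z)) x)) * c (label (w (fst z)) x)) \<in> borel_measurable unif"
      by (rule m)
    fix t x assume t: "\<bar>t - t0\<bar> < 1"
    show "\<bar>exp (t * c (label (w (fst z)) x))\<bar> \<le> exp ((\<bar>t0\<bar> + 1) * K)"
      using tc[OF t] by simp
    show "\<bar>exp (t * c (label (w (fst z)) x)) * c (label (w (fst z)) x)\<bar> \<le> exp ((\<bar>t0\<bar> + 1) * K) * K"
      unfolding abs_mult using tc[OF t] cK by (intro mult_mono) auto
  qed (auto intro!: derivative_eq_intros unif.finite_measure_axioms)
  then show ?thesis
    unfolding gcov_sum[OF z] gav_def savg_def g c_def[symmetric] .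
qed

lemma gbd_mono:
  assumes "\<bar>t\<bar> \<le> c"
  shows "gbd n (\<lambda>a. t * s a) \<le> gbd n (\<lambda>a. c * s a)"
  using assms by (auto simp: gbd_def abs_mult intro!: sum_mono mult_right_mono)

definition tilt_exponent :: "nat \<Rightarrow> nat \<Rightarrow> (nat \<Rightarrow> real) \<Rightarrow> 'a \<times> (nat \<Rightarrow> real) \<Rightarrow> real" where
  "tilt_exponent n p s z = (\<Sum>i<n. s i * ggr n i p z)"

lemma tilt_exponent_bound:
  assumes "z \<in> space N"
  shows "\<bar>tilt_exponent n p s z\<bar> \<le> (\<Sum>i<n. \<bar>s i\<bar> * real n)"
  unfolding tilt_exponent_def using ggr_bound[OF _ assms]
  by (intro order_trans[OF sum_abs] sum_mono) (auto simp: abs_mult intro!: mult_left_mono)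

lemma measurable_tilt_exponent[measurable]: "tilt_exponent n p s \<in> borel_measurable N"
  unfolding tilt_exponent_def[abs_def] by measurable

text \<open>The Ghirlanda-Guerra identities hold if and only if the mean of \<open>f (RN n z) * tilt_ratio n p s t z\<close>
  does not depend on \<open>t\<close>; the identities are its derivative at \<open>t = 0\<close>.\<close>

definition tilt_ratio :: "nat \<Rightarrow> nat \<Rightarrow> (nat \<Rightarrow> real) \<Rightarrow> real \<Rightarrow> 'a \<times> (nat \<Rightarrow> real) \<Rightarrow> real" where
  "tilt_ratio n p s t z = exp (t * tilt_exponent n p s z) / gav n p (\<lambda>a. t * s a) z ^ n"

lemma measurable_tilt_ratio[measurable]: "tilt_ratio n p s t \<in> borel_measurable N"
  unfolding tilt_ratio_def[abs_def] by measurable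

lemma tilt_integral_derivative:
  assumes f[measurable]: "f \<in> borel_measurable (Pi\<^sub>M ({..<n} \<times> {..<n}) (\<lambda>_. borel))"
    and B: "\<And>z. z \<in> space N \<Longrightarrow> \<bar>f (RN n z)\<bar> \<le> B"
  shows "((\<lambda>t. \<integral>z. f (RN n z) * tilt_ratio n p s t z \<partial>N) has_field_derivative
    (\<integral>z. f (RN n z) * (exp (t0 * tilt_exponent n p s z) * (tilt_exponent n p s z / gav n p (\<lambda>a. t0 * s a) z ^ n
      - real n * (\<Sum>i<n. s i * gcov n i p (\<lambda>a. t0 * s a) z) / gav n p (\<lambda>a. t0 * s a) z ^ Suc n)) \<partial>N)) (at t0)"
proof -
  define E where "E = tilt_exponent n p s"
  define S where "S t z = gav n p (\<lambda>a. t * s a) z" for t z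
  define S' where "S' t z = (\<Sum>i<n. s i * gcov n i p (\<lambda>a. t * s a) z)" for t z
  define K where "K = (\<Sum>i<n. \<bar>s i\<bar> * real n)"
  \<comment> \<open>Bounds \<open>\<bar>t\<bar>\<close> throughout the interval of radius 1 around
    \<open>t0\<close>, where all estimates have to be uniform.\<close>
  define c where "c = \<bar>t0\<bar> + 1"
  define A where "A = gbd n (\<lambda>a. c * s a)"
  have [measurable]: "E \<in> borel_measurable N" "S t \<in> borel_measurable N" "S' t \<in> borel_measurable N" for t
    unfolding E_def S_def[abs_def] S'_def[abs_def] by measurable
  have A1: "1 \<le> A" unfolding A_def by (rule gbd_ge_1)
  have B0: "0 \<le> B" using B MN.P.not_empty by (metis abs_ge_zero all_not_in_conv order_trans)
  have K0: "0 \<le> K" unfolding K_def by (intro sum_nonneg) auto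
  have Spos: "0 < S t z" if "z \<in> space N" for t z unfolding S_def by (rule gav_pos[OF that])
  have inv: "1 / S t z ^ k \<le> A ^ k" if t: "\<bar>t - t0\<bar> < 1" and z: "z \<in> space N" for t z k
  proof -
    have "\<bar>t\<bar> \<le> c" using t by (auto simp: c_def)
    then have g: "gbd n (\<lambda>a. t * s a) \<le> A" unfolding A_def by (rule gbd_mono)
    have "1 / S t z \<le> gbd n (\<lambda>a. t * s a)"
      using gav_bounds(1)[OF z, of n p "\<lambda>a. t * s a"] Spos[OF z, of t] gbd_ge_1[of n "\<lambda>a. t * s a"]
      by (simp add: S_def field_simps)
    then have "1 / S t z \<le> A" using g by linarith
    then have "(1 / S t z) ^ k \<le> A ^ k" using Spos[OF z, of t] by (intro power_mono) auto
    then show ?thesis by (simp add: power_one_over)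
  qed
  have Eb: "\<bar>E z\<bar> \<le> K" if "z \<in> space N" for z
    unfolding E_def K_def by (rule tilt_exponent_bound[OF that])
  have ex: "exp (t * E z) \<le> exp (c * K)" if t: "\<bar>t - t0\<bar> < 1" and z: "z \<in> space N" for t z
  proof -
    have "t * E z \<le> \<bar>t\<bar> * \<bar>E z\<bar>" by (metis abs_ge_self abs_mult)
    also have "\<dots> \<le> c * K" using t Eb[OF z] K0 by (intro mult_mono) (auto simp: c_def)
    finally show ?thesis by simp
  qed
  have S'b: "\<bar>S' t z\<bar> \<le> (\<Sum>i<n. \<bar>s i\<bar> * A)" if t: "\<bar>t - t0\<bar> < 1" and z: "z \<in> space N" for t z
  proof -
    have "\<bar>t\<bar> \<le> c" using t by (auto simp: c_def)
    then have g: "gbd n (\<lambda>a. t * s a) \<le> A" unfolding A_def by (rule gbd_mono)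
    show ?thesis
      unfolding S'_def using order_trans[OF gav_bounds(2)[OF z] g]
      by (intro order_trans[OF sum_abs] sum_mono) (auto simp: abs_mult intro!: mult_left_mono)
  qed
  define D where "D t z = exp (t * E z) * (E z / S t z ^ n - real n * S' t z / S t z ^ Suc n)" for t z
  have "((\<lambda>t. \<integral>z. f (RN n z) * (exp (t * E z) / S t z ^ n) \<partial>N) has_field_derivative
    (\<integral>z. f (RN n z) * D t0 z \<partial>N)) (at t0)"
  proof (rule DERIV_integral_bounded[where C = "B * (exp (c * K) * A ^ n)"
        and C' = "B * (exp (c * K) * (K * A ^ n + real n * (\<Sum>i<n. \<bar>s i\<bar> * A) * A ^ Suc n))"])
    show "finite_measure N" by (rule MN.P.finite_measure_axioms)
    show "(\<lambda>z. f (RN n z) * (exp (t * E z) / S t z ^ n)) \<in> borel_measurable N" for t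
      by measurable
    show "(\<lambda>z. f (RN n z) * D t0 z) \<in> borel_measurable N"
      unfolding D_def by measurable
    fix t z assume t: "\<bar>t - t0\<bar> < 1" and z: "z \<in> space N"
    have "exp (t * E z) * (1 / S t z ^ n) \<le> exp (c * K) * A ^ n"
      using ex[OF t z] inv[OF t z] less_imp_le[OF Spos[OF z]] by (intro mult_mono) auto
    then show "\<bar>f (RN n z) * (exp (t * E z) / S t z ^ n)\<bar> \<le> B * (exp (c * K) * A ^ n)"
      unfolding abs_mult[of "f (RN n z)"] using B[OF z] B0 Spos[OF z, of t] by (intro mult_mono) auto
    have "\<bar>E z * (1 / S t z ^ n)\<bar> \<le> K * A ^ n"
      unfolding abs_mult using Eb[OF z] inv[OF t z, of n] Spos[OF z, of t] K0 by (intro mult_mono) auto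
    moreover have "\<bar>real n * S' t z * (1 / S t z ^ Suc n)\<bar> \<le> real n * (\<Sum>i<n. \<bar>s i\<bar> * A) * A ^ Suc n"
      unfolding abs_mult using S'b[OF t z] inv[OF t z, of "Suc n"] Spos[OF z, of t] A1
      by (intro mult_mono) (auto intro!: mult_nonneg_nonneg sum_nonneg)
    ultimately have "\<bar>E z * (1 / S t z ^ n) - real n * S' t z * (1 / S t z ^ Suc n)\<bar> \<le> K * A ^ n + real n * (\<Sum>i<n. \<bar>s i\<bar> * A) * A ^ Suc n"
      by (intro order_trans[OF abs_triangle_ineq4 add_mono])
    then have "\<bar>D t z\<bar> \<le> exp (c * K) * (K * A ^ n + real n * (\<Sum>i<n. \<bar>s i\<bar> * A) * A ^ Suc n)"
      unfolding D_def abs_mult using ex[OF t z] by (intro mult_mono) auto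
    then show "\<bar>f (RN n z) * D t z\<bar> \<le> B * (exp (c * K) * (K * A ^ n + real n * (\<Sum>i<n. \<bar>s i\<bar> * A) * A ^ Suc n))"
      unfolding abs_mult[of "f (RN n z)"] using B[OF z] B0 by (intro mult_mono) auto
    have dS: "((\<lambda>t. S t z) has_field_derivative S' t z) (at t)"
      unfolding S_def S'_def by (rule gav_derivative[OF z])
    have dn: "((\<lambda>t. S t z ^ n) has_field_derivative real n * (S' t z * S t z ^ (n - Suc 0))) (at t)"
      using DERIV_power[OF dS, of n] by simp
    have de: "((\<lambda>t. exp (t * E z)) has_field_derivative exp (t * E z) * E z) (at t)"
      by (auto intro!: derivative_eq_intros)
    have "((\<lambda>t. exp (t * E z) / S t z ^ n) has_field_derivative
      (exp (t * E z) * E z * S t z ^ n - exp (t * E z) * (real n * (S' t z * S t z ^ (n - Suc 0)))) / (S t z ^ n * S t z ^ n)) (at t)"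
      using Spos[OF z, of t] by (intro DERIV_divide[OF de dn]) auto
    also have "(exp (t * E z) * E z * S t z ^ n - exp (t * E z) * (real n * (S' t z * S t z ^ (n - Suc 0)))) / (S t z ^ n * S t z ^ n) = D t z"
      using Spos[OF z, of t] by (cases n) (auto simp: D_def field_simps)
    finally show "((\<lambda>t. f (RN n z) * (exp (t * E z) / S t z ^ n)) has_field_derivative f (RN n z) * D t z) (at t)"
      by (rule DERIV_cmult)
  qed
  then show ?thesis by (simp add: tilt_ratio_def D_def E_def S_def S'_def)
qed

lemma tilt_ratio_0: "z \<in> space N \<Longrightarrow> tilt_ratio n p s 0 z = 1"
  and gav_0: "gav n p (\<lambda>_. 0) z = 1"
  and gcov_0: "gcov n i p (\<lambda>_. 0) z = cav i p z"
  by (simp_all add: tilt_ratio_def gav_def gcov_def cav_def gibbs_def savg_def unif.prob_space)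

lemma gg_term_bound:
  assumes i: "i < n" and z: "z \<in> space N"
  shows "\<bar>real n * gcov n i p s z / gav n p s z ^ Suc n - ggr n i p z / gav n p s z ^ n\<bar> \<le>
    real n * gbd n s * gbd n s ^ Suc n + real n * gbd n s ^ n"
proof -
  have g1: "0 \<le> gbd n s" "1 \<le> gbd n s" using gbd_ge_1[of n s] by auto
  have inv: "1 / gav n p s z ^ k \<le> gbd n s ^ k" for k
  proof -
    have "1 / gav n p s z \<le> gbd n s"
      using gav_bounds(1)[OF z, of n p s] gav_pos[OF z, of n p s] g1 by (simp add: field_simps)
    then have "(1 / gav n p s z) ^ k \<le> gbd n s ^ k"
      using less_imp_le[OF gav_pos[OF z, of n p s]] by (intro power_mono) auto
    then show ?thesis by (simp add: power_one_over)
  qed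
  have "\<bar>real n * gcov n i p s z * (1 / gav n p s z ^ Suc n)\<bar> \<le> real n * gbd n s * gbd n s ^ Suc n"
    unfolding abs_mult using gav_bounds(2)[OF z, of n i p s] inv[of "Suc n"] less_imp_le[OF gav_pos[OF z, of n p s]] g1
    by (intro mult_mono) auto
  moreover have "\<bar>ggr n i p z * (1 / gav n p s z ^ n)\<bar> \<le> real n * gbd n s ^ n"
    unfolding abs_mult using ggr_bound[OF i z] inv[of n] less_imp_le[OF gav_pos[OF z, of n p s]] by (intro mult_mono) auto
  moreover have e: "real n * gcov n i p s z / gav n p s z ^ Suc n - ggr n i p z / gav n p s z ^ n =
    real n * gcov n i p s z * (1 / gav n p s z ^ Suc n) - ggr n i p z * (1 / gav n p s z ^ n)" by simp
  ultimately show ?thesis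
    unfolding e by (intro order_trans[OF abs_triangle_ineq4 add_mono])
qed

text \<open>The numerator of the factor depends only on the overlaps of the first \<open>n\<close>
  replicas, so at every \<open>t\<close> it can be absorbed into the test function. What is left of
  the derivative is a linear combination over \<open>i\<close> of the expressions in
  \<open>gg_inverse_power\<close>.\<close>

theorem gg_integral_tilt_ratio:
  assumes gg: "ghirlanda_guerra M w \<xi>" and n: "2 \<le> n" "1 \<le> p"
    and f[measurable]: "f \<in> borel_measurable (Pi\<^sub>M ({..<n} \<times> {..<n}) (\<lambda>_. borel))"
    and B: "\<And>z. z \<in> space N \<Longrightarrow> \<bar>f (RN n z)\<bar> \<le> B"
  shows "(\<integral>z. f (RN n z) * tilt_ratio n p s t z \<partial>N) = (\<integral>z. f (RN n z) \<partial>N)"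
proof -
  have der0: "((\<lambda>t. \<integral>z. f (RN n z) * tilt_ratio n p s t z \<partial>N) has_field_derivative 0) (at t)" for t
  proof -
    define K where "K = (\<Sum>i<n. \<bar>s i\<bar> * real n)"
    define g where "g r = f r * exp (t * (\<Sum>i<n. s i * ((\<Sum>l\<in>{..<n} - {i}. r (i, l) ^ p) + mom p)))" for r :: "nat \<times> nat \<Rightarrow> real"
    have g[measurable]: "g \<in> borel_measurable (Pi\<^sub>M ({..<n} \<times> {..<n}) (\<lambda>_. borel))"
    proof -
      have "(\<lambda>r. \<Sum>i<n. s i * ((\<Sum>l\<in>{..<n} - {i}. r (i, l) ^ p) + mom p)) \<in> borel_measurable (Pi\<^sub>M ({..<n} \<times> {..<n}) (\<lambda>_. borel :: real measure))"
        by (intro borel_measurable_sum borel_measurable_times borel_measurable_add borel_measurable_const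
            borel_measurable_power measurable_component_singleton) auto
      then show ?thesis unfolding g_def by measurable
    qed
    have gR: "g (RN n z) = f (RN n z) * exp (t * tilt_exponent n p s z)" for z
      by (simp add: g_def tilt_exponent_def ggr_def RN_def)
    have gB: "\<bar>g (RN n z)\<bar> \<le> B * exp (\<bar>t\<bar> * K)" if z: "z \<in> space N" for z
    proof -
      have "t * tilt_exponent n p s z \<le> \<bar>t\<bar> * \<bar>tilt_exponent n p s z\<bar>" by (metis abs_ge_self abs_mult)
      also have "\<dots> \<le> \<bar>t\<bar> * K" unfolding K_def by (intro mult_left_mono tilt_exponent_bound[OF z]) auto
      finally show ?thesis
        unfolding gR abs_mult using B[OF z] order_trans[OF abs_ge_zero B[OF z]] by (intro mult_mono) auto
    qed
    define h where "h i z = real n * gcov n i p (\<lambda>a. t * s a) z / gav n p (\<lambda>a. t * s a) z ^ Suc n - ggr n i p z / gav n p (\<lambda>a. t * s a) z ^ n" for i z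
    have hm[measurable]: "h i \<in> borel_measurable N" for i
      unfolding h_def by measurable
    have h0: "(\<integral>z. g (RN n z) * h i z \<partial>N) = 0" if "i < n" for i
      unfolding h_def by (rule gg_inverse_power[OF gg n(1) that n(2) g gB])
    have ih: "integrable N (\<lambda>z. g (RN n z) * h i z)" if "i < n" for i
    proof (rule integrable_N_bounded)
      show "\<bar>g (RN n z) * h i z\<bar> \<le> B * exp (\<bar>t\<bar> * K) *
          (real n * gbd n (\<lambda>a. t * s a) * gbd n (\<lambda>a. t * s a) ^ Suc n + real n * gbd n (\<lambda>a. t * s a) ^ n)" if z: "z \<in> space N" for z
        unfolding abs_mult[of "g (RN n z)"] h_def
        by (intro mult_mono gB[OF z] gg_term_bound[OF \<open>i < n\<close> z] order_trans[OF abs_ge_zero gB[OF z]] abs_ge_zero)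
    qed measurable
    have e: "f (RN n z) * (exp (t * tilt_exponent n p s z) * (tilt_exponent n p s z / gav n p (\<lambda>a. t * s a) z ^ n
      - real n * (\<Sum>i<n. s i * gcov n i p (\<lambda>a. t * s a) z) / gav n p (\<lambda>a. t * s a) z ^ Suc n)) =
      (\<Sum>i<n. - s i * (g (RN n z) * h i z))" for z
    proof -
      have e1: "tilt_exponent n p s z / gav n p (\<lambda>a. t * s a) z ^ n
        - real n * (\<Sum>i<n. s i * gcov n i p (\<lambda>a. t * s a) z) / gav n p (\<lambda>a. t * s a) z ^ Suc n = (\<Sum>i<n. - s i * h i z)"
        unfolding h_def tilt_exponent_def
        by (simp add: right_diff_distrib sum_subtractf sum_divide_distrib sum_distrib_left mult_ac)
      show ?thesis
        unfolding gR e1 by (simp add: sum_distrib_left sum_distrib_right sum_negf mult_ac)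
    qed
    have "(\<integral>z. (\<Sum>i<n. - s i * (g (RN n z) * h i z)) \<partial>N) = (\<Sum>i<n. \<integral>z. - s i * (g (RN n z) * h i z) \<partial>N)"
      using ih by (intro Bochner_Integration.integral_sum) (simp del: mult_minus_left)
    also have "\<dots> = 0" using h0 by simp
    finally show ?thesis
      using tilt_integral_derivative[OF f B, of p s t] unfolding e by simp
  qed
  have "(\<integral>z. f (RN n z) * tilt_ratio n p s t z \<partial>N) = (\<integral>z. f (RN n z) * tilt_ratio n p s 0 z \<partial>N)"
    by (rule DERIV_isconst_all[of "\<lambda>t. \<integral>z. f (RN n z) * tilt_ratio n p s t z \<partial>N"]) (use der0 in blast)
  also have "\<dots> = (\<integral>z. f (RN n z) \<partial>N)"
    by (intro Bochner_Integration.integral_cong refl) (simp add: tilt_ratio_0)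
  finally show ?thesis .
qed

text \<open>Differentiation at 0 in the direction of replica 0, the one singled out in the
  definition of the identities. Constancy is assumed only for nonnegative test functions; a bounded
  \<open>f\<close> is reached by adding \<open>B\<close> and subtracting the contribution of the
  constant.\<close>

theorem gg_of_integral_tilt_ratio:
  assumes const: "\<And>n p f t B. 2 \<le> n \<Longrightarrow> 1 \<le> p \<Longrightarrow> f \<in> borel_measurable (Pi\<^sub>M ({..<n} \<times> {..<n}) (\<lambda>_. borel)) \<Longrightarrow>
      (\<And>r. 0 \<le> f r) \<Longrightarrow> (\<And>r. f r \<le> B) \<Longrightarrow>
      (\<integral>z. f (RN n z) * tilt_ratio n p (\<lambda>a. if a = 0 then 1 else 0) t z \<partial>N) = (\<integral>z. f (RN n z) \<partial>N)"
  shows "ghirlanda_guerra M w \<xi>"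
  unfolding ghirlanda_guerra_iff
proof (intro allI ballI impI)
  fix n p :: nat and f :: "(nat \<times> nat \<Rightarrow> real) \<Rightarrow> real"
  assume n: "2 \<le> n" "1 \<le> p" and f[measurable]: "f \<in> borel_measurable (Pi\<^sub>M ({..<n} \<times> {..<n}) (\<lambda>_. borel))"
    and "\<exists>B. \<forall>R. \<bar>f R\<bar> \<le> B"
  then obtain B where B: "\<And>r. \<bar>f r\<bar> \<le> B" by blast
  define s :: "nat \<Rightarrow> real" where "s = (\<lambda>a. if a = 0 then 1 else 0)"
  define g where "g r = f r + B" for r
  have gm[measurable]: "g \<in> borel_measurable (Pi\<^sub>M ({..<n} \<times> {..<n}) (\<lambda>_. borel))"
    unfolding g_def by measurable
  have g: "0 \<le> g r" "g r \<le> 2 * B" for r using B[of r] by (auto simp: g_def abs_le_iff)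
  have n0: "0 < n" using n by simp
  have s_sum: "(\<Sum>i<n. s i * x i) = x 0" for x
  proof -
    have "(\<Sum>i<n. s i * x i) = (\<Sum>i<n. if i = 0 then x i else 0)"
      by (intro sum.cong) (auto simp: s_def)
    then show ?thesis using n0 by simp
  qed
  have zero: "(\<integral>z. u (RN n z) * (ggr n 0 p z - real n * cav 0 p z) \<partial>N) = 0"
    if u[measurable]: "u \<in> borel_measurable (Pi\<^sub>M ({..<n} \<times> {..<n}) (\<lambda>_. borel))"
      and ub: "\<And>r. 0 \<le> u r" "\<And>r. u r \<le> C" for u C
  proof -
    have "((\<lambda>t. \<integral>z. u (RN n z) * tilt_ratio n p s t z \<partial>N) has_field_derivative
      (\<integral>z. u (RN n z) * (exp (0 * tilt_exponent n p s z) * (tilt_exponent n p s z / gav n p (\<lambda>a. 0 * s a) z ^ n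
        - real n * (\<Sum>i<n. s i * gcov n i p (\<lambda>a. 0 * s a) z) / gav n p (\<lambda>a. 0 * s a) z ^ Suc n)) \<partial>N)) (at 0)"
      by (rule tilt_integral_derivative[OF u, where B = C]) (use ub in auto)
    moreover have "((\<lambda>t. \<integral>z. u (RN n z) * tilt_ratio n p s t z \<partial>N) has_field_derivative 0) (at 0)"
      using const[OF n u ub] by (simp add: s_def)
    ultimately have "(\<integral>z. u (RN n z) * (exp (0 * tilt_exponent n p s z) * (tilt_exponent n p s z / gav n p (\<lambda>a. 0 * s a) z ^ n
        - real n * (\<Sum>i<n. s i * gcov n i p (\<lambda>a. 0 * s a) z) / gav n p (\<lambda>a. 0 * s a) z ^ Suc n)) \<partial>N) = 0"
      by (rule DERIV_unique)
    then show ?thesis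
      by (simp add: gav_0 gcov_0 tilt_exponent_def s_sum)
  qed
  have bd: "\<bar>ggr n 0 p z - real n * cav 0 p z\<bar> \<le> real n + real n * 1" if z: "z \<in> space N" for z
  proof -
    have "\<bar>real n * cav 0 p z\<bar> \<le> real n * 1"
      unfolding abs_mult using gav_bounds(3)[OF z] by (intro mult_mono) auto
    then show ?thesis using ggr_bound[OF n0 z, of p] by linarith
  qed
  have int: "integrable N (\<lambda>z. f (RN n z) * v z)" if [measurable]: "v \<in> borel_measurable N" and v: "\<And>z. z \<in> space N \<Longrightarrow> \<bar>v z\<bar> \<le> C" for v C
    by (rule integrable_N_bounded[where B = "B * C"])
      (use v B order_trans[OF abs_ge_zero B] in \<open>auto simp: abs_mult intro!: mult_mono\<close>)
  have intB: "integrable N (\<lambda>z. ggr n 0 p z - real n * cav 0 p z)"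
    by (rule integrable_N_bounded[OF _ bd]) measurable
  have "(\<integral>z. f (RN n z) * (ggr n 0 p z - real n * cav 0 p z) \<partial>N) =
    (\<integral>z. g (RN n z) * (ggr n 0 p z - real n * cav 0 p z) \<partial>N) - B * (\<integral>z. 1 * (ggr n 0 p z - real n * cav 0 p z) \<partial>N)"
    using int[OF _ bd] intB by (simp add: g_def distrib_right)
  also have "\<dots> = 0"
    using zero[OF gm g] zero[of "\<lambda>_. 1" 1] by simp
  finally have z0: "(\<integral>z. f (RN n z) * (ggr n 0 p z - real n * cav 0 p z) \<partial>N) = 0" .
  have c1: "integrable N (\<lambda>z. f (RN n z) * cav 0 p z)"
    by (rule int[OF _ gav_bounds(3)]) measurable
  have c2: "integrable N (\<lambda>z. f (RN n z) * R z 0 l ^ p)" for l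
    by (rule int[OF _ R_power_abs_le_1]) measurable
  have c3: "integrable N (\<lambda>z. f (RN n z))"
    using int[of "\<lambda>_. 1" 1] by simp
  have ggr: "(\<integral>z. f (RN n z) * ggr n 0 p z \<partial>N) = (\<integral>z. f (RN n z) \<partial>N) * mom p + (\<Sum>l=1..<n. \<integral>z. f (RN n z) * R z 0 l ^ p \<partial>N)"
  proof -
    have "{..<n} - {0} = {1..<n}" by auto
    then have "(\<integral>z. f (RN n z) * ggr n 0 p z \<partial>N) = (\<integral>z. f (RN n z) * mom p + (\<Sum>l=1..<n. f (RN n z) * R z 0 l ^ p) \<partial>N)"
      by (simp add: ggr_def distrib_left sum_distrib_left add.commute)
    also have "\<dots> = (\<integral>z. f (RN n z) * mom p \<partial>N) + (\<integral>z. (\<Sum>l=1..<n. f (RN n z) * R z 0 l ^ p) \<partial>N)"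
      using c2 c3 by (intro Bochner_Integration.integral_add) auto
    finally show ?thesis using c2 by (simp add: Bochner_Integration.integral_sum)
  qed
  have c4: "integrable N (\<lambda>z. f (RN n z) * ggr n 0 p z)"
    by (rule int[OF _ ggr_bound[OF n0]]) measurable
  have "(\<integral>z. f (RN n z) * R z 0 n ^ p \<partial>N) = (\<integral>z. f (RN n z) * covi 0 p z (lab z n) \<partial>N)"
    by (simp add: covi_def R_def)
  also have "\<dots> = (\<integral>z. f (RN n z) * savg (w (fst z)) (covi 0 p z) \<partial>N)"
  proof (rule integral_peel[where B = B and C = 1])
    show "f (RN n (fst z, (snd z)(n := x))) = f (RN n z)" for z x
      using indep_from_RN[of n] by (simp add: indep_from_def)
    show "covi 0 p (fst z, (snd z)(n := x)) j = covi 0 p z j" for z x j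
      using indep_covi[OF n0, of p] by (simp add: indep_from_def)
  qed (use B covi_bound in auto)
  also have "\<dots> = (\<integral>z. f (RN n z) * cav 0 p z \<partial>N)"
    by (simp add: cav_def)
  finally have "real n * (\<integral>z. f (RN n z) * R z 0 n ^ p \<partial>N) = (\<integral>z. real n * (f (RN n z) * cav 0 p z) \<partial>N)"
    by simp
  also have "\<dots> = (\<integral>z. f (RN n z) * ggr n 0 p z \<partial>N)"
    using z0 c1 c4 by (simp add: right_diff_distrib mult.left_commute)
  finally show "real n * (\<integral>z. f (RN n z) * R z 0 n ^ p \<partial>N) =
      (\<integral>z. f (RN n z) \<partial>N) * mom p + (\<Sum>l=1..<n. \<integral>z. f (RN n z) * R z 0 l ^ p \<partial>N)"
    unfolding ggr .
qed

end

section \<open>The law of the field after the change of density\<close>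

lemma measurable_navg:
  assumes [measurable]: "\<And>k. (\<lambda>x. v x k) \<in> borel_measurable A" "\<And>l. (\<lambda>x. H x l) \<in> borel_measurable A"
  shows "(\<lambda>x. navg (v x) n (H x)) \<in> borel_measurable A"
proof -
  let ?P = "{..<n} \<rightarrow>\<^sub>E (UNIV :: nat set)"
  interpret C: sigma_finite_measure "count_space ?P"
    by (rule sigma_finite_measure_count_space_countable[OF countable_PiE_nat])
  have "(\<lambda>y. ennreal (\<Prod>i<n. v (fst y) (snd y i)) * H (fst y) (snd y)) \<in> borel_measurable (A \<Otimes>\<^sub>M count_space ?P)"
    by (rule measurable_compose_countable'[where f = "\<lambda>l y. ennreal (\<Prod>i<n. v (fst y) (l i)) * H (fst y) l", OF _ measurable_snd countable_PiE_nat])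
      measurable
  then show ?thesis
    unfolding navg_def by (intro C.borel_measurable_nn_integral) (simp add: case_prod_beta')
qed

lemma measurable_ovl:
  assumes [measurable]: "\<And>k. (\<lambda>x. q x k) \<in> borel_measurable A"
  shows "(\<lambda>x. ovl n (q x) l) \<in> A \<rightarrow>\<^sub>M Pi\<^sub>M ({..<n} \<times> {..<n}) (\<lambda>_. borel)"
  unfolding ovl_def by (rule measurable_restrict) (auto split: prod.split)

lemma measurable_shift_factor:
  assumes [measurable]: "\<And>k. (\<lambda>x. v x k) \<in> borel_measurable A" "\<And>k. (\<lambda>x. q x k) \<in> borel_measurable A"
  shows "(\<lambda>x. shift_factor p n s (v x) (q x) l) \<in> borel_measurable A"
  unfolding shift_factor_def by measurable

lemma shift_factor_cong:
  "(\<And>i. i < n \<Longrightarrow> l i = l' i) \<Longrightarrow> shift_factor p n s v q l = shift_factor p n s v q l'"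
  unfolding shift_factor_def by simp

lemma ovl_cong: "(\<And>i. i < n \<Longrightarrow> l i = l' i) \<Longrightarrow> ovl n q l = ovl n q l'"
  by (auto simp: ovl_def fun_eq_iff restrict_def)

text \<open>Conditional variance of \<open>\<Sum>i<n. s i * h (l i)\<close> when \<open>r\<close>
  holds the overlaps of the labels.\<close>

definition qform :: "nat \<Rightarrow> nat \<Rightarrow> (nat \<Rightarrow> real) \<Rightarrow> (nat \<times> nat \<Rightarrow> real) \<Rightarrow> real" where
  "qform p n s r = (\<Sum>i<n. \<Sum>j<n. s i * s j * r (i, j) ^ p)"

lemma measurable_qform[measurable]: "qform p n s \<in> borel_measurable (Pi\<^sub>M ({..<n} \<times> {..<n}) (\<lambda>_. borel))"
  unfolding qform_def[abs_def]
  by (intro borel_measurable_sum borel_measurable_times borel_measurable_const borel_measurable_power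
      measurable_component_singleton) auto

lemma AE_distr_fst:
  assumes "prob_space A" "prob_space B" "AE x in A. P x"
  shows "AE z in A \<Otimes>\<^sub>M B. P (fst z)"
proof -
  have eq: "distr (A \<Otimes>\<^sub>M B) A fst = A"
    using assms(2) by (rule prob_space.distr_pair_fst)
  have "AE x in distr (A \<Otimes>\<^sub>M B) A fst. P x" unfolding eq by (rule assms(3))
  then show ?thesis by (rule AE_distrD[OF measurable_fst])
qed

context random_atoms
begin

lemma AE_N_fst: "AE \<omega> in M. P \<omega> \<Longrightarrow> AE z in N. P (fst z)"
  by (rule AE_distr_fst[OF prob_space_axioms unifs.prob_space_axioms])

text \<open>The points attached to zero weights are arbitrary. That replicas almost surely avoid
  them is what lets properties of the atoms pass to overlaps of replicas.\<close>

lemma AE_lab_pos: "AE z in N. \<forall>i. 0 < w (fst z) (lab z i)"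
  unfolding AE_all_countable
proof
  fix i
  define H where "H \<omega> l = (indicator {0} (w \<omega> (l i)) :: ennreal)" for \<omega> and l :: "nat \<Rightarrow> nat"
  have [measurable]: "(\<lambda>\<omega>. H \<omega> l) \<in> borel_measurable M" for l
    unfolding H_def by measurable
  have wl[measurable]: "(\<lambda>z. w (fst z) (lab z i)) \<in> borel_measurable N"
    by (rule measurable_compose_countable[OF _ measurable_lab]) measurable
  have "navg (w \<omega>) (Suc i) (H \<omega>) = 0" for \<omega>
  proof -
    have z0: "ennreal (\<Prod>k<Suc i. w \<omega> (l k)) * H \<omega> l = 0" for l
      by (cases "w \<omega> (l i) = 0") (auto simp: H_def)
    show ?thesis unfolding navg_def z0 by simp
  qed
  then have "(\<integral>\<^sup>+z. H (fst z) (labels (Suc i) (w (fst z)) (snd z)) \<partial>N) = 0"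
    by (subst nn_integral_navg_eq[symmetric]) simp_all
  then have "(\<integral>\<^sup>+z. indicator {0} (w (fst z) (lab z i)) \<partial>N) = 0"
    by (simp add: H_def labels_eq_lab)
  then have "AE z in N. (indicator {0} (w (fst z) (lab z i)) :: ennreal) = 0"
    by (subst (asm) nn_integral_0_iff_AE) auto
  then show "AE z in N. 0 < w (fst z) (lab z i)"
    using AE_space
  proof eventually_elim
    case (elim z)
    then show ?case using w_nonneg[OF space_N_fst[OF elim(2)], of "lab z i"] by (auto simp: indicator_def split: if_splits)
  qed
qed

lemma RN_eq_ovl: "RN n z = ovl n (Qm (fst z)) (lab z)"
  by (simp add: RN_def ovl_def R_def)

lemma nn_integral_navg_RN:
  fixes f :: "(nat \<times> nat \<Rightarrow> real) \<Rightarrow> ennreal" and G :: "'a \<Rightarrow> (nat \<Rightarrow> nat) \<Rightarrow> ennreal"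
  assumes f[measurable]: "f \<in> borel_measurable (Pi\<^sub>M ({..<n} \<times> {..<n}) (\<lambda>_. borel))"
    and G[measurable]: "\<And>l. (\<lambda>\<omega>. G \<omega> l) \<in> borel_measurable M"
    and dep: "\<And>\<omega> l l'. (\<And>i. i < n \<Longrightarrow> l i = l' i) \<Longrightarrow> G \<omega> l = G \<omega> l'"
  shows "(\<integral>\<^sup>+\<omega>. navg (w \<omega>) n (\<lambda>l. f (ovl n (Qm \<omega>) l) * G \<omega> l) \<partial>M) = (\<integral>\<^sup>+z. f (RN n z) * G (fst z) (lab z) \<partial>N)"
proof -
  have Qm[measurable]: "(\<lambda>\<omega>. Qm \<omega> k) \<in> borel_measurable M" for k
    by (cases k) simp
  note [measurable] = measurable_ovl[OF Qm]
  have "(\<integral>\<^sup>+\<omega>. navg (w \<omega>) n (\<lambda>l. f (ovl n (Qm \<omega>) l) * G \<omega> l) \<partial>M) =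
    (\<integral>\<^sup>+z. f (ovl n (Qm (fst z)) (labels n (w (fst z)) (snd z))) * G (fst z) (labels n (w (fst z)) (snd z)) \<partial>N)"
    by (rule nn_integral_navg_eq) measurable
  also have "\<dots> = (\<integral>\<^sup>+z. f (RN n z) * G (fst z) (lab z) \<partial>N)"
    unfolding RN_eq_ovl
    by (intro nn_integral_cong arg_cong2[where f = "(*)"] arg_cong[where f = f] ovl_cong dep) (auto simp: labels_eq_lab)
  finally show ?thesis .
qed

text \<open>The origin of b_p: \<open>ggr\<close> omits the diagonal overlap and has
  \<open>mom p\<close> in its place. Restoring the diagonal adds q^p - \<open>mom p\<close> for each
  replica, which on a sphere is a constant and leaves the average as a deterministic factor.\<close>

lemma shift_factor_eq_tilt_ratio:
  assumes z: "z \<in> space N" and R: "\<And>i. R z i i = q"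
  shows "shift_factor p n (\<lambda>i. t * s i) (w (fst z)) (Qm (fst z)) (lab z) =
    tilt_ratio n p s t z * exp (t * ((q ^ p - mom p) * (\<Sum>i<n. s i)))"
proof -
  have "(\<lambda>k. w (fst z) k * gibbs n p (\<lambda>i. t * s i) z k) sums gav n p (\<lambda>i. t * s i) z"
    unfolding gav_def by (rule savg_w_sums[OF space_N_fst[OF z] gibbs_bounds(3)[OF z]])
  then have den: "(\<Sum>k. w (fst z) k * exp (\<Sum>i<n. t * s i * Qm (fst z) (lab z i, k) ^ p)) = gav n p (\<lambda>i. t * s i) z"
    by (simp add: sums_iff gibbs_def)
  have "(\<Sum>j<n. R z i j ^ p) = ggr n i p z + (q ^ p - mom p)" if "i < n" for i
    using that R[of i] by (simp add: ggr_def sum.remove[of "{..<n}" i])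
  then have "(\<Sum>i<n. \<Sum>j<n. t * s i * R z i j ^ p) = (\<Sum>i<n. t * s i * (ggr n i p z + (q ^ p - mom p)))"
    by (intro sum.cong refl) (simp add: sum_distrib_left[symmetric])
  also have "\<dots> = t * tilt_exponent n p s z + t * ((q ^ p - mom p) * (\<Sum>i<n. s i))"
    by (simp add: tilt_exponent_def distrib_left sum.distrib sum_distrib_left sum_distrib_right mult_ac)
  finally have num: "(\<Sum>i<n. \<Sum>j<n. t * s i * R z i j ^ p) = t * tilt_exponent n p s z + t * ((q ^ p - mom p) * (\<Sum>i<n. s i))" .
  show ?thesis
    unfolding shift_factor_def den tilt_ratio_def using num by (simp add: R_def exp_add)
qed

end

section \<open>The arrays reordered after the change of density\<close>

context gaussian_field
begin

definition tperm :: "real \<Rightarrow> 'a \<Rightarrow> nat \<Rightarrow> nat" where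
  "tperm t \<omega> = decreasing_perm (tilted (w \<omega>) (h \<omega>) t)"

definition tw :: "real \<Rightarrow> 'a \<Rightarrow> nat \<Rightarrow> real" where
  "tw t \<omega> l = tilted (w \<omega>) (h \<omega>) t (tperm t \<omega> l)"

definition th :: "real \<Rightarrow> 'a \<Rightarrow> nat \<Rightarrow> real" where
  "th t \<omega> l = h \<omega> (tperm t \<omega> l)"

definition tQ :: "real \<Rightarrow> 'a \<Rightarrow> nat \<times> nat \<Rightarrow> real" where
  "tQ t \<omega> = (\<lambda>(l, l'). Q \<omega> (tperm t \<omega> l) (tperm t \<omega> l'))"

lemma measurable_tperm[measurable]: "(\<lambda>\<omega>. tperm t \<omega> k) \<in> M \<rightarrow>\<^sub>M count_space UNIV"
  unfolding tperm_def by (rule measurable_decreasing_perm) measurable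

lemma measurable_tw[measurable]: "(\<lambda>\<omega>. tw t \<omega> l) \<in> borel_measurable M"
  and measurable_th[measurable]: "(\<lambda>\<omega>. th t \<omega> l) \<in> borel_measurable M"
  unfolding tw_def th_def by (rule measurable_compose_countable[OF _ measurable_tperm], measurable)+

lemma measurable_tQ[measurable]: "(\<lambda>\<omega>. tQ t \<omega> k) \<in> borel_measurable M"
proof (cases k)
  case (Pair l l')
  have "(\<lambda>\<omega>. Q \<omega> j (tperm t \<omega> l')) \<in> borel_measurable M" for j
    by (rule measurable_compose_countable[OF _ measurable_tperm]) measurable
  then have "(\<lambda>\<omega>. Q \<omega> (tperm t \<omega> l) (tperm t \<omega> l')) \<in> borel_measurable M"
    by (rule measurable_compose_countable[OF _ measurable_tperm])
  then show ?thesis by (simp add: tQ_def Pair)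
qed

lemma measurable_Qm[measurable]: "(\<lambda>\<omega>. Qm \<omega> k) \<in> borel_measurable M"
  by (cases k) simp

lemma tilted_sums:
  assumes "\<omega> \<in> space M" "summable (\<lambda>k. w \<omega> k * exp (t * h \<omega> k))"
  shows "tilted (w \<omega>) (h \<omega>) t sums 1"
  using sums_divide[OF summable_sums[OF assms(2)], of "\<Sum>k. w \<omega> k * exp (t * h \<omega> k)"] tilt_sum_pos[OF assms]
  by (simp add: tilted_def[abs_def])

text \<open>A tilted weight vanishes only where \<open>w\<close> does, and \<open>w\<close> is
  non-increasing. Hence either no tilted weight is 0, or only finitely many are positive.\<close>

lemma sorting_tperm:
  assumes \<omega>: "\<omega> \<in> space M" and sm: "summable (\<lambda>k. w \<omega> k * exp (t * h \<omega> k))"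
  shows "sorting (tilted (w \<omega>) (h \<omega>) t) (tperm t \<omega>)"
  unfolding tperm_def
proof (rule sorting_decreasing_perm, rule sortableI)
  show "0 \<le> tilted (w \<omega>) (h \<omega>) t l" for l by (rule tilted_nonneg[OF \<omega> sm])
  show "summable (tilted (w \<omega>) (h \<omega>) t)" using tilted_sums[OF \<omega> sm] by (rule sums_summable)
  fix l assume "tilted (w \<omega>) (h \<omega>) t l = 0"
  then have "w \<omega> l = 0" using tilt_sum_pos[OF \<omega> sm] by (simp add: tilted_def)
  then have "w \<omega> j = 0" if "l \<le> j" for j
    using decseqD[OF w_decseq[OF \<omega>] that] w_nonneg[OF \<omega>, of j] by simp
  then have "tilted (w \<omega>) (h \<omega>) t j = 0" if "l \<le> j" for j
    using that by (simp add: tilted_def)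
  then have "{j. 0 < tilted (w \<omega>) (h \<omega>) t j} \<subseteq> {..<l}"
    by (intro subsetI) (metis lessThan_iff less_irrefl mem_Collect_eq not_le)
  then show "finite {j. 0 < tilted (w \<omega>) (h \<omega>) t j}" by (rule finite_subset) simp
qed

lemma navg_tilted_eq:
  assumes \<omega>: "\<omega> \<in> space M" and sm: "summable (\<lambda>k. w \<omega> k * exp (t * h \<omega> k))"
    and dep: "\<And>l l'. (\<And>i. i < n \<Longrightarrow> l i = l' i) \<Longrightarrow> G l = G l'"
  shows "navg (tilted (w \<omega>) (h \<omega>) t) n G = navg (tw t \<omega>) n (\<lambda>l. G (\<lambda>i. tperm t \<omega> (l i)))"
proof -
  have "bij (tperm t \<omega>)" using sorting_tperm[OF \<omega> sm] by (simp add: sorting_def)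
  then have "navg (tilted (w \<omega>) (h \<omega>) t) n G = navg (tw t \<omega>) n (\<lambda>l. G (\<lambda>i\<in>{..<n}. tperm t \<omega> (l i)))"
    unfolding tw_def by (rule navg_bij)
  also have "(\<lambda>l. G (\<lambda>i\<in>{..<n}. tperm t \<omega> (l i))) = (\<lambda>l. G (\<lambda>i. tperm t \<omega> (l i)))"
    by (intro ext dep) simp
  finally show ?thesis .
qed

lemma shift_factor_tperm:
  assumes \<omega>: "\<omega> \<in> space M" and sm: "summable (\<lambda>k. w \<omega> k * exp (t * h \<omega> k))"
  shows "shift_factor p' n s (tilted (w \<omega>) (h \<omega>) t) (Qm \<omega>) (\<lambda>i. tperm t \<omega> (l i)) = shift_factor p' n s (tw t \<omega>) (tQ t \<omega>) l"
proof -
  have b: "bij (tperm t \<omega>)" using sorting_tperm[OF \<omega> sm] by (simp add: sorting_def)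
  define f where "f k = tilted (w \<omega>) (h \<omega>) t k * exp (\<Sum>i<n. s i * Q \<omega> (tperm t \<omega> (l i)) k ^ p')" for k
  have "summable f"
  proof (rule summable_comparison_test)
    show "summable (\<lambda>k. tilted (w \<omega>) (h \<omega>) t k * exp (\<Sum>i<n. \<bar>s i\<bar>))"
      by (rule summable_mult2[OF sums_summable[OF tilted_sums[OF \<omega> sm]]])
    have "(\<Sum>i<n. s i * Q \<omega> (tperm t \<omega> (l i)) k ^ p') \<le> (\<Sum>i<n. \<bar>s i\<bar>)" for k
    proof (rule sum_mono)
      fix i
      have "s i * Q \<omega> (tperm t \<omega> (l i)) k ^ p' \<le> \<bar>s i\<bar> * \<bar>Q \<omega> (tperm t \<omega> (l i)) k ^ p'\<bar>"
        by (metis abs_ge_self abs_mult)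
      also have "\<dots> \<le> \<bar>s i\<bar>" using Q_power_abs_le_1[OF \<omega>] by (intro mult_left_le) auto
      finally show "s i * Q \<omega> (tperm t \<omega> (l i)) k ^ p' \<le> \<bar>s i\<bar>" .
    qed
    then show "\<exists>N. \<forall>k\<ge>N. norm (f k) \<le> tilted (w \<omega>) (h \<omega>) t k * exp (\<Sum>i<n. \<bar>s i\<bar>)"
      unfolding f_def using tilted_nonneg[OF \<omega> sm] by (auto simp: abs_mult intro!: mult_left_mono)
  qed
  moreover have "0 \<le> f k" for k
    unfolding f_def using tilted_nonneg[OF \<omega> sm] by simp
  ultimately have "(\<Sum>k. f (tperm t \<omega> k)) = (\<Sum>k. f k)"
    by (intro suminf_bij(1)[OF b])
  then show ?thesis
    by (simp add: shift_factor_def f_def tw_def tQ_def)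
qed

text \<open>Averages do not see the order of the atoms, so sorting can be undone before
  \<open>tilted_mgf\<close> is applied. The outcome no longer contains the field outside the tilted
  weights; after sorting again it is a functional of weights and overlaps alone, whose law stability
  replaces by the original one.\<close>

theorem sorted_tilt_mgf:
  fixes f :: "(nat \<times> nat \<Rightarrow> real) \<Rightarrow> ennreal"
  assumes f[measurable]: "f \<in> borel_measurable (Pi\<^sub>M ({..<n} \<times> {..<n}) (\<lambda>_. borel))"
    and ac: "same_fdd M (\<lambda>\<omega>. case_sum (tw t \<omega>) (tQ t \<omega>)) (\<lambda>\<omega>. case_sum (w \<omega>) (Qm \<omega>))"
  shows "(\<integral>\<^sup>+\<omega>. navg (tw t \<omega>) n (\<lambda>l. f (ovl n (tQ t \<omega>) l) * ennreal (exp (\<Sum>i<n. s i * th t \<omega> (l i)))) \<partial>M) =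
    (\<integral>\<^sup>+z. f (RN n z) * (ennreal (exp (qform p n s (RN n z) / 2)) *
      ennreal (shift_factor p n (\<lambda>i. t * s i) (w (fst z)) (Qm (fst z)) (lab z))) \<partial>N)"
proof -
  define \<Psi> where "\<Psi> x = navg (\<lambda>k. x (Inl k)) n (\<lambda>l. f (ovl n (\<lambda>k. x (Inr k)) l) *
      (ennreal (exp (qform p n s (ovl n (\<lambda>k. x (Inr k)) l) / 2)) *
       ennreal (shift_factor p n (\<lambda>i. t * s i) (\<lambda>k. x (Inl k)) (\<lambda>k. x (Inr k)) l)))"
    for x :: "nat + nat \<times> nat \<Rightarrow> real"
  have c[measurable]: "(\<lambda>z. z k) \<in> borel_measurable (Pi\<^sub>M UNIV (\<lambda>_. borel))" for k :: "nat + nat \<times> nat"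
    by (rule measurable_component_singleton) simp
  have o[measurable]: "(\<lambda>x. ovl n (\<lambda>k. x (Inr k)) l) \<in> Pi\<^sub>M UNIV (\<lambda>_. borel) \<rightarrow>\<^sub>M Pi\<^sub>M ({..<n} \<times> {..<n}) (\<lambda>_. borel :: real measure)"
    for l and dummy :: nat
    by (rule measurable_ovl) measurable
  have s[measurable]: "(\<lambda>x. shift_factor p n (\<lambda>i. t * s i) (\<lambda>k. x (Inl k)) (\<lambda>k. x (Inr k)) l) \<in> borel_measurable (Pi\<^sub>M UNIV (\<lambda>_. borel :: real measure))" for l
    by (rule measurable_shift_factor) measurable
  have \<Psi>[measurable]: "\<Psi> \<in> borel_measurable (Pi\<^sub>M UNIV (\<lambda>_. borel))"
    unfolding \<Psi>_def by (rule measurable_navg) measurable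
  have m1: "(\<lambda>\<omega>. case_sum (tw t \<omega>) (tQ t \<omega>) k) \<in> borel_measurable M" for k by (cases k) auto
  have m2: "(\<lambda>\<omega>. case_sum (w \<omega>) (Qm \<omega>) k) \<in> borel_measurable M" for k by (cases k) auto
  have m1': "(\<lambda>\<omega>. case_sum (tw t \<omega>) (tQ t \<omega>)) \<in> M \<rightarrow>\<^sub>M Pi\<^sub>M UNIV (\<lambda>_. borel)"
    and m2': "(\<lambda>\<omega>. case_sum (w \<omega>) (Qm \<omega>)) \<in> M \<rightarrow>\<^sub>M Pi\<^sub>M UNIV (\<lambda>_. borel)"
    by (rule measurable_PiM_single'; use m1 m2 in simp)+
  have law: "(\<integral>\<^sup>+\<omega>. \<Psi> (case_sum (tw t \<omega>) (tQ t \<omega>)) \<partial>M) = (\<integral>\<^sup>+\<omega>. \<Psi> (case_sum (w \<omega>) (Qm \<omega>)) \<partial>M)"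
  proof -
    have "distr M (Pi\<^sub>M UNIV (\<lambda>_. borel)) (\<lambda>\<omega>. case_sum (tw t \<omega>) (tQ t \<omega>)) = distr M (Pi\<^sub>M UNIV (\<lambda>_. borel)) (\<lambda>\<omega>. case_sum (w \<omega>) (Qm \<omega>))"
      using ac distr_PiM_eq_iff_same_fdd[of "\<lambda>\<omega>. case_sum (tw t \<omega>) (tQ t \<omega>)" M "\<lambda>\<omega>. case_sum (w \<omega>) (Qm \<omega>)", OF m1 m2 prob_space_axioms] by simp
    then have "(\<integral>\<^sup>+x. \<Psi> x \<partial>distr M (Pi\<^sub>M UNIV (\<lambda>_. borel)) (\<lambda>\<omega>. case_sum (tw t \<omega>) (tQ t \<omega>))) =
      (\<integral>\<^sup>+x. \<Psi> x \<partial>distr M (Pi\<^sub>M UNIV (\<lambda>_. borel)) (\<lambda>\<omega>. case_sum (w \<omega>) (Qm \<omega>)))" by simp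
    then show ?thesis
      by (simp add: nn_integral_distr[OF m1'] nn_integral_distr[OF m2'])
  qed
  have qf: "(\<Sum>i<n. \<Sum>j<n. s i * s j * Q \<omega> (l i) (l j) ^ p) = qform p n s (ovl n (Qm \<omega>) l)" for \<omega> l
    by (simp add: qform_def ovl_def)
  have ovlp: "ovl n (Qm \<omega>) (\<lambda>i. tperm t \<omega> (l i)) = ovl n (tQ t \<omega>) l" for \<omega> l
    by (simp add: ovl_def tQ_def)
  have "(\<integral>\<^sup>+\<omega>. navg (tw t \<omega>) n (\<lambda>l. f (ovl n (tQ t \<omega>) l) * ennreal (exp (\<Sum>i<n. s i * th t \<omega> (l i)))) \<partial>M) =
    (\<integral>\<^sup>+\<omega>. navg (tilted (w \<omega>) (h \<omega>) t) n (\<lambda>l. f (ovl n (Qm \<omega>) l) * ennreal (exp (\<Sum>i<n. s i * h \<omega> (l i)))) \<partial>M)"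
  proof (rule nn_integral_cong_AE, rule AE_mp[OF AE_summable_tilt[of t]], intro AE_I2 impI)
    fix \<omega> assume \<omega>: "\<omega> \<in> space M" "summable (\<lambda>k. w \<omega> k * exp (t * h \<omega> k))"
    show "navg (tw t \<omega>) n (\<lambda>l. f (ovl n (tQ t \<omega>) l) * ennreal (exp (\<Sum>i<n. s i * th t \<omega> (l i)))) =
      navg (tilted (w \<omega>) (h \<omega>) t) n (\<lambda>l. f (ovl n (Qm \<omega>) l) * ennreal (exp (\<Sum>i<n. s i * h \<omega> (l i))))"
    proof (subst navg_tilted_eq[OF \<omega>])
      show "f (ovl n (Qm \<omega>) l) * ennreal (exp (\<Sum>i<n. s i * h \<omega> (l i))) =
          f (ovl n (Qm \<omega>) l') * ennreal (exp (\<Sum>i<n. s i * h \<omega> (l' i)))" if "\<And>i. i < n \<Longrightarrow> l i = l' i" for l l'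
        using ovl_cong[of n l l'] that by simp
    qed (simp add: ovlp th_def)
  qed
  also have "\<dots> = (\<integral>\<^sup>+\<omega>. navg (tilted (w \<omega>) (h \<omega>) t) n (\<lambda>l. f (ovl n (Qm \<omega>) l) *
        (ennreal (exp (qform p n s (ovl n (Qm \<omega>) l) / 2)) *
         ennreal (shift_factor p n (\<lambda>i. t * s i) (tilted (w \<omega>) (h \<omega>) t) (Qm \<omega>) l))) \<partial>M)"
    using tilted_mgf[OF f, of t s] by (simp only: qf)
  also have "\<dots> = (\<integral>\<^sup>+\<omega>. \<Psi> (case_sum (tw t \<omega>) (tQ t \<omega>)) \<partial>M)"
  proof (rule nn_integral_cong_AE, rule AE_mp[OF AE_summable_tilt[of t]], intro AE_I2 impI)
    fix \<omega> assume \<omega>: "\<omega> \<in> space M" "summable (\<lambda>k. w \<omega> k * exp (t * h \<omega> k))"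
    show "navg (tilted (w \<omega>) (h \<omega>) t) n (\<lambda>l. f (ovl n (Qm \<omega>) l) *
        (ennreal (exp (qform p n s (ovl n (Qm \<omega>) l) / 2)) *
         ennreal (shift_factor p n (\<lambda>i. t * s i) (tilted (w \<omega>) (h \<omega>) t) (Qm \<omega>) l))) = \<Psi> (case_sum (tw t \<omega>) (tQ t \<omega>))"
    proof (subst navg_tilted_eq[OF \<omega>])
      show "f (ovl n (Qm \<omega>) l) * (ennreal (exp (qform p n s (ovl n (Qm \<omega>) l) / 2)) *
          ennreal (shift_factor p n (\<lambda>i. t * s i) (tilted (w \<omega>) (h \<omega>) t) (Qm \<omega>) l)) =
        f (ovl n (Qm \<omega>) l') * (ennreal (exp (qform p n s (ovl n (Qm \<omega>) l') / 2)) *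
          ennreal (shift_factor p n (\<lambda>i. t * s i) (tilted (w \<omega>) (h \<omega>) t) (Qm \<omega>) l'))"
        if "\<And>i. i < n \<Longrightarrow> l i = l' i" for l l'
        using ovl_cong[of n l l'] shift_factor_cong[of n l l'] that by simp
    qed (simp add: ovlp \<Psi>_def shift_factor_tperm[OF \<omega>])
  qed
  also have "\<dots> = (\<integral>\<^sup>+\<omega>. navg (w \<omega>) n (\<lambda>l. f (ovl n (Qm \<omega>) l) *
      (ennreal (exp (qform p n s (ovl n (Qm \<omega>) l) / 2)) *
       ennreal (shift_factor p n (\<lambda>i. t * s i) (w \<omega>) (Qm \<omega>) l))) \<partial>M)"
    unfolding law by (simp add: \<Psi>_def)
  also have "\<dots> = (\<integral>\<^sup>+z. f (RN n z) * (ennreal (exp (qform p n s (ovl n (Qm (fst z)) (lab z)) / 2)) *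
      ennreal (shift_factor p n (\<lambda>i. t * s i) (w (fst z)) (Qm (fst z)) (lab z))) \<partial>N)"
  proof (rule nn_integral_navg_RN[OF f])
    note [measurable] = measurable_ovl[OF measurable_Qm] measurable_shift_factor[OF measurable_w measurable_Qm]
    show "(\<lambda>\<omega>. ennreal (exp (qform p n s (ovl n (Qm \<omega>) l) / 2)) *
         ennreal (shift_factor p n (\<lambda>i. t * s i) (w \<omega>) (Qm \<omega>) l)) \<in> borel_measurable M" for l
      by measurable
  qed (metis ovl_cong shift_factor_cong)
  finally show ?thesis by (simp add: RN_eq_ovl)
qed

text \<open>The case \<open>t = 0\<close> of \<open>tilted_mgf\<close>, where the weights are
  unchanged and the shift has no effect on them.\<close>

theorem untilted_mgf:
  fixes f :: "(nat \<times> nat \<Rightarrow> real) \<Rightarrow> ennreal"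
  assumes f[measurable]: "f \<in> borel_measurable (Pi\<^sub>M ({..<n} \<times> {..<n}) (\<lambda>_. borel))"
  shows "(\<integral>\<^sup>+\<omega>. navg (w \<omega>) n (\<lambda>l. f (ovl n (Qm \<omega>) l) * ennreal (exp (\<Sum>i<n. s i * h \<omega> (l i)))) \<partial>M) =
    (\<integral>\<^sup>+z. f (RN n z) * ennreal (exp (qform p n s (RN n z) / 2)) \<partial>N)"
proof -
  have t0: "tilted (w \<omega>) (h \<omega>) 0 = w \<omega>" if "\<omega> \<in> space M" for \<omega>
    using w_sums[OF that] by (auto simp: tilted_def fun_eq_iff sums_iff)
  have s0: "shift_factor p n (\<lambda>i. 0 * s i) (w \<omega>) (Qm \<omega>) l = 1" if "\<omega> \<in> space M" for \<omega> l
    using w_sums[OF that] by (simp add: shift_factor_def sums_iff)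
  have qf: "(\<Sum>i<n. \<Sum>j<n. s i * s j * Q \<omega> (l i) (l j) ^ p) = qform p n s (ovl n (Qm \<omega>) l)" for \<omega> l
    by (simp add: qform_def ovl_def)
  note [measurable] = measurable_ovl[OF measurable_Qm]
  have "(\<integral>\<^sup>+\<omega>. navg (w \<omega>) n (\<lambda>l. f (ovl n (Qm \<omega>) l) * ennreal (exp (\<Sum>i<n. s i * h \<omega> (l i)))) \<partial>M) =
    (\<integral>\<^sup>+\<omega>. navg (w \<omega>) n (\<lambda>l. f (ovl n (Qm \<omega>) l) * ennreal (exp (qform p n s (ovl n (Qm \<omega>) l) / 2))) \<partial>M)"
    using tilted_mgf[OF f, of 0 s] by (simp add: t0 s0[simplified] qf cong: nn_integral_cong)
  also have "\<dots> = (\<integral>\<^sup>+z. f (RN n z) * ennreal (exp (qform p n s (ovl n (Qm (fst z)) (lab z)) / 2)) \<partial>N)"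
    by (rule nn_integral_navg_RN[OF f]) (measurable, metis ovl_cong)
  finally show ?thesis by (simp add: RN_eq_ovl)
qed

end

section \<open>Consequences of the Ghirlanda-Guerra identities\<close>

text \<open>Each fibre contributes 1 in total. It serves to write the number of occupied atoms as a
  function of the overlaps, as a test function in the identities has to be.\<close>

lemma sum_inverse_fibre_card:
  assumes "finite A"
  shows "(\<Sum>i\<in>A. 1 / real (card {j \<in> A. g j = g i})) = real (card (g ` A))"
proof -
  have "(\<Sum>i\<in>A. 1 / real (card {j \<in> A. g j = g i})) =
    (\<Sum>y\<in>g ` A. \<Sum>i\<in>{i \<in> A. g i = y}. 1 / real (card {j \<in> A. g j = g i}))"
    by (rule sum.image_gen[OF assms])
  also have "\<dots> = (\<Sum>y\<in>g ` A. 1)"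
  proof (rule sum.cong[OF refl])
    fix y assume "y \<in> g ` A"
    then have "{i \<in> A. g i = y} \<noteq> {}" by auto
    moreover have "(\<Sum>i\<in>{i \<in> A. g i = y}. 1 / real (card {j \<in> A. g j = g i})) =
      (\<Sum>i\<in>{i \<in> A. g i = y}. 1 / real (card {j \<in> A. g j = y}))"
      by (intro sum.cong) auto
    ultimately show "(\<Sum>i\<in>{i \<in> A. g i = y}. 1 / real (card {j \<in> A. g j = g i})) = 1"
      using assms by simp
  qed
  finally show ?thesis by simp
qed

text \<open>With L > 0 step n would lose at least c L / n. The harmonic series diverges, so the
  sequence could not stay above L.\<close>

lemma decay_to_zero:
  fixes e :: "nat \<Rightarrow> real"
  assumes c: "0 < c" and e: "\<And>n. n0 \<le> n \<Longrightarrow> e (Suc n) \<le> e n - c / real n * e n"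
    and L: "\<And>n. n0 \<le> n \<Longrightarrow> L \<le> e n" and n0: "0 < n0"
  shows "L \<le> 0"
proof (rule ccontr)
  assume "\<not> L \<le> 0"
  then have L0: "0 < L" by simp
  have tel: "c * L * (\<Sum>k<m. 1 / real (n0 + k)) \<le> e n0 - e (n0 + m)" for m
  proof (induction m)
    case (Suc m)
    have "c * L * (1 / real (n0 + m)) \<le> c / real (n0 + m) * e (n0 + m)"
      using c L[of "n0 + m"] n0 by (simp add: divide_right_mono mult_left_mono)
    then show ?case using Suc e[of "n0 + m"] by (simp add: distrib_left)
  qed simp
  have "(\<Sum>k<m. 1 / real (n0 + k)) \<le> e n0 / (c * L)" for m
  proof -
    have "c * L * (\<Sum>k<m. 1 / real (n0 + k)) \<le> e n0"
      using tel[of m] L[of "n0 + m"] L0 by simp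
    then show ?thesis using c L0 by (simp add: pos_le_divide_eq mult.commute)
  qed
  then have "summable (\<lambda>k. 1 / real (n0 + k))"
    by (intro summableI_nonneg_bounded) auto
  then have "summable (\<lambda>k. 1 / real (k + n0))" by (simp add: add.commute)
  then have "summable (\<lambda>k. 1 / real k)" by (subst (asm) summable_iff_shift[of "\<lambda>k. 1 / real k"])
  then show False
    using not_summable_harmonic[where 'a = real] unfolding inverse_eq_divide by contradiction
qed

section \<open>The identities for general functions of an overlap\<close>

context random_atoms
begin

context
  fixes n i :: nat and f :: "(nat \<times> nat \<Rightarrow> real) \<Rightarrow> real" and B :: real
  assumes gg: "ghirlanda_guerra M w \<xi>" and n: "2 \<le> n" "i < n"
    and f[measurable]: "f \<in> borel_measurable (Pi\<^sub>M ({..<n} \<times> {..<n}) (\<lambda>_. borel))"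
    and B: "\<And>z. z \<in> space N \<Longrightarrow> \<bar>f (RN n z)\<bar> \<le> B"
begin

text \<open>Left side minus right side of the identity, with \<psi> in place of the power and before
  the average against \<open>f\<close>. It is linear and uniformly continuous in \<psi>, which
  carries the identities over to limits.\<close>

definition gg_diff :: "(real \<Rightarrow> real) \<Rightarrow> 'a \<times> (nat \<Rightarrow> real) \<Rightarrow> real" where
  "gg_diff \<psi> z = real n * \<psi> (R z i n) - (\<integral>z. \<psi> (R z 0 1) \<partial>N) - (\<Sum>l\<in>{..<n} - {i}. \<psi> (R z i l))"

lemma measurable_gg_diff[measurable (raw)]:
  assumes [measurable]: "\<psi> \<in> borel_measurable borel"
  shows "gg_diff \<psi> \<in> borel_measurable N"
  unfolding gg_diff_def[abs_def] by measurable

lemma integrable_R: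
  fixes \<psi> :: "real \<Rightarrow> real"
  assumes [measurable]: "\<psi> \<in> borel_measurable borel" and "\<And>x. x \<in> {-1..1} \<Longrightarrow> \<bar>\<psi> x\<bar> \<le> C"
  shows "integrable N (\<lambda>z. \<psi> (R z a b))"
proof (rule integrable_N_bounded)
  show "\<bar>\<psi> (R z a b)\<bar> \<le> C" if "z \<in> space N" for z
    using R_abs_le_1[OF that, of a b] by (intro assms) (auto simp: abs_le_iff)
qed measurable

lemma gg_diff_close:
  assumes \<psi>: "\<psi> \<in> borel_measurable borel" "\<And>x. x \<in> {-1..1} \<Longrightarrow> \<bar>\<psi> x\<bar> \<le> C"
    and \<psi>': "\<psi>' \<in> borel_measurable borel" "\<And>x. x \<in> {-1..1} \<Longrightarrow> \<bar>\<psi>' x\<bar> \<le> C'"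
    and close: "\<And>x. x \<in> {-1..1} \<Longrightarrow> \<bar>\<psi> x - \<psi>' x\<bar> \<le> \<epsilon>" and z: "z \<in> space N"
  shows "\<bar>gg_diff \<psi> z - gg_diff \<psi>' z\<bar> \<le> (2 * real n + 1) * \<epsilon>"
proof -
  have R: "\<bar>\<psi> (R z a b) - \<psi>' (R z a b)\<bar> \<le> \<epsilon>" if "z \<in> space N" for z a b
    using R_abs_le_1[OF that, of a b] by (intro close) (auto simp: abs_le_iff)
  have \<epsilon>: "0 \<le> \<epsilon>" using R[OF z, of 0 0] by linarith
  note i1 = integrable_R[OF \<psi>] and i2 = integrable_R[OF \<psi>']
  have "\<bar>(\<integral>z. \<psi> (R z 0 1) \<partial>N) - (\<integral>z. \<psi>' (R z 0 1) \<partial>N)\<bar> = \<bar>\<integral>z. \<psi> (R z 0 1) - \<psi>' (R z 0 1) \<partial>N\<bar>"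
    using i1 i2 by simp
  also have "\<dots> \<le> (\<integral>z. \<bar>\<psi> (R z 0 1) - \<psi>' (R z 0 1)\<bar> \<partial>N)"
    using integral_norm_bound[of N "\<lambda>z. \<psi> (R z 0 1) - \<psi>' (R z 0 1)"] by simp
  also have "\<dots> \<le> (\<integral>z. \<epsilon> \<partial>N)"
    using i1 i2 R by (intro Bochner_Integration.integral_mono) auto
  finally have 1: "\<bar>(\<integral>z. \<psi> (R z 0 1) \<partial>N) - (\<integral>z. \<psi>' (R z 0 1) \<partial>N)\<bar> \<le> \<epsilon>"
    by (simp add: MN.P.prob_space)
  have "\<bar>\<Sum>l\<in>{..<n} - {i}. \<psi> (R z i l) - \<psi>' (R z i l)\<bar> \<le> (\<Sum>l\<in>{..<n} - {i}. \<epsilon>)"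
    by (intro order_trans[OF sum_abs] sum_mono R z)
  also have "\<dots> \<le> real n * \<epsilon>" using \<epsilon> n by (simp add: mult_right_mono)
  finally have 2: "\<bar>\<Sum>l\<in>{..<n} - {i}. \<psi> (R z i l) - \<psi>' (R z i l)\<bar> \<le> real n * \<epsilon>" .
  have 3: "\<bar>real n * (\<psi> (R z i n) - \<psi>' (R z i n))\<bar> \<le> real n * \<epsilon>"
    using R[OF z, of i n] by (simp add: abs_mult mult_left_mono)
  have "gg_diff \<psi> z - gg_diff \<psi>' z = real n * (\<psi> (R z i n) - \<psi>' (R z i n)) -
    ((\<integral>z. \<psi> (R z 0 1) \<partial>N) - (\<integral>z. \<psi>' (R z 0 1) \<partial>N)) - (\<Sum>l\<in>{..<n} - {i}. \<psi> (R z i l) - \<psi>' (R z i l))"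
    by (simp add: gg_diff_def right_diff_distrib sum_subtractf)
  then show ?thesis using 1 2 3 by (simp add: distrib_right abs_le_iff)
qed

lemma integrable_f_gg_diff:
  assumes \<psi>: "\<psi> \<in> borel_measurable borel" "\<And>x. x \<in> {-1..1} \<Longrightarrow> \<bar>\<psi> x\<bar> \<le> C"
  shows "integrable N (\<lambda>z. f (RN n z) * gg_diff \<psi> z)"
proof (rule integrable_f[OF gg n order_refl f B, where K = "(2 * real n + 1) * C"])
  show "\<bar>gg_diff \<psi> z\<bar> \<le> (2 * real n + 1) * C" if z: "z \<in> space N" for z
  proof -
    have "gg_diff (\<lambda>_. 0) z = 0" by (simp add: gg_diff_def)
    then show ?thesis
      using gg_diff_close[OF \<psi>, of "\<lambda>_. 0" 0 C z] \<psi>(2) z by simp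
  qed
qed (use \<psi> in measurable)

lemma gg_diff_eq:
  assumes \<psi>: "\<psi> \<in> borel_measurable borel" "\<And>x. x \<in> {-1..1} \<Longrightarrow> \<bar>\<psi> x\<bar> \<le> C"
  shows "(\<integral>z. f (RN n z) * gg_diff \<psi> z \<partial>N) = real n * (\<integral>z. f (RN n z) * \<psi> (R z i n) \<partial>N)
    - (\<integral>z. f (RN n z) \<partial>N) * (\<integral>z. \<psi> (R z 0 1) \<partial>N) - (\<Sum>l\<in>{..<n} - {i}. \<integral>z. f (RN n z) * \<psi> (R z i l) \<partial>N)"
proof -
  have R: "\<bar>\<psi> (R z a b)\<bar> \<le> C" if "z \<in> space N" for z a b
    using R_abs_le_1[OF that, of a b] by (intro \<psi>) (auto simp: abs_le_iff)
  have int: "integrable N (\<lambda>z. f (RN n z) * \<psi> (R z a b))" for a b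
    by (rule integrable_f[OF gg n order_refl f B, where K = C]) (use R \<psi>(1) in auto)
  have int0: "integrable N (\<lambda>z. f (RN n z))"
    by (rule integrable_N_bounded[OF _ B]) (use f in measurable)
  have "(\<integral>z. f (RN n z) * gg_diff \<psi> z \<partial>N) = (\<integral>z. real n * (f (RN n z) * \<psi> (R z i n)) -
      f (RN n z) * (\<integral>z. \<psi> (R z 0 1) \<partial>N) - (\<Sum>l\<in>{..<n} - {i}. f (RN n z) * \<psi> (R z i l)) \<partial>N)"
    by (simp add: gg_diff_def right_diff_distrib sum_distrib_left mult_ac)
  also have "\<dots> = (\<integral>z. real n * (f (RN n z) * \<psi> (R z i n)) \<partial>N) - (\<integral>z. f (RN n z) * (\<integral>z. \<psi> (R z 0 1) \<partial>N) \<partial>N)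
      - (\<integral>z. (\<Sum>l\<in>{..<n} - {i}. f (RN n z) * \<psi> (R z i l)) \<partial>N)"
  proof -
    have a: "integrable N (\<lambda>z. real n * (f (RN n z) * \<psi> (R z i n)))"
      "integrable N (\<lambda>z. f (RN n z) * (\<integral>z. \<psi> (R z 0 1) \<partial>N))"
      "integrable N (\<lambda>z. \<Sum>l\<in>{..<n} - {i}. f (RN n z) * \<psi> (R z i l))"
      using int int0 by (auto intro!: Bochner_Integration.integrable_sum)
    show ?thesis
      by (simp only: Bochner_Integration.integral_diff[OF Bochner_Integration.integrable_diff[OF a(1,2)] a(3)]
          Bochner_Integration.integral_diff[OF a(1,2)])
  qed
  finally show ?thesis
    using int by (simp add: Bochner_Integration.integral_sum)
qed

lemma gg_diff_polynomial:
  "(\<integral>z. f (RN n z) * gg_diff (\<lambda>x. \<Sum>k\<le>d. \<alpha> k * x ^ k) z \<partial>N) = 0"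
proof -
  have bd: "\<bar>x ^ k\<bar> \<le> 1" if "x \<in> {-1..1}" for x :: real and k
    using that by (simp add: power_abs power_le_one abs_le_iff)
  have mono: "(\<integral>z. f (RN n z) * gg_diff (\<lambda>x. x ^ k) z \<partial>N) = 0" for k
  proof (cases "k = 0")
    case True
    \<comment> \<open>The identities start with the first power; for a constant both sides agree
      because n = 1 + (n - 1).\<close>
    have "gg_diff (\<lambda>x. x ^ k) z = 0" for z
      using n True by (simp add: gg_diff_def MN.P.prob_space of_nat_diff)
    then show ?thesis by simp
  next
    case False
    then show ?thesis
      using gg_diff_eq[of "\<lambda>x. x ^ k" 1] bd ghirlanda_guerra_N[OF gg n _ f B, of k] by (simp add: mom_def)
  qed
  have "integrable N (\<lambda>z. R z 0 1 ^ k)" for k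
    by (rule integrable_R[of "\<lambda>x. x ^ k" 1]) (use bd in auto)
  then have "gg_diff (\<lambda>x. \<Sum>k\<le>d. \<alpha> k * x ^ k) z = (\<Sum>k\<le>d. \<alpha> k * gg_diff (\<lambda>x. x ^ k) z)" for z
    unfolding gg_diff_def
    by (simp add: Bochner_Integration.integral_sum right_diff_distrib sum_subtractf sum_distrib_left mult_ac)
      (subst sum.swap, simp)
  then have "(\<integral>z. f (RN n z) * gg_diff (\<lambda>x. \<Sum>k\<le>d. \<alpha> k * x ^ k) z \<partial>N) =
    (\<integral>z. (\<Sum>k\<le>d. \<alpha> k * (f (RN n z) * gg_diff (\<lambda>x. x ^ k) z)) \<partial>N)"
    by (simp add: sum_distrib_left mult_ac)
  also have "\<dots> = (\<Sum>k\<le>d. \<integral>z. \<alpha> k * (f (RN n z) * gg_diff (\<lambda>x. x ^ k) z) \<partial>N)"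
    by (intro Bochner_Integration.integral_sum integrable_mult_right integrable_f_gg_diff[where C = 1]) (use bd in auto)
  finally show ?thesis by (simp add: mono)
qed

lemma gg_diff_continuous:
  assumes \<psi>: "continuous_on UNIV \<psi>"
  shows "(\<integral>z. f (RN n z) * gg_diff \<psi> z \<partial>N) = 0"
proof -
  have B0: "0 \<le> B" using B MN.P.not_empty by (metis abs_ge_zero all_not_in_conv order_trans)
  have bounded: "\<exists>C. \<forall>x\<in>{-1..1}. \<bar>u x\<bar> \<le> C" if "continuous_on UNIV u" for u :: "real \<Rightarrow> real"
  proof -
    have "compact (u ` {-1..1})"
      using that by (intro compact_continuous_image) (auto intro: continuous_on_subset)
    then show ?thesis
      using compact_imp_bounded[of "u ` {-1..1}"] unfolding bounded_iff by auto
  qed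
  have m: "u \<in> borel_measurable borel" if "continuous_on UNIV u" for u :: "real \<Rightarrow> real"
    using that by (rule borel_measurable_continuous_onI)
  obtain C where "\<forall>x\<in>{-1..1}. \<bar>\<psi> x\<bar> \<le> C" using bounded[OF \<psi>] by blast
  then have C: "\<bar>\<psi> x\<bar> \<le> C" if "x \<in> {-1..1}" for x using that by blast
  have "\<bar>\<integral>z. f (RN n z) * gg_diff \<psi> z \<partial>N\<bar> \<le> 0 + e" if e: "0 < e" for e
  proof -
    define \<epsilon> where "\<epsilon> = e / ((B + 1) * (2 * real n + 1))"
    have \<epsilon>: "0 < \<epsilon>" using e B0 by (simp add: \<epsilon>_def)
    obtain g where g: "real_polynomial_function g" "\<And>x. x \<in> {-1..1} \<Longrightarrow> \<bar>\<psi> x - g x\<bar> < \<epsilon>"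
      using Stone_Weierstrass_real_polynomial_function[OF compact_Icc continuous_on_subset[OF \<psi> subset_UNIV] \<epsilon>, of "-1" 1] by blast
    obtain \<alpha> d where gd: "g = (\<lambda>x. \<Sum>k\<le>d. \<alpha> k * x ^ k)"
      using g(1) real_polynomial_function_iff_sum by blast
    have gc: "continuous_on UNIV g" unfolding gd by (intro continuous_intros)
    obtain C' where "\<forall>x\<in>{-1..1}. \<bar>g x\<bar> \<le> C'" using bounded[OF gc] by blast
    then have C': "\<bar>g x\<bar> \<le> C'" if "x \<in> {-1..1}" for x using that by blast
    note i1 = integrable_f_gg_diff[OF m[OF \<psi>] C] and i2 = integrable_f_gg_diff[OF m[OF gc] C']
    have ii: "integrable N (\<lambda>z. f (RN n z) * (gg_diff \<psi> z - gg_diff g z))"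
      using Bochner_Integration.integrable_diff[OF i1 i2] by (simp only: right_diff_distrib)
    have d: "\<bar>gg_diff \<psi> z - gg_diff g z\<bar> \<le> (2 * real n + 1) * \<epsilon>" if z: "z \<in> space N" for z
    proof (rule gg_diff_close[where C = C and C' = C'])
      show "\<psi> \<in> borel_measurable borel" "g \<in> borel_measurable borel"
        using m \<psi> gc by blast+
      fix x :: real assume x: "x \<in> {-1..1}"
      show "\<bar>\<psi> x\<bar> \<le> C" "\<bar>g x\<bar> \<le> C'" "\<bar>\<psi> x - g x\<bar> \<le> \<epsilon>"
        using C[OF x] C'[OF x] g(2)[OF x] by auto
    qed (rule z)
    have bnd: "\<bar>f (RN n z) * (gg_diff \<psi> z - gg_diff g z)\<bar> \<le> B * ((2 * real n + 1) * \<epsilon>)" if z: "z \<in> space N" for z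
      using mult_mono[OF B[OF z] d[OF z] B0 abs_ge_zero] by (simp only: abs_mult)
    have eq: "(\<integral>z. f (RN n z) * gg_diff \<psi> z \<partial>N) = (\<integral>z. f (RN n z) * (gg_diff \<psi> z - gg_diff g z) \<partial>N)"
      using Bochner_Integration.integral_diff[OF i1 i2] gg_diff_polynomial[of \<alpha> d]
      by (simp only: right_diff_distrib gd diff_0_right)
    have "\<bar>\<integral>z. f (RN n z) * gg_diff \<psi> z \<partial>N\<bar> \<le> (\<integral>z. \<bar>f (RN n z) * (gg_diff \<psi> z - gg_diff g z)\<bar> \<partial>N)"
      unfolding eq by (rule integral_abs_bound)
    also have "\<dots> \<le> (\<integral>z. B * ((2 * real n + 1) * \<epsilon>) \<partial>N)"
      by (rule Bochner_Integration.integral_mono[OF integrable_abs[OF ii] _ bnd]) simp_all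
    also have "\<dots> = e * (B / (B + 1))"
      using B0 n by (simp add: \<epsilon>_def MN.P.prob_space)
    also have "\<dots> \<le> e * 1"
      using B0 e by (intro mult_left_mono) auto
    finally show ?thesis by simp
  qed
  then have "\<bar>\<integral>z. f (RN n z) * gg_diff \<psi> z \<partial>N\<bar> \<le> 0" by (rule field_le_epsilon)
  then show ?thesis by simp
qed

text \<open>Indicators of half-lines and of points are bounded pointwise limits of continuous
  functions, so dominated convergence extends the identities to them.\<close>

lemma gg_pointwise_limit:
  fixes \<psi> :: "real \<Rightarrow> real"
  assumes c: "\<And>k. continuous_on UNIV (u k)" and b: "\<And>k x. \<bar>u k x\<bar> \<le> 1" and lim: "\<And>x. (\<lambda>k. u k x) \<longlonglongrightarrow> \<psi> x"
  shows "real n * (\<integral>z. f (RN n z) * \<psi> (R z i n) \<partial>N) = (\<integral>z. f (RN n z) \<partial>N) * (\<integral>z. \<psi> (R z 0 1) \<partial>N)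
    + (\<Sum>l\<in>{..<n} - {i}. \<integral>z. f (RN n z) * \<psi> (R z i l) \<partial>N)"
proof -
  have um[measurable]: "u k \<in> borel_measurable borel" for k
    using c by (rule borel_measurable_continuous_onI)
  have [measurable]: "\<psi> \<in> borel_measurable borel"
    by (rule borel_measurable_LIMSEQ_real[OF lim um])
  have l1: "(\<lambda>k. \<integral>z. f (RN n z) * u k (R z a b) \<partial>N) \<longlonglongrightarrow> (\<integral>z. f (RN n z) * \<psi> (R z a b) \<partial>N)" for a b
  proof (rule integral_dominated_convergence[where w = "\<lambda>z. \<bar>f (RN n z)\<bar>"])
    show "integrable N (\<lambda>z. \<bar>f (RN n z)\<bar>)"
      by (rule integrable_N_bounded[where B = B]) (use B in auto)
    show "AE z in N. norm (f (RN n z) * u k (R z a b)) \<le> \<bar>f (RN n z)\<bar>" for k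
      using b by (auto simp: abs_mult intro!: mult_left_le)
    show "AE z in N. (\<lambda>k. f (RN n z) * u k (R z a b)) \<longlonglongrightarrow> f (RN n z) * \<psi> (R z a b)"
      by (intro AE_I2 tendsto_mult tendsto_const lim)
  qed measurable
  have l2: "(\<lambda>k. \<integral>z. u k (R z 0 1) \<partial>N) \<longlonglongrightarrow> (\<integral>z. \<psi> (R z 0 1) \<partial>N)"
    by (rule integral_dominated_convergence[where w = "\<lambda>_. 1"]) (use b lim in auto)
  have eq: "real n * (\<integral>z. f (RN n z) * u k (R z i n) \<partial>N) = (\<integral>z. f (RN n z) \<partial>N) * (\<integral>z. u k (R z 0 1) \<partial>N)
    + (\<Sum>l\<in>{..<n} - {i}. \<integral>z. f (RN n z) * u k (R z i l) \<partial>N)" for k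
    using gg_diff_continuous[OF c, of k] gg_diff_eq[OF um b, of k] by simp
  have "(\<lambda>k. real n * (\<integral>z. f (RN n z) * u k (R z i n) \<partial>N)) \<longlonglongrightarrow> real n * (\<integral>z. f (RN n z) * \<psi> (R z i n) \<partial>N)"
    by (intro tendsto_intros l1)
  moreover have "(\<lambda>k. real n * (\<integral>z. f (RN n z) * u k (R z i n) \<partial>N)) \<longlonglongrightarrow>
    (\<integral>z. f (RN n z) \<partial>N) * (\<integral>z. \<psi> (R z 0 1) \<partial>N) + (\<Sum>l\<in>{..<n} - {i}. \<integral>z. f (RN n z) * \<psi> (R z i l) \<partial>N)"
    unfolding eq by (intro tendsto_intros l1 l2)
  ultimately show ?thesis by (rule LIMSEQ_unique)
qed

lemma gg_greater:
  "real n * (\<integral>z. f (RN n z) * (if a < R z i n then 1 else 0) \<partial>N) =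
    (\<integral>z. f (RN n z) \<partial>N) * (\<integral>z. (if a < R z 0 1 then 1 else 0) \<partial>N)
    + (\<Sum>l\<in>{..<n} - {i}. \<integral>z. f (RN n z) * (if a < R z i l then 1 else 0) \<partial>N)"
proof (rule gg_pointwise_limit[where u = "\<lambda>k x. min 1 (real k * max 0 (x - a))" and \<psi> = "\<lambda>x. if a < x then 1 else 0"])
  show "(\<lambda>k. min 1 (real k * max 0 (x - a))) \<longlonglongrightarrow> (if a < x then 1 else 0)" for x
  proof (cases "a < x")
    case True
    obtain K where K: "1 / (x - a) \<le> real K" using real_arch_simple by blast
    have "min 1 (real k * max 0 (x - a)) = 1" if "K \<le> k" for k
    proof -
      have "1 / (x - a) \<le> real k" using K that by linarith
      then show ?thesis using True by (simp add: field_simps)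
    qed
    then show ?thesis
      using True by (intro tendsto_eventually) (auto simp: eventually_sequentially intro!: exI[of _ K])
  qed simp
qed (auto intro!: continuous_intros)

lemma gg_equal:
  "real n * (\<integral>z. f (RN n z) * (if R z i n = a then 1 else 0) \<partial>N) =
    (\<integral>z. f (RN n z) \<partial>N) * (\<integral>z. (if R z 0 1 = a then 1 else 0) \<partial>N)
    + (\<Sum>l\<in>{..<n} - {i}. \<integral>z. f (RN n z) * (if R z i l = a then 1 else 0) \<partial>N)"
proof (rule gg_pointwise_limit[where u = "\<lambda>k x. max 0 (1 - real k * \<bar>x - a\<bar>)" and \<psi> = "\<lambda>x. if x = a then 1 else 0"])
  show "(\<lambda>k. max 0 (1 - real k * \<bar>x - a\<bar>)) \<longlonglongrightarrow> (if x = a then 1 else 0)" for x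
  proof (cases "x = a")
    case False
    then have p: "0 < \<bar>x - a\<bar>" by simp
    obtain K where K: "1 / \<bar>x - a\<bar> \<le> real K" using real_arch_simple by blast
    have "max 0 (1 - real k * \<bar>x - a\<bar>) = 0" if "K \<le> k" for k
    proof -
      have "1 / \<bar>x - a\<bar> \<le> real k" using K that by linarith
      then have "1 \<le> real k * \<bar>x - a\<bar>" using p by (simp add: pos_divide_le_eq)
      then show ?thesis by simp
    qed
    then show ?thesis
      using False by (intro tendsto_eventually) (auto simp: eventually_sequentially intro!: exI[of _ K])
  qed simp
qed (auto intro!: continuous_intros)

end

end

section \<open>The right edge of the overlap distribution and the sphere\<close>

context random_atoms
begin

text \<open>A tuple of labels with positive weights is sampled with positive conditional
  probability. What holds almost surely for replicas therefore holds for all such tuples of atoms,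
  repetitions included.\<close>

lemma AE_labels_imp:
  assumes P[measurable]: "\<And>l. Measurable.pred M (\<lambda>\<omega>. P \<omega> l)"
    and ae: "AE z in N. P (fst z) (labels n (w (fst z)) (snd z))"
  shows "AE \<omega> in M. \<forall>l\<in>{..<n} \<rightarrow>\<^sub>E UNIV. (\<forall>i<n. 0 < w \<omega> (l i)) \<longrightarrow> P \<omega> l"
proof -
  define H where "H \<omega> l = (if P \<omega> l then 0 else 1 :: ennreal)" for \<omega> l
  have Hm[measurable]: "(\<lambda>\<omega>. H \<omega> l) \<in> borel_measurable M" for l
    unfolding H_def by measurable
  have "(\<integral>\<^sup>+\<omega>. navg (w \<omega>) n (H \<omega>) \<partial>M) = (\<integral>\<^sup>+z. H (fst z) (labels n (w (fst z)) (snd z)) \<partial>N)"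
    by (rule nn_integral_navg_eq) measurable
  also have "\<dots> = (\<integral>\<^sup>+z. 0 \<partial>N)"
    using ae by (intro nn_integral_cong_AE) (auto simp: H_def)
  finally have z0: "(\<integral>\<^sup>+\<omega>. navg (w \<omega>) n (H \<omega>) \<partial>M) = 0" by simp
  have "AE \<omega> in M. navg (w \<omega>) n (H \<omega>) = 0"
    by (rule iffD1[OF nn_integral_0_iff_AE z0]) (rule measurable_navg, measurable)
  then show ?thesis
    using AE_space
  proof eventually_elim
    case (elim \<omega>)
    then have z: "ennreal (\<Prod>i<n. w \<omega> (l i)) * H \<omega> l = 0" if "l \<in> {..<n} \<rightarrow>\<^sub>E UNIV" for l
      using that unfolding navg_def by (subst (asm) nn_integral_0_iff_AE) (auto simp: AE_count_space)
    show ?case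
    proof (intro ballI impI)
      fix l :: "nat \<Rightarrow> nat" assume l: "l \<in> {..<n} \<rightarrow>\<^sub>E UNIV" "\<forall>i<n. 0 < w \<omega> (l i)"
      then have "0 < (\<Prod>i<n. w \<omega> (l i))" by (intro prod_pos) auto
      then have "ennreal (\<Prod>i<n. w \<omega> (l i)) \<noteq> 0"
        by (simp only: ennreal_eq_0_iff not_le not_False_eq_True)
      then have "H \<omega> l = 0" using z[OF l(1)] by (simp only: mult_eq_0_iff simp_thms)
      then show "P \<omega> l" by (simp add: H_def split: if_splits)
    qed
  qed
qed

definition tail :: "real \<Rightarrow> real" where
  "tail a = (\<integral>z. (if a < R z 0 1 then 1 else 0) \<partial>N)"

lemma integrable_ind: "Measurable.pred N P \<Longrightarrow> integrable N (\<lambda>z. if P z then 1 else 0 :: real)"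
  by (rule integrable_N_bounded[where B = 1]) auto

lemma AE_of_integral_ind_0:
  assumes [measurable]: "Measurable.pred N P" and "(\<integral>z. (if P z then 1 else 0 :: real) \<partial>N) = 0"
  shows "AE z in N. \<not> P z"
proof -
  have "AE z in N. (if P z then 1 else 0 :: real) = 0"
    using assms(2) integrable_ind[OF assms(1)] by (subst (asm) integral_nonneg_eq_0_iff_AE) auto
  then show ?thesis by eventually_elim (auto split: if_splits)
qed

lemma tail_le_1: "tail (-2) = 1" "1 \<le> a \<Longrightarrow> tail a = 0"
proof -
  have b: "-1 \<le> R z 0 1" "R z 0 1 \<le> 1" if "z \<in> space N" for z
    using R_abs_le_1[OF that, of 0 1] by (auto simp: abs_le_iff)
  have "tail (-2) = (\<integral>z. 1 \<partial>N)"
    unfolding tail_def by (intro Bochner_Integration.integral_cong refl) (use b(1) in force)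
  then show "tail (-2) = 1" by (simp add: MN.P.prob_space)
  assume "1 \<le> a"
  then have "tail a = (\<integral>z. 0 \<partial>N)"
    unfolding tail_def by (intro Bochner_Integration.integral_cong refl) (use b(2) in force)
  then show "tail a = 0" by simp
qed

lemma tail_mono: "a \<le> b \<Longrightarrow> tail b \<le> tail a"
  unfolding tail_def by (intro Bochner_Integration.integral_mono integrable_ind) auto

lemma tail_nonneg: "0 \<le> tail a"
  unfolding tail_def by (intro Bochner_Integration.integral_nonneg) auto

lemma tail_right_continuous: "(\<lambda>k. tail (a + 1 / real (Suc k))) \<longlonglongrightarrow> tail a"
  unfolding tail_def
proof (rule integral_dominated_convergence[where w = "\<lambda>_. 1"])
  show "AE z in N. (\<lambda>k. if a + 1 / real (Suc k) < R z 0 1 then 1 else 0 :: real) \<longlonglongrightarrow> (if a < R z 0 1 then 1 else 0)"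
  proof (rule AE_I2)
    fix z
    show "(\<lambda>k. if a + 1 / real (Suc k) < R z 0 1 then 1 else 0 :: real) \<longlonglongrightarrow> (if a < R z 0 1 then 1 else 0)"
    proof (cases "a < R z 0 1")
      case True
      have "(\<lambda>k. a + 1 / real (Suc k)) \<longlonglongrightarrow> a + 0"
        by (intro tendsto_add tendsto_const LIMSEQ_inverse_real_of_nat[unfolded inverse_eq_divide])
      then have "\<forall>\<^sub>F k in sequentially. a + 1 / real (Suc k) < R z 0 1"
        using True by (intro order_tendstoD(2)) auto
      then show ?thesis
        using True by (intro tendsto_eventually) (auto elim: eventually_mono)
    next
      case False
      have "\<not> a + 1 / real (Suc k) < R z 0 1" for k
      proof -
        have "0 \<le> 1 / real (Suc k)" by simp
        then show ?thesis using False by linarith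
      qed
      then show ?thesis using False by simp
    qed
  qed
qed auto

lemma overlap_support_eq:
  "overlap_support M w \<xi> = {r. \<forall>U. open U \<and> r \<in> U \<longrightarrow> 0 < (\<integral>z. (if R z 0 1 \<in> U then 1 else 0 :: real) \<partial>N)}"
proof -
  have "mean_bracket M w \<xi> 2 (\<lambda>\<sigma>. indicator U (overlap \<sigma> 0 1)) = (\<integral>z. (if R z 0 1 \<in> U then 1 else 0 :: real) \<partial>N)"
    if "open U" for U
  proof -
    have [measurable]: "U \<in> sets borel" using that by simp
    have "mean_bracket M w \<xi> 2 (\<lambda>\<sigma>. indicator U (overlap \<sigma> 0 1)) =
      (\<integral>z. indicator U (overlap (\<lambda>k. \<xi> (fst z) (lab z k)) 0 1) \<partial>N)"
      by (rule mean_bracket_eq[where B = 1]) (auto simp: overlap_def indicator_def)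
    then show ?thesis by (simp add: R_def overlap_def indicator_def of_bool_def)
  qed
  then show ?thesis unfolding overlap_support_def by auto
qed

text \<open>The supremum of the support is the right edge of the distribution,
  \<open>Sup {x. 0 < tail x}\<close>. Above the edge \<open>tail\<close> is 0, and right continuity
  extends this to the edge itself.\<close>

lemma q_star_properties:
  shows tail_q_star: "tail (q_star M w \<xi>) = 0" and tail_below: "x < q_star M w \<xi> \<Longrightarrow> 0 < tail x"
proof -
  define X where "X = {x. 0 < tail x}"
  have ne: "X \<noteq> {}" using tail_le_1(1) by (auto simp: X_def intro!: exI[of _ "-2"])
  have bdd: "x \<le> 1" if "x \<in> X" for x
    using that tail_le_1(2)[of x] by (cases "x \<le> 1") (auto simp: X_def)
  then have bdd': "bdd_above X" by (rule bdd_aboveI)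
  define r where "r = Sup X"
  have below: "0 < tail x" if x: "x < r" for x
  proof -
    obtain y where "y \<in> X" "x < y" using less_cSup_iff[OF ne bdd'] x unfolding r_def by auto
    then show ?thesis using tail_mono[of x y] by (simp add: X_def)
  qed
  have above: "tail x = 0" if "r < x" for x
  proof (rule ccontr)
    assume "tail x \<noteq> 0"
    then have "x \<in> X" using tail_nonneg[of x] by (simp add: X_def)
    then show False using cSup_upper[OF _ bdd', of x] that by (simp add: r_def)
  qed
  have "(\<lambda>k. tail (r + 1 / real (Suc k))) \<longlonglongrightarrow> 0"
    using above by simp
  then have r0: "tail r = 0" using tail_right_continuous[of r] by (rule LIMSEQ_unique[symmetric])
  have "r \<in> overlap_support M w \<xi>"
    unfolding overlap_support_eq
  proof (intro CollectI allI impI)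
    fix U :: "real set" assume U: "open U \<and> r \<in> U"
    then obtain e where e: "0 < e" "\<And>y. dist y r < e \<Longrightarrow> y \<in> U" by (auto simp: open_dist)
    have [measurable]: "U \<in> sets borel" using U by simp
    \<comment> \<open>This difference is the mass of the half-open interval from r - e/2 to r, which
      lies in \<open>U\<close>.\<close>
    have "0 < tail (r - e / 2) - tail r" using below[of "r - e / 2"] r0 e by simp
    also have "tail (r - e / 2) - tail r = (\<integral>z. (if r - e / 2 < R z 0 1 then 1 else 0) - (if r < R z 0 1 then 1 else 0) \<partial>N)"
      unfolding tail_def by (intro Bochner_Integration.integral_diff[symmetric] integrable_ind) auto
    also have "\<dots> \<le> (\<integral>z. (if R z 0 1 \<in> U then 1 else 0) \<partial>N)"
    proof (intro Bochner_Integration.integral_mono Bochner_Integration.integrable_diff integrable_ind)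
      show "(if r - e / 2 < R z 0 1 then 1 else 0) - (if r < R z 0 1 then 1 else 0) \<le> (if R z 0 1 \<in> U then 1 else 0 :: real)" for z
        using e(2)[of "R z 0 1"] e(1) by (auto simp: dist_real_def)
    qed auto
    finally show "0 < (\<integral>z. (if R z 0 1 \<in> U then 1 else 0 :: real) \<partial>N)" .
  qed
  moreover have "x \<le> r" if x: "x \<in> overlap_support M w \<xi>" for x
  proof (rule ccontr)
    assume "\<not> x \<le> r"
    then have "open {r<..}" "x \<in> {r<..}" by auto
    then have "0 < (\<integral>z. (if R z 0 1 \<in> {r<..} then 1 else 0 :: real) \<partial>N)"
      using x unfolding overlap_support_eq by blast
    then show False using r0 by (simp add: tail_def)
  qed
  ultimately have "q_star M w \<xi> = r"
    unfolding q_star_def by (rule cSup_eq_maximum)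
  then show "tail (q_star M w \<xi>) = 0" "x < q_star M w \<xi> \<Longrightarrow> 0 < tail x"
    using r0 below by auto
qed

abbreviation q :: real where "q \<equiv> q_star M w \<xi>"

definition spherical :: bool where
  "spherical \<longleftrightarrow> (AE \<omega> in M. \<forall>l. 0 < w \<omega> l \<longrightarrow> Q \<omega> l l = q)"

lemma AE_R_le_q: "AE z in N. R z 0 1 \<le> q"
proof -
  have "AE z in N. \<not> q < R z 0 1"
    using tail_q_star unfolding tail_def by (intro AE_of_integral_ind_0) auto
  then show ?thesis by eventually_elim simp
qed

text \<open>Two replicas may sit on the same atom, so the bound on the overlap of two replicas is
  also one on self-overlaps.\<close>

lemma AE_Q_le_q: "AE \<omega> in M. \<forall>l. 0 < w \<omega> l \<longrightarrow> Q \<omega> l l \<le> q"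
proof -
  have "AE z in N. Q (fst z) (labels 2 (w (fst z)) (snd z) 0) (labels 2 (w (fst z)) (snd z) 1) \<le> q"
    using AE_R_le_q by eventually_elim (simp add: R_def labels_eq_lab)
  from AE_labels_imp[where P = "\<lambda>\<omega> l. Q \<omega> (l 0) (l 1) \<le> q", OF _ this]
  have "AE \<omega> in M. \<forall>l\<in>{..<2::nat} \<rightarrow>\<^sub>E UNIV. (\<forall>i<2. 0 < w \<omega> (l i)) \<longrightarrow> Q \<omega> (l 0) (l 1) \<le> q" by simp
  then show ?thesis
  proof eventually_elim
    case (elim \<omega>)
    show ?case
    proof (intro allI impI)
      fix l assume "0 < w \<omega> l"
      then show "Q \<omega> l l \<le> q" using bspec[OF elim, of "\<lambda>i\<in>{..<2}. l"] by simp
    qed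
  qed
qed

lemma AE_R_diag_le_q: "AE z in N. \<forall>i. R z i i \<le> q"
  using AE_lab_pos AE_N_fst[OF AE_Q_le_q] by eventually_elim (simp add: R_def)

lemma R_le_diag: "z \<in> space N \<Longrightarrow> 2 * R z i j \<le> R z i i + R z j j"
  unfolding R_def by (intro ell2_inner_le xi_ell2 space_N_fst)

text \<open>If replica 0 has self-overlap at most q - e, then its overlap with any other replica is
  at most q - e/2, as the other self-overlap is at most q. The identity for the indicator of values
  above q - e/2 then reduces to: the probability of this event times \<open>tail (q - e / 2)\<close>
  is 0. The second factor is positive by the choice of q.\<close>

theorem gg_imp_spherical:
  assumes gg: "ghirlanda_guerra M w \<xi>"
  shows "spherical"
proof -
  have "AE z in N. q - 1 / real (Suc k) < R z 0 0" for k
  proof -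
    define e where "e = 1 / real (Suc k)"
    have e: "0 < e" by (simp add: e_def)
    define f where "f r = (if r (0, 0) \<le> q - e then 1 else 0 :: real)" for r :: "nat \<times> nat \<Rightarrow> real"
    have f[measurable]: "f \<in> borel_measurable (Pi\<^sub>M ({..<2} \<times> {..<2}) (\<lambda>_. borel))"
    proof -
      have [measurable]: "(\<lambda>r. r (0, 0)) \<in> borel_measurable (Pi\<^sub>M ({..<2::nat} \<times> {..<2::nat}) (\<lambda>_. borel :: real measure))"
        by (rule measurable_component_singleton) auto
      show ?thesis unfolding f_def by measurable
    qed
    have fR: "f (RN 2 z) = (if R z 0 0 \<le> q - e then 1 else 0)" for z by (simp add: f_def RN_def)
    have z0: "AE z in N. f (RN 2 z) * (if q - e / 2 < R z 0 l then 1 else 0) = 0" for l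
      using AE_R_diag_le_q AE_space
    proof eventually_elim
      case (elim z)
      then show ?case using R_le_diag[OF elim(2), of 0 l] e by (auto simp: fR dest!: spec[of _ l])
    qed
    have "(\<integral>z. f (RN 2 z) * (if q - e / 2 < R z 0 l then 1 else 0) \<partial>N) = 0" for l
      using integral_cong_AE[OF _ _ z0[of l]] by simp
    then have "(\<integral>z. f (RN 2 z) \<partial>N) * tail (q - e / 2) = 0"
      using gg_greater[OF gg, of 2 0 f 1 "q - e / 2"] f by (simp add: fR tail_def)
    then have "(\<integral>z. f (RN 2 z) \<partial>N) = 0"
      using tail_below[of "q - e / 2"] e by simp
    then have "AE z in N. \<not> R z 0 0 \<le> q - e"
      unfolding fR by (intro AE_of_integral_ind_0) auto
    then show ?thesis unfolding e_def by eventually_elim simp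
  qed
  then have "AE z in N. \<forall>k. q - 1 / real (Suc k) < R z 0 0"
    by (simp add: AE_all_countable)
  then have "AE z in N. q \<le> R z 0 0"
  proof eventually_elim
    case (elim z)
    have "(\<lambda>k. q - 1 / real (Suc k)) \<longlonglongrightarrow> q - 0"
      by (intro tendsto_diff tendsto_const LIMSEQ_inverse_real_of_nat[unfolded inverse_eq_divide])
    then show ?case using elim by (intro LIMSEQ_le_const2) (auto intro: less_imp_le)
  qed
  then have "AE z in N. q \<le> Q (fst z) (labels 1 (w (fst z)) (snd z) 0) (labels 1 (w (fst z)) (snd z) 0)"
    by eventually_elim (simp add: R_def labels_eq_lab)
  from AE_labels_imp[where P = "\<lambda>\<omega> l. q \<le> Q \<omega> (l 0) (l 0)", OF _ this]
  have "AE \<omega> in M. \<forall>l\<in>{..<1::nat} \<rightarrow>\<^sub>E UNIV. (\<forall>i<1. 0 < w \<omega> (l i)) \<longrightarrow> q \<le> Q \<omega> (l 0) (l 0)" by simp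
  then show ?thesis
    unfolding spherical_def using AE_Q_le_q
  proof eventually_elim
    case (elim \<omega>)
    show ?case
    proof (intro allI impI)
      fix l assume l: "0 < w \<omega> l"
      then show "Q \<omega> l l = q" using bspec[OF elim(1), of "\<lambda>i\<in>{..<1}. l"] elim(2) by (auto intro!: antisym)
    qed
  qed
qed

lemma spherical_iff:
  "spherical \<longleftrightarrow> (AE \<omega> in M. AE x in atomic_measure (w \<omega>) (\<xi> \<omega>). ell2_norm x = sqrt q)"
proof -
  have c[measurable]: "(\<lambda>x. x i) \<in> borel_measurable seq_space" for i :: nat
    by (rule measurable_component_singleton) simp
  have [measurable]: "ell2_norm \<in> borel_measurable seq_space"
    unfolding ell2_norm_def[abs_def] ell2_inner_def by measurable
  have "(AE x in atomic_measure (w \<omega>) (\<xi> \<omega>). ell2_norm x = sqrt q) \<longleftrightarrow> (\<forall>l. 0 < w \<omega> l \<longrightarrow> Q \<omega> l l = q)" for \<omega>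
  proof -
    have "\<xi> \<omega> \<in> point_measure UNIV (\<lambda>l. ennreal (w \<omega> l)) \<rightarrow>\<^sub>M seq_space"
      by (simp add: measurable_point_measure_eq1 space_PiM)
    then have "(AE x in atomic_measure (w \<omega>) (\<xi> \<omega>). ell2_norm x = sqrt q) \<longleftrightarrow>
      (AE l in point_measure UNIV (\<lambda>l. ennreal (w \<omega> l)). ell2_norm (\<xi> \<omega> l) = sqrt q)"
      unfolding atomic_measure_def by (intro AE_distr_iff) auto
    then show ?thesis by (simp add: AE_point_measure ell2_norm_def)
  qed
  then show ?thesis by (simp add: spherical_def)
qed

lemma spherical_R_diag: "spherical \<Longrightarrow> AE z in N. \<forall>i. R z i i = q"
proof -
  assume spherical
  then have "AE z in N. \<forall>l. 0 < w (fst z) l \<longrightarrow> Q (fst z) l l = q"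
    unfolding spherical_def by (rule AE_N_fst)
  then show ?thesis
    using AE_lab_pos by eventually_elim (simp add: R_def)
qed

lemma spherical_Q_eq_iff:
  assumes \<omega>: "\<omega> \<in> space M" and s: "\<forall>l. 0 < w \<omega> l \<longrightarrow> Q \<omega> l l = q" and l: "0 < w \<omega> l" "0 < w \<omega> l'"
  shows "Q \<omega> l l' = q \<longleftrightarrow> l = l'"
proof
  assume "Q \<omega> l l' = q"
  then have "\<xi> \<omega> l = \<xi> \<omega> l'"
    using s l by (intro ell2_eq_of_inner xi_ell2[OF \<omega>]) auto
  then show "l = l'" using xi_inj[OF \<omega>] l by (auto dest: inj_onD)
qed (use s l in auto)

lemma spherical_R_eq_iff:
  assumes spherical
  shows "AE z in N. \<forall>i j. R z i j = q \<longleftrightarrow> lab z i = lab z j"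
  using AE_lab_pos AE_N_fst[OF assms[unfolded spherical_def]] AE_space
proof eventually_elim
  case (elim z)
  then show ?case
    using spherical_Q_eq_iff[OF space_N_fst[OF elim(3)] elim(2)] by (simp add: R_def)
qed

section \<open>A single atom or infinitely many\<close>

definition coincide :: real where
  "coincide = (\<integral>z. (if R z 0 1 = q then 1 else 0) \<partial>N)"

definition clusters :: "nat \<Rightarrow> 'a \<times> (nat \<Rightarrow> real) \<Rightarrow> nat" where
  "clusters n z = card (lab z ` {..<n})"

lemma measurable_clusters[measurable]: "clusters n \<in> N \<rightarrow>\<^sub>M count_space UNIV"
proof -
  have "(\<lambda>z. card (labels n (w (fst z)) (snd z) ` {..<n})) \<in> N \<rightarrow>\<^sub>M count_space UNIV"
    by (rule measurable_compose[OF measurable_labels_N]) simp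
  moreover have "labels n (w (fst z)) (snd z) ` {..<n} = lab z ` {..<n}" for z
    by (intro image_cong) (auto simp: labels_eq_lab)
  ultimately show ?thesis by (simp add: clusters_def[abs_def])
qed

text \<open>Under the Ghirlanda-Guerra identities, given \<open>n\<close> replicas occupying \<open>c\<close> atoms, the next one
  occupies a new atom with conditional probability \<open>(1 - coincide) * c / n\<close>.\<close>

lemma clusters_step:
  assumes gg: "ghirlanda_guerra M w \<xi>" and n: "2 \<le> n"
  shows "(\<integral>z. (1 / 2) ^ clusters (Suc n) z \<partial>N) \<le>
    (\<integral>z. (1 / 2) ^ clusters n z \<partial>N) - ((1 - coincide) / 2) / real n * (\<integral>z. (1 / 2) ^ clusters n z \<partial>N)"
proof -
  have sph: spherical by (rule gg_imp_spherical[OF gg])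
  define sz where "sz r i = (\<Sum>j<n. if r (i, j) = q then 1 else 0 :: real)" for r :: "nat \<times> nat \<Rightarrow> real" and i
  define cn where "cn r = (\<Sum>i<n. 1 / sz r i)" for r
  \<comment> \<open>\<open>sz\<close> and \<open>cn\<close> read the size of the cluster of
    \<open>i\<close> and the number of clusters from the overlaps. Division by the size makes the
    members of a cluster together count once the event that the next replica joins it.\<close>
  define f where "f i r = (1 / 2) powr cn r / sz r i" for i r
  have c: "(\<lambda>r. r (a, b)) \<in> borel_measurable (Pi\<^sub>M ({..<n} \<times> {..<n}) (\<lambda>_. borel :: real measure))"
    if "a < n" "b < n" for a b
    using that by (intro measurable_component_singleton) auto
  have szm: "(\<lambda>r. sz r i) \<in> borel_measurable (Pi\<^sub>M ({..<n} \<times> {..<n}) (\<lambda>_. borel))" if "i < n" for i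
    unfolding sz_def
  proof (rule borel_measurable_sum)
    fix j assume "j \<in> {..<n}"
    then have [measurable]: "(\<lambda>r. r (i, j)) \<in> borel_measurable (Pi\<^sub>M ({..<n} \<times> {..<n}) (\<lambda>_. borel :: real measure))"
      using that by (intro c) auto
    show "(\<lambda>r. if r (i, j) = q then 1 else 0 :: real) \<in> borel_measurable (Pi\<^sub>M ({..<n} \<times> {..<n}) (\<lambda>_. borel))"
      by measurable
  qed
  have cnm: "cn \<in> borel_measurable (Pi\<^sub>M ({..<n} \<times> {..<n}) (\<lambda>_. borel))"
    unfolding cn_def[abs_def] by (intro borel_measurable_sum borel_measurable_divide szm) auto
  have f: "f i \<in> borel_measurable (Pi\<^sub>M ({..<n} \<times> {..<n}) (\<lambda>_. borel))" if "i < n" for i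
    unfolding f_def[abs_def] using szm[OF that] cnm by measurable
  have sz_nat: "sz r i = 0 \<or> 1 \<le> sz r i" for r i
  proof -
    have "sz r i = real (card {j \<in> {..<n}. r (i, j) = q})"
      unfolding sz_def by (simp add: sum.If_cases Int_def)
    then show ?thesis by (cases "card {j \<in> {..<n}. r (i, j) = q}") auto
  qed
  have cn0: "0 \<le> cn r" for r
    unfolding cn_def using sz_nat by (intro sum_nonneg) (metis order_refl order_trans zero_le_divide_1_iff zero_le_one)
  have fb: "\<bar>f i r\<bar> \<le> 1" for i r
  proof -
    have "(1 / 2) powr cn r \<le> (1::real)" using cn0[of r] powr_mono'[of 0 "cn r" "1/2"] by simp
    then show ?thesis using sz_nat[of r i] by (auto simp: f_def abs_divide pos_divide_le_eq)
  qed
  \<comment> \<open>The overlaps encode the partition of the replicas into clusters only almost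
    surely; outside this event \<open>sz\<close> could even be 0.\<close>
  define good where "good z \<longleftrightarrow> (\<forall>i j. R z i j = q \<longleftrightarrow> lab z i = lab z j)" for z
  have good: "AE z in N. good z" unfolding good_def by (rule spherical_R_eq_iff[OF sph])
  have szR: "sz (RN n z) i = real (card {j \<in> {..<n}. lab z j = lab z i})" if "good z" "i < n" for z i
  proof -
    have "sz (RN n z) i = (\<Sum>j<n. if lab z j = lab z i then 1 else 0)"
      unfolding sz_def using that by (intro sum.cong) (auto simp: RN_def good_def)
    then show ?thesis by (simp add: sum.If_cases Int_def)
  qed
  have szR1: "1 \<le> sz (RN n z) i" if "good z" "i < n" for z i
  proof -
    have "i \<in> {j \<in> {..<n}. lab z j = lab z i}" using that by simp
    then have "0 < card {j \<in> {..<n}. lab z j = lab z i}" by (subst card_gt_0_iff) auto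
    then show ?thesis using szR[OF that] by simp
  qed
  have cnR: "cn (RN n z) = real (clusters n z)" if "good z" for z
    unfolding cn_def clusters_def using szR[OF that] sum_inverse_fibre_card[of "{..<n}" "lab z"] by simp
  have fR: "f i (RN n z) = (1 / 2) ^ clusters n z / sz (RN n z) i" if "good z" for z i
    unfolding f_def cnR[OF that] by (simp add: powr_realpow)
  define F where "F z = (1 / 2 :: real) ^ clusters n z" for z
  have Fm[measurable]: "F \<in> borel_measurable N" unfolding F_def[abs_def] by (rule measurable_compose[OF measurable_clusters]) simp
  have Fb: "0 \<le> F z" "F z \<le> 1" for z by (auto simp: F_def power_le_one)
  define old where "old z = (if \<exists>i<n. lab z n = lab z i then 1 else 0 :: real)" for z
  have oldm[measurable]: "old \<in> borel_measurable N"
  proof -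
    have lm: "(\<lambda>z. real (lab z i)) \<in> borel_measurable N" for i
      by (rule measurable_compose[OF measurable_lab]) simp
    have "Measurable.pred N (\<lambda>z. real (lab z n) = real (lab z i))" for i
      unfolding pred_def by (rule borel_measurable_eq[OF lm lm])
    then have "Measurable.pred N (\<lambda>z. \<exists>i\<in>{..<n}. lab z n = lab z i)"
      by (intro pred_intros_finite) (simp_all only: of_nat_eq_iff finite_lessThan)
    note pr = predE[OF this]
    have eq: "old = (\<lambda>z. if \<exists>i\<in>{..<n}. lab z n = lab z i then 1 else 0)"
      by (auto simp: old_def fun_eq_iff)
    show ?thesis unfolding eq by (rule measurable_If[OF measurable_const measurable_const pr]) simp_all
  qed
  \<comment> \<open>A new atom halves the weight. A bounded decreasing function of the number of
    clusters keeps all integrals finite uniformly in \<open>n\<close>.\<close>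
  have nxt: "(1 / 2) ^ clusters (Suc n) z = F z - (1 / 2) * (F z * (1 - old z))" for z
  proof -
    have im: "lab z ` {..<Suc n} = insert (lab z n) (lab z ` {..<n})"
      by (simp add: lessThan_Suc)
    show ?thesis
    proof (cases "lab z n \<in> lab z ` {..<n}")
      case True
      then have "old z = 1" by (auto simp: old_def)
      then show ?thesis using True by (simp add: F_def clusters_def im insert_absorb)
    next
      case False
      then have "old z = 0" by (auto simp: old_def)
      then show ?thesis using False by (simp add: F_def clusters_def im)
    qed
  qed
  have oldsum: "F z * old z = (\<Sum>i<n. f i (RN n z) * (if R z i n = q then 1 else 0))" if g: "good z" for z
  proof (cases "\<exists>i<n. lab z n = lab z i")
    case True
    then obtain i0 where i0: "i0 < n" "lab z n = lab z i0" by auto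
    define K where "K = {j \<in> {..<n}. lab z j = lab z i0}"
    have K: "finite K" "K \<noteq> {}" using i0 by (auto simp: K_def)
    have "(\<Sum>i<n. f i (RN n z) * (if R z i n = q then 1 else 0)) = (\<Sum>i<n. if lab z i = lab z i0 then f i (RN n z) else 0)"
      using g i0 by (intro sum.cong) (auto simp: good_def)
    also have "\<dots> = (\<Sum>i\<in>K. f i (RN n z))"
      by (simp add: sum.If_cases K_def Int_def)
    also have "\<dots> = (\<Sum>i\<in>K. F z / real (card K))"
      using g by (intro sum.cong refl) (auto simp: fR F_def szR K_def)
    also have "\<dots> = F z" using K by simp
    finally show ?thesis using True by (simp add: old_def)
  next
    case False
    then have "(\<Sum>i<n. f i (RN n z) * (if R z i n = q then 1 else 0)) = 0"
      using g by (intro sum.neutral) (auto simp: good_def)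
    then show ?thesis using False by (auto simp: old_def)
  qed
  have ifR: "integrable N (\<lambda>z. f i (RN n z) * (if R z a b = q then 1 else 0))" if "i < n" for i a b
    by (rule integrable_N_bounded[where B = "1"]) (use fb f[OF that] in auto)
  have ggi: "real n * (\<integral>z. f i (RN n z) * (if R z i n = q then 1 else 0) \<partial>N) =
    (\<integral>z. f i (RN n z) * (sz (RN n z) i - (1 - coincide)) \<partial>N)" if i: "i < n" for i
  proof -
    have fi: "integrable N (\<lambda>z. f i (RN n z))"
      by (rule integrable_N_bounded[where B = "1"]) (use fb f[OF i] in auto)
    have "real n * (\<integral>z. f i (RN n z) * (if R z i n = q then 1 else 0) \<partial>N) = (\<integral>z. f i (RN n z) \<partial>N) * coincide
        + (\<Sum>l\<in>{..<n} - {i}. \<integral>z. f i (RN n z) * (if R z i l = q then 1 else 0) \<partial>N)"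
      unfolding coincide_def by (rule gg_equal[OF gg n i f[OF i] fb])
    also have "\<dots> = (\<integral>z. f i (RN n z) * coincide + (\<Sum>l\<in>{..<n} - {i}. f i (RN n z) * (if R z i l = q then 1 else 0)) \<partial>N)"
    proof -
      have "integrable N (\<lambda>z. \<Sum>l\<in>{..<n} - {i}. f i (RN n z) * (if R z i l = q then 1 else 0))"
        by (intro Bochner_Integration.integrable_sum ifR i)
      then show ?thesis
        using fi ifR[OF i] by (simp only: Bochner_Integration.integral_add integrable_mult_left integral_mult_left_zero Bochner_Integration.integral_sum)
    qed
    also have "\<dots> = (\<integral>z. f i (RN n z) * (sz (RN n z) i - (1 - coincide)) \<partial>N)"
    proof (rule integral_cong_AE)
      show "AE z in N. f i (RN n z) * coincide + (\<Sum>l\<in>{..<n} - {i}. f i (RN n z) * (if R z i l = q then 1 else 0)) =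
          f i (RN n z) * (sz (RN n z) i - (1 - coincide))"
        using good
      proof eventually_elim
        case (elim z)
        have "sz (RN n z) i = (\<Sum>l<n. if R z i l = q then 1 else 0)"
          unfolding sz_def using i by (intro sum.cong) (auto simp: RN_def)
        also have "\<dots> = 1 + (\<Sum>l\<in>{..<n} - {i}. if R z i l = q then 1 else 0)"
          using i elim by (simp add: sum.remove[of "{..<n}" i] good_def)
        finally show ?case by (simp add: sum_distrib_left[symmetric] algebra_simps)
      qed
    qed (use f[OF i] szm[OF i] in measurable)
    finally show ?thesis .
  qed
  have ib: "integrable N (\<lambda>z. f i (RN n z) * (sz (RN n z) i - (1 - coincide)))" if i: "i < n" for i
  proof (rule integrable_N_bounded[where B = "1 * (real n + \<bar>1 - coincide\<bar>)"])
    have "\<bar>sz r i\<bar> \<le> real n" for r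
    proof -
      have "\<bar>sz r i\<bar> \<le> (\<Sum>j<n. 1)" unfolding sz_def by (intro order_trans[OF sum_abs] sum_mono) auto
      then show ?thesis by simp
    qed
    then show "\<bar>f i (RN n z) * (sz (RN n z) i - (1 - coincide))\<bar> \<le> 1 * (real n + \<bar>1 - coincide\<bar>)" if "z \<in> space N" for z
      unfolding abs_mult by (intro mult_mono fb order_trans[OF abs_triangle_ineq4 add_mono]) auto
  qed (use f[OF i] szm[OF i] in measurable)
  have iF: "integrable N F" by (rule integrable_N_bounded[OF Fm, where B = 1]) (use Fb in simp)
  have iFo: "integrable N (\<lambda>z. F z * old z)"
  proof (rule integrable_N_bounded[where B = 1])
    have "0 \<le> old z" "old z \<le> 1" for z by (simp_all add: old_def)
    then show "\<bar>F z * old z\<bar> \<le> 1" for z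
      using Fb[of z] mult_le_one[of "F z" "old z"] by (simp add: abs_mult)
  qed (intro borel_measurable_times Fm oldm)
  have iFc: "integrable N (\<lambda>z. F z * real (clusters n z))"
  proof (rule integrable_N_bounded[where B = "1 * real n"])
    have "clusters n z \<le> n" for z
      unfolding clusters_def using card_image_le[of "{..<n}" "lab z"] by simp
    then show "\<bar>F z * real (clusters n z)\<bar> \<le> 1 * real n" for z
      unfolding abs_mult using Fb by (intro mult_mono) auto
  qed measurable
  have "real n * (\<integral>z. F z * old z \<partial>N) = real n * (\<integral>z. (\<Sum>i<n. f i (RN n z) * (if R z i n = q then 1 else 0)) \<partial>N)"
    using good oldsum f by (intro arg_cong2[where f = "(*)"] refl integral_cong_AE) (auto elim!: eventually_mono)
  also have "\<dots> = (\<Sum>i<n. real n * (\<integral>z. f i (RN n z) * (if R z i n = q then 1 else 0) \<partial>N))"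
    using ifR by (subst Bochner_Integration.integral_sum) (auto simp: sum_distrib_left)
  also have "\<dots> = (\<Sum>i<n. \<integral>z. f i (RN n z) * (sz (RN n z) i - (1 - coincide)) \<partial>N)"
    using ggi by simp
  also have "\<dots> = (\<integral>z. (\<Sum>i<n. f i (RN n z) * (sz (RN n z) i - (1 - coincide))) \<partial>N)"
    using ib by (intro Bochner_Integration.integral_sum[symmetric]) auto
  also have "\<dots> = (\<integral>z. real n * F z - (1 - coincide) * (F z * real (clusters n z)) \<partial>N)"
  proof (rule integral_cong_AE)
    show "AE z in N. (\<Sum>i<n. f i (RN n z) * (sz (RN n z) i - (1 - coincide))) =
        real n * F z - (1 - coincide) * (F z * real (clusters n z))"
      using good
    proof eventually_elim
      case (elim z)
      have "f i (RN n z) * (sz (RN n z) i - (1 - coincide)) = F z - (1 - coincide) * (F z * (1 / sz (RN n z) i))" if "i < n" for i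
        using szR1[OF elim that] by (simp add: fR[OF elim] F_def field_simps)
      then have "(\<Sum>i<n. f i (RN n z) * (sz (RN n z) i - (1 - coincide))) = (\<Sum>i<n. F z - (1 - coincide) * (F z * (1 / sz (RN n z) i)))"
        by (intro sum.cong) auto
      also have "\<dots> = real n * F z - (1 - coincide) * (F z * cn (RN n z))"
        by (simp add: sum_subtractf sum_distrib_left cn_def)
      finally show ?case by (simp add: cnR[OF elim])
    qed
    show "(\<lambda>z. \<Sum>i<n. f i (RN n z) * (sz (RN n z) i - (1 - coincide))) \<in> borel_measurable N"
      using ib by (intro borel_measurable_sum) auto
  qed measurable
  also have "\<dots> = real n * (\<integral>z. F z \<partial>N) - (1 - coincide) * (\<integral>z. F z * real (clusters n z) \<partial>N)"
    using iF iFc by simp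
  finally have old_eq: "real n * (\<integral>z. F z * old z \<partial>N) = real n * (\<integral>z. F z \<partial>N) - (1 - coincide) * (\<integral>z. F z * real (clusters n z) \<partial>N)" .
  have "coincide \<le> (\<integral>z. 1 \<partial>N)"
    unfolding coincide_def by (intro Bochner_Integration.integral_mono integrable_ind) auto
  then have co: "0 \<le> 1 - coincide" by (simp add: MN.P.prob_space)
  \<comment> \<open>At least one cluster is present. This crude bound already gives a relative loss
    of order 1/n, and the sum of these losses diverges.\<close>
  have "(\<integral>z. F z \<partial>N) \<le> (\<integral>z. F z * real (clusters n z) \<partial>N)"
  proof (intro Bochner_Integration.integral_mono iF iFc)
    have "1 \<le> clusters n z" for z
      unfolding clusters_def using n by (simp add: Suc_le_eq card_gt_0_iff lessThan_empty_iff)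
    then show "F z \<le> F z * real (clusters n z)" for z
      using Fb[of z] mult_left_mono[of 1 "real (clusters n z)" "F z"] by simp
  qed
  then have ge: "(1 - coincide) * (\<integral>z. F z \<partial>N) \<le> (1 - coincide) * (\<integral>z. F z * real (clusters n z) \<partial>N)"
    by (intro mult_left_mono co)
  have "(\<integral>z. (1 / 2) ^ clusters (Suc n) z \<partial>N) = (\<integral>z. F z - (1 / 2) * (F z - F z * old z) \<partial>N)"
    unfolding nxt by (simp add: right_diff_distrib)
  also have "\<dots> = (\<integral>z. F z \<partial>N) - (1 / 2) * ((\<integral>z. F z \<partial>N) - (\<integral>z. F z * old z \<partial>N))"
    using iF iFo by simp
  also have "(\<integral>z. F z \<partial>N) - (\<integral>z. F z * old z \<partial>N) = (1 - coincide) / real n * (\<integral>z. F z * real (clusters n z) \<partial>N)"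
    using old_eq n by (simp add: field_simps)
  also have "(\<integral>z. F z \<partial>N) - (1 / 2) * ((1 - coincide) / real n * (\<integral>z. F z * real (clusters n z) \<partial>N)) \<le>
    (\<integral>z. F z \<partial>N) - (1 - coincide) / 2 / real n * (\<integral>z. F z \<partial>N)"
    using divide_right_mono[OF ge, of "real n"] by simp
  finally show ?thesis by (simp add: F_def)
qed

text \<open>Where \<open>w \<omega> K = 0\<close> at most \<open>K\<close> atoms are ever occupied,
  so the mean of (1/2)^\<open>clusters\<close> stays above (1/2)^K times the probability of this
  event, for every number of replicas. By \<open>clusters_step\<close> the mean tends to 0.\<close>

theorem gg_infinitely_many_atoms:
  assumes gg: "ghirlanda_guerra M w \<xi>" and co: "coincide \<noteq> 1"
  shows "AE \<omega> in M. \<forall>l. 0 < w \<omega> l"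
  unfolding AE_all_countable
proof
  fix K
  have "coincide \<le> (\<integral>z. 1 \<partial>N)"
    unfolding coincide_def by (intro Bochner_Integration.integral_mono integrable_ind) auto
  then have co1: "0 < 1 - coincide" using co by (simp add: MN.P.prob_space)
  define I where "I z = (if w (fst z) K = 0 then 1 else 0 :: real)" for z :: "'a \<times> (nat \<Rightarrow> real)"
  have Im[measurable]: "I \<in> borel_measurable N" unfolding I_def by measurable
  have le: "(1 / 2) ^ K * (\<integral>z. I z \<partial>N) \<le> (\<integral>z. (1 / 2) ^ clusters n z \<partial>N)" for n
  proof -
    have "(1 / 2) ^ K * (\<integral>z. I z \<partial>N) = (\<integral>z. (1 / 2) ^ K * I z \<partial>N)" by simp
    also have "\<dots> \<le> (\<integral>z. (1 / 2) ^ clusters n z \<partial>N)"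
    proof (rule integral_mono_AE)
      show "integrable N (\<lambda>z. (1 / 2) ^ K * I z)"
        by (rule integrable_N_bounded[where B = 1]) (auto simp: I_def power_le_one)
      show "integrable N (\<lambda>z. (1 / 2 :: real) ^ clusters n z)"
        by (rule integrable_N_bounded[where B = 1]) (auto simp: power_le_one)
      show "AE z in N. (1 / 2) ^ K * I z \<le> (1 / 2) ^ clusters n z"
        using AE_lab_pos AE_space
      proof eventually_elim
        case (elim z)
        show ?case
        proof (cases "w (fst z) K = 0")
          case True
          have "lab z i < K" for i
          proof (rule ccontr)
            assume "\<not> lab z i < K"
            then have "w (fst z) (lab z i) \<le> w (fst z) K"
              using w_decseq[OF space_N_fst[OF elim(2)]] by (auto simp: decseq_def)
            then show False using elim(1) True by (metis not_le)
          qed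
          then have "lab z ` {..<n} \<subseteq> {..<K}" by auto
          then have "clusters n z \<le> K"
            unfolding clusters_def using card_mono[of "{..<K}" "lab z ` {..<n}"] by simp
          then have "(1 / 2 :: real) ^ K \<le> (1 / 2) ^ clusters n z" by (intro power_decreasing) auto
          then show ?thesis using True by (simp add: I_def)
        qed (simp add: I_def)
      qed
    qed
    finally show ?thesis .
  qed
  have "(1 / 2) ^ K * (\<integral>z. I z \<partial>N) \<le> 0"
    by (rule decay_to_zero[where e = "\<lambda>n. \<integral>z. (1 / 2) ^ clusters n z \<partial>N" and c = "(1 - coincide) / 2" and ?n0.0 = 2])
      (use co1 clusters_step[OF gg] le in auto)
  moreover have "(0 :: real) < (1 / 2) ^ K" by simp
  ultimately have "(\<integral>z. I z \<partial>N) \<le> 0" by (metis mult_pos_pos not_le)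
  moreover have "0 \<le> (\<integral>z. I z \<partial>N)" by (intro Bochner_Integration.integral_nonneg) (auto simp: I_def)
  ultimately have "(\<integral>z. I z \<partial>N) = 0" by (rule antisym)
  then have "AE z in N. \<not> w (fst z) K = 0"
    unfolding I_def by (intro AE_of_integral_ind_0) auto
  then have "AE \<omega> in distr N M fst. w \<omega> K \<noteq> 0"
    by (subst AE_distr_iff) (auto simp: AE_distr_iff)
  then have "AE \<omega> in M. w \<omega> K \<noteq> 0"
    by (simp only: prob_space.distr_pair_fst[OF unifs.prob_space_axioms])
  then show "AE \<omega> in M. 0 < w \<omega> K"
    using AE_space by eventually_elim (simp add: less_le w_nonneg)
qed

text \<open>On the sphere \<open>coincide\<close> is the probability that two replicas share an
  atom. If it is 1, any two labels of positive weight are equal, and monotonicity of the weights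
  places the only atom at index 0.\<close>

theorem single_atom:
  assumes sph: spherical and co: "coincide = 1"
  shows "AE \<omega> in M. w \<omega> = (\<lambda>l. if l = 0 then 1 else 0)"
proof -
  have "(\<integral>z. (if R z 0 1 \<noteq> q then 1 else 0 :: real) \<partial>N) = (\<integral>z. 1 - (if R z 0 1 = q then 1 else 0 :: real) \<partial>N)"
    by (intro Bochner_Integration.integral_cong) auto
  also have "\<dots> = 1 - coincide"
    unfolding coincide_def using integrable_ind[of "\<lambda>z. R z 0 1 = q"] by (simp add: MN.P.prob_space)
  finally have "AE z in N. \<not> R z 0 1 \<noteq> q"
    using co by (intro AE_of_integral_ind_0) auto
  then have "AE z in N. labels 2 (w (fst z)) (snd z) 0 = labels 2 (w (fst z)) (snd z) 1"
    using spherical_R_eq_iff[OF sph] by eventually_elim (simp add: labels_eq_lab)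
  from AE_labels_imp[where P = "\<lambda>\<omega> l. l 0 = l 1", OF _ this]
  have "AE \<omega> in M. \<forall>l\<in>{..<2::nat} \<rightarrow>\<^sub>E UNIV. (\<forall>i<2. 0 < w \<omega> (l i)) \<longrightarrow> l 0 = l 1" by simp
  then show ?thesis
    using AE_space
  proof eventually_elim
    case (elim \<omega>)
    note \<omega> = elim(2)
    have uniq: "l = l'" if "0 < w \<omega> l" "0 < w \<omega> l'" for l l'
      using bspec[OF elim(1), of "\<lambda>i\<in>{..<2}. if i = 0 then l else l'"] that by (auto simp: less_2_cases_iff)
    obtain l where l: "0 < w \<omega> l" using w_pos_ex[OF \<omega>] by auto
    have "w \<omega> l \<le> w \<omega> 0" using w_decseq[OF \<omega>] by (auto simp: decseq_def)
    then have "0 < w \<omega> 0" using l by simp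
    then have z: "w \<omega> l = 0" if "l \<noteq> 0" for l
      using uniq[of 0 l] w_nonneg[OF \<omega>, of l] that by (cases "w \<omega> l = 0") auto
    have "w \<omega> sums w \<omega> 0"
      using sums_finite[of "{0}" "w \<omega>"] z by auto
    then have "w \<omega> 0 = 1" using w_sums[OF \<omega>] sums_unique2 by blast
    then show ?case using z by auto
  qed
qed

end

text \<open>By the Cameron-Martin formula, shifting the field in the direction of \<open>h l - h l'\<close> by different
  amounts turns the event of a tie into disjoint events whose probabilities are comparable to its own.\<close>

lemma (in gaussian_field) no_ties:
  assumes p: "p = 1"
  shows "AE \<omega> in M. \<forall>l l'. l \<noteq> l' \<longrightarrow> 0 < w \<omega> l \<longrightarrow> 0 < w \<omega> l' \<longrightarrow>
    w \<omega> l * exp (h \<omega> l) \<noteq> w \<omega> l' * exp (h \<omega> l')"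
proof -
  have "AE \<omega> in M. l \<noteq> l' \<longrightarrow> 0 < w \<omega> l \<longrightarrow> 0 < w \<omega> l' \<longrightarrow>
    w \<omega> l * exp (h \<omega> l) \<noteq> w \<omega> l' * exp (h \<omega> l')" for l l'
  proof (cases "l = l'")
    case neq: False
    \<comment> \<open>The variance of \<open>h \<omega> l - h \<omega> l'\<close> for p = 1, which
      is the squared distance of the two points and hence positive for distinct atoms. For even p it
      would vanish for antipodal points, where the field takes the same value, and ties could
      persist.\<close>
    define V where "V \<omega> = Q \<omega> l l + Q \<omega> l' l' - 2 * Q \<omega> l l'" for \<omega>
    define k1 where "k1 \<omega> = Q \<omega> l l - Q \<omega> l' l" for \<omega>
    define k2 where "k2 \<omega> = Q \<omega> l l' - Q \<omega> l' l'" for \<omega>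
    \<comment> \<open>The event of a tie once the field has been shifted by \<open>c\<close> times
      its covariance with \<open>h \<omega> l - h \<omega> l'\<close>. The log ratio of the two
      terms moves by \<open>c * V \<omega>\<close>, so different \<open>c\<close> exclude each
      other.\<close>
    define T where "T c = {\<omega> \<in> space M. 0 < w \<omega> l \<and> 0 < w \<omega> l' \<and>
      w \<omega> l * exp (h \<omega> l + c * k1 \<omega>) = w \<omega> l' * exp (h \<omega> l' + c * k2 \<omega>)}" for c
    have Tm[measurable]: "T c \<in> sets M" for c unfolding T_def k1_def k2_def by measurable
    have kV: "k1 \<omega> - k2 \<omega> = V \<omega>" if "\<omega> \<in> space M" for \<omega>
      using Q_commute[of \<omega> l l'] that by (simp add: k1_def k2_def V_def)
    have V4: "V \<omega> \<le> 4" if "\<omega> \<in> space M" for \<omega>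
      using Q_abs_le_1[OF that, of l l] Q_abs_le_1[OF that, of l' l'] Q_abs_le_1[OF that, of l l']
      by (simp add: V_def abs_le_iff)
    have V0: "V \<omega> \<noteq> 0" if \<omega>: "\<omega> \<in> space M" and pos: "0 < w \<omega> l" "0 < w \<omega> l'" for \<omega>
    proof
      assume "V \<omega> = 0"
      then have s0: "(\<lambda>i. (\<xi> \<omega> l i - \<xi> \<omega> l' i)\<^sup>2) sums 0"
        using ell2_dist_sums[OF xi_ell2[OF \<omega>] xi_ell2[OF \<omega>], of l l'] by (simp add: V_def)
      have "(\<Sum>i. (\<xi> \<omega> l i - \<xi> \<omega> l' i)\<^sup>2) = 0" using sums_unique[OF s0] by simp
      then have "\<forall>i. (\<xi> \<omega> l i - \<xi> \<omega> l' i)\<^sup>2 = 0"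
        using suminf_eq_zero_iff[OF sums_summable[OF s0]] by simp
      then have "\<xi> \<omega> l = \<xi> \<omega> l'" by (simp add: fun_eq_iff)
      then show False using xi_inj[OF \<omega>] pos neq by (auto dest: inj_onD)
    qed
    have log_eq: "c * V \<omega> = ln (w \<omega> l') + h \<omega> l' - ln (w \<omega> l) - h \<omega> l" if "\<omega> \<in> T c" for c \<omega>
    proof -
      have \<omega>: "\<omega> \<in> space M" "0 < w \<omega> l" "0 < w \<omega> l'" using that by (auto simp: T_def)
      have "ln (w \<omega> l * exp (h \<omega> l + c * k1 \<omega>)) = ln (w \<omega> l' * exp (h \<omega> l' + c * k2 \<omega>))"
        using that by (simp add: T_def)
      then have "ln (w \<omega> l) + (h \<omega> l + c * k1 \<omega>) = ln (w \<omega> l') + (h \<omega> l' + c * k2 \<omega>)"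
        using \<omega> by (simp add: ln_mult)
      then show ?thesis by (simp add: kV[OF \<omega>(1), symmetric] algebra_simps)
    qed
    \<comment> \<open>Infinitely many distinct amounts in a bounded range: the probabilities of the
      disjoint events tend to 0, while the bounds comparing them with the tie hold
      uniformly.\<close>
    define c where "c k = 1 / real (Suc k)" for k
    have c: "0 < c k" "c k \<le> 1" for k by (auto simp: c_def)
    have c_inj: "c i = c j \<longleftrightarrow> i = j" for i j by (simp add: c_def)
    have disj: "disjoint_family (\<lambda>k. T (c k))"
      unfolding disjoint_family_on_def
    proof (intro ballI impI equals0I)
      fix i j \<omega> assume ij: "i \<noteq> j" "\<omega> \<in> T (c i) \<inter> T (c j)"
      then have \<omega>: "\<omega> \<in> space M" "0 < w \<omega> l" "0 < w \<omega> l'" by (auto simp: T_def)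
      have "c i * V \<omega> = c j * V \<omega>" using log_eq[of \<omega> "c i"] log_eq[of \<omega> "c j"] ij by simp
      then show False using V0[OF \<omega>] ij c_inj by simp
    qed
    have "(\<lambda>k. prob (T (c k))) sums prob (\<Union>k. T (c k))"
      using disj by (intro finite_measure_UNION) auto
    then have lim: "(\<lambda>k. prob (T (c k))) \<longlonglongrightarrow> 0"
      by (intro summable_LIMSEQ_zero sums_summable)
    define \<Phi> where "\<Phi> x = (if 0 < x (Inl l) \<and> 0 < x (Inl l') \<and> x (Inl l) * exp (x (Inr (Inr l))) - x (Inl l') * exp (x (Inr (Inr l'))) = 0
      then 1 else 0 :: ennreal)" for x :: "nat + (nat \<times> nat) + nat \<Rightarrow> real"
    have \<Phi>: "\<Phi> \<in> borel_measurable (Pi\<^sub>M UNIV (\<lambda>_. borel))"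
    proof -
      have [measurable]: "(\<lambda>x. x k) \<in> borel_measurable (Pi\<^sub>M UNIV (\<lambda>_. borel))" for k :: "nat + (nat \<times> nat) + nat"
        by (rule measurable_component_singleton) simp
      show ?thesis unfolding \<Phi>_def by measurable
    qed
    have shift: "(\<integral>\<^sup>+\<omega>. indicator (T 0) \<omega> * ennreal (exp (d * (h \<omega> l - h \<omega> l'))) \<partial>M) =
      (\<integral>\<^sup>+\<omega>. indicator (T d) \<omega> * ennreal (exp (d\<^sup>2 * V \<omega> / 2)) \<partial>M)" for d
    proof -
      define s where "s i = (if i then d else - d)" for i
      define L where "L i = (if i then l else l')" for i
      have "(\<integral>\<^sup>+\<omega>. indicator (T 0) \<omega> * ennreal (exp (d * (h \<omega> l - h \<omega> l'))) \<partial>M) =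
        (\<integral>\<^sup>+\<omega>. \<Phi> (arr (w \<omega>) (\<xi> \<omega>) (h \<omega>)) * ennreal (exp (\<Sum>i\<in>UNIV. s i * h \<omega> (L i))) \<partial>M)"
        by (intro nn_integral_cong)
          (auto simp: \<Phi>_def arr_def T_def indicator_def UNIV_bool s_def L_def algebra_simps)
      also have "\<dots> = (\<integral>\<^sup>+\<omega>. \<Phi> (arr (w \<omega>) (\<xi> \<omega>) (\<lambda>j. h \<omega> j + (\<Sum>i\<in>UNIV. s i * Q \<omega> (L i) j ^ p))) *
          ennreal (exp ((\<Sum>i\<in>UNIV. \<Sum>j\<in>UNIV. s i * s j * Q \<omega> (L i) (L j) ^ p) / 2)) \<partial>M)"
        by (rule cameron_martin[OF _ \<Phi>]) simp
      also have "\<dots> = (\<integral>\<^sup>+\<omega>. indicator (T d) \<omega> * ennreal (exp (d\<^sup>2 * V \<omega> / 2)) \<partial>M)"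
      proof (rule nn_integral_cong)
        fix \<omega> assume \<omega>: "\<omega> \<in> space M"
        have 1: "(\<Sum>i\<in>UNIV. s i * Q \<omega> (L i) l ^ p) = d * k1 \<omega>" "(\<Sum>i\<in>UNIV. s i * Q \<omega> (L i) l' ^ p) = d * k2 \<omega>"
          by (auto simp: UNIV_bool s_def L_def p k1_def k2_def algebra_simps)
        have "(\<Sum>i\<in>UNIV. \<Sum>j\<in>UNIV. s i * s j * Q \<omega> (L i) (L j) ^ p) = d\<^sup>2 * V \<omega>"
          using Q_commute[of \<omega> l l'] by (simp add: UNIV_bool s_def L_def p V_def power2_eq_square algebra_simps)
        then show "\<Phi> (arr (w \<omega>) (\<xi> \<omega>) (\<lambda>j. h \<omega> j + (\<Sum>i\<in>UNIV. s i * Q \<omega> (L i) j ^ p))) *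
          ennreal (exp ((\<Sum>i\<in>UNIV. \<Sum>j\<in>UNIV. s i * s j * Q \<omega> (L i) (L j) ^ p) / 2)) =
          indicator (T d) \<omega> * ennreal (exp (d\<^sup>2 * V \<omega> / 2))"
          using \<omega> 1 by (simp add: \<Phi>_def arr_def T_def indicator_def)
      qed
      finally show ?thesis .
    qed
    \<comment> \<open>On this part of the tie event the density exp(c (h l - h l')) with 0 < c \<le>
      1 is bounded below by exp(-m).\<close>
    define A where "A m = T 0 \<inter> {\<omega> \<in> space M. \<bar>h \<omega> l - h \<omega> l'\<bar> \<le> real m}" for m
    have Am[measurable]: "A m \<in> sets M" for m unfolding A_def by measurable
    have bound: "exp (- real m) * prob (A m) \<le> exp 2 * prob (T (c k))" for m k
    proof -
      have "ennreal (exp (- real m) * prob (A m)) = (\<integral>\<^sup>+\<omega>. ennreal (exp (- real m)) * indicator (A m) \<omega> \<partial>M)"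
        by (simp add: nn_integral_cmult_indicator emeasure_eq_measure ennreal_mult)
      also have "\<dots> \<le> (\<integral>\<^sup>+\<omega>. indicator (T 0) \<omega> * ennreal (exp (c k * (h \<omega> l - h \<omega> l'))) \<partial>M)"
      proof (rule nn_integral_mono)
        fix \<omega> assume "\<omega> \<in> space M"
        have "- real m \<le> c k * (h \<omega> l - h \<omega> l')" if "\<bar>h \<omega> l - h \<omega> l'\<bar> \<le> real m"
        proof -
          have "\<bar>c k * (h \<omega> l - h \<omega> l')\<bar> \<le> 1 * real m"
            unfolding abs_mult using c[of k] that by (intro mult_mono) auto
          then show ?thesis by (simp add: abs_le_iff)
        qed
        then show "ennreal (exp (- real m)) * indicator (A m) \<omega> \<le> indicator (T 0) \<omega> * ennreal (exp (c k * (h \<omega> l - h \<omega> l')))"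
          by (auto simp: A_def indicator_def)
      qed
      also have "\<dots> = (\<integral>\<^sup>+\<omega>. indicator (T (c k)) \<omega> * ennreal (exp ((c k)\<^sup>2 * V \<omega> / 2)) \<partial>M)" by (rule shift)
      also have "\<dots> \<le> (\<integral>\<^sup>+\<omega>. ennreal (exp 2) * indicator (T (c k)) \<omega> \<partial>M)"
      proof (rule nn_integral_mono)
        fix \<omega> assume \<omega>: "\<omega> \<in> space M"
        have "(c k)\<^sup>2 * V \<omega> \<le> (c k)\<^sup>2 * 4" by (intro mult_left_mono V4 \<omega>) simp
        also have "\<dots> \<le> 4" using c[of k] by (simp add: power_le_one)
        finally show "indicator (T (c k)) \<omega> * ennreal (exp ((c k)\<^sup>2 * V \<omega> / 2)) \<le> ennreal (exp 2) * indicator (T (c k)) \<omega>"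
          by (auto simp: indicator_def)
      qed
      also have "\<dots> = ennreal (exp 2 * prob (T (c k)))"
        by (simp add: nn_integral_cmult_indicator emeasure_eq_measure ennreal_mult)
      finally show ?thesis by (subst (asm) ennreal_le_iff) auto
    qed
    have "prob (A m) = 0" for m
    proof -
      have "(\<lambda>k. exp 2 * prob (T (c k))) \<longlonglongrightarrow> exp 2 * 0" by (intro tendsto_mult tendsto_const lim)
      then have "exp (- real m) * prob (A m) \<le> exp 2 * 0"
        by (rule LIMSEQ_le_const) (use bound in blast)
      then have "prob (A m) \<le> 0" by (simp add: mult_le_0_iff)
      then show ?thesis using measure_nonneg[of M "A m"] by linarith
    qed
    then have "AE \<omega> in M. \<omega> \<notin> A m" for m
      by (intro AE_not_in) (auto simp: null_sets_def emeasure_eq_measure)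
    then have "AE \<omega> in M. \<forall>m. \<omega> \<notin> A m" by (simp add: AE_all_countable)
    then show ?thesis
      using AE_space
    proof eventually_elim
      case (elim \<omega>)
      obtain m where "\<bar>h \<omega> l - h \<omega> l'\<bar> \<le> real m" using real_arch_simple by blast
      then have "\<omega> \<notin> T 0" using elim by (auto simp: A_def)
      then show ?case using elim(2) by (simp add: T_def)
    qed
  qed simp
  then show ?thesis by (simp add: AE_all_countable)
qed

section \<open>Reconstructing the arrays from replicas\<close>

text \<open>The indicators of different replicas are independent, so the mean square error is the
  variance (v l - (v l)^2) / n.\<close>

lemma label_frequency_variance:
  assumes v: "\<And>l. 0 \<le> v l" "v sums 1" and n: "0 < n"
  shows "(\<integral>\<^sup>+u. ennreal (((\<Sum>j<n. if label v (u j) = l then 1 else 0) / real n - v l)\<^sup>2) \<partial>unifs) \<le> ennreal (1 / real n)"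
proof -
  define I where "I j u = (if label v (u j) = l then 1 else 0 :: real)" for j :: nat and u :: "nat \<Rightarrow> real"
  define A where "A = {x. label v x = l}"
  have A: "A \<in> sets unif" unfolding A_def by measurable
  have Im[measurable]: "I j \<in> borel_measurable unifs" for j
  proof -
    have "(\<lambda>x. if label v x = l then 1 else 0 :: real) \<in> borel_measurable unif" by measurable
    then show ?thesis
      unfolding I_def[abs_def]
      by (rule measurable_compose[OF measurable_component_singleton[of j UNIV "\<lambda>_. unif"], rotated]) simp
  qed
  have I01: "0 \<le> I j u" "I j u \<le> 1" for j u by (auto simp: I_def)
  have int2: "integrable unifs (\<lambda>u. I i u * I j u)" for i j
    using I01 by (intro unifs.integrable_const_bound[where B = 1]) (auto intro!: mult_le_one)
  have int1: "integrable unifs (I i)" for i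
    using I01 by (intro unifs.integrable_const_bound[where B = 1]) auto
  have E2: "(\<integral>u. I i u * I j u \<partial>unifs) = (v l)\<^sup>2 + (if i = j then v l - (v l)\<^sup>2 else 0)" for i j
  proof -
    have S: "{u \<in> space unifs. \<forall>k\<in>{i, j}. u k \<in> A} \<in> sets unifs" (is "?S \<in> _")
      using A by measurable
    have "(\<integral>u. I i u * I j u \<partial>unifs) = (\<integral>u. indicator ?S u \<partial>unifs)"
      by (intro Bochner_Integration.integral_cong) (auto simp: I_def A_def indicator_def)
    also have "\<dots> = measure unifs ?S" using S by simp
    finally have 1: "(\<integral>u. I i u * I j u \<partial>unifs) = measure unifs ?S" .
    have "emeasure unifs ?S = (\<Prod>k\<in>{i, j}. emeasure unif A)"
      using A by (intro unifs.emeasure_PiM_Collect) auto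
    also have "\<dots> = (\<Prod>k\<in>{i, j}. ennreal (v l))"
      unfolding A_def emeasure_unif_label[OF v] ..
    also have "\<dots> = ennreal ((v l)\<^sup>2 + (if i = j then v l - (v l)\<^sup>2 else 0))"
      using v(1)[of l] by (auto simp: power2_eq_square ennreal_mult)
    finally have "measure unifs ?S = (v l)\<^sup>2 + (if i = j then v l - (v l)\<^sup>2 else 0)"
      using v(1)[of l] by (simp add: measure_def)
    then show ?thesis using 1 by simp
  qed
  have E1: "(\<integral>u. I i u \<partial>unifs) = v l" for i
  proof -
    have "I i u = I i u * I i u" for u by (simp add: I_def)
    then have "(\<integral>u. I i u \<partial>unifs) = (\<integral>u. I i u * I i u \<partial>unifs)" by (intro Bochner_Integration.integral_cong) auto
    then show ?thesis using E2[of i i] by simp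
  qed
  have v1: "v l \<le> 1" using sum_le_suminf[OF sums_summable[OF v(2)], of "{l}"] v by (simp add: sums_iff)
  have expand: "((\<Sum>j<n. I j u) / real n - v l)\<^sup>2 =
    (\<Sum>i<n. \<Sum>j<n. I i u * I j u) / (real n)\<^sup>2 - 2 * v l / real n * (\<Sum>i<n. I i u) + (v l)\<^sup>2" for u
  proof -
    have prod: "(\<Sum>i<n. \<Sum>j<n. I i u * I j u) = (\<Sum>i<n. I i u)\<^sup>2"
      by (simp add: power2_eq_square sum_product)
    show ?thesis unfolding prod by (simp add: power2_diff power_divide mult_ac)
  qed
  have ii: "integrable unifs (\<lambda>u. ((\<Sum>j<n. I j u) / real n - v l)\<^sup>2)"
    unfolding expand using int1 int2
    by (intro Bochner_Integration.integrable_add Bochner_Integration.integrable_diff integrable_divide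
        integrable_mult_right Bochner_Integration.integrable_sum) auto
  have "(\<integral>u. ((\<Sum>j<n. I j u) / real n - v l)\<^sup>2 \<partial>unifs) =
    (\<Sum>i<n. \<Sum>j<n. \<integral>u. I i u * I j u \<partial>unifs) / (real n)\<^sup>2 - 2 * v l / real n * (\<Sum>i<n. \<integral>u. I i u \<partial>unifs) + (v l)\<^sup>2"
  proof -
    have a: "integrable unifs (\<lambda>u. (\<Sum>i<n. \<Sum>j<n. I i u * I j u) / (real n)\<^sup>2)"
      "integrable unifs (\<lambda>u. 2 * v l / real n * (\<Sum>i<n. I i u))"
      using int1 int2 by (auto intro!: integrable_divide integrable_mult_right Bochner_Integration.integrable_sum)
    show ?thesis
      unfolding expand
      using a int1 int2 by (simp add: Bochner_Integration.integral_sum prob_space.prob_space[OF unifs.prob_space_axioms])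
  qed
  also have "\<dots> = (v l - (v l)\<^sup>2) / real n"
  proof -
    have "(\<Sum>i<n. \<Sum>j<n. \<integral>u. I i u * I j u \<partial>unifs) = (real n)\<^sup>2 * (v l)\<^sup>2 + real n * (v l - (v l)\<^sup>2)"
      by (simp add: E2 sum.distrib power2_eq_square algebra_simps)
    moreover have "((real n)\<^sup>2 * (v l)\<^sup>2 + real n * (v l - (v l)\<^sup>2)) / (real n)\<^sup>2 = (v l)\<^sup>2 + (v l - (v l)\<^sup>2) / real n"
      using n by (simp add: add_divide_distrib power2_eq_square)
    moreover have "2 * v l / real n * (\<Sum>i<n. \<integral>u. I i u \<partial>unifs) = 2 * (v l)\<^sup>2"
      using n by (simp add: E1 power2_eq_square)
    ultimately show ?thesis by simp
  qed
  also have "\<dots> \<le> 1 / real n" 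
  proof (rule divide_right_mono)
    show "v l - (v l)\<^sup>2 \<le> 1" using v1 zero_le_power2[of "v l"] by linarith
  qed simp
  finally have "(\<integral>u. ((\<Sum>j<n. I j u) / real n - v l)\<^sup>2 \<partial>unifs) \<le> 1 / real n" .
  then show ?thesis
    unfolding I_def[symmetric] by (subst nn_integral_eq_integral[OF ii]) (auto intro: ennreal_leI)
qed

text \<open>Here \<open>x\<close> holds the overlaps of infinitely many replicas and the values of the field at them. Two
  replicas occupy the same atom iff their overlap is \<open>q\<close>, so \<open>freq q x i\<close> is the weight of the atom
  of replica \<open>i\<close>, and distinct weights can be put in order. The truncation to \<open>[0, 1]\<close> keeps the
  suprema in \<open>ranked\<close> bounded also where the limit does not exist.\<close>

definition freq :: "real \<Rightarrow> ((nat \<times> nat) + nat \<Rightarrow> real) \<Rightarrow> nat \<Rightarrow> real" where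
  "freq q x i = max 0 (min 1 (lim (\<lambda>k. (\<Sum>j<2 ^ k. if x (Inl (i, j)) = q then 1 else 0) / 2 ^ k)))"

text \<open>A weight appears in \<open>W\<close> once for each replica of its atom, so the next
  value is a supremum over the entries strictly below the previous one. The value 0 for the excluded
  entries cannot exceed it, since weights are nonnegative.\<close>

primrec ranked :: "(nat \<Rightarrow> real) \<Rightarrow> nat \<Rightarrow> real" where
  "ranked W 0 = (SUP j. W j)"
| "ranked W (Suc k) = (SUP j. if W j < ranked W k then W j else 0)"

definition locate :: "(nat \<Rightarrow> real) \<Rightarrow> nat \<Rightarrow> nat" where
  "locate W l = (LEAST i. W i = ranked W l)"

definition rebuild :: "real \<Rightarrow> ((nat \<times> nat) + nat \<Rightarrow> real) \<Rightarrow> nat + nat + nat \<times> nat \<Rightarrow> real" where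
  "rebuild q x = case_sum (ranked (freq q x)) (case_sum (\<lambda>l. x (Inr (locate (freq q x) l)))
    (\<lambda>(l, l'). x (Inl (locate (freq q x) l, locate (freq q x) l'))))"

lemma ranked_eq:
  assumes V: "\<And>l. 0 \<le> V l" "\<And>l. V (Suc l) < V l" and surj: "surj \<nu>" and W: "\<And>i. W i = V (\<nu> i)"
  shows "ranked W k = V k"
proof -
  have dec: "V l' < V l" if "l < l'" for l l'
    using lift_Suc_mono_less[of "\<lambda>l. - V l", OF _ that] V(2) by simp
  have dec': "V l' \<le> V l" if "l \<le> l'" for l l'
    using dec[of l l'] that by (cases "l = l'") auto
  show ?thesis
  proof (cases k)
    case 0
    obtain j where "\<nu> j = 0" using surj by (metis surj_def)
    then have "V 0 \<in> range W" using W[of j] by (metis rangeI)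
    then have "(SUP j. W j) = V 0" by (rule cSup_eq_maximum) (auto simp: W dec')
    then show ?thesis using 0 by simp
  next
    case (Suc k')
    have "ranked W m = V m \<Longrightarrow> ranked W (Suc m) = V (Suc m)" for m
    proof -
      assume m: "ranked W m = V m"
      obtain j where "\<nu> j = Suc m" using surj by (metis surj_def)
      then have "V (Suc m) = (if W j < V m then W j else 0)" using V(2) by (simp add: W)
      then have "V (Suc m) \<in> range (\<lambda>j. if W j < V m then W j else 0)" by (rule range_eqI)
      moreover have "y \<le> V (Suc m)" if y: "y \<in> range (\<lambda>j. if W j < V m then W j else 0)" for y
      proof -
        obtain j where j: "y = (if W j < V m then W j else 0)" using y by blast
        show ?thesis
        proof (cases "W j < V m")
          case True
          then have "Suc m \<le> \<nu> j" using dec'[of "\<nu> j" m] by (force simp: W)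
          then show ?thesis using True j dec' by (simp add: W)
        qed (use j V(1) in simp)
      qed
      ultimately have "(SUP j. if W j < V m then W j else 0) = V (Suc m)" by (rule cSup_eq_maximum)
      then show ?thesis using m by simp
    qed
    moreover have "ranked W 0 = V 0"
    proof -
      obtain j where "\<nu> j = 0" using surj by (metis surj_def)
      then have "V 0 \<in> range W" using W[of j] by (metis rangeI)
      then have "(SUP j. W j) = V 0" by (rule cSup_eq_maximum) (auto simp: W dec')
      then show ?thesis by simp
    qed
    ultimately show ?thesis by (induction k) auto
  qed
qed

lemma locate_eq:
  assumes V: "\<And>l. 0 \<le> V l" "\<And>l. V (Suc l) < V l" and surj: "surj \<nu>" and W: "\<And>i. W i = V (\<nu> i)"
  shows "\<nu> (locate W l) = l"
proof -
  obtain j where "\<nu> j = l" using surj by (metis surj_def)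
  then have "W j = ranked W l" using ranked_eq[OF assms, of l] W[of j] by metis
  then have "W (locate W l) = ranked W l" unfolding locate_def by (rule LeastI)
  then have eq: "V (\<nu> (locate W l)) = V l" using ranked_eq[OF assms] by (simp add: W)
  have "V l' < V l" if "l < l'" for l l'
    using lift_Suc_mono_less[of "\<lambda>l. - V l", OF _ that] V(2) by simp
  then show ?thesis using eq by (metis less_irrefl linorder_neqE_nat)
qed

section \<open>Measurability of the reconstruction\<close>

lemma measurable_component_UNIV: "(\<lambda>x. x k) \<in> borel_measurable (Pi\<^sub>M UNIV (\<lambda>_. borel))"
  by (rule measurable_component_singleton) simp

lemma measurable_PiM_UNIV_I:
  assumes "\<And>k. (\<lambda>x. f x k) \<in> borel_measurable A"
  shows "f \<in> A \<rightarrow>\<^sub>M Pi\<^sub>M UNIV (\<lambda>_. borel)"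
proof -
  have "(\<lambda>x. \<lambda>k\<in>UNIV. f x k) \<in> A \<rightarrow>\<^sub>M Pi\<^sub>M UNIV (\<lambda>_. borel)" by (rule measurable_restrict) (rule assms)
  then show ?thesis by (simp only: restrict_UNIV)
qed

lemma measurable_case_sum:
  assumes "\<And>l. (\<lambda>x. f x l) \<in> borel_measurable A" "\<And>l. (\<lambda>x. g x l) \<in> borel_measurable A"
  shows "(\<lambda>x. case_sum (f x) (g x) k) \<in> borel_measurable A"
  by (cases k) (simp_all add: assms)

lemma freq_bounds: "0 \<le> freq q x i" "freq q x i \<le> 1"
  by (auto simp: freq_def)

lemma measurable_freq: "(\<lambda>x. freq q x i) \<in> borel_measurable (Pi\<^sub>M UNIV (\<lambda>_. borel))"
proof -
  note [measurable] = measurable_component_UNIV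
  have [measurable]: "(\<lambda>x. lim (\<lambda>k. (\<Sum>j<2 ^ k. if x (Inl (i, j)) = q then 1 else 0 :: real) / 2 ^ k))
    \<in> borel_measurable (Pi\<^sub>M UNIV (\<lambda>_ :: (nat \<times> nat) + nat. borel :: real measure))"
    by (rule borel_measurable_lim_metric) measurable
  show ?thesis unfolding freq_def by measurable
qed

lemma measurable_ranked:
  "(\<lambda>x. ranked (freq q x) l) \<in> borel_measurable (Pi\<^sub>M UNIV (\<lambda>_. borel))"
proof (induction l)
  case 0
  show ?case unfolding ranked.simps
    by (rule borel_measurable_cSUP) (auto intro: measurable_freq freq_bounds bdd_aboveI2[where M = 1])
next
  case (Suc l)
  note [measurable] = Suc measurable_freq
  show ?case unfolding ranked.simps
  proof (rule borel_measurable_cSUP)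
    show "bdd_above (range (\<lambda>j. if freq q x j < ranked (freq q x) l then freq q x j else 0))" for x
      by (rule bdd_aboveI2[where M = 1]) (simp add: freq_bounds)
  qed (simp, measurable)
qed

lemma measurable_locate:
  "(\<lambda>x. locate (freq q x) l) \<in> Pi\<^sub>M UNIV (\<lambda>_. borel) \<rightarrow>\<^sub>M count_space UNIV"
proof -
  have "Measurable.pred (Pi\<^sub>M UNIV (\<lambda>_. borel)) (\<lambda>x. freq q x i = ranked (freq q x) l)" for i
    unfolding pred_def by (rule borel_measurable_eq[OF measurable_freq measurable_ranked])
  then show ?thesis unfolding locate_def by (rule measurable_Least)
qed

lemma measurable_rebuild: "rebuild q \<in> Pi\<^sub>M UNIV (\<lambda>_. borel) \<rightarrow>\<^sub>M Pi\<^sub>M UNIV (\<lambda>_. borel)"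
proof (rule measurable_PiM_UNIV_I)
  fix k :: "nat + nat + nat \<times> nat"
  let ?P = "Pi\<^sub>M UNIV (\<lambda>_ :: (nat \<times> nat) + nat. borel :: real measure)"
  have 1: "(\<lambda>x. x (Inr (locate (freq q x) l))) \<in> borel_measurable ?P" for l
    by (rule measurable_compose_countable[OF _ measurable_locate]) (rule measurable_component_UNIV)
  have "(\<lambda>x. x (Inl (a, locate (freq q x) l))) \<in> borel_measurable ?P" for a l
    by (rule measurable_compose_countable[OF _ measurable_locate]) (rule measurable_component_UNIV)
  then have 2: "(\<lambda>x. x (Inl (locate (freq q x) l, locate (freq q x) l'))) \<in> borel_measurable ?P" for l l'
    by (rule measurable_compose_countable[OF _ measurable_locate])
  show "(\<lambda>x. rebuild q x k) \<in> borel_measurable ?P"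
  proof (cases k)
    case (Inl l)
    then show ?thesis by (simp add: rebuild_def measurable_ranked)
  next
    case k: (Inr k')
    show ?thesis
    proof (cases k')
      case (Inl l)
      then show ?thesis using k 1 by (simp add: rebuild_def)
    next
      case (Inr ll)
      then show ?thesis using k 2 by (cases ll) (simp add: rebuild_def)
    qed
  qed
qed

section \<open>Sampling from arrays and recovering them\<close>

definition array_mgf ::
    "'a measure \<Rightarrow> ('a \<Rightarrow> nat \<Rightarrow> real) \<Rightarrow> ('a \<Rightarrow> nat \<Rightarrow> real) \<Rightarrow> ('a \<Rightarrow> nat \<times> nat \<Rightarrow> real) \<Rightarrow>
      nat \<Rightarrow> (nat \<times> nat \<Rightarrow> real) \<Rightarrow> (nat \<Rightarrow> real) \<Rightarrow> ennreal" where
  "array_mgf M v h C n c s = (\<integral>\<^sup>+\<omega>. navg (v \<omega>) n (\<lambda>l.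
     ennreal (exp (\<Sum>k\<in>{..<n} \<times> {..<n}. c k * ovl n (C \<omega>) l k)) * ennreal (exp (\<Sum>i<n. s i * h \<omega> (l i)))) \<partial>M)"

text \<open>Stated for abstract arrays because it is needed twice: for the original arrays, and for
  the sorted ones with the centred field after the change of density.\<close>

locale replica_arrays = prob_space M for M :: "'a measure" +
  fixes v h :: "'a \<Rightarrow> nat \<Rightarrow> real" and C :: "'a \<Rightarrow> nat \<times> nat \<Rightarrow> real" and q :: real
  assumes v_meas[measurable]: "\<And>l. (\<lambda>\<omega>. v \<omega> l) \<in> borel_measurable M"
    and h_meas[measurable]: "\<And>l. (\<lambda>\<omega>. h \<omega> l) \<in> borel_measurable M"
    and C_meas[measurable]: "\<And>k. (\<lambda>\<omega>. C \<omega> k) \<in> borel_measurable M"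
    and regular: "AE \<omega> in M. (\<forall>l. 0 < v \<omega> l) \<and> (\<forall>l. v \<omega> (Suc l) < v \<omega> l) \<and> v \<omega> sums 1 \<and>
      (\<forall>l l'. C \<omega> (l, l') = q \<longleftrightarrow> l = l')"
begin

definition slab :: "'a \<times> (nat \<Rightarrow> real) \<Rightarrow> nat \<Rightarrow> nat" where
  "slab z i = label (v (fst z)) (snd z i)"

definition sample :: "'a \<times> (nat \<Rightarrow> real) \<Rightarrow> (nat \<times> nat) + nat \<Rightarrow> real" where
  "sample z = case_sum (\<lambda>(i, j). C (fst z) (slab z i, slab z j)) (\<lambda>i. h (fst z) (slab z i))"

lemma measurable_slab[measurable]: "(\<lambda>z. slab z i) \<in> M \<Otimes>\<^sub>M unifs \<rightarrow>\<^sub>M count_space UNIV"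
  unfolding slab_def by (rule measurable_label) measurable

lemma measurable_sample: "(\<lambda>z. sample z k) \<in> borel_measurable (M \<Otimes>\<^sub>M unifs)"
proof (cases k)
  case (Inl ij)
  obtain i j where ij: "ij = (i, j)" by (cases ij)
  have "(\<lambda>z. C (fst z) (l, slab z j)) \<in> borel_measurable (M \<Otimes>\<^sub>M unifs)" for l
    by (rule measurable_compose_countable[OF _ measurable_slab]) measurable
  then have "(\<lambda>z. C (fst z) (slab z i, slab z j)) \<in> borel_measurable (M \<Otimes>\<^sub>M unifs)"
    by (rule measurable_compose_countable[OF _ measurable_slab])
  then show ?thesis by (simp add: sample_def Inl ij)
next
  case (Inr i)
  have "(\<lambda>z. h (fst z) (slab z i)) \<in> borel_measurable (M \<Otimes>\<^sub>M unifs)"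
    by (rule measurable_compose_countable[OF _ measurable_slab]) measurable
  then show ?thesis by (simp add: sample_def Inr)
qed

lemma AE_fst: "AE \<omega> in M. P \<omega> \<Longrightarrow> AE z in M \<Otimes>\<^sub>M unifs. P (fst z)"
  by (rule AE_distr_fst[OF prob_space_axioms unifs.prob_space_axioms])

text \<open>Along sample sizes 2^k the mean square errors are at most 2^-k. Their sum is finite, so
  almost surely the squared errors are summable and tend to 0; this is why \<open>freq\<close> uses
  powers of 2.\<close>

lemma frequency_limit:
  "AE z in M \<Otimes>\<^sub>M unifs. \<forall>l. (\<lambda>k. (\<Sum>j<2 ^ k. if slab z j = l then 1 else 0) / 2 ^ k) \<longlonglongrightarrow> v (fst z) l"
  unfolding AE_all_countable
proof
  fix l
  define d where "d k z = (\<Sum>j<2 ^ k. if slab z j = l then 1 else 0) / 2 ^ k - v (fst z) l" for k z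
  define F where "F k z = ennreal ((d k z)\<^sup>2)" for k z
  have ind: "(\<lambda>z. if slab z j = l then 1 else 0 :: real) \<in> borel_measurable (M \<Otimes>\<^sub>M unifs)" for j
    by measurable
  have Fm[measurable]: "F k \<in> borel_measurable (M \<Otimes>\<^sub>M unifs)" for k
    unfolding F_def[abs_def] d_def
    by (intro measurable_compose[OF _ measurable_ennreal] borel_measurable_power borel_measurable_diff
        borel_measurable_divide borel_measurable_sum ind) measurable
  have "(\<integral>\<^sup>+z. F k z \<partial>(M \<Otimes>\<^sub>M unifs)) \<le> ennreal ((1 / 2) ^ k)" for k
  proof -
    have "(\<integral>\<^sup>+z. F k z \<partial>(M \<Otimes>\<^sub>M unifs)) = (\<integral>\<^sup>+\<omega>. \<integral>\<^sup>+u. F k (\<omega>, u) \<partial>unifs \<partial>M)"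
      by (rule unifs.nn_integral_fst[OF Fm, symmetric])
    also have "\<dots> \<le> (\<integral>\<^sup>+\<omega>. ennreal ((1 / 2) ^ k) \<partial>M)"
    proof (rule nn_integral_mono_AE)
      show "AE \<omega> in M. (\<integral>\<^sup>+u. F k (\<omega>, u) \<partial>unifs) \<le> ennreal ((1 / 2) ^ k)"
        using regular
      proof eventually_elim
        case (elim \<omega>)
        then have "(\<integral>\<^sup>+u. ennreal (((\<Sum>j<2 ^ k. if label (v \<omega>) (u j) = l then 1 else 0) / real (2 ^ k) - v \<omega> l)\<^sup>2) \<partial>unifs)
          \<le> ennreal (1 / real (2 ^ k))"
          by (intro label_frequency_variance) (auto intro: less_imp_le)
        then show ?case by (simp add: F_def d_def slab_def power_one_over)
      qed
    qed
    finally show ?thesis by (simp add: emeasure_space_1)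
  qed
  then have "(\<Sum>k. \<integral>\<^sup>+z. F k z \<partial>(M \<Otimes>\<^sub>M unifs)) \<le> (\<Sum>k. ennreal ((1 / 2) ^ k))"
    by (intro suminf_le) auto
  also have "\<dots> = ennreal (\<Sum>k. (1 / 2) ^ k)"
    by (rule suminf_ennreal2) (auto intro: summable_geometric)
  finally have "(\<integral>\<^sup>+z. (\<Sum>k. F k z) \<partial>(M \<Otimes>\<^sub>M unifs)) \<noteq> \<infinity>"
    by (subst nn_integral_suminf) (auto simp: top_unique)
  then have "AE z in M \<Otimes>\<^sub>M unifs. (\<Sum>k. F k z) \<noteq> \<infinity>"
    by (intro nn_integral_noteq_infinite) measurable
  then show "AE z in M \<Otimes>\<^sub>M unifs. (\<lambda>k. (\<Sum>j<2 ^ k. if slab z j = l then 1 else 0) / 2 ^ k) \<longlonglongrightarrow> v (fst z) l"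
  proof eventually_elim
    case (elim z)
    then have "summable (\<lambda>k. (d k z)\<^sup>2)"
      unfolding F_def by (intro summable_suminf_not_top) auto
    then have "(\<lambda>k. (d k z)\<^sup>2) \<longlonglongrightarrow> 0" by (rule summable_LIMSEQ_zero)
    then have "(\<lambda>k. sqrt ((d k z)\<^sup>2)) \<longlonglongrightarrow> sqrt 0" by (rule tendsto_real_sqrt)
    then have "(\<lambda>k. d k z) \<longlonglongrightarrow> 0" by (simp add: tendsto_rabs_zero_iff)
    then show ?case unfolding d_def by (rule LIM_zero_cancel)
  qed
qed

theorem rebuild_sample:
  "AE z in M \<Otimes>\<^sub>M unifs. rebuild q (sample z) = case_sum (v (fst z)) (case_sum (h (fst z)) (C (fst z)))"
  using frequency_limit AE_fst[OF regular]
proof eventually_elim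
  case (elim z)
  note lim = elim(1)
  have pos: "\<And>l. 0 < v (fst z) l" and dec: "\<And>l. v (fst z) (Suc l) < v (fst z) l" and one: "v (fst z) sums 1"
    and C: "\<And>l l'. C (fst z) (l, l') = q \<longleftrightarrow> l = l'"
    using elim(2) by blast+
  have nonneg: "0 \<le> v (fst z) l" for l using pos[of l] by simp
  \<comment> \<open>An atom that is never sampled has frequency 0, which contradicts its positive
    weight.\<close>
  have surj: "surj (slab z)"
    unfolding surj_def
  proof (intro allI, rule ccontr)
    fix l assume "\<not> (\<exists>x. l = slab z x)"
    then have "slab z j \<noteq> l" for j by auto
    then have "(\<lambda>k. 0 :: real) \<longlonglongrightarrow> v (fst z) l" using spec[OF lim, of l] by simp
    then have "v (fst z) l = 0" by (simp add: LIMSEQ_const_iff)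
    then show False using pos[of l] by simp
  qed
  have fr: "freq q (sample z) i = v (fst z) (slab z i)" for i
  proof -
    have "(\<lambda>k. (\<Sum>j<2 ^ k. if sample z (Inl (i, j)) = q then 1 else 0) / 2 ^ k :: real) \<longlonglongrightarrow> v (fst z) (slab z i)"
      using spec[OF lim, of "slab z i"] by (simp add: sample_def C eq_commute[of "slab z i"])
    then have "lim (\<lambda>k. (\<Sum>j<2 ^ k. if sample z (Inl (i, j)) = q then 1 else 0) / 2 ^ k :: real) = v (fst z) (slab z i)"
      by (rule limI)
    moreover have "v (fst z) (slab z i) \<le> 1"
      using sum_le_suminf[OF sums_summable[OF one], of "{slab z i}"] nonneg one by (simp add: sums_iff)
    ultimately show ?thesis using nonneg[of "slab z i"] by (simp add: freq_def)
  qed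
  note r = ranked_eq[where W = "freq q (sample z)", OF nonneg dec surj fr]
    and l = locate_eq[where W = "freq q (sample z)", OF nonneg dec surj fr]
  have "sample z (Inr i) = h (fst z) (slab z i)" "sample z (Inl (i, j)) = C (fst z) (slab z i, slab z j)" for i j
    by (simp_all add: sample_def)
  then show ?case
    by (auto simp: rebuild_def fun_eq_iff r l split: sum.split)
qed

lemma array_mgf_eq:
  "array_mgf M v h C n c s = (\<integral>\<^sup>+z. ennreal (exp ((\<Sum>k\<in>{..<n} \<times> {..<n}. c k * sample z (Inl k)) +
    (\<Sum>i<n. s i * sample z (Inr i)))) \<partial>(M \<Otimes>\<^sub>M unifs))"
proof -
  define G where "G \<omega> l = ennreal (exp (\<Sum>k\<in>{..<n} \<times> {..<n}. c k * ovl n (C \<omega>) l k)) * ennreal (exp (\<Sum>i<n. s i * h \<omega> (l i)))"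
    for \<omega> l
  have eq: "G (fst z) (labels n (v (fst z)) (snd z)) = ennreal (exp ((\<Sum>k\<in>{..<n} \<times> {..<n}. c k * sample z (Inl k)) +
    (\<Sum>i<n. s i * sample z (Inr i))))" for z
  proof -
    have "(\<Sum>k\<in>{..<n} \<times> {..<n}. c k * ovl n (C (fst z)) (labels n (v (fst z)) (snd z)) k) =
      (\<Sum>k\<in>{..<n} \<times> {..<n}. c k * sample z (Inl k))"
      by (intro sum.cong) (auto simp: ovl_def labels_def sample_def slab_def)
    moreover have "(\<Sum>i<n. s i * h (fst z) (labels n (v (fst z)) (snd z) i)) = (\<Sum>i<n. s i * sample z (Inr i))"
      by (intro sum.cong) (auto simp: labels_def sample_def slab_def)
    ultimately show ?thesis by (simp add: G_def exp_add ennreal_mult)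
  qed
  have m: "(\<lambda>z. ennreal (exp ((\<Sum>k\<in>{..<n} \<times> {..<n}. c k * sample z (Inl k)) +
    (\<Sum>i<n. s i * sample z (Inr i))))) \<in> borel_measurable (M \<Otimes>\<^sub>M unifs)"
    using measurable_sample by measurable
  have "array_mgf M v h C n c s = (\<integral>\<^sup>+\<omega>. navg (v \<omega>) n (G \<omega>) \<partial>M)"
    unfolding array_mgf_def G_def[abs_def] ..
  also have "\<dots> = (\<integral>\<^sup>+\<omega>. \<integral>\<^sup>+u. G \<omega> (labels n (v \<omega>) u) \<partial>unifs \<partial>M)"
  proof (rule nn_integral_cong_AE)
    show "AE \<omega> in M. navg (v \<omega>) n (G \<omega>) = (\<integral>\<^sup>+u. G \<omega> (labels n (v \<omega>) u) \<partial>unifs)"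
      using regular by eventually_elim (auto intro!: navg_eq_labels less_imp_le)
  qed
  also have "\<dots> = (\<integral>\<^sup>+z. ennreal (exp ((\<Sum>k\<in>{..<n} \<times> {..<n}. c k * sample z (Inl k)) +
    (\<Sum>i<n. s i * sample z (Inr i)))) \<partial>(M \<Otimes>\<^sub>M unifs))"
    using unifs.nn_integral_fst[OF m, symmetric] eq[of "(\<omega>, u)" for \<omega> u] by simp
  finally show ?thesis .
qed

lemma array_mgf_sum:
  assumes J: "finite (J :: ((nat \<times> nat) + nat) set)"
  obtains n c s where "2 \<le> n"
    and "\<And>x :: (nat \<times> nat) + nat \<Rightarrow> real. (\<Sum>k\<in>J. a k * x k) = (\<Sum>k\<in>{..<n} \<times> {..<n}. c k * x (Inl k)) + (\<Sum>i<n. s i * x (Inr i))"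
proof -
  define b where "b k = (case k of Inl (i, j) \<Rightarrow> max i j | Inr i \<Rightarrow> i)" for k :: "(nat \<times> nat) + nat"
  obtain m where m: "b ` J \<subseteq> {..<m}" using finite_nat_bounded[of "b ` J"] J by auto
  \<comment> \<open>The 2 ensures \<open>2 \<le> n\<close>, where the Ghirlanda-Guerra identities
    are available.\<close>
  define n where "n = m + 2"
  define A where "A = {k. Inl k \<in> J}"
  define B where "B = {i. Inr i \<in> J}"
  have JAB: "J = A <+> B"
  proof (rule set_eqI)
    show "k \<in> J \<longleftrightarrow> k \<in> A <+> B" for k
      by (cases k) (auto simp: A_def B_def Plus_def)
  qed
  have AB: "finite A" "finite B" using J by (auto simp: A_def B_def intro: finite_vimageI[unfolded vimage_def] inj_onI)
  have An: "A \<subseteq> {..<n} \<times> {..<n}" and Bn: "B \<subseteq> {..<n}"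
  proof -
    show "A \<subseteq> {..<n} \<times> {..<n}"
    proof
      fix k assume "k \<in> A"
      then have "b (Inl k) < m" using m by (auto simp: A_def)
      then show "k \<in> {..<n} \<times> {..<n}" by (cases k) (auto simp: b_def n_def)
    qed
    show "B \<subseteq> {..<n}"
    proof
      fix i assume "i \<in> B"
      then have "b (Inr i) < m" using m by (auto simp: B_def)
      then show "i \<in> {..<n}" by (auto simp: b_def n_def)
    qed
  qed
  show thesis
  proof (rule that[of n "\<lambda>k. if k \<in> A then a (Inl k) else 0" "\<lambda>i. if i \<in> B then a (Inr i) else 0"])
    fix x :: "(nat \<times> nat) + nat \<Rightarrow> real"
    have "(\<Sum>k\<in>J. a k * x k) = (\<Sum>k\<in>A. a (Inl k) * x (Inl k)) + (\<Sum>i\<in>B. a (Inr i) * x (Inr i))"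
      unfolding JAB by (simp add: sum.Plus[OF AB])
    also have "(\<Sum>k\<in>A. a (Inl k) * x (Inl k)) = (\<Sum>k\<in>{..<n} \<times> {..<n}. (if k \<in> A then a (Inl k) else 0) * x (Inl k))"
      using An by (intro sum.mono_neutral_cong_left) auto
    also have "(\<Sum>i\<in>B. a (Inr i) * x (Inr i)) = (\<Sum>i<n. (if i \<in> B then a (Inr i) else 0) * x (Inr i))"
      using Bn by (intro sum.mono_neutral_cong_left) auto
    finally show "(\<Sum>k\<in>J. a k * x k) = (\<Sum>k\<in>{..<n} \<times> {..<n}. (if k \<in> A then a (Inl k) else 0) * x (Inl k)) +
      (\<Sum>i<n. (if i \<in> B then a (Inr i) else 0) * x (Inr i))" .
  qed (simp add: n_def)
qed

lemma distr_rebuild: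
  "distr M (Pi\<^sub>M UNIV (\<lambda>_. borel)) (\<lambda>\<omega>. case_sum (v \<omega>) (case_sum (h \<omega>) (C \<omega>))) =
    distr (distr (M \<Otimes>\<^sub>M unifs) (Pi\<^sub>M UNIV (\<lambda>_. borel)) sample) (Pi\<^sub>M UNIV (\<lambda>_. borel)) (rebuild q)"
proof -
  have S: "sample \<in> M \<Otimes>\<^sub>M unifs \<rightarrow>\<^sub>M Pi\<^sub>M UNIV (\<lambda>_. borel)"
    by (rule measurable_PiM_UNIV_I) (rule measurable_sample)
  have T: "(\<lambda>\<omega>. case_sum (v \<omega>) (case_sum (h \<omega>) (C \<omega>))) \<in> M \<rightarrow>\<^sub>M Pi\<^sub>M UNIV (\<lambda>_. borel)"
    by (intro measurable_PiM_UNIV_I measurable_case_sum v_meas h_meas C_meas)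
  have "distr M (Pi\<^sub>M UNIV (\<lambda>_. borel)) (\<lambda>\<omega>. case_sum (v \<omega>) (case_sum (h \<omega>) (C \<omega>))) =
    distr (distr (M \<Otimes>\<^sub>M unifs) M fst) (Pi\<^sub>M UNIV (\<lambda>_. borel)) (\<lambda>\<omega>. case_sum (v \<omega>) (case_sum (h \<omega>) (C \<omega>)))"
    by (simp only: prob_space.distr_pair_fst[OF unifs.prob_space_axioms])
  also have "\<dots> = distr (M \<Otimes>\<^sub>M unifs) (Pi\<^sub>M UNIV (\<lambda>_. borel)) (\<lambda>z. case_sum (v (fst z)) (case_sum (h (fst z)) (C (fst z))))"
    using T by (subst distr_distr) (auto simp: o_def)
  also have "\<dots> = distr (M \<Otimes>\<^sub>M unifs) (Pi\<^sub>M UNIV (\<lambda>_. borel)) (rebuild q \<circ> sample)"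
  proof (rule distr_cong_AE[OF refl refl])
    show "AE z in M \<Otimes>\<^sub>M unifs. case_sum (v (fst z)) (case_sum (h (fst z)) (C (fst z))) = (rebuild q \<circ> sample) z"
      using rebuild_sample by eventually_elim simp
    show "(\<lambda>z. case_sum (v (fst z)) (case_sum (h (fst z)) (C (fst z)))) \<in> M \<Otimes>\<^sub>M unifs \<rightarrow>\<^sub>M Pi\<^sub>M UNIV (\<lambda>_. borel)"
      by (rule measurable_compose[OF measurable_fst T])
    show "rebuild q \<circ> sample \<in> M \<Otimes>\<^sub>M unifs \<rightarrow>\<^sub>M Pi\<^sub>M UNIV (\<lambda>_. borel)"
      by (rule measurable_comp[OF S measurable_rebuild])
  qed
  also have "\<dots> = distr (distr (M \<Otimes>\<^sub>M unifs) (Pi\<^sub>M UNIV (\<lambda>_. borel)) sample) (Pi\<^sub>M UNIV (\<lambda>_. borel)) (rebuild q)"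
    by (rule distr_distr[OF measurable_rebuild S, symmetric])
  finally show ?thesis .
qed

end

text \<open>Equal generating functions give the samples the same law, and both families of arrays
  are obtained from their samples by the same map \<open>rebuild q\<close>. The value marking a
  shared atom must therefore be common to both.\<close>

theorem replica_arrays_eqI:
  assumes A: "replica_arrays M v h C q" and A': "replica_arrays M' v' h' C' q"
    and eq: "\<And>n c s. 2 \<le> n \<Longrightarrow> array_mgf M v h C n c s = array_mgf M' v' h' C' n c s"
    and fin: "\<And>n c s. 2 \<le> n \<Longrightarrow> array_mgf M v h C n c s < \<infinity>"
  shows "distr M (Pi\<^sub>M UNIV (\<lambda>_. borel)) (\<lambda>\<omega>. case_sum (v \<omega>) (case_sum (h \<omega>) (C \<omega>))) =
    distr M' (Pi\<^sub>M UNIV (\<lambda>_. borel)) (\<lambda>\<omega>. case_sum (v' \<omega>) (case_sum (h' \<omega>) (C' \<omega>)))"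
proof -
  interpret A: replica_arrays M v h C q by (rule A)
  interpret A': replica_arrays M' v' h' C' q by (rule A')
  have "(\<integral>\<^sup>+z. ennreal (exp (\<Sum>k\<in>J. a k * A.sample z k)) \<partial>(M \<Otimes>\<^sub>M unifs)) =
      (\<integral>\<^sup>+z. ennreal (exp (\<Sum>k\<in>J. a k * A'.sample z k)) \<partial>(M' \<Otimes>\<^sub>M unifs)) \<and>
      (\<integral>\<^sup>+z. ennreal (exp (\<Sum>k\<in>J. a k * A.sample z k)) \<partial>(M \<Otimes>\<^sub>M unifs)) < \<infinity>"
    if J: "finite J" for J :: "((nat \<times> nat) + nat) set" and a
  proof -
    obtain n c s where n: "2 \<le> n"
      and sum: "\<And>x :: (nat \<times> nat) + nat \<Rightarrow> real. (\<Sum>k\<in>J. a k * x k) = (\<Sum>k\<in>{..<n} \<times> {..<n}. c k * x (Inl k)) + (\<Sum>i<n. s i * x (Inr i))"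
      using A.array_mgf_sum[OF J, of a] by blast
    show ?thesis
      unfolding sum A.array_mgf_eq[symmetric] A'.array_mgf_eq[symmetric] using eq[OF n] fin[OF n] by simp
  qed
  then have "distr (M \<Otimes>\<^sub>M unifs) (Pi\<^sub>M UNIV (\<lambda>_. borel)) A.sample = distr (M' \<Otimes>\<^sub>M unifs) (Pi\<^sub>M UNIV (\<lambda>_. borel)) A'.sample"
    by (intro distr_PiM_eq_of_mgf A.measurable_sample A'.measurable_sample) blast+
  then show ?thesis
    unfolding A.distr_rebuild A'.distr_rebuild by simp
qed

section \<open>The equivalence\<close>

lemma same_fdd_sym: "same_fdd M X Y \<Longrightarrow> same_fdd M Y X"
  by (simp add: same_fdd_def)

section \<open>Transfer along equality of finite dimensional distributions\<close>

context
  fixes M :: "'a measure" and X Y :: "'a \<Rightarrow> 'i \<Rightarrow> real"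
  assumes M: "prob_space M"
    and X: "\<And>k. (\<lambda>\<omega>. X \<omega> k) \<in> borel_measurable M" and Y: "\<And>k. (\<lambda>\<omega>. Y \<omega> k) \<in> borel_measurable M"
begin

lemma measurable_X: "X \<in> M \<rightarrow>\<^sub>M Pi\<^sub>M UNIV (\<lambda>_. borel)"
  and measurable_Y: "Y \<in> M \<rightarrow>\<^sub>M Pi\<^sub>M UNIV (\<lambda>_. borel)"
  by (rule measurable_PiM_UNIV_I, rule X, rule measurable_PiM_UNIV_I, rule Y)

lemma same_fdd_of_AE_eq:
  assumes "AE \<omega> in M. X \<omega> = Y \<omega>"
  shows "same_fdd M X Y"
  unfolding distr_PiM_eq_iff_same_fdd[OF X Y M]
  by (rule distr_cong_AE[OF refl refl assms measurable_X measurable_Y])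

context
  assumes same: "same_fdd M X Y"
begin

lemma same_distr: "distr M (Pi\<^sub>M UNIV (\<lambda>_. borel)) X = distr M (Pi\<^sub>M UNIV (\<lambda>_. borel)) Y"
  using same unfolding distr_PiM_eq_iff_same_fdd[OF X Y M] .

lemma same_fdd_AE:
  assumes P: "{x. P x} \<in> sets (Pi\<^sub>M UNIV (\<lambda>_. borel))" and ae: "AE \<omega> in M. P (X \<omega>)"
  shows "AE \<omega> in M. P (Y \<omega>)"
proof -
  have P': "{x \<in> space (Pi\<^sub>M UNIV (\<lambda>_. borel)). P x} \<in> sets (Pi\<^sub>M UNIV (\<lambda>_ :: 'i. borel :: real measure))"
    using P by (simp add: space_PiM)
  have "AE x in distr M (Pi\<^sub>M UNIV (\<lambda>_. borel)) X. P x"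
    using ae AE_distr_iff[OF measurable_X P'] by simp
  then have "AE x in distr M (Pi\<^sub>M UNIV (\<lambda>_. borel)) Y. P x"
    unfolding same_distr .
  then show ?thesis using AE_distr_iff[OF measurable_Y P'] by simp
qed

lemma same_fdd_nn_integral:
  assumes "\<Psi> \<in> borel_measurable (Pi\<^sub>M UNIV (\<lambda>_. borel))"
  shows "(\<integral>\<^sup>+\<omega>. \<Psi> (X \<omega>) \<partial>M) = (\<integral>\<^sup>+\<omega>. \<Psi> (Y \<omega>) \<partial>M)"
  using nn_integral_distr[OF measurable_X, of \<Psi>] nn_integral_distr[OF measurable_Y, of \<Psi>]
    same_distr assms by simp

lemma same_fdd_reindex: "same_fdd M (\<lambda>\<omega> k. X \<omega> (e k)) (\<lambda>\<omega> k. Y \<omega> (e k))"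
proof -
  have e: "(\<lambda>x k. x (e k)) \<in> Pi\<^sub>M UNIV (\<lambda>_ :: 'i. borel :: real measure) \<rightarrow>\<^sub>M Pi\<^sub>M UNIV (\<lambda>_. borel)"
    by (intro measurable_PiM_UNIV_I measurable_component_UNIV)
  have "distr M (Pi\<^sub>M UNIV (\<lambda>_. borel)) (\<lambda>\<omega> k. X \<omega> (e k)) = distr M (Pi\<^sub>M UNIV (\<lambda>_. borel)) (\<lambda>\<omega> k. Y \<omega> (e k))"
    using distr_distr[OF e measurable_X] distr_distr[OF e measurable_Y] same_distr
    by (simp add: o_def)
  then show ?thesis unfolding distr_PiM_eq_iff_same_fdd[OF X Y M] .
qed

end

end

context random_atoms
begin

lemma tilt_ratio_nonneg: "z \<in> space N \<Longrightarrow> 0 \<le> tilt_ratio n p s t z"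
  unfolding tilt_ratio_def using gav_pos[of z n p "\<lambda>a. t * s a"] by simp

lemma tilt_ratio_le:
  assumes z: "z \<in> space N"
  shows "tilt_ratio n p s t z \<le> exp (\<bar>t\<bar> * (\<Sum>i<n. \<bar>s i\<bar> * real n)) * gbd n (\<lambda>a. t * s a) ^ n"
proof -
  let ?g = "gav n p (\<lambda>a. t * s a) z" and ?B = "gbd n (\<lambda>a. t * s a)"
  have g: "0 < ?g" by (rule gav_pos[OF z])
  have "1 / ?B \<le> ?g" using gav_bounds(1)[OF z, of n p "\<lambda>a. t * s a"] by simp
  then have "1 / ?g \<le> ?B"
    using g gbd_ge_1[of n "\<lambda>a. t * s a"] by (simp add: pos_divide_le_eq mult.commute)
  then have 1: "(1 / ?g) ^ n \<le> ?B ^ n" using g by (intro power_mono) auto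
  have "t * tilt_exponent n p s z \<le> \<bar>t\<bar> * \<bar>tilt_exponent n p s z\<bar>" by (metis abs_ge_self abs_mult)
  also have "\<dots> \<le> \<bar>t\<bar> * (\<Sum>i<n. \<bar>s i\<bar> * real n)" by (intro mult_left_mono tilt_exponent_bound z) simp
  finally have "exp (t * tilt_exponent n p s z) * (1 / ?g) ^ n \<le> exp (\<bar>t\<bar> * (\<Sum>i<n. \<bar>s i\<bar> * real n)) * ?B ^ n"
    using 1 g by (intro mult_mono) auto
  then show ?thesis by (simp add: tilt_ratio_def power_one_over)
qed

lemma tilt_ratio_scale: "tilt_ratio n p (\<lambda>i. c * s i) 1 = tilt_ratio n p s c"
  by (simp add: fun_eq_iff tilt_ratio_def tilt_exponent_def sum_distrib_left mult_ac)

end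

section \<open>Joint stability with the field\<close>

context gaussian_field
begin

definition b :: real where "b = q ^ p - mom p"

definition stable :: "real \<Rightarrow> bool" where
  "stable t \<longleftrightarrow> same_fdd M (\<lambda>\<omega>. case_sum (tw t \<omega>) (tQ t \<omega>)) (\<lambda>\<omega>. case_sum (w \<omega>) (Qm \<omega>))"

definition jointly_stable :: "real \<Rightarrow> bool" where
  "jointly_stable t \<longleftrightarrow> same_fdd M (\<lambda>\<omega>. case_sum (tw t \<omega>) (case_sum (\<lambda>l. th t \<omega> l - b * t) (tQ t \<omega>)))
    (\<lambda>\<omega>. case_sum (w \<omega>) (case_sum (h \<omega>) (Qm \<omega>)))"

lemma measurable_w': "(\<lambda>\<omega>. w \<omega> l) \<in> borel_measurable M"
  by measurable

lemma measurable_th_shift: "(\<lambda>\<omega>. th t \<omega> l - c) \<in> borel_measurable M"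
  by measurable

lemmas measurable_arrays = measurable_case_sum measurable_tw measurable_tQ measurable_th_shift
  measurable_w' measurable_h measurable_Qm

lemma jointly_stable_imp_stable:
  assumes "jointly_stable t"
  shows "stable t"
proof -
  define e :: "nat + nat \<times> nat \<Rightarrow> nat + nat + nat \<times> nat" where "e = case_sum Inl (\<lambda>k. Inr (Inr k))"
  have "same_fdd M (\<lambda>\<omega> k. case_sum (tw t \<omega>) (case_sum (\<lambda>l. th t \<omega> l - b * t) (tQ t \<omega>)) (e k))
    (\<lambda>\<omega> k. case_sum (w \<omega>) (case_sum (h \<omega>) (Qm \<omega>)) (e k))"
    by (rule same_fdd_reindex[OF prob_space_axioms _ _ assms[unfolded jointly_stable_def]]) (intro measurable_arrays)+
  moreover have "(\<lambda>k. case_sum f (case_sum g q) (e k)) = case_sum f q" for f g :: "nat \<Rightarrow> real" and q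
    by (auto simp: e_def fun_eq_iff split: sum.split)
  ultimately show ?thesis by (simp add: stable_def)
qed

text \<open>Centring by \<open>b * t\<close> contributes exp(- b t \<Sum> s i), and the diagonal
  overlaps on the sphere contribute its inverse. What remains is \<open>tilt_ratio\<close>.\<close>

lemma shifted_mgf:
  assumes sph: spherical and ac: "stable t"
    and f[measurable]: "f \<in> borel_measurable (Pi\<^sub>M ({..<n} \<times> {..<n}) (\<lambda>_. borel))" and f0: "\<And>r. 0 \<le> f r"
  shows "(\<integral>\<^sup>+\<omega>. navg (tw t \<omega>) n (\<lambda>l. ennreal (f (ovl n (tQ t \<omega>) l)) *
      ennreal (exp (\<Sum>i<n. s i * (th t \<omega> (l i) - b * t)))) \<partial>M) =
    (\<integral>\<^sup>+z. ennreal (f (RN n z) * exp (qform p n s (RN n z) / 2) * tilt_ratio n p s t z) \<partial>N)"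
proof -
  define S where "S = (\<Sum>i<n. s i)"
  define F where "F r = ennreal (f r * exp (- (b * t * S)))" for r
  have Fm: "F \<in> borel_measurable (Pi\<^sub>M ({..<n} \<times> {..<n}) (\<lambda>_. borel))" unfolding F_def[abs_def] by measurable
  have "(\<Sum>i<n. s i * (b * t)) = b * t * S"
    unfolding S_def sum_distrib_left by (simp only: mult.commute)
  then have lin: "(\<Sum>i<n. s i * (x i - b * t)) = - (b * t * S) + (\<Sum>i<n. s i * x i)" for x
    by (simp add: right_diff_distrib sum_subtractf)
  have "ennreal (f r) * ennreal (exp (\<Sum>i<n. s i * (x i - b * t))) = F r * ennreal (exp (\<Sum>i<n. s i * x i))" for r x
    unfolding lin F_def exp_add by (simp add: ennreal_mult f0 mult_ac)
  then have "(\<integral>\<^sup>+\<omega>. navg (tw t \<omega>) n (\<lambda>l. ennreal (f (ovl n (tQ t \<omega>) l)) *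
      ennreal (exp (\<Sum>i<n. s i * (th t \<omega> (l i) - b * t)))) \<partial>M) =
    (\<integral>\<^sup>+\<omega>. navg (tw t \<omega>) n (\<lambda>l. F (ovl n (tQ t \<omega>) l) * ennreal (exp (\<Sum>i<n. s i * th t \<omega> (l i)))) \<partial>M)"
    by simp
  also have "\<dots> = (\<integral>\<^sup>+z. F (RN n z) * (ennreal (exp (qform p n s (RN n z) / 2)) *
      ennreal (shift_factor p n (\<lambda>i. t * s i) (w (fst z)) (Qm (fst z)) (lab z))) \<partial>N)"
    by (rule sorted_tilt_mgf[OF Fm ac[unfolded stable_def]])
  also have "\<dots> = (\<integral>\<^sup>+z. ennreal (f (RN n z) * exp (qform p n s (RN n z) / 2) * tilt_ratio n p s t z) \<partial>N)"
  proof (rule nn_integral_cong_AE)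
    show "AE z in N. F (RN n z) * (ennreal (exp (qform p n s (RN n z) / 2)) *
        ennreal (shift_factor p n (\<lambda>i. t * s i) (w (fst z)) (Qm (fst z)) (lab z))) =
      ennreal (f (RN n z) * exp (qform p n s (RN n z) / 2) * tilt_ratio n p s t z)"
      using spherical_R_diag[OF sph] AE_space
    proof eventually_elim
      case (elim z)
      define E where "E = exp (qform p n s (RN n z) / 2)"
      define tr where "tr = tilt_ratio n p s t z"
      have tr: "0 \<le> tr" unfolding tr_def by (rule tilt_ratio_nonneg[OF elim(2)])
      have E: "0 \<le> E" by (simp add: E_def)
      have sf: "shift_factor p n (\<lambda>i. t * s i) (w (fst z)) (Qm (fst z)) (lab z) = tr * exp (b * t * S)"
        using shift_factor_eq_tilt_ratio[OF elim(2), of q p n t s] elim(1) by (simp add: tr_def b_def S_def mult_ac)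
      have "f (RN n z) * exp (- (b * t * S)) * (E * (tr * exp (b * t * S))) =
        f (RN n z) * E * tr * (exp (- (b * t * S)) * exp (b * t * S))" by (simp only: mult_ac)
      also have "exp (- (b * t * S)) * exp (b * t * S) = 1" by (simp add: exp_add[symmetric])
      finally have "f (RN n z) * exp (- (b * t * S)) * (E * (tr * exp (b * t * S))) = f (RN n z) * E * tr" by simp
      then show ?case
        unfolding sf F_def E_def[symmetric] tr_def[symmetric]
        using tr E f0 by (simp add: ennreal_mult[symmetric])
    qed
  qed
  finally show ?thesis .
qed

text \<open>Joint stability equates generating functions that differ by \<open>tilt_ratio\<close>.
  Both contain the Gaussian factor exp(\<open>qform\<close> / 2), which is a function of the
  overlaps and is cancelled by the choice of test function. Stability at \<open>t = 1\<close>
  suffices, since \<open>tilt_ratio\<close> depends only on the products of \<open>t\<close> and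
  \<open>s i\<close>.\<close>

theorem jointly_stable_imp_tilt_ratio:
  assumes sph: spherical and js: "jointly_stable 1"
    and f[measurable]: "f \<in> borel_measurable (Pi\<^sub>M ({..<n} \<times> {..<n}) (\<lambda>_. borel))" and f0: "\<And>r. 0 \<le> f r"
  shows "(\<integral>z. f (RN n z) * tilt_ratio n p s c z \<partial>N) = (\<integral>z. f (RN n z) \<partial>N)"
proof -
  define s' where "s' i = c * s i" for i
  define f' where "f' r = f r * exp (- (qform p n s' r / 2))" for r
  have f'[measurable]: "f' \<in> borel_measurable (Pi\<^sub>M ({..<n} \<times> {..<n}) (\<lambda>_. borel))"
    unfolding f'_def[abs_def] by measurable
  have f'0: "0 \<le> f' r" for r using f0 by (simp add: f'_def)
  have canc: "f' r * exp (qform p n s' r / 2) = f r" for r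
    unfolding f'_def mult.assoc by (simp add: exp_add[symmetric])
  define \<Psi> where "\<Psi> x = navg (\<lambda>k. x (Inl k)) n (\<lambda>l. ennreal (f' (ovl n (\<lambda>k. x (Inr (Inr k))) l)) *
      ennreal (exp (\<Sum>i<n. s' i * x (Inr (Inl (l i))))))" for x :: "nat + nat + nat \<times> nat \<Rightarrow> real"
  have \<Psi>: "\<Psi> \<in> borel_measurable (Pi\<^sub>M UNIV (\<lambda>_. borel))"
  proof -
    have [measurable]: "(\<lambda>x. x k) \<in> borel_measurable (Pi\<^sub>M UNIV (\<lambda>_. borel))" for k :: "nat + nat + nat \<times> nat"
      by (rule measurable_component_UNIV)
    have [measurable]: "(\<lambda>x. ovl n (\<lambda>k. x (Inr (Inr k))) l) \<in> Pi\<^sub>M UNIV (\<lambda>_ :: nat + nat + nat \<times> nat. borel :: real measure)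
        \<rightarrow>\<^sub>M Pi\<^sub>M ({..<n} \<times> {..<n}) (\<lambda>_. borel)" for l
      by (rule measurable_ovl) (rule measurable_component_UNIV)
    show ?thesis unfolding \<Psi>_def by (rule measurable_navg) measurable
  qed
  have "(\<integral>\<^sup>+\<omega>. \<Psi> (case_sum (tw 1 \<omega>) (case_sum (\<lambda>l. th 1 \<omega> l - b * 1) (tQ 1 \<omega>))) \<partial>M) =
    (\<integral>\<^sup>+\<omega>. \<Psi> (case_sum (w \<omega>) (case_sum (h \<omega>) (Qm \<omega>))) \<partial>M)"
    by (rule same_fdd_nn_integral[OF prob_space_axioms _ _ js[unfolded jointly_stable_def] \<Psi>]) (intro measurable_arrays)+
  then have "(\<integral>\<^sup>+\<omega>. navg (tw 1 \<omega>) n (\<lambda>l. ennreal (f' (ovl n (tQ 1 \<omega>) l)) *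
      ennreal (exp (\<Sum>i<n. s' i * (th 1 \<omega> (l i) - b * 1)))) \<partial>M) =
    (\<integral>\<^sup>+\<omega>. navg (w \<omega>) n (\<lambda>l. ennreal (f' (ovl n (Qm \<omega>) l)) * ennreal (exp (\<Sum>i<n. s' i * h \<omega> (l i)))) \<partial>M)"
    by (simp only: \<Psi>_def sum.case)
  also have "\<dots> = (\<integral>\<^sup>+z. ennreal (f' (RN n z)) * ennreal (exp (qform p n s' (RN n z) / 2)) \<partial>N)"
    by (rule untilted_mgf) measurable
  also have "\<dots> = (\<integral>\<^sup>+z. ennreal (f (RN n z)) \<partial>N)"
    using f'0 by (simp add: ennreal_mult[symmetric] canc)
  finally have eq: "(\<integral>\<^sup>+z. ennreal (f (RN n z) * tilt_ratio n p s c z) \<partial>N) = (\<integral>\<^sup>+z. ennreal (f (RN n z)) \<partial>N)"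
    unfolding shifted_mgf[OF sph jointly_stable_imp_stable[OF js] f' f'0] canc
    unfolding s'_def tilt_ratio_scale .
  have "(\<integral>z. f (RN n z) * tilt_ratio n p s c z \<partial>N) = enn2real (\<integral>\<^sup>+z. ennreal (f (RN n z) * tilt_ratio n p s c z) \<partial>N)"
    using f0 tilt_ratio_nonneg by (intro integral_eq_nn_integral AE_I2) (auto intro: mult_nonneg_nonneg)
  also have "\<dots> = (\<integral>z. f (RN n z) \<partial>N)"
    unfolding eq using f0 by (intro integral_eq_nn_integral[symmetric] AE_I2) auto
  finally show ?thesis .
qed

lemma AE_strictly_decreasing_tw:
  assumes ties: "AE \<omega> in M. \<forall>l l'. l \<noteq> l' \<longrightarrow> w \<omega> l * exp (t * h \<omega> l) \<noteq> w \<omega> l' * exp (t * h \<omega> l')"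
  shows "AE \<omega> in M. \<forall>l. tw t \<omega> (Suc l) < tw t \<omega> l"
  using ties AE_summable_tilt[of t] AE_space
proof eventually_elim
  case (elim \<omega>)
  have s: "sorting (tilted (w \<omega>) (h \<omega>) t) (tperm t \<omega>)" by (rule sorting_tperm[OF elim(3,2)])
  show ?case
  proof
    fix l
    have "tperm t \<omega> (Suc l) \<noteq> tperm t \<omega> l"
      using s by (auto simp: sorting_def dest!: bij_is_inj injD)
    then have "w \<omega> (tperm t \<omega> (Suc l)) * exp (t * h \<omega> (tperm t \<omega> (Suc l))) \<noteq> w \<omega> (tperm t \<omega> l) * exp (t * h \<omega> (tperm t \<omega> l))"
      using elim(1) by blast
    then have "tw t \<omega> (Suc l) \<noteq> tw t \<omega> l"
      using tilt_sum_pos[OF elim(3,2)] by (simp add: tw_def tilted_def)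
    moreover have "precedes (tilted (w \<omega>) (h \<omega>) t) (tperm t \<omega> l) (tperm t \<omega> (Suc l))"
      using s by (simp add: sorting_def)
    ultimately show "tw t \<omega> (Suc l) < tw t \<omega> l" by (auto simp: precedes_def tw_def)
  qed
qed

lemma sets_strictly_decreasing:
  "{x :: nat + 'i \<Rightarrow> real. \<forall>l. x (Inl (Suc l)) < x (Inl l)} \<in> sets (Pi\<^sub>M UNIV (\<lambda>_. borel))"
proof -
  have [measurable]: "(\<lambda>x. x k) \<in> borel_measurable (Pi\<^sub>M UNIV (\<lambda>_. borel))" for k :: "nat + 'i"
    by (rule measurable_component_UNIV)
  have "{x \<in> space (Pi\<^sub>M UNIV (\<lambda>_. borel)). \<forall>l. x (Inl (Suc l)) < x (Inl l :: nat + 'i)} \<in>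
    sets (Pi\<^sub>M UNIV (\<lambda>_. borel :: real measure))" by measurable
  then show ?thesis by (simp add: space_PiM)
qed

text \<open>Strict monotonicity of the sorted tilted weights comes from the absence of ties. It
  depends only on their law, so stability makes it a property of \<open>w\<close>, about which
  nothing of this kind was assumed.\<close>

lemma AE_strictly_decreasing_w:
  assumes p: "p = 1" and pos: "AE \<omega> in M. \<forall>l. 0 < w \<omega> l" and st: "stable 1"
  shows "AE \<omega> in M. \<forall>l. w \<omega> (Suc l) < w \<omega> l"
proof -
  have "AE \<omega> in M. \<forall>l l'. l \<noteq> l' \<longrightarrow> w \<omega> l * exp (1 * h \<omega> l) \<noteq> w \<omega> l' * exp (1 * h \<omega> l')"
    using no_ties[OF p] pos by eventually_elim simp
  then have "AE \<omega> in M. \<forall>l. case_sum (tw 1 \<omega>) (tQ 1 \<omega>) (Inl (Suc l)) < case_sum (tw 1 \<omega>) (tQ 1 \<omega>) (Inl l)"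
    by (simp add: AE_strictly_decreasing_tw)
  then have "AE \<omega> in M. \<forall>l. case_sum (w \<omega>) (Qm \<omega>) (Inl (Suc l)) < case_sum (w \<omega>) (Qm \<omega>) (Inl l)"
    by (rule same_fdd_AE[OF prob_space_axioms _ _ st[unfolded stable_def] sets_strictly_decreasing, rotated -1])
      (intro measurable_arrays)+
  then show ?thesis by simp
qed

text \<open>For other powers ties cannot be excluded through the field; strictness of
  \<open>w\<close>, once known, returns to the tilted weights by stability.\<close>

lemma AE_strictly_decreasing_tw':
  assumes w: "AE \<omega> in M. \<forall>l. w \<omega> (Suc l) < w \<omega> l" and st: "stable t"
  shows "AE \<omega> in M. \<forall>l. tw t \<omega> (Suc l) < tw t \<omega> l"
proof -
  have "AE \<omega> in M. \<forall>l. case_sum (w \<omega>) (Qm \<omega>) (Inl (Suc l)) < case_sum (w \<omega>) (Qm \<omega>) (Inl l)"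
    using w by simp
  then have "AE \<omega> in M. \<forall>l. case_sum (tw t \<omega>) (tQ t \<omega>) (Inl (Suc l)) < case_sum (tw t \<omega>) (tQ t \<omega>) (Inl l)"
    by (rule same_fdd_AE[OF prob_space_axioms _ _ same_fdd_sym[OF st[unfolded stable_def]] sets_strictly_decreasing, rotated -1])
      (intro measurable_arrays)+
  then show ?thesis by simp
qed

lemma replica_arrays_untilted:
  assumes sph: spherical and pos: "AE \<omega> in M. \<forall>l. 0 < w \<omega> l" and dec: "AE \<omega> in M. \<forall>l. w \<omega> (Suc l) < w \<omega> l"
  shows "replica_arrays M w h Qm q"
proof (rule replica_arrays.intro[OF prob_space_axioms replica_arrays_axioms.intro])
  show "AE \<omega> in M. (\<forall>l. 0 < w \<omega> l) \<and> (\<forall>l. w \<omega> (Suc l) < w \<omega> l) \<and> w \<omega> sums 1 \<and>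
      (\<forall>l l'. Qm \<omega> (l, l') = q \<longleftrightarrow> l = l')"
    using sph[unfolded spherical_def] pos dec AE_space
  proof eventually_elim
    case (elim \<omega>)
    have "Qm \<omega> (l, l') = q \<longleftrightarrow> l = l'" for l l'
      using spherical_Q_eq_iff[OF elim(4,1)] elim(2) by simp
    then show ?case using elim(2,3) w_sums[OF elim(4)] by blast
  qed
qed (intro measurable_arrays)+

lemma replica_arrays_tilted:
  assumes sph: spherical and pos: "AE \<omega> in M. \<forall>l. 0 < w \<omega> l" and dec: "AE \<omega> in M. \<forall>l. tw t \<omega> (Suc l) < tw t \<omega> l"
  shows "replica_arrays M (tw t) (\<lambda>\<omega> l. th t \<omega> l - b * t) (tQ t) q"
proof (rule replica_arrays.intro[OF prob_space_axioms replica_arrays_axioms.intro])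
  show "AE \<omega> in M. (\<forall>l. 0 < tw t \<omega> l) \<and> (\<forall>l. tw t \<omega> (Suc l) < tw t \<omega> l) \<and> tw t \<omega> sums 1 \<and>
      (\<forall>l l'. tQ t \<omega> (l, l') = q \<longleftrightarrow> l = l')"
    using sph[unfolded spherical_def] pos dec AE_summable_tilt[of t] AE_space
  proof eventually_elim
    case (elim \<omega>)
    note \<omega> = elim(5) and sm = elim(4)
    have bij: "bij (tperm t \<omega>)" using sorting_tperm[OF \<omega> sm] by (simp add: sorting_def)
    have inj: "tperm t \<omega> l = tperm t \<omega> l' \<longleftrightarrow> l = l'" for l l'
      using bij_is_inj[OF bij] by (auto dest: injD)
    have "0 < tw t \<omega> l" for l
      using elim(2) tilt_sum_pos[OF \<omega> sm] by (simp add: tw_def tilted_def)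
    moreover have "tw t \<omega> sums 1"
    proof -
      note ts = tilted_sums[OF \<omega> sm]
      have "summable (tw t \<omega>)" "(\<Sum>k. tw t \<omega> k) = 1"
        using suminf_bij[OF bij sums_summable[OF ts] tilted_nonneg[OF \<omega> sm]] sums_unique[OF ts]
        by (simp_all add: tw_def[abs_def])
      then show ?thesis by (simp add: sums_iff)
    qed
    moreover have "tQ t \<omega> (l, l') = q \<longleftrightarrow> l = l'" for l l'
      using spherical_Q_eq_iff[OF \<omega> elim(1), of "tperm t \<omega> l" "tperm t \<omega> l'"] elim(2) by (simp add: tQ_def inj)
    ultimately show ?case using elim(3) by blast
  qed
qed (intro measurable_arrays)+

lemma abs_sum_RN_le:
  assumes z: "z \<in> space N"
  shows "\<bar>\<Sum>k\<in>{..<n} \<times> {..<n}. c k * RN n z k\<bar> \<le> (\<Sum>k\<in>{..<n} \<times> {..<n}. \<bar>c k\<bar>)"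
  using R_abs_le_1[OF z]
  by (intro order_trans[OF sum_abs] sum_mono) (auto simp: RN_def abs_mult intro!: mult_left_le)

lemma abs_qform_RN_le:
  assumes z: "z \<in> space N"
  shows "\<bar>qform p n s (RN n z)\<bar> \<le> (\<Sum>i<n. \<Sum>j<n. \<bar>s i * s j\<bar>)"
proof -
  have "\<bar>\<Sum>j<n. s i * s j * RN n z (i, j) ^ p\<bar> \<le> (\<Sum>j<n. \<bar>s i * s j\<bar>)" if "i < n" for i
    using that R_power_abs_le_1[OF z]
    by (intro order_trans[OF sum_abs] sum_mono) (auto simp: RN_def abs_mult intro!: mult_left_le)
  then have "(\<Sum>i<n. \<bar>\<Sum>j<n. s i * s j * RN n z (i, j) ^ p\<bar>) \<le> (\<Sum>i<n. \<Sum>j<n. \<bar>s i * s j\<bar>)"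
    by (intro sum_mono) auto
  then show ?thesis
    unfolding qform_def by (rule order_trans[OF sum_abs])
qed

text \<open>The generating function before the change of density is the mean of a test function
  \<open>G\<close> of the overlaps, including the Gaussian factor. After it, the same
  \<open>G\<close> is averaged against \<open>tilt_ratio\<close>, which the identities make
  harmless; reconstruction then gives equality of the arrays.\<close>

theorem gg_imp_jointly_stable:
  assumes gg: "ghirlanda_guerra M w \<xi>" and p: "1 \<le> p" and st: "stable t"
    and pos: "AE \<omega> in M. \<forall>l. 0 < w \<omega> l" and dec: "AE \<omega> in M. \<forall>l. w \<omega> (Suc l) < w \<omega> l"
  shows "jointly_stable t"
proof -
  have sph: spherical by (rule gg_imp_spherical[OF gg])
  have mgf: "array_mgf M (tw t) (\<lambda>\<omega> l. th t \<omega> l - b * t) (tQ t) n c s = array_mgf M w h Qm n c s \<and>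
      array_mgf M w h Qm n c s < \<infinity>" if n: "2 \<le> n" for n c s
  proof -
    define f where "f r = exp (\<Sum>k\<in>{..<n} \<times> {..<n}. c k * r k)" for r :: "nat \<times> nat \<Rightarrow> real"
    define G where "G r = f r * exp (qform p n s r / 2)" for r
    have f[measurable]: "f \<in> borel_measurable (Pi\<^sub>M ({..<n} \<times> {..<n}) (\<lambda>_. borel))"
      unfolding f_def[abs_def]
      by (intro borel_measurable_exp[THEN measurable_compose[rotated]] borel_measurable_sum borel_measurable_times
          borel_measurable_const measurable_component_singleton)
    have G[measurable]: "G \<in> borel_measurable (Pi\<^sub>M ({..<n} \<times> {..<n}) (\<lambda>_. borel))"
      unfolding G_def[abs_def] by measurable
    have f0: "0 \<le> f r" and G0: "0 \<le> G r" for r by (simp_all add: f_def G_def)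
    define B where "B = exp (\<Sum>k\<in>{..<n} \<times> {..<n}. \<bar>c k\<bar>) * exp ((\<Sum>i<n. \<Sum>j<n. \<bar>s i * s j\<bar>) / 2)"
    have B: "\<bar>G (RN n z)\<bar> \<le> B" if z: "z \<in> space N" for z
    proof -
      have "f (RN n z) \<le> exp (\<Sum>k\<in>{..<n} \<times> {..<n}. \<bar>c k\<bar>)"
        using abs_sum_RN_le[OF z, of c n] by (simp add: f_def abs_le_iff)
      moreover have "exp (qform p n s (RN n z) / 2) \<le> exp ((\<Sum>i<n. \<Sum>j<n. \<bar>s i * s j\<bar>) / 2)"
        using abs_qform_RN_le[OF z, of n s] by (simp add: abs_le_iff)
      ultimately have "G (RN n z) \<le> B" unfolding G_def B_def using f0 by (intro mult_mono) auto
      then show ?thesis using G0 by simp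
    qed
    have iG: "integrable N (\<lambda>z. G (RN n z))" by (rule integrable_N_bounded[OF _ B]) measurable
    have iGt: "integrable N (\<lambda>z. G (RN n z) * tilt_ratio n p s t z)"
    proof (rule integrable_N_bounded)
      fix z assume z: "z \<in> space N"
      show "\<bar>G (RN n z) * tilt_ratio n p s t z\<bar> \<le> B * (exp (\<bar>t\<bar> * (\<Sum>i<n. \<bar>s i\<bar> * real n)) * gbd n (\<lambda>a. t * s a) ^ n)"
        unfolding abs_mult using B[OF z] tilt_ratio_le[OF z, of n p s t] tilt_ratio_nonneg[OF z, of n p s t]
        by (intro mult_mono) (auto simp: B_def)
    qed measurable
    have "array_mgf M w h Qm n c s = (\<integral>\<^sup>+z. ennreal (f (RN n z)) * ennreal (exp (qform p n s (RN n z) / 2)) \<partial>N)"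
      unfolding array_mgf_def f_def[symmetric] by (rule untilted_mgf) measurable
    also have "\<dots> = (\<integral>\<^sup>+z. ennreal (G (RN n z)) \<partial>N)"
      using f0 by (simp add: G_def ennreal_mult)
    also have "\<dots> = ennreal (\<integral>z. G (RN n z) \<partial>N)"
      using G0 by (intro nn_integral_eq_integral iG) auto
    finally have 1: "array_mgf M w h Qm n c s = ennreal (\<integral>z. G (RN n z) \<partial>N)" .
    have "array_mgf M (tw t) (\<lambda>\<omega> l. th t \<omega> l - b * t) (tQ t) n c s =
      (\<integral>\<^sup>+z. ennreal (f (RN n z) * exp (qform p n s (RN n z) / 2) * tilt_ratio n p s t z) \<partial>N)"
      unfolding array_mgf_def f_def[symmetric] by (rule shifted_mgf[OF sph st f f0])
    also have "\<dots> = ennreal (\<integral>z. G (RN n z) * tilt_ratio n p s t z \<partial>N)"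
      unfolding G_def[symmetric] using G0 tilt_ratio_nonneg
      by (intro nn_integral_eq_integral iGt AE_I2) (auto intro: mult_nonneg_nonneg)
    also have "(\<integral>z. G (RN n z) * tilt_ratio n p s t z \<partial>N) = (\<integral>z. G (RN n z) \<partial>N)"
      by (rule gg_integral_tilt_ratio[OF gg n p G B])
    finally show ?thesis using 1 by simp
  qed
  have "distr M (Pi\<^sub>M UNIV (\<lambda>_. borel)) (\<lambda>\<omega>. case_sum (tw t \<omega>) (case_sum (\<lambda>l. th t \<omega> l - b * t) (tQ t \<omega>))) =
    distr M (Pi\<^sub>M UNIV (\<lambda>_. borel)) (\<lambda>\<omega>. case_sum (w \<omega>) (case_sum (h \<omega>) (Qm \<omega>)))"
    by (rule replica_arrays_eqI[OF replica_arrays_tilted[OF sph pos AE_strictly_decreasing_tw'[OF dec st]]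
        replica_arrays_untilted[OF sph pos dec]]) (use mgf in simp_all)
  then show ?thesis
    unfolding jointly_stable_def
    by (subst distr_PiM_eq_iff_same_fdd[OF _ _ prob_space_axioms]) (intro measurable_arrays)+
qed

text \<open>Reconstruction needs infinitely many positive weights. With one atom of weight 1
  normalisation undoes the change of density, two replicas always have overlap q so that b = 0, and
  the arrays agree almost surely.\<close>

lemma single_atom_jointly_stable:
  assumes sph: spherical and co: "coincide = 1"
  shows "jointly_stable t"
proof -
  note single = single_atom[OF sph co]
  have "AE z in N. R z 0 1 = q"
    using AE_N_fst[OF single] AE_lab_pos spherical_R_diag[OF sph]
  proof eventually_elim
    case (elim z)
    have "lab z i = 0" for i using spec[OF elim(2), of i] by (auto simp: elim(1) split: if_splits)
    then have "R z 0 1 = R z 0 0" by (simp add: R_def)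
    then show ?case using elim(3) by simp
  qed
  then have "mom p = (\<integral>z. q ^ p \<partial>N)"
    unfolding mom_def by (intro integral_cong_AE) (auto elim: eventually_mono)
  then have b0: "b = 0" by (simp add: b_def MN.P.prob_space)
  have "AE \<omega> in M. case_sum (tw t \<omega>) (case_sum (\<lambda>l. th t \<omega> l - b * t) (tQ t \<omega>)) = case_sum (w \<omega>) (case_sum (h \<omega>) (Qm \<omega>))"
    using single
  proof eventually_elim
    case (elim \<omega>)
    have "(\<lambda>j. w \<omega> j * exp (t * h \<omega> j)) sums exp (t * h \<omega> 0)"
      using sums_finite[of "{0}" "\<lambda>j. w \<omega> j * exp (t * h \<omega> j)"] by (simp add: elim)
    then have "(\<Sum>j. w \<omega> j * exp (t * h \<omega> j)) = exp (t * h \<omega> 0)" by (rule sums_unique[symmetric])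
    then have t: "tilted (w \<omega>) (h \<omega>) t = w \<omega>"
      by (auto simp: tilted_def fun_eq_iff elim)
    \<comment> \<open>The zero weights are all tied; breaking ties by index leaves them in place,
      together with the field values and overlaps attached to them.\<close>
    have "sorting (w \<omega>) id" by (auto simp: sorting_def precedes_def elim)
    then have "tperm t \<omega> = id" unfolding tperm_def t by (rule decreasing_perm_eqI)
    then show ?case
      by (auto simp: fun_eq_iff tw_def th_def tQ_def t b0 Qm_def split: sum.split)
  qed
  then show ?thesis
    unfolding jointly_stable_def by (intro same_fdd_of_AE_eq prob_space_axioms measurable_arrays)
qed

end

theorem theorem1:
  fixes M :: "'a measure"
    and w :: "'a \<Rightarrow> nat \<Rightarrow> real"
    and \<xi> :: "'a \<Rightarrow> nat \<Rightarrow> point"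
    and g :: "nat \<Rightarrow> 'a \<Rightarrow> nat \<Rightarrow> real"
  assumes "prob_space M"
    and "random_atomic_measure M w \<xi>"
    and "gaussian_fields M w \<xi> g"
  shows "(ghirlanda_guerra M w \<xi> \<and> aizenman_contucci M w \<xi> g) \<longleftrightarrow>
    ((AE \<omega> in M. AE x in atomic_measure (w \<omega>) (\<xi> \<omega>). ell2_norm x = sqrt (q_star M w \<xi>)) \<and>
     (\<forall>p\<ge>1. \<forall>t. same_fdd M
        (\<lambda>\<omega>. case_sum (w_perm w g p t \<omega>)
               (case_sum (\<lambda>l. g p \<omega> (perm w g p t \<omega> l) - b_const M w \<xi> p * t)
                 (Q_perm w \<xi> g p t \<omega>)))
        (\<lambda>\<omega>. case_sum (w \<omega>) (case_sum (g p \<omega>) (Q_mat \<xi> \<omega>)))))"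
proof -
  interpret random_atoms M w \<xi>
    using assms(1,2) by (simp add: random_atoms_def random_atoms_axioms_def)
  have field: "gaussian_field M w \<xi> p (g p)" if "1 \<le> p" for p
    using assms(3) that random_atoms_axioms
    by (simp add: gaussian_field_def gaussian_field_axioms_def gaussian_fields_def)
  have ac: "same_fdd M (\<lambda>\<omega>. case_sum (w_perm w g p t \<omega>) (Q_perm w \<xi> g p t \<omega>)) (\<lambda>\<omega>. case_sum (w \<omega>) (Q_mat \<xi> \<omega>)) \<longleftrightarrow>
      gaussian_field.stable M w \<xi> (g p) t"
    and tr: "same_fdd M
        (\<lambda>\<omega>. case_sum (w_perm w g p t \<omega>)
               (case_sum (\<lambda>l. g p \<omega> (perm w g p t \<omega> l) - b_const M w \<xi> p * t)
                 (Q_perm w \<xi> g p t \<omega>)))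
        (\<lambda>\<omega>. case_sum (w \<omega>) (case_sum (g p \<omega>) (Q_mat \<xi> \<omega>))) \<longleftrightarrow>
      gaussian_field.jointly_stable M w \<xi> p (g p) t" if p: "1 \<le> p" for p t
  proof -
    interpret G: gaussian_field M w \<xi> p "g p" by (rule field[OF p])
    have 1: "perm w g p t = G.tperm t" by (simp add: fun_eq_iff perm_def G.tperm_def)
    have 2: "w_perm w g p t = G.tw t" by (simp add: fun_eq_iff w_perm_def G.tw_def 1)
    have 3: "Q_perm w \<xi> g p t = G.tQ t" by (simp add: fun_eq_iff Q_perm_def G.tQ_def 1)
    have 4: "b_const M w \<xi> p = G.b" unfolding b_const_def G.b_def mean_bracket_overlap_power ..
    show "same_fdd M (\<lambda>\<omega>. case_sum (w_perm w g p t \<omega>) (Q_perm w \<xi> g p t \<omega>)) (\<lambda>\<omega>. case_sum (w \<omega>) (Q_mat \<xi> \<omega>)) \<longleftrightarrow>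
        G.stable t"
      unfolding G.stable_def 2 3 Qm_eq ..
    show "same_fdd M
        (\<lambda>\<omega>. case_sum (w_perm w g p t \<omega>)
               (case_sum (\<lambda>l. g p \<omega> (perm w g p t \<omega> l) - b_const M w \<xi> p * t)
                 (Q_perm w \<xi> g p t \<omega>)))
        (\<lambda>\<omega>. case_sum (w \<omega>) (case_sum (g p \<omega>) (Q_mat \<xi> \<omega>))) \<longleftrightarrow> G.jointly_stable t"
      unfolding G.jointly_stable_def 1 2 3 4 Qm_eq G.th_def ..
  qed
  show ?thesis
    unfolding spherical_iff[symmetric]
  proof (intro iffI conjI allI impI)
    assume i: "ghirlanda_guerra M w \<xi> \<and> aizenman_contucci M w \<xi> g"
    then have gg: "ghirlanda_guerra M w \<xi>" ..
    then show sph: spherical by (rule gg_imp_spherical)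
    have st: "gaussian_field.stable M w \<xi> (g p) t" if "1 \<le> p" for p t
      using i that by (simp add: aizenman_contucci_def ac)
    fix p t assume p: "1 \<le> (p :: nat)"
    interpret G: gaussian_field M w \<xi> p "g p" by (rule field[OF p])
    have "G.jointly_stable t"
    \<comment> \<open>If all replicas share one atom, all but one of the weights vanish and
      frequencies determine nothing about the remaining points, so this case is settled
      directly.\<close>
    proof (cases "coincide = 1")
      case True
      then show ?thesis by (rule G.single_atom_jointly_stable[OF sph])
    next
      case False
      have pos: "AE \<omega> in M. \<forall>l. 0 < w \<omega> l" by (rule gg_infinitely_many_atoms[OF gg False])
      \<comment> \<open>Strictness is a property of \<open>w\<close>, so it may be derived from the
        field with p = 1 whatever the power in the claim.\<close>
      have "AE \<omega> in M. \<forall>l. w \<omega> (Suc l) < w \<omega> l"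
        by (rule gaussian_field.AE_strictly_decreasing_w[OF field[OF order_refl] refl pos st[OF order_refl]])
      then show ?thesis by (rule G.gg_imp_jointly_stable[OF gg p st[OF p] pos])
    qed
    then show "same_fdd M
        (\<lambda>\<omega>. case_sum (w_perm w g p t \<omega>)
               (case_sum (\<lambda>l. g p \<omega> (perm w g p t \<omega> l) - b_const M w \<xi> p * t)
                 (Q_perm w \<xi> g p t \<omega>)))
        (\<lambda>\<omega>. case_sum (w \<omega>) (case_sum (g p \<omega>) (Q_mat \<xi> \<omega>)))"
      by (simp only: tr[OF p])
  next
    assume ii: "spherical \<and> (\<forall>p\<ge>1. \<forall>t. same_fdd M
        (\<lambda>\<omega>. case_sum (w_perm w g p t \<omega>)
               (case_sum (\<lambda>l. g p \<omega> (perm w g p t \<omega> l) - b_const M w \<xi> p * t)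
                 (Q_perm w \<xi> g p t \<omega>)))
        (\<lambda>\<omega>. case_sum (w \<omega>) (case_sum (g p \<omega>) (Q_mat \<xi> \<omega>))))"
    then have sph: spherical by blast
    have js: "gaussian_field.jointly_stable M w \<xi> p (g p) t" if "1 \<le> p" for p t
      using ii that tr[OF that, of t] by blast
    show "ghirlanda_guerra M w \<xi>"
    proof (rule gg_of_integral_tilt_ratio)
      fix n p :: nat and f :: "(nat \<times> nat \<Rightarrow> real) \<Rightarrow> real" and t B :: real
      assume p: "1 \<le> p" and f: "f \<in> borel_measurable (Pi\<^sub>M ({..<n} \<times> {..<n}) (\<lambda>_. borel))"
        and f0: "\<And>r. 0 \<le> f r"
      show "(\<integral>z. f (RN n z) * tilt_ratio n p (\<lambda>a. if a = 0 then 1 else 0) t z \<partial>N) = (\<integral>z. f (RN n z) \<partial>N)"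
        by (rule gaussian_field.jointly_stable_imp_tilt_ratio[OF field[OF p] sph js[OF p] f f0])
    qed
    show "aizenman_contucci M w \<xi> g"
      unfolding aizenman_contucci_def
      using gaussian_field.jointly_stable_imp_stable[OF field js] by (simp add: ac)
  qed
qed

end
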